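(* Let $C$ be a smooth irreducible curve over $\mathbb{C}$, $n\geq 2$ an integer and $g\in H^1(C,\mathcal{G}_n)$. 1. If $n'\geq 2$ is an integer and $g'\in H^1(C,\mathcal{G}_{n'})$, then there exists an isomorphism $C(g)\simeq C(g')$ inducing the identity on $C$ if and only if $n=n'$ and $g=g'$. 2. For $2\leq k\leq n$, if $g_k$ denotes the image of $g$ in $H^1(C,\mathcal{G}_k)$, one has $C(g_k)=C_k(g)$. 3. Let $L=H^1(\xi_n)(g)\in\mathrm{Pic}(C)$. Then $\mathcal{I}_C/\mathcal{I}_C^2\simeq L$, where $\mathcal{I}_C$ is the ideal sheaf of $C$ in $C(g)$. 4. Every abstract primitive curve of multiplicity $n$ can be extended to an abstract primitive curve of multiplicity $n+1$ with the same associated reduced curve.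
   Context: $\mathbf{Z}_n=\mathrm{spec}(\mathbb{C}[t]/(t^n))$. $\mathcal{G}_n$ is the sheaf of groups on $C$ of automorphisms of $C\times\mathbf{Z}_n$ leaving $C$ invariant: for a proper open subset $U$, $\mathcal{G}_n(U)$ is the group of $\mathbb{C}$-algebra automorphisms of $\mathcal{O}_C(U)[t]/(t^n)$ commuting with the projection $t\mapsto 0$ to $\mathcal{O}_C(U)$. For $k\leq n$ there is an obvious restriction morphism $\mathcal{G}_n\to\mathcal{G}_k$ (reduction modulo $t^k$). The morphism $\xi_n:\mathcal{G}_n\to\mathcal{O}_C^*$ sends $\phi$ with $\phi(t)=\nu t$ to $\nu|_{t=0}$. $H^1(C,\mathcal{G}_n)$ is the nonabelian Čech cohomology set (classes of cocycles $(g_{ij})$, $g_{ij}g_{jk}=g_{ik}$, modulo $g_{ij}\sim h_ig_{ij}h_j^{-1}$), and $H^1(\xi_n):H^1(C,\mathcal{G}_n)\to H^1(C,\mathcal{O}_C^* )=\mathrm{Pic}(C)$ is the induced map. If $g$ is represented by a cocycle $(g_{ij})$ of an open cover $(U_i)$ of $C$, $C(g)$ is the scheme obtained by gluing the $U_i\times\mathbf{Z}_n$ by means of the automorphisms of the $U_{ij}\times\mathbf{Z}_n$ defined by the $g_{ij}$ (so local sections of its structure sheaf are families $(f_i)$ with $f_i=g_{ij}(f_j)$); it depends only on $g$. It is called an abstract primitive (multiple) curve of multiplicity $n$, with associated reduced curve $C$. For $1\leq k\leq n$ the subschemes $U_i\times\mathbf{Z}_k$ glue to a closed subscheme $C_k(g)\subset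 C(g)$, with ideal sheaf $\mathcal{I}_C^k$. A curve $D$ of multiplicity $n+1$ extends a curve $C(g)$ of multiplicity $n$ if $C(g)$ is the subscheme of multiplicity $n$ of $D$ (defined by the $n$-th power of the ideal sheaf of $C$ in $D$). *)

theory Defs
  imports
    "HOL-Analysis.Abstract_Topology"
    "HOL-Library.Extended_Nat"
    "HOL-Algebra.UnivPoly"
    "HOL-Algebra.QuotRing"
    "HOL-Algebra.Ideal_Product"
    "HOL-Algebra.Generated_Rings"
    "HOL-Algebra.Ring_Divisibility"
    "HOL-Algebra.Algebraic_Closure_Type"
begin

section \<open>Ringed spaces over the complex numbers\<close>

abbreviation complex_ring :: "complex ring" where
  "complex_ring \<equiv> ring_of_type_algebra"

text \<open>A space with a (pre)sheaf of complex algebras: \<open>sect S U\<close> is the ring of sections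
  over the open set \<open>U\<close>, \<open>rest S U V\<close> the restriction from \<open>U\<close> to \<open>V\<close>, and \<open>scal S U\<close>
  the structure map from the complex numbers.\<close>

record ('p, 'a) cspace =
  topo :: "'p topology"
  sect :: "'p set \<Rightarrow> 'a ring"
  rest :: "'p set \<Rightarrow> 'p set \<Rightarrow> 'a \<Rightarrow> 'a"
  scal :: "'p set \<Rightarrow> complex \<Rightarrow> 'a"

abbreviation points :: "('p, 'a) cspace \<Rightarrow> 'p set" where
  "points S \<equiv> topspace (topo S)"

locale ringed_cspace =
  fixes S :: "('p, 'a) cspace"
  assumes sect_cring: "openin (topo S) U \<Longrightarrow> cring (sect S U)"
    and rest_hom: "\<lbrakk>openin (topo S) U; openin (topo S) V; V \<subseteq> U\<rbrakk>
      \<Longrightarrow> rest S U V \<in> ring_hom (sect S U) (sect S V)"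
    and rest_id: "\<lbrakk>openin (topo S) U; s \<in> carrier (sect S U)\<rbrakk> \<Longrightarrow> rest S U U s = s"
    and rest_comp: "\<lbrakk>openin (topo S) U; openin (topo S) V; openin (topo S) W; W \<subseteq> V; V \<subseteq> U;
        s \<in> carrier (sect S U)\<rbrakk> \<Longrightarrow> rest S V W (rest S U V s) = rest S U W s"
    and scal_hom: "openin (topo S) U \<Longrightarrow> scal S U \<in> ring_hom complex_ring (sect S U)"
    and scal_rest: "\<lbrakk>openin (topo S) U; openin (topo S) V; V \<subseteq> U\<rbrakk>
      \<Longrightarrow> rest S U V (scal S U c) = scal S V c"
    and glue: "\<lbrakk>\<And>U. U \<in> \<U> \<Longrightarrow> openin (topo S) U; \<And>U. U \<in> \<U> \<Longrightarrow> \<sigma> U \<in> carrier (sect S U);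
        \<And>U V. \<lbrakk>U \<in> \<U>; V \<in> \<U>\<rbrakk> \<Longrightarrow> rest S U (U \<inter> V) (\<sigma> U) = rest S V (U \<inter> V) (\<sigma> V)\<rbrakk>
      \<Longrightarrow> \<exists>!a. a \<in> carrier (sect S (\<Union>\<U>)) \<and> (\<forall>U\<in>\<U>. rest S (\<Union>\<U>) U a = \<sigma> U)"

definition open_subspace :: "('p, 'a) cspace \<Rightarrow> 'p set \<Rightarrow> ('p, 'a) cspace" where
  "open_subspace S U = S\<lparr>topo := subtopology (topo S) U\<rparr>"

text \<open>A morphism \<open>S \<rightarrow> Y\<close> is a map of points together with its comorphism, which sends
  sections of \<open>Y\<close> over \<open>V\<close> to sections of \<open>S\<close> over the preimage of \<open>V\<close>.\<close>

type_synonym ('p, 'a, 'q, 'b) cmor = "('p \<Rightarrow> 'q) \<times> ('q set \<Rightarrow> 'b \<Rightarrow> 'a)"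

definition preim :: "('p, 'a) cspace \<Rightarrow> ('p \<Rightarrow> 'q) \<Rightarrow> 'q set \<Rightarrow> 'p set" where
  "preim S f V = {x \<in> points S. f x \<in> V}"

text \<open>Isomorphisms of ringed spaces automatically are isomorphisms of locally ringed spaces.\<close>

definition cspace_iso ::
  "('p, 'a) cspace \<Rightarrow> ('q, 'b) cspace \<Rightarrow> ('p, 'a, 'q, 'b) cmor \<Rightarrow> bool" where
  "cspace_iso S Y m \<longleftrightarrow> (case m of (f, \<phi>) \<Rightarrow>
     homeomorphic_map (topo S) (topo Y) f \<and>
     (\<forall>V. openin (topo Y) V \<longrightarrow>
        \<phi> V \<in> ring_iso (sect Y V) (sect S (preim S f V)) \<and>
        (\<forall>c. \<phi> V (scal Y V c) = scal S (preim S f V) c)) \<and>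
     (\<forall>V W s. openin (topo Y) V \<and> openin (topo Y) W \<and> W \<subseteq> V \<and> s \<in> carrier (sect Y V) \<longrightarrow>
        \<phi> W (rest Y V W s) = rest S (preim S f V) (preim S f W) (\<phi> V s)))"

definition mor_comp ::
  "('q, 'b) cspace \<Rightarrow> ('q, 'b, 'r, 'c) cmor \<Rightarrow> ('p, 'a, 'q, 'b) cmor \<Rightarrow> ('p, 'a, 'r, 'c) cmor" where
  "mor_comp Y m' m = (\<lambda>x. fst m' (fst m x), \<lambda>V s. snd m (preim Y (fst m') V) (snd m' V s))"

definition mor_eq ::
  "('p, 'a) cspace \<Rightarrow> ('q, 'b) cspace \<Rightarrow> ('p, 'a, 'q, 'b) cmor \<Rightarrow> ('p, 'a, 'q, 'b) cmor \<Rightarrow> bool" where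
  "mor_eq S Y m m' \<longleftrightarrow> (\<forall>x\<in>points S. fst m x = fst m' x) \<and>
     (\<forall>V. openin (topo Y) V \<longrightarrow> (\<forall>s\<in>carrier (sect Y V). snd m V s = snd m' V s))"

section \<open>Stalks, ideal sheaves and quotient sheaves\<close>

definition germ :: "('p, 'a) cspace \<Rightarrow> 'p \<Rightarrow> 'p set \<Rightarrow> 'a \<Rightarrow> ('p set \<times> 'a) set" where
  "germ S x U s = {(V, r). openin (topo S) V \<and> x \<in> V \<and> r \<in> carrier (sect S V) \<and>
     (\<exists>W. openin (topo S) W \<and> x \<in> W \<and> W \<subseteq> U \<inter> V \<and> rest S U W s = rest S V W r)}"

definition germ_op ::
  "('p, 'a) cspace \<Rightarrow> 'p \<Rightarrow> ('a ring \<Rightarrow> 'a \<Rightarrow> 'a \<Rightarrow> 'a)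
    \<Rightarrow> ('p set \<times> 'a) set \<Rightarrow> ('p set \<times> 'a) set \<Rightarrow> ('p set \<times> 'a) set" where
  "germ_op S x opn a b = (THE c. \<exists>U s r. openin (topo S) U \<and> x \<in> U \<and>
     s \<in> carrier (sect S U) \<and> r \<in> carrier (sect S U) \<and>
     a = germ S x U s \<and> b = germ S x U r \<and> c = germ S x U (opn (sect S U) s r))"

definition stalk :: "('p, 'a) cspace \<Rightarrow> 'p \<Rightarrow> ('p set \<times> 'a) set ring" where
  "stalk S x =
    \<lparr>carrier = {germ S x U s | U s. openin (topo S) U \<and> x \<in> U \<and> s \<in> carrier (sect S U)},
     monoid.mult = germ_op S x monoid.mult,
     one = germ S x (points S) \<one>\<^bsub>sect S (points S)\<^esub>,
     ring.zero = germ S x (points S) \<zero>\<^bsub>sect S (points S)\<^esub>,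
     add = germ_op S x add\<rparr>"

text \<open>An ideal sheaf is given by its ideals of sections.\<close>

type_synonym ('p, 'a) ideal_sheaf = "'p set \<Rightarrow> 'a set"

abbreviation unit_ideal :: "('p, 'a) cspace \<Rightarrow> ('p, 'a) ideal_sheaf" where
  "unit_ideal S \<equiv> \<lambda>U. carrier (sect S U)"

fun ideal_power :: "'a ring \<Rightarrow> 'a set \<Rightarrow> nat \<Rightarrow> 'a set" where
  "ideal_power R I 0 = carrier R"
| "ideal_power R I (Suc k) = ideal_prod R (ideal_power R I k) I"

definition ideal_sheaf_power ::
  "('p, 'a) cspace \<Rightarrow> ('p, 'a) ideal_sheaf \<Rightarrow> nat \<Rightarrow> ('p, 'a) ideal_sheaf" where
  "ideal_sheaf_power S I k U = {s \<in> carrier (sect S U). \<forall>x\<in>U. \<exists>V.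
     openin (topo S) V \<and> x \<in> V \<and> V \<subseteq> U \<and> rest S U V s \<in> ideal_power (sect S V) (I V) k}"

definition stalk_ideal ::
  "('p, 'a) cspace \<Rightarrow> ('p, 'a) ideal_sheaf \<Rightarrow> 'p \<Rightarrow> ('p set \<times> 'a) set set" where
  "stalk_ideal S J x = {germ S x U s | U s. openin (topo S) U \<and> x \<in> U \<and> s \<in> J U}"

abbreviation stalk_quot ::
  "('p, 'a) cspace \<Rightarrow> ('p, 'a) ideal_sheaf \<Rightarrow> 'p \<Rightarrow> ('p set \<times> 'a) set set ring" where
  "stalk_quot S J x \<equiv> stalk S x Quot stalk_ideal S J x"

definition quot_germ ::
  "('p, 'a) cspace \<Rightarrow> ('p, 'a) ideal_sheaf \<Rightarrow> 'p \<Rightarrow> 'p set \<Rightarrow> 'a \<Rightarrow> ('p set \<times> 'a) set set" where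
  "quot_germ S J x U s = stalk_ideal S J x +>\<^bsub>stalk S x\<^esub> germ S x U s"

text \<open>Sections of the (sheafified) quotient \<open>I/J\<close> of ideal sheaves \<open>J \<subseteq> I\<close>, as functions
  to the stalks of the quotient which are locally induced by sections of \<open>I\<close>.  The set \<open>W\<close>
  need only be open in the support \<open>Z\<close> of the quotient, so that this also describes the
  inverse image of the quotient sheaf on \<open>Z\<close>.\<close>

definition quot_sections ::
  "('p, 'a) cspace \<Rightarrow> ('p, 'a) ideal_sheaf \<Rightarrow> ('p, 'a) ideal_sheaf \<Rightarrow> 'p set
    \<Rightarrow> ('p \<Rightarrow> ('p set \<times> 'a) set set) set" where
  "quot_sections S I J W = {s \<in> (\<Pi>\<^sub>E y\<in>W. carrier (stalk_quot S J y)).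
     \<forall>y\<in>W. \<exists>V r. openin (topo S) V \<and> y \<in> V \<and> r \<in> I V \<and>
       (\<forall>z\<in>V \<inter> W. s z = quot_germ S J z V r)}"

text \<open>The closed subspace with ideal sheaf \<open>J\<close>: the support of \<open>O/J\<close> with the sheaf \<open>O/J\<close>.\<close>

definition closed_subspace ::
  "('p, 'a) cspace \<Rightarrow> ('p, 'a) ideal_sheaf \<Rightarrow> ('p, 'p \<Rightarrow> ('p set \<times> 'a) set set) cspace" where
  "closed_subspace S J =
    \<lparr>topo = subtopology (topo S)
       {x \<in> points S. stalk_ideal S J x \<noteq> carrier (stalk S x)},
     sect = (\<lambda>W.
       \<lparr>carrier = quot_sections S (unit_ideal S) J W,
        monoid.mult = (\<lambda>s r. \<lambda>y\<in>W. s y \<otimes>\<^bsub>stalk_quot S J y\<^esub> r y),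
        one = (\<lambda>y\<in>W. \<one>\<^bsub>stalk_quot S J y\<^esub>),
        ring.zero = (\<lambda>y\<in>W. \<zero>\<^bsub>stalk_quot S J y\<^esub>),
        add = (\<lambda>s r. \<lambda>y\<in>W. s y \<oplus>\<^bsub>stalk_quot S J y\<^esub> r y)\<rparr>),
     rest = (\<lambda>W W' s. restrict s W'),
     scal = (\<lambda>W c. \<lambda>y\<in>W. quot_germ S J y (points S) (scal S (points S) c))\<rparr>"

definition closed_incl ::
  "('p, 'a) cspace \<Rightarrow> ('p, 'a) ideal_sheaf
    \<Rightarrow> ('p, 'p \<Rightarrow> ('p set \<times> 'a) set set, 'p, 'a) cmor" where
  "closed_incl S J =
    (\<lambda>x. x, \<lambda>U s. \<lambda>y\<in>U \<inter> points (closed_subspace S J). quot_germ S J y U s)"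

section \<open>Sheaves of modules\<close>

record ('p, 'a, 'm) modsheaf =
  msec :: "'p set \<Rightarrow> ('a, 'm) module"
  mres :: "'p set \<Rightarrow> 'p set \<Rightarrow> 'm \<Rightarrow> 'm"

definition modsheaf_iso ::
  "('p, 'a) cspace \<Rightarrow> ('p, 'a, 'm) modsheaf \<Rightarrow> ('p, 'a, 'k) modsheaf
    \<Rightarrow> ('p set \<Rightarrow> 'm \<Rightarrow> 'k) \<Rightarrow> bool" where
  "modsheaf_iso S M N \<Phi> \<longleftrightarrow>
    (\<forall>U. openin (topo S) U \<longrightarrow>
       bij_betw (\<Phi> U) (carrier (msec M U)) (carrier (msec N U)) \<and>
       (\<forall>s\<in>carrier (msec M U). \<forall>r\<in>carrier (msec M U).
          \<Phi> U (s \<oplus>\<^bsub>msec M U\<^esub> r) = \<Phi> U s \<oplus>\<^bsub>msec N U\<^esub> \<Phi> U r) \<and>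
       (\<forall>a\<in>carrier (sect S U). \<forall>s\<in>carrier (msec M U).
          \<Phi> U (a \<odot>\<^bsub>msec M U\<^esub> s) = a \<odot>\<^bsub>msec N U\<^esub> \<Phi> U s)) \<and>
    (\<forall>U V s. openin (topo S) U \<and> openin (topo S) V \<and> V \<subseteq> U \<and> s \<in> carrier (msec M U) \<longrightarrow>
       \<Phi> V (mres M U V s) = mres N U V (\<Phi> U s))"

definition quot_module ::
  "('p, 'a) cspace \<Rightarrow> ('p, 'a) ideal_sheaf \<Rightarrow> ('p, 'a) ideal_sheaf
    \<Rightarrow> ('p, 'a, 'p \<Rightarrow> ('p set \<times> 'a) set set) modsheaf" where
  "quot_module S I J =
    \<lparr>msec = (\<lambda>W.
       \<lparr>carrier = quot_sections S I J W,
        monoid.mult = undefined, one = undefined,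
        ring.zero = (\<lambda>y\<in>W. \<zero>\<^bsub>stalk_quot S J y\<^esub>),
        add = (\<lambda>s r. \<lambda>y\<in>W. s y \<oplus>\<^bsub>stalk_quot S J y\<^esub> r y),
        module.smult = (\<lambda>a s. \<lambda>y\<in>W. quot_germ S J y W a \<otimes>\<^bsub>stalk_quot S J y\<^esub> s y)\<rparr>),
     mres = (\<lambda>W W' s. restrict s W')\<rparr>"

definition pushforward ::
  "('p, 'a) cspace \<Rightarrow> ('p, 'a, 'q, 'b) cmor \<Rightarrow> ('p, 'a, 'm) modsheaf \<Rightarrow> ('q, 'b, 'm) modsheaf" where
  "pushforward S m M =
    \<lparr>msec = (\<lambda>V. let N = msec M (preim S (fst m) V) in
       \<lparr>carrier = carrier N, monoid.mult = monoid.mult N, one = one N, ring.zero = ring.zero N, add = add N,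
        module.smult = (\<lambda>b. module.smult N (snd m V b))\<rparr>),
     mres = (\<lambda>V V'. mres M (preim S (fst m) V) (preim S (fst m) V'))\<rparr>"

section \<open>Spectra, schemes, smooth curves\<close>

definition loc_frac :: "'a ring \<Rightarrow> 'a set \<Rightarrow> 'a \<Rightarrow> 'a \<Rightarrow> ('a \<times> 'a) set" where
  "loc_frac A \<pp> a s = {(b, t). b \<in> carrier A \<and> t \<in> carrier A - \<pp> \<and>
     (\<exists>u\<in>carrier A - \<pp>. u \<otimes>\<^bsub>A\<^esub> (a \<otimes>\<^bsub>A\<^esub> t) = u \<otimes>\<^bsub>A\<^esub> (b \<otimes>\<^bsub>A\<^esub> s))}"

definition loc_op ::
  "'a ring \<Rightarrow> 'a set \<Rightarrow> ('a \<Rightarrow> 'a \<Rightarrow> 'a \<Rightarrow> 'a \<Rightarrow> 'a)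
    \<Rightarrow> ('a \<times> 'a) set \<Rightarrow> ('a \<times> 'a) set \<Rightarrow> ('a \<times> 'a) set" where
  "loc_op A \<pp> num x y = (THE z. \<exists>a s b t.
     a \<in> carrier A \<and> s \<in> carrier A - \<pp> \<and> b \<in> carrier A \<and> t \<in> carrier A - \<pp> \<and>
     x = loc_frac A \<pp> a s \<and> y = loc_frac A \<pp> b t \<and>
     z = loc_frac A \<pp> (num a s b t) (s \<otimes>\<^bsub>A\<^esub> t))"

definition localization :: "'a ring \<Rightarrow> 'a set \<Rightarrow> ('a \<times> 'a) set ring" where
  "localization A \<pp> =
    \<lparr>carrier = {loc_frac A \<pp> a s | a s. a \<in> carrier A \<and> s \<in> carrier A - \<pp>},
     monoid.mult = loc_op A \<pp> (\<lambda>a s b t. a \<otimes>\<^bsub>A\<^esub> b),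
     one = loc_frac A \<pp> \<one>\<^bsub>A\<^esub> \<one>\<^bsub>A\<^esub>,
     ring.zero = loc_frac A \<pp> \<zero>\<^bsub>A\<^esub> \<one>\<^bsub>A\<^esub>,
     add = loc_op A \<pp> (\<lambda>a s b t. a \<otimes>\<^bsub>A\<^esub> t \<oplus>\<^bsub>A\<^esub> b \<otimes>\<^bsub>A\<^esub> s)\<rparr>"

text \<open>The sets of primes avoiding a given element form a basis, not just a subbasis, of the
  Zariski topology.\<close>

definition zariski :: "'a ring \<Rightarrow> 'a set topology" where
  "zariski A = topology_generated_by {{\<pp>. primeideal \<pp> A \<and> f \<notin> \<pp>} | f. f \<in> carrier A}"

definition Spec :: "'a ring \<Rightarrow> (complex \<Rightarrow> 'a) \<Rightarrow> ('a set, 'a set \<Rightarrow> ('a \<times> 'a) set) cspace" where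
  "Spec A \<kappa> =
    \<lparr>topo = zariski A,
     sect = (\<lambda>U.
       \<lparr>carrier = {s \<in> (\<Pi>\<^sub>E \<pp>\<in>U. carrier (localization A \<pp>)).
          \<forall>\<pp>\<in>U. \<exists>V a f. openin (zariski A) V \<and> \<pp> \<in> V \<and> V \<subseteq> U \<and>
            a \<in> carrier A \<and> f \<in> carrier A \<and>
            (\<forall>\<qq>\<in>V. f \<notin> \<qq> \<and> s \<qq> = loc_frac A \<qq> a f)},
        monoid.mult = (\<lambda>s r. \<lambda>\<pp>\<in>U. s \<pp> \<otimes>\<^bsub>localization A \<pp>\<^esub> r \<pp>),
        one = (\<lambda>\<pp>\<in>U. \<one>\<^bsub>localization A \<pp>\<^esub>),
        ring.zero = (\<lambda>\<pp>\<in>U. \<zero>\<^bsub>localization A \<pp>\<^esub>),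
        add = (\<lambda>s r. \<lambda>\<pp>\<in>U. s \<pp> \<oplus>\<^bsub>localization A \<pp>\<^esub> r \<pp>)\<rparr>),
     rest = (\<lambda>U V s. restrict s V),
     scal = (\<lambda>U c. \<lambda>\<pp>\<in>U. loc_frac A \<pp> (\<kappa> c) \<one>\<^bsub>A\<^esub>)\<rparr>"

text \<open>Requiring the ring \<open>A\<close> to live on the type of sections is no restriction, because
  \<open>A\<close> is isomorphic to the ring of sections over \<open>U\<close>.\<close>

definition affine_open :: "('p, 'a) cspace \<Rightarrow> 'p set \<Rightarrow> bool" where
  "affine_open S U \<longleftrightarrow> openin (topo S) U \<and>
     (\<exists>(A :: 'a ring) \<kappa> m. cring A \<and> \<kappa> \<in> ring_hom complex_ring A \<and>
        cspace_iso (open_subspace S U) (Spec A \<kappa>) m)"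

locale complex_scheme = ringed_cspace +
  assumes affine_nbhd: "x \<in> points S \<Longrightarrow> \<exists>U. affine_open S U \<and> x \<in> U"

text \<open>The diagonal of \<open>S\<close> is a closed immersion: on the affine open \<open>U \<times> V\<close> of \<open>S \<times> S\<close> this
  says that \<open>U \<inter> V\<close> is affine and \<open>O(U) \<otimes> O(V) \<rightarrow> O(U \<inter> V)\<close> is surjective.\<close>

definition separated :: "('p, 'a) cspace \<Rightarrow> bool" where
  "separated S \<longleftrightarrow> (\<forall>U V. affine_open S U \<and> affine_open S V \<longrightarrow>
     affine_open S (U \<inter> V) \<and>
     generate_ring (sect S (U \<inter> V))
       (rest S U (U \<inter> V) ` carrier (sect S U) \<union> rest S V (U \<inter> V) ` carrier (sect S V))
     = carrier (sect S (U \<inter> V)))"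

definition finite_type :: "('p, 'a) cspace \<Rightarrow> bool" where
  "finite_type S \<longleftrightarrow> compact_space (topo S) \<and>
     (\<forall>x\<in>points S. \<exists>U. affine_open S U \<and> x \<in> U \<and>
        (\<exists>B. finite B \<and> B \<subseteq> carrier (sect S U) \<and>
           generate_ring (sect S U) (range (scal S U) \<union> B) = carrier (sect S U)))"

definition reduced :: "('p, 'a) cspace \<Rightarrow> bool" where
  "reduced S \<longleftrightarrow> (\<forall>U. openin (topo S) U \<longrightarrow>
     (\<forall>s\<in>carrier (sect S U). \<forall>k::nat. s [^]\<^bsub>sect S U\<^esub> k = \<zero>\<^bsub>sect S U\<^esub> \<longrightarrow> s = \<zero>\<^bsub>sect S U\<^esub>))"

definition irreducible_in :: "'p topology \<Rightarrow> 'p set \<Rightarrow> bool" where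
  "irreducible_in T Z \<longleftrightarrow> Z \<noteq> {} \<and> Z \<subseteq> topspace T \<and>
     (\<forall>A B. closedin T A \<and> closedin T B \<and> Z \<subseteq> A \<union> B \<longrightarrow> Z \<subseteq> A \<or> Z \<subseteq> B)"

definition top_dim :: "'p topology \<Rightarrow> enat" where
  "top_dim T = Sup {enat n | n. \<exists>Z :: nat \<Rightarrow> 'p set.
     (\<forall>i\<le>n. closedin T (Z i) \<and> irreducible_in T (Z i)) \<and> (\<forall>i<n. Z i \<subset> Z (Suc i))}"

definition krull_dim :: "'a ring \<Rightarrow> enat" where
  "krull_dim R = Sup {enat n | n. \<exists>\<pp> :: nat \<Rightarrow> 'a set.
     (\<forall>i\<le>n. primeideal (\<pp> i) R) \<and> (\<forall>i<n. \<pp> i \<subset> \<pp> (Suc i))}"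

definition regular_local_ring :: "'a ring \<Rightarrow> bool" where
  "regular_local_ring R \<longleftrightarrow> cring R \<and> noetherian_ring R \<and>
     (\<exists>!\<mm>. maximalideal \<mm> R) \<and>
     (\<forall>\<mm>. maximalideal \<mm> R \<longrightarrow>
        (\<exists>B. finite B \<and> B \<subseteq> carrier R \<and> enat (card B) = krull_dim R \<and> \<mm> = genideal R B))"

text \<open>Over the complex numbers, smooth means that all local rings are regular.\<close>

locale smooth_irreducible_curve = complex_scheme +
  assumes sep: "separated S"
    and ft: "finite_type S"
    and red: "reduced S"
    and irred: "irreducible_in (topo S) (points S)"
    and dim: "top_dim (topo S) = 1"
    and smooth: "x \<in> points S \<Longrightarrow> regular_local_ring (stalk S x)"

section \<open>Nonabelian Cech cohomology\<close>

record ('p, 'g) gsheaf =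
  gsec :: "'p set \<Rightarrow> 'g monoid"
  gres :: "'p set \<Rightarrow> 'p set \<Rightarrow> 'g \<Rightarrow> 'g"

record ('i, 'p, 'g) cocycle =
  idx :: "'i set"
  cov :: "'i \<Rightarrow> 'p set"
  trans :: "'i \<Rightarrow> 'i \<Rightarrow> 'g"

definition is_cocycle :: "'p topology \<Rightarrow> ('p, 'g) gsheaf \<Rightarrow> ('i, 'p, 'g) cocycle \<Rightarrow> bool" where
  "is_cocycle T G c \<longleftrightarrow>
     (\<forall>i\<in>idx c. openin T (cov c i)) \<and> (\<Union>i\<in>idx c. cov c i) = topspace T \<and>
     (\<forall>i\<in>idx c. \<forall>j\<in>idx c. trans c i j \<in> carrier (gsec G (cov c i \<inter> cov c j))) \<and>
     (\<forall>i\<in>idx c. \<forall>j\<in>idx c. \<forall>k\<in>idx c. let W = cov c i \<inter> cov c j \<inter> cov c k in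
        gres G (cov c i \<inter> cov c j) W (trans c i j) \<otimes>\<^bsub>gsec G W\<^esub>
        gres G (cov c j \<inter> cov c k) W (trans c j k) =
        gres G (cov c i \<inter> cov c k) W (trans c i k))"

text \<open>Two cocycles, possibly on different covers, are cohomologous if on some common
  refinement \<open>(W k)\<close> of the covers, with refinement maps \<open>\<sigma>\<close> and \<open>\<tau>\<close>, the restricted
  cocycles \<open>c\<close> and \<open>d\<close> satisfy \<open>c = h\<^sub>k d h\<^sub>l\<^sup>-\<^sup>1\<close>.\<close>

definition cohomologous ::
  "'p topology \<Rightarrow> ('p, 'g) gsheaf \<Rightarrow> ('i, 'p, 'g) cocycle \<Rightarrow> ('j, 'p, 'g) cocycle \<Rightarrow> bool" where
  "cohomologous T G c d \<longleftrightarrow>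
    (\<exists>(K :: 'p set set) W \<sigma> \<tau> h.
       (\<forall>k\<in>K. openin T (W k) \<and> \<sigma> k \<in> idx c \<and> \<tau> k \<in> idx d \<and>
          W k \<subseteq> cov c (\<sigma> k) \<and> W k \<subseteq> cov d (\<tau> k) \<and> h k \<in> carrier (gsec G (W k))) \<and>
       (\<Union>k\<in>K. W k) = topspace T \<and>
       (\<forall>k\<in>K. \<forall>l\<in>K. let V = W k \<inter> W l in
          gres G (cov c (\<sigma> k) \<inter> cov c (\<sigma> l)) V (trans c (\<sigma> k) (\<sigma> l)) =
          gres G (W k) V (h k) \<otimes>\<^bsub>gsec G V\<^esub>
          gres G (cov d (\<tau> k) \<inter> cov d (\<tau> l)) V (trans d (\<tau> k) (\<tau> l)) \<otimes>\<^bsub>gsec G V\<^esub>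
          inv\<^bsub>gsec G V\<^esub> (gres G (W l) V (h l))))"

text \<open>Covers are indexed by arbitrary sets of sets of points.  This loses nothing: any
  indexed cover and the same cover indexed by its own members refine each other.\<close>

definition H1 :: "'p topology \<Rightarrow> ('p, 'g) gsheaf \<Rightarrow> ('p set, 'p, 'g) cocycle set set" where
  "H1 T G = {c. is_cocycle T G c} //
     {(c, d). is_cocycle T G c \<and> is_cocycle T G d \<and> cohomologous T G c d}"

text \<open>The map on cohomology induced by a morphism \<open>f\<close> to the sheaf of groups \<open>H\<close>.\<close>

definition map_cocycle ::
  "('p set \<Rightarrow> 'g \<Rightarrow> 'h) \<Rightarrow> ('i, 'p, 'g) cocycle \<Rightarrow> ('i, 'p, 'h) cocycle" where
  "map_cocycle f c =
    \<lparr>idx = idx c, cov = cov c, trans = (\<lambda>i j. f (cov c i \<inter> cov c j) (trans c i j))\<rparr>"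

definition H1_map ::
  "'p topology \<Rightarrow> ('p, 'h) gsheaf \<Rightarrow> ('p set \<Rightarrow> 'g \<Rightarrow> 'h)
    \<Rightarrow> ('p set, 'p, 'g) cocycle set \<Rightarrow> ('p set, 'p, 'h) cocycle set" where
  "H1_map T H f g = {d. is_cocycle T H d \<and> (\<exists>c\<in>g. cohomologous T H (map_cocycle f c) d)}"

section \<open>Thickenings of a curve and their automorphisms\<close>

text \<open>The ring \<open>R[t]/(t^n)\<close>, and the maps between such rings.  Elements are cosets of
  polynomials, so a map is defined by adding the target ideal to the image of a coset.\<close>

abbreviation tpow_ideal :: "'a ring \<Rightarrow> nat \<Rightarrow> (nat \<Rightarrow> 'a) set" where
  "tpow_ideal R n \<equiv> genideal (UP R) {up_ring.monom (UP R) \<one>\<^bsub>R\<^esub> n}"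

definition trunc_ring :: "'a ring \<Rightarrow> nat \<Rightarrow> (nat \<Rightarrow> 'a) set ring" where
  "trunc_ring R n = UP R Quot tpow_ideal R n"

definition trunc_monom :: "'a ring \<Rightarrow> nat \<Rightarrow> 'a \<Rightarrow> nat \<Rightarrow> (nat \<Rightarrow> 'a) set" where
  "trunc_monom R n a i = tpow_ideal R n +>\<^bsub>UP R\<^esub> up_ring.monom (UP R) a i"

abbreviation trunc_t :: "'a ring \<Rightarrow> nat \<Rightarrow> (nat \<Rightarrow> 'a) set" where
  "trunc_t R n \<equiv> trunc_monom R n \<one>\<^bsub>R\<^esub> 1"

definition trunc_map ::
  "'b ring \<Rightarrow> nat \<Rightarrow> ('a \<Rightarrow> 'b) \<Rightarrow> (nat \<Rightarrow> 'a) set \<Rightarrow> (nat \<Rightarrow> 'b) set" where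
  "trunc_map B n f F = tpow_ideal B n <+>\<^bsub>UP B\<^esub> ((\<lambda>p i. f (p i)) ` F)"

text \<open>Evaluation at \<open>t = 0\<close>, and reduction modulo \<open>t^k\<close>.\<close>

definition at_zero :: "'a ring \<Rightarrow> (nat \<Rightarrow> 'a) set \<Rightarrow> 'a" where
  "at_zero R F = (THE a. \<exists>p\<in>F. a = up_ring.coeff (UP R) p 0)"

definition trunc_red :: "'a ring \<Rightarrow> nat \<Rightarrow> (nat \<Rightarrow> 'a) set \<Rightarrow> (nat \<Rightarrow> 'a) set" where
  "trunc_red R k F = tpow_ideal R k <+>\<^bsub>UP R\<^esub> F"

text \<open>The product of \<open>C\<close> with the spectrum \<open>Z\<^sub>n\<close> of \<open>\<complex>[t]/(t^n)\<close>.\<close>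

definition thick :: "('p, 'a) cspace \<Rightarrow> nat \<Rightarrow> ('p, (nat \<Rightarrow> 'a) set) cspace" where
  "thick C n =
    \<lparr>topo = topo C,
     sect = (\<lambda>U. trunc_ring (sect C U) n),
     rest = (\<lambda>U V. trunc_map (sect C V) n (rest C U V)),
     scal = (\<lambda>U c. trunc_monom (sect C U) n (scal C U c) 0)\<rparr>"

text \<open>An element of \<open>aut_set C n U\<close> is an automorphism of \<open>U \<times> Z\<^sub>n\<close> over the complex numbers
  inducing the identity on \<open>U\<close>.  As its map of points is the identity, it is given by
  automorphisms of the algebras \<open>O(V)[t]/(t^n)\<close>, for \<open>V\<close> open in \<open>U\<close>, commuting with
  restrictions and with evaluation at \<open>t = 0\<close>.  If \<open>U\<close> is affine, in particular if it is a
  proper open subset of the curve, it is determined by an arbitrary such automorphism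
  of \<open>O(U)[t]/(t^n)\<close>.\<close>

type_synonym ('p, 'a) taut = "'p set \<Rightarrow> (nat \<Rightarrow> 'a) set \<Rightarrow> (nat \<Rightarrow> 'a) set"

definition opens_in :: "('p, 'a) cspace \<Rightarrow> 'p set \<Rightarrow> 'p set set" where
  "opens_in C U = {V. openin (topo C) V \<and> V \<subseteq> U}"

definition aut_set :: "('p, 'a) cspace \<Rightarrow> nat \<Rightarrow> 'p set \<Rightarrow> ('p, 'a) taut set" where
  "aut_set C n U = {\<phi> \<in> extensional (opens_in C U).
     (\<forall>V\<in>opens_in C U.
        \<phi> V \<in> extensional (carrier (sect (thick C n) V)) \<and>
        \<phi> V \<in> ring_iso (sect (thick C n) V) (sect (thick C n) V) \<and>
        (\<forall>c. \<phi> V (scal (thick C n) V c) = scal (thick C n) V c) \<and>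
        (\<forall>F\<in>carrier (sect (thick C n) V). at_zero (sect C V) (\<phi> V F) = at_zero (sect C V) F)) \<and>
     (\<forall>V\<in>opens_in C U. \<forall>V'\<in>opens_in C V. \<forall>F\<in>carrier (sect (thick C n) V).
        \<phi> V' (rest (thick C n) V V' F) = rest (thick C n) V V' (\<phi> V F))}"

definition aut_sheaf :: "('p, 'a) cspace \<Rightarrow> nat \<Rightarrow> ('p, ('p, 'a) taut) gsheaf" where
  "aut_sheaf C n =
    \<lparr>gsec = (\<lambda>U.
       \<lparr>carrier = aut_set C n U,
        monoid.mult = (\<lambda>\<phi> \<psi>. \<lambda>V\<in>opens_in C U.
          compose (carrier (sect (thick C n) V)) (\<phi> V) (\<psi> V)),
        one = (\<lambda>V\<in>opens_in C U. \<lambda>F\<in>carrier (sect (thick C n) V). F)\<rparr>),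
     gres = (\<lambda>U V \<phi>. restrict \<phi> (opens_in C V))\<rparr>"

definition unit_sheaf :: "('p, 'a) cspace \<Rightarrow> ('p, 'a) gsheaf" where
  "unit_sheaf C = \<lparr>gsec = (\<lambda>U. units_of (sect C U)), gres = rest C\<rparr>"

text \<open>The reduction from multiplicity \<open>n\<close> to multiplicity \<open>k\<close>.\<close>

definition aut_red :: "('p, 'a) cspace \<Rightarrow> nat \<Rightarrow> nat \<Rightarrow> 'p set \<Rightarrow> ('p, 'a) taut \<Rightarrow> ('p, 'a) taut" where
  "aut_red C n k U \<phi> = (\<lambda>V\<in>opens_in C U. \<lambda>F\<in>carrier (sect (thick C k) V).
     THE F'. \<exists>E\<in>carrier (sect (thick C n) V).
       F = trunc_red (sect C V) k E \<and> F' = trunc_red (sect C V) k (\<phi> V E))"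

text \<open>The morphism \<open>\<xi>\<^sub>n\<close>, sending \<open>\<phi>\<close> with \<open>\<phi>(t) = \<nu>t\<close> to the value of \<open>\<nu>\<close> at \<open>t = 0\<close>.\<close>

definition xi :: "('p, 'a) cspace \<Rightarrow> nat \<Rightarrow> 'p set \<Rightarrow> ('p, 'a) taut \<Rightarrow> 'a" where
  "xi C n U \<phi> = (THE a. \<exists>\<nu>\<in>carrier (sect (thick C n) U).
     \<phi> U (trunc_t (sect C U) n) = \<nu> \<otimes>\<^bsub>sect (thick C n) U\<^esub> trunc_t (sect C U) n \<and>
     a = at_zero (sect C U) \<nu>)"

section \<open>Abstract primitive curves\<close>

text \<open>The curve \<open>C(\<gamma>)\<close> glued from the \<open>U\<^sub>i \<times> Z\<^sub>n\<close> by a cocycle \<open>\<gamma>\<close>.  The gluing maps induce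
  the identity on points, so the underlying space is that of \<open>C\<close>; sections are families
  with \<open>f\<^sub>i = \<gamma>\<^sub>i\<^sub>j(f\<^sub>j)\<close>.\<close>

definition prim_curve ::
  "('p, 'a) cspace \<Rightarrow> nat \<Rightarrow> ('i, 'p, ('p, 'a) taut) cocycle
    \<Rightarrow> ('p, 'i \<Rightarrow> (nat \<Rightarrow> 'a) set) cspace" where
  "prim_curve C n \<gamma> =
    \<lparr>topo = topo C,
     sect = (\<lambda>W.
       \<lparr>carrier = {f \<in> (\<Pi>\<^sub>E i\<in>idx \<gamma>. carrier (sect (thick C n) (W \<inter> cov \<gamma> i))).
          \<forall>i\<in>idx \<gamma>. \<forall>j\<in>idx \<gamma>. let V = W \<inter> (cov \<gamma> i \<inter> cov \<gamma> j) in
            rest (thick C n) (W \<inter> cov \<gamma> i) V (f i) =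
            trans \<gamma> i j V (rest (thick C n) (W \<inter> cov \<gamma> j) V (f j))},
        monoid.mult = (\<lambda>f h. \<lambda>i\<in>idx \<gamma>. f i \<otimes>\<^bsub>sect (thick C n) (W \<inter> cov \<gamma> i)\<^esub> h i),
        one = (\<lambda>i\<in>idx \<gamma>. \<one>\<^bsub>sect (thick C n) (W \<inter> cov \<gamma> i)\<^esub>),
        ring.zero = (\<lambda>i\<in>idx \<gamma>. \<zero>\<^bsub>sect (thick C n) (W \<inter> cov \<gamma> i)\<^esub>),
        add = (\<lambda>f h. \<lambda>i\<in>idx \<gamma>. f i \<oplus>\<^bsub>sect (thick C n) (W \<inter> cov \<gamma> i)\<^esub> h i)\<rparr>),
     rest = (\<lambda>W W' f. \<lambda>i\<in>idx \<gamma>. rest (thick C n) (W \<inter> cov \<gamma> i) (W' \<inter> cov \<gamma> i) (f i)),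
     scal = (\<lambda>W c. \<lambda>i\<in>idx \<gamma>. scal (thick C n) (W \<inter> cov \<gamma> i) c)\<rparr>"

text \<open>The inclusion of \<open>C\<close> in \<open>C(\<gamma>)\<close>, given by \<open>t = 0\<close> on each \<open>U\<^sub>i \<times> Z\<^sub>n\<close>.\<close>

definition core_incl ::
  "('p, 'a) cspace \<Rightarrow> ('i, 'p, ('p, 'a) taut) cocycle
    \<Rightarrow> ('p, 'a, 'p, 'i \<Rightarrow> (nat \<Rightarrow> 'a) set) cmor" where
  "core_incl C \<gamma> = (\<lambda>x. x, \<lambda>W f. THE s. s \<in> carrier (sect C W) \<and>
     (\<forall>i\<in>idx \<gamma>. rest C W (W \<inter> cov \<gamma> i) s = at_zero (sect C (W \<inter> cov \<gamma> i)) (f i)))"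

text \<open>The ideal sheaf \<open>\<I>\<^sub>C\<close> of \<open>C\<close> in \<open>C(\<gamma>)\<close>.\<close>

definition core_ideal ::
  "('p, 'a) cspace \<Rightarrow> nat \<Rightarrow> ('i, 'p, ('p, 'a) taut) cocycle
    \<Rightarrow> ('p, 'i \<Rightarrow> (nat \<Rightarrow> 'a) set) ideal_sheaf" where
  "core_ideal C n \<gamma> W =
     a_kernel (sect (prim_curve C n \<gamma>) W) (sect C W) (snd (core_incl C \<gamma>) W)"

abbreviation core_ideal_power ::
  "('p, 'a) cspace \<Rightarrow> nat \<Rightarrow> ('i, 'p, ('p, 'a) taut) cocycle \<Rightarrow> nat
    \<Rightarrow> ('p, 'i \<Rightarrow> (nat \<Rightarrow> 'a) set) ideal_sheaf" where
  "core_ideal_power C n \<gamma> \<equiv> ideal_sheaf_power (prim_curve C n \<gamma>) (core_ideal C n \<gamma>)"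

text \<open>\<open>C(\<gamma>) \<simeq> C(\<gamma>')\<close> by an isomorphism inducing the identity on \<open>C\<close>.\<close>

definition iso_over_core ::
  "('p, 'a) cspace \<Rightarrow> nat \<Rightarrow> ('i, 'p, ('p, 'a) taut) cocycle
    \<Rightarrow> nat \<Rightarrow> ('j, 'p, ('p, 'a) taut) cocycle \<Rightarrow> bool" where
  "iso_over_core C n \<gamma> n' \<gamma>' \<longleftrightarrow>
    (\<exists>\<psi>. cspace_iso (prim_curve C n \<gamma>) (prim_curve C n' \<gamma>') \<psi> \<and>
       mor_eq C (prim_curve C n' \<gamma>')
         (mor_comp (prim_curve C n \<gamma>) \<psi> (core_incl C \<gamma>)) (core_incl C \<gamma>'))"

text \<open>The closed subscheme \<open>C\<^sub>k(\<gamma>)\<close> of \<open>C(\<gamma>)\<close>, with ideal sheaf \<open>\<I>\<^sub>C\<^sup>k\<close>.\<close>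

definition sub_curve ::
  "('p, 'a) cspace \<Rightarrow> nat \<Rightarrow> ('i, 'p, ('p, 'a) taut) cocycle \<Rightarrow> nat
    \<Rightarrow> ('p, 'p \<Rightarrow> ('p set \<times> ('i \<Rightarrow> (nat \<Rightarrow> 'a) set)) set set) cspace" where
  "sub_curve C n \<gamma> k = closed_subspace (prim_curve C n \<gamma>) (core_ideal_power C n \<gamma> k)"

definition sub_incl ::
  "('p, 'a) cspace \<Rightarrow> nat \<Rightarrow> ('i, 'p, ('p, 'a) taut) cocycle \<Rightarrow> nat
    \<Rightarrow> ('p, 'p \<Rightarrow> ('p set \<times> ('i \<Rightarrow> (nat \<Rightarrow> 'a) set)) set set,
        'p, 'i \<Rightarrow> (nat \<Rightarrow> 'a) set) cmor" where
  "sub_incl C n \<gamma> k = closed_incl (prim_curve C n \<gamma>) (core_ideal_power C n \<gamma> k)"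

text \<open>\<open>C(\<delta>)\<close>, of multiplicity \<open>k\<close>, is the subscheme \<open>C\<^sub>k(\<gamma>)\<close> of \<open>C(\<gamma>)\<close>, by an
  identification inducing the identity on \<open>C\<close>, i.e. such that the composite
  \<open>C \<rightarrow> C(\<delta>) \<simeq> C\<^sub>k(\<gamma>) \<rightarrow> C(\<gamma>)\<close> is the inclusion of \<open>C\<close>.\<close>

definition is_sub_curve ::
  "('p, 'a) cspace \<Rightarrow> nat \<Rightarrow> ('i, 'p, ('p, 'a) taut) cocycle
    \<Rightarrow> nat \<Rightarrow> ('j, 'p, ('p, 'a) taut) cocycle \<Rightarrow> bool" where
  "is_sub_curve C n \<gamma> k \<delta> \<longleftrightarrow>
    (\<exists>\<psi>. cspace_iso (prim_curve C k \<delta>) (sub_curve C n \<gamma> k) \<psi> \<and>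
       mor_eq C (prim_curve C n \<gamma>)
         (mor_comp (prim_curve C k \<delta>) (mor_comp (sub_curve C n \<gamma> k) (sub_incl C n \<gamma> k) \<psi>)
           (core_incl C \<delta>))
         (core_incl C \<gamma>))"

text \<open>The invertible sheaf on \<open>C\<close> given by a cocycle of units, with sections
  \<open>f\<^sub>i = \<mu>\<^sub>i\<^sub>j f\<^sub>j\<close>, as for \<open>C(\<gamma>)\<close>.\<close>

definition line_bundle ::
  "('p, 'a) cspace \<Rightarrow> ('i, 'p, 'a) cocycle \<Rightarrow> ('p, 'a, 'i \<Rightarrow> 'a) modsheaf" where
  "line_bundle C \<mu> =
    \<lparr>msec = (\<lambda>W.
       \<lparr>carrier = {f \<in> (\<Pi>\<^sub>E i\<in>idx \<mu>. carrier (sect C (W \<inter> cov \<mu> i))).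
          \<forall>i\<in>idx \<mu>. \<forall>j\<in>idx \<mu>. let V = W \<inter> (cov \<mu> i \<inter> cov \<mu> j) in
            rest C (W \<inter> cov \<mu> i) V (f i) =
            rest C (cov \<mu> i \<inter> cov \<mu> j) V (trans \<mu> i j) \<otimes>\<^bsub>sect C V\<^esub>
            rest C (W \<inter> cov \<mu> j) V (f j)},
        monoid.mult = undefined, one = undefined,
        ring.zero = (\<lambda>i\<in>idx \<mu>. \<zero>\<^bsub>sect C (W \<inter> cov \<mu> i)\<^esub>),
        add = (\<lambda>f h. \<lambda>i\<in>idx \<mu>. f i \<oplus>\<^bsub>sect C (W \<inter> cov \<mu> i)\<^esub> h i),
        module.smult = (\<lambda>a f. \<lambda>i\<in>idx \<mu>.
          rest C W (W \<inter> cov \<mu> i) a \<otimes>\<^bsub>sect C (W \<inter> cov \<mu> i)\<^esub> f i)\<rparr>),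
     mres = (\<lambda>W W' f. \<lambda>i\<in>idx \<mu>. rest C (W \<inter> cov \<mu> i) (W' \<inter> cov \<mu> i) (f i))\<rparr>"

text \<open>\<open>\<I>\<^sub>C/\<I>\<^sub>C\<^sup>2 \<simeq> L\<close> as modules on \<open>C\<close>.  Both sides are regarded as modules over the structure
  sheaf of \<open>C(\<gamma>)\<close>, which acts through its quotient, the structure sheaf of \<open>C\<close>.\<close>

definition conormal_iso ::
  "('p, 'a) cspace \<Rightarrow> nat \<Rightarrow> ('i, 'p, ('p, 'a) taut) cocycle \<Rightarrow> ('j, 'p, 'a) cocycle \<Rightarrow> bool" where
  "conormal_iso C n \<gamma> \<mu> \<longleftrightarrow>
    (\<exists>\<Phi>. modsheaf_iso (prim_curve C n \<gamma>)
       (quot_module (prim_curve C n \<gamma>) (core_ideal C n \<gamma>) (core_ideal_power C n \<gamma> 2))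
       (pushforward C (core_incl C \<gamma>) (line_bundle C \<mu>)) \<Phi>)"

end

theory Submission
  imports Defs
begin

text \<open>The curve \<open>C(\<gamma>)\<close> is a twisted form of the sheaf \<open>O\<^sub>C[t]/(t\<^sup>n)\<close>.  A coboundary between two cocycles
  is the same as an isomorphism of twisted forms over \<open>C\<close>, and the multiplicity is recovered from
  nilpotency of \<open>t\<close>; this is part 1.  Parts 2 and 3 follow from locally surjective maps out of the
  twisted form, reduction modulo \<open>t\<^sup>k\<close> and the coefficient of \<open>t\<close>, whose kernels are \<open>\<I>\<^sub>C\<^sup>k\<close> and
  (on \<open>\<I>\<^sub>C\<close>) \<open>\<I>\<^sub>C\<^sup>2\<close>.  For part 4, every automorphism of \<open>O(U)[t]/(t\<^sup>n)\<close> lifts to \<open>O(U)[t]/(t\<^sup>n\<^sup>+\<^sup>1)\<close> because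
  the characteristic is zero, and every proper closed subset of \<open>C\<close> is discrete, so that a cocycle can be refined to
  one whose double intersections all lie in a single member of the cover; then no condition on triple
  intersections obstructs the lifting of the cocycle.\<close>

text \<open>A section of the automorphism presheaf is a family of automorphisms over all smaller
  open sets, so a lift of it must commute with restriction. Existence of a lift over each open set
  is therefore not enough; the lift has to be given by formulas natural in the ring. It is fixed by
  its values on constants and on t, and its value on a constant f needs one new coefficient, that of
  t^n. The derivation t d/dt multiplies this coefficient by n, so it suffices to prescribe t d/dt of
  the lift; conjugating t d/dt by the automorphism tells what that must be in lower degrees.
  Dividing by n is where characteristic zero enters.

  Discreteness of proper closed subsets rests on dimension one and finite type. Finite generation is
  given for the ring of sections of an affine open set, while its topology is that of the primes of
  some ring A. The ideals of sections vanishing at a point link the two, so that Hilbert's basis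
  theorem yields a descending chain condition for closed sets.\<close>

section \<open>Presheaves of groups and nonabelian cocycles\<close>

locale group_presheaf =
 fixes T :: "'p topology" and G :: "('p, 'g) gsheaf"
 assumes sec_group: "openin T U ==> group (gsec G U)"
  and res_hom: "[|openin T U; openin T V; V <= U|] ==> gres G U V : hom (gsec G U) (gsec G V)"
  and res_id: "[|openin T U; g : carrier (gsec G U)|] ==> gres G U U g = g"
  and res_comp: "[|openin T U; openin T V; openin T W; W <= V; V <= U; g : carrier (gsec G U)|]
   ==> gres G V W (gres G U V g) = gres G U W g"
begin

lemma res_closed:
 "[|openin T U; openin T V; V <= U; g : carrier (gsec G U)|] ==> gres G U V g : carrier (gsec G V)"
 by (rule hom_in_carrier[OF res_hom])

lemma res_mult:
 "[|openin T U; openin T V; V <= U; g : carrier (gsec G U); h : carrier (gsec G U)|]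
  ==> gres G U V (g \<otimes>\<^bsub>gsec G U\<^esub> h) = gres G U V g \<otimes>\<^bsub>gsec G V\<^esub> gres G U V h"
 by (rule hom_mult[OF res_hom])

lemma res_one:
 "[|openin T U; openin T V; V <= U|] ==> gres G U V \<one>\<^bsub>gsec G U\<^esub> = \<one>\<^bsub>gsec G V\<^esub>"
 by (rule hom_one[OF res_hom sec_group sec_group])

lemma res_inv:
 "[|openin T U; openin T V; V <= U; g : carrier (gsec G U)|]
  ==> gres G U V (inv\<^bsub>gsec G U\<^esub> g) = inv\<^bsub>gsec G V\<^esub> (gres G U V g)"
 using res_hom sec_group group_hom.hom_inv[of "gsec G U" "gsec G V" "gres G U V" g]
 by (simp add: group_hom_def group_hom_axioms_def)

abbreviation cres :: "('i, 'p, 'g) cocycle => 'i => 'i => 'p set => 'g" where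
 "cres c i j V \<equiv> gres G (cov c i Int cov c j) V (trans c i j)"

lemma cocycle_open: "[|is_cocycle T G c; i : idx c|] ==> openin T (cov c i)"
 by (simp add: is_cocycle_def)

lemma cocycle_cover: "is_cocycle T G c ==> (\<Union>i\<in>idx c. cov c i) = topspace T"
 by (simp add: is_cocycle_def)

lemma cocycle_trans:
 "[|is_cocycle T G c; i : idx c; j : idx c|] ==> trans c i j : carrier (gsec G (cov c i Int cov c j))"
 by (simp add: is_cocycle_def)

lemma cres_closed:
 "[|is_cocycle T G c; i : idx c; j : idx c; openin T V; V <= cov c i; V <= cov c j|]
  ==> cres c i j V : carrier (gsec G V)"
 by (intro res_closed) (auto simp: cocycle_trans intro: cocycle_open)

lemma cres_res:
 "[|is_cocycle T G c; i : idx c; j : idx c; openin T V; V <= cov c i; V <= cov c j;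
  openin T V'; V' <= V|]
  ==> gres G V V' (cres c i j V) = cres c i j V'"
 by (intro res_comp) (auto simp: cocycle_trans intro: cocycle_open)

text \<open>The cocycle identity is postulated on the full triple intersection; restricting it makes
  it available on every smaller open set.\<close>

lemma cres_mult:
 assumes c: "is_cocycle T G c" and i: "i : idx c" "j : idx c" "k : idx c"
  and V: "openin T V" "V <= cov c i" "V <= cov c j" "V <= cov c k"
 shows "cres c i j V \<otimes>\<^bsub>gsec G V\<^esub> cres c j k V = cres c i k V"
proof -
 let ?W = "cov c i Int cov c j Int cov c k"
 have o: "openin T ?W" "openin T (cov c i)" "openin T (cov c j)" "openin T (cov c k)"
  using c i by (auto intro: cocycle_open)
 have e: "cres c i j ?W \<otimes>\<^bsub>gsec G ?W\<^esub> cres c j k ?W = cres c i k ?W"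
  using c i by (auto simp: is_cocycle_def Let_def)
 have "gres G ?W V (cres c i j ?W \<otimes>\<^bsub>gsec G ?W\<^esub> cres c j k ?W)
  = gres G ?W V (cres c i j ?W) \<otimes>\<^bsub>gsec G V\<^esub> gres G ?W V (cres c j k ?W)"
  by (rule res_mult) (use c i V o in \<open>auto intro!: cres_closed\<close>)
 moreover have "gres G ?W V (cres c i j ?W) = cres c i j V"
  "gres G ?W V (cres c j k ?W) = cres c j k V" "gres G ?W V (cres c i k ?W) = cres c i k V"
  by (rule cres_res; use c i V o in auto)+
 ultimately show ?thesis using e by simp
qed

text \<open>The cocycle identity for the triple (i, i, i) makes g_ii idempotent, and a group has
  only one idempotent.\<close>

lemma cres_self:
 assumes c: "is_cocycle T G c" and i: "i : idx c" and V: "openin T V" "V <= cov c i"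
 shows "cres c i i V = \<one>\<^bsub>gsec G V\<^esub>"
proof -
 interpret group "gsec G V" by (rule sec_group[OF V(1)])
 have "cres c i i V : carrier (gsec G V)" by (rule cres_closed) (use assms in auto)
 then show ?thesis
  using cres_mult[OF c i i i V V(2) V(2)] by (simp add: r_cancel_one)
qed

lemma cres_inv:
 assumes c: "is_cocycle T G c" and i: "i : idx c" "j : idx c"
  and V: "openin T V" "V <= cov c i" "V <= cov c j"
 shows "inv\<^bsub>gsec G V\<^esub> (cres c i j V) = cres c j i V"
proof -
 interpret group "gsec G V" by (rule sec_group[OF V(1)])
 show ?thesis
  using cres_mult[OF c i(2) i(1) i(2) V(1) V(3) V(2) V(3)] cres_self[OF c i(2) V(1,3)]
   cres_closed[OF c i V] cres_closed[OF c i(2,1) V(1,3,2)]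
  by (simp add: inv_equality)
qed

text \<open>\<open>cohomologous\<close> asks for a refinement indexed by sets of points. An
  arbitrary index set reduces to this by reindexing the cover by its own members and choosing one
  index for each member. The coboundary equation is written without an inverse, as c h_l = h_k
  d.\<close>

lemma cohomologousI:
 fixes I :: "'z set"
 assumes c: "is_cocycle T G c" and d: "is_cocycle T G d"
  and I: "!!k. k : I ==> openin T (W k) & sg k : idx c & \<tau> k : idx d & W k <= cov c (sg k) \<and>
    W k <= cov d (\<tau> k) & h k : carrier (gsec G (W k))"
  and cover: "(\<Union>k\<in>I. W k) = topspace T"
  and eq: "!!k l V. [|k : I; l : I; V = W k Int W l; openin T V|] ==>
    cres c (sg k) (sg l) V \<otimes>\<^bsub>gsec G V\<^esub> gres G (W l) V (h l) =
    gres G (W k) V (h k) \<otimes>\<^bsub>gsec G V\<^esub> cres d (\<tau> k) (\<tau> l) V"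
 shows "cohomologous T G c d"
proof -
 define s where "s = inv_into I W"
 have s: "s V : I" "W (s V) = V" if "V : W ` I" for V
  using that by (auto simp: s_def inv_into_into f_inv_into_f)
 have P: "openin T V" "sg (s V) : idx c" "\<tau> (s V) : idx d" "V <= cov c (sg (s V))"
  "V <= cov d (\<tau> (s V))" "h (s V) : carrier (gsec G V)" if "V : W ` I" for V
  using I[OF s(1)[OF that]] s(2)[OF that] by auto
 have E: "cres c (sg (s k)) (sg (s l)) (k Int l) =
    gres G k (k Int l) (h (s k)) \<otimes>\<^bsub>gsec G (k Int l)\<^esub>
    cres d (\<tau> (s k)) (\<tau> (s l)) (k Int l) \<otimes>\<^bsub>gsec G (k Int l)\<^esub>
    inv\<^bsub>gsec G (k Int l)\<^esub> (gres G l (k Int l) (h (s l)))"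
  if kl: "k : W ` I" "l : W ` I" for k l
 proof -
  let ?V = "k Int l"
  note k = P[OF kl(1)] and l = P[OF kl(2)]
  have oV: "openin T ?V" using k l by auto
  interpret group "gsec G ?V" by (rule sec_group[OF oV])
  have 1: "cres c (sg (s k)) (sg (s l)) ?V \<otimes>\<^bsub>gsec G ?V\<^esub> gres G l ?V (h (s l)) =
    gres G k ?V (h (s k)) \<otimes>\<^bsub>gsec G ?V\<^esub> cres d (\<tau> (s k)) (\<tau> (s l)) ?V"
   using eq[of "s k" "s l" ?V] s[OF kl(1)] s[OF kl(2)] oV by simp
  have 2: "cres c (sg (s k)) (sg (s l)) ?V : carrier (gsec G ?V)"
   "cres d (\<tau> (s k)) (\<tau> (s l)) ?V : carrier (gsec G ?V)"
   by (rule cres_closed; use k l c d oV in auto)+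
  have 4: "gres G k ?V (h (s k)) : carrier (gsec G ?V)" "gres G l ?V (h (s l)) : carrier (gsec G ?V)"
   using res_closed k l oV by auto
  show ?thesis
   using 1 2 4 by (simp add: inv_solve_right)
 qed
 have cover': "(\<Union>k\<in>W ` I. k) = topspace T" using cover by simp
 show ?thesis
  unfolding cohomologous_def Let_def
  apply (rule exI[where x="W ` I"], rule exI[where x="%V. V"], rule exI[where x="%V. sg (s V)"],
    rule exI[where x="%V. \<tau> (s V)"], rule exI[where x="%V. h (s V)"])
  apply (rule conjI[OF _ conjI[OF cover']])
   apply (intro ballI conjI; rule P; assumption)
  apply (intro ballI; rule E; assumption)
  done
qed

text \<open>The data of a coboundary, with its equation demanded on every open V inside both members
  rather than on their intersection, so that later computations can be done directly on the set
  where they are needed.\<close>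

definition cobounds :: "('i, 'p, 'g) cocycle => ('j, 'p, 'g) cocycle => 'z set => ('z => 'p set) =>
  ('z => 'i) => ('z => 'j) => ('z => 'g) => bool" where
 "cobounds c d K W sg \<tau> h \<longleftrightarrow>
  (\<forall>k\<in>K. openin T (W k) & sg k : idx c & \<tau> k : idx d \<and>
    W k <= cov c (sg k) & W k <= cov d (\<tau> k) & h k : carrier (gsec G (W k))) \<and>
  (\<Union>k\<in>K. W k) = topspace T \<and>
  (\<forall>k\<in>K. \<forall>l\<in>K. \<forall>V. openin T V \<longrightarrow> V <= W k \<longrightarrow> V <= W l \<longrightarrow>
    cres c (sg k) (sg l) V \<otimes>\<^bsub>gsec G V\<^esub> gres G (W l) V (h l) =
    gres G (W k) V (h k) \<otimes>\<^bsub>gsec G V\<^esub> cres d (\<tau> k) (\<tau> l) V)"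

lemma cobounds_eq:
 "[|cobounds c d K W sg \<tau> h; k : K; l : K; openin T V; V <= W k; V <= W l|] ==>
    cres c (sg k) (sg l) V \<otimes>\<^bsub>gsec G V\<^esub> gres G (W l) V (h l) =
    gres G (W k) V (h k) \<otimes>\<^bsub>gsec G V\<^esub> cres d (\<tau> k) (\<tau> l) V"
 unfolding cobounds_def by meson

lemma cobounds_data:
 assumes "cobounds c d K W sg \<tau> h"
 shows "k : K ==> openin T (W k)" "k : K ==> sg k : idx c" "k : K ==> \<tau> k : idx d"
  "k : K ==> W k <= cov c (sg k)" "k : K ==> W k <= cov d (\<tau> k)"
  "k : K ==> h k : carrier (gsec G (W k))" "(\<Union>k\<in>K. W k) = topspace T"
 using assms unfolding cobounds_def by simp_all

lemma cobounds_closed: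
 assumes D: "cobounds c d K W sg \<tau> h" and V: "openin T V" "V <= W k" and k: "k : K"
 shows "gres G (W k) V (h k) : carrier (gsec G V)"
  and "[|is_cocycle T G c; l : K; V <= W l|] ==> cres c (sg k) (sg l) V : carrier (gsec G V)"
  and "[|is_cocycle T G d; l : K; V <= W l|] ==> cres d (\<tau> k) (\<tau> l) V : carrier (gsec G V)"
proof -
 note K = cobounds_data[OF D]
 show "gres G (W k) V (h k) : carrier (gsec G V)"
  by (rule res_closed[OF K(1)[OF k] V K(6)[OF k]])
 show "cres c (sg k) (sg l) V : carrier (gsec G V)" if "is_cocycle T G c" "l : K" "V <= W l"
  by (rule cres_closed[OF that(1) K(2)[OF k] K(2)[OF that(2)] V(1)
     subset_trans[OF V(2) K(4)[OF k]] subset_trans[OF that(3) K(4)[OF that(2)]]])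
 show "cres d (\<tau> k) (\<tau> l) V : carrier (gsec G V)" if "is_cocycle T G d" "l : K" "V <= W l"
  by (rule cres_closed[OF that(1) K(3)[OF k] K(3)[OF that(2)] V(1)
     subset_trans[OF V(2) K(5)[OF k]] subset_trans[OF that(3) K(5)[OF that(2)]]])
qed

lemma cohomologousE:
 assumes "cohomologous T G c d" and c: "is_cocycle T G c" and d: "is_cocycle T G d"
 obtains K :: "'p set set" and W sg \<tau> h where "cobounds c d K W sg \<tau> h"
proof -
 obtain K :: "'p set set" and W sg \<tau> h where
  "(\<forall>k\<in>K. openin T (W k) & sg k : idx c & \<tau> k : idx d \<and>
     W k <= cov c (sg k) & W k <= cov d (\<tau> k) & h k : carrier (gsec G (W k))) \<and>
  (\<Union>k\<in>K. W k) = topspace T \<and>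
  (\<forall>k\<in>K. \<forall>l\<in>K.
     cres c (sg k) (sg l) (W k Int W l) =
     gres G (W k) (W k Int W l) (h k) \<otimes>\<^bsub>gsec G (W k Int W l)\<^esub>
     cres d (\<tau> k) (\<tau> l) (W k Int W l) \<otimes>\<^bsub>gsec G (W k Int W l)\<^esub>
     inv\<^bsub>gsec G (W k Int W l)\<^esub> (gres G (W l) (W k Int W l) (h l)))"
  using assms(1) unfolding cohomologous_def Let_def by (elim exE) (rule that)
 note D = conjunct1[OF this] conjunct1[OF conjunct2[OF this]] conjunct2[OF conjunct2[OF this]]
 note 1 = D(1)[rule_format] and 3 = D(3)[rule_format]
 show ?thesis
 proof (rule that[of K W sg \<tau> h], unfold cobounds_def, intro conjI[OF D(1) conjI[OF D(2)]] ballI allI impI)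
  fix k l V assume kl: "k : K" "l : K" and V: "openin T V" "V <= W k" "V <= W l"
  let ?W = "W k Int W l"
  have o: "openin T ?W" "openin T (W k)" "openin T (W l)" using 1 kl by auto
  interpret group "gsec G ?W" by (rule sec_group[OF o(1)])
  have a: "cres c (sg k) (sg l) ?W : carrier (gsec G ?W)"
   by (rule cres_closed) (use 1 kl o c in auto)
  have b: "cres d (\<tau> k) (\<tau> l) ?W : carrier (gsec G ?W)"
   by (rule cres_closed) (use 1 kl o d in auto)
  have h: "gres G (W k) ?W (h k) : carrier (gsec G ?W)" "gres G (W l) ?W (h l) : carrier (gsec G ?W)"
   using 1 kl o by (auto intro!: res_closed)
  have "cres c (sg k) (sg l) ?W \<otimes>\<^bsub>gsec G ?W\<^esub> gres G (W l) ?W (h l) =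
    gres G (W k) ?W (h k) \<otimes>\<^bsub>gsec G ?W\<^esub> cres d (\<tau> k) (\<tau> l) ?W"
   using 3[OF kl] a b h by (simp add: m_assoc)
  then have "gres G ?W V (cres c (sg k) (sg l) ?W \<otimes>\<^bsub>gsec G ?W\<^esub> gres G (W l) ?W (h l)) =
    gres G ?W V (gres G (W k) ?W (h k) \<otimes>\<^bsub>gsec G ?W\<^esub> cres d (\<tau> k) (\<tau> l) ?W)" by simp
  then have "gres G ?W V (cres c (sg k) (sg l) ?W) \<otimes>\<^bsub>gsec G V\<^esub> gres G ?W V (gres G (W l) ?W (h l)) =
    gres G ?W V (gres G (W k) ?W (h k)) \<otimes>\<^bsub>gsec G V\<^esub> gres G ?W V (cres d (\<tau> k) (\<tau> l) ?W)"
   using a b h V o by (simp add: res_mult)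
  moreover have "gres G ?W V (cres c (sg k) (sg l) ?W) = cres c (sg k) (sg l) V"
   "gres G ?W V (cres d (\<tau> k) (\<tau> l) ?W) = cres d (\<tau> k) (\<tau> l) V"
   by (rule cres_res; use 1 kl V o c d in auto)+
  moreover have "gres G ?W V (gres G (W l) ?W (h l)) = gres G (W l) V (h l)"
   "gres G ?W V (gres G (W k) ?W (h k)) = gres G (W k) V (h k)"
   by (rule res_comp; use 1 kl V o in auto)+
  ultimately show "cres c (sg k) (sg l) V \<otimes>\<^bsub>gsec G V\<^esub> gres G (W l) V (h l) =
    gres G (W k) V (h k) \<otimes>\<^bsub>gsec G V\<^esub> cres d (\<tau> k) (\<tau> l) V" by simp
 qed
qed

lemma cohomologous_refl:
 assumes c: "is_cocycle T G c"
 shows "cohomologous T G c c"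
proof (rule cohomologousI[where I="idx c" and W="cov c" and sg="%k. k" and \<tau>="%k. k"
   and h="%k. \<one>\<^bsub>gsec G (cov c k)\<^esub>", OF c c])
 fix k l V assume kl: "k : idx c" "l : idx c" and V: "V = cov c k Int cov c l" "openin T V"
 interpret group "gsec G V" by (rule sec_group[OF V(2)])
 have "gres G (cov c l) V \<one>\<^bsub>gsec G (cov c l)\<^esub> = \<one>\<^bsub>gsec G V\<^esub>"
  "gres G (cov c k) V \<one>\<^bsub>gsec G (cov c k)\<^esub> = \<one>\<^bsub>gsec G V\<^esub>"
  using kl V c by (auto intro!: res_one cocycle_open)
 moreover have "cres c k l V : carrier (gsec G V)"
  by (rule cres_closed) (use kl V c in auto)
 ultimately show "cres c k l V \<otimes>\<^bsub>gsec G V\<^esub> gres G (cov c l) V \<one>\<^bsub>gsec G (cov c l)\<^esub> =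
    gres G (cov c k) V \<one>\<^bsub>gsec G (cov c k)\<^esub> \<otimes>\<^bsub>gsec G V\<^esub> cres c k l V" by simp
qed (use c sec_group in \<open>auto simp: cocycle_open cocycle_cover intro!: monoid.one_closed group.is_monoid\<close>)

lemma cobounds_sym:
 assumes D: "cobounds c d K W sg \<tau> h" and c: "is_cocycle T G c" and d: "is_cocycle T G d"
 shows "cobounds d c K W \<tau> sg (%k. inv\<^bsub>gsec G (W k)\<^esub> (h k))"
 unfolding cobounds_def
proof (intro conjI ballI allI impI)
 note K = cobounds_data[OF D]
 fix k l V assume kl: "k : K" "l : K" and V: "openin T V" and s: "V <= W k" "V <= W l"
 interpret group "gsec G V" by (rule sec_group[OF V])
 note a = cobounds_closed(2)[OF D V s(1) kl(1) c kl(2) s(2)]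
  and b = cobounds_closed(3)[OF D V s(1) kl(1) d kl(2) s(2)]
  and h = cobounds_closed(1)[OF D V s(1) kl(1)] cobounds_closed(1)[OF D V s(2) kl(2)]
 have i: "gres G (W k) V (inv\<^bsub>gsec G (W k)\<^esub> h k) = inv\<^bsub>gsec G V\<^esub> gres G (W k) V (h k)"
  "gres G (W l) V (inv\<^bsub>gsec G (W l)\<^esub> h l) = inv\<^bsub>gsec G V\<^esub> gres G (W l) V (h l)"
  using K kl V s by (auto intro!: res_inv)
 have "cres d (\<tau> k) (\<tau> l) V = inv\<^bsub>gsec G V\<^esub> (gres G (W k) V (h k)) \<otimes>\<^bsub>gsec G V\<^esub>
   (cres c (sg k) (sg l) V \<otimes>\<^bsub>gsec G V\<^esub> gres G (W l) V (h l))"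
  using cobounds_eq[OF D kl V s] a b h by (simp add: inv_solve_left)
 then show "cres d (\<tau> k) (\<tau> l) V \<otimes>\<^bsub>gsec G V\<^esub> gres G (W l) V (inv\<^bsub>gsec G (W l)\<^esub> h l) =
   gres G (W k) V (inv\<^bsub>gsec G (W k)\<^esub> h k) \<otimes>\<^bsub>gsec G V\<^esub> cres c (sg k) (sg l) V"
  using a h by (simp add: i m_assoc)
next
 note K = cobounds_data[OF D]
 show "inv\<^bsub>gsec G (W k)\<^esub> (h k) : carrier (gsec G (W k))" if "k : K" for k
  using K(6)[OF that] sec_group[OF K(1)[OF that]] by (rule group.inv_closed[rotated])
qed (use cobounds_data[OF D] in auto)

lemma cobounds_cohomologous:
 assumes D: "cobounds c d K W sg \<tau> h" and c: "is_cocycle T G c" and d: "is_cocycle T G d"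
 shows "cohomologous T G c d"
proof (rule cohomologousI[where I=K and W=W and sg=sg and \<tau>=\<tau> and h=h, OF c d])
 fix k l V assume "k : K" "l : K" "V = W k Int W l" "openin T V"
 then show "cres c (sg k) (sg l) V \<otimes>\<^bsub>gsec G V\<^esub> gres G (W l) V (h l) =
    gres G (W k) V (h k) \<otimes>\<^bsub>gsec G V\<^esub> cres d (\<tau> k) (\<tau> l) V"
  by (intro cobounds_eq[OF D]) auto
qed (use cobounds_data[OF D] in auto)

lemma cohomologous_sym:
 assumes cd: "cohomologous T G c d" and c: "is_cocycle T G c" and d: "is_cocycle T G d"
 shows "cohomologous T G d c"
 using cohomologousE[OF assms] cobounds_cohomologous[OF cobounds_sym d c] c d by blast

lemma cohomologous_trans:
 assumes cd: "cohomologous T G c d" and de: "cohomologous T G d e"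
  and c: "is_cocycle T G c" and d: "is_cocycle T G d" and e: "is_cocycle T G e"
 shows "cohomologous T G c e"
proof -
 obtain K :: "'p set set" and W sg \<tau> h where D: "cobounds c d K W sg \<tau> h"
  using cohomologousE[OF cd c d] by blast
 note K = cobounds_data[OF D] and eq = cobounds_eq[OF D]
 obtain K' :: "'p set set" and W' sg' \<tau>' h' where D': "cobounds d e K' W' sg' \<tau>' h'"
  using cohomologousE[OF de d e] by blast
 note K' = cobounds_data[OF D'] and eq' = cobounds_eq[OF D']
 define WW where "WW = (%(k, k'). W k Int W' k')"
 \<comment> \<open>On the overlap of W k and W' k' the middle cocycle d is seen at two indices,
   \<open>\<tau> k\<close> and \<open>sg' k'\<close>. The two coboundaries can be composed only
   after inserting the transition function of d between these indices.\<close>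
 define H where "H = (%(k, k'). gres G (W k) (W k Int W' k') (h k) \<otimes>\<^bsub>gsec G (W k Int W' k')\<^esub>
   cres d (\<tau> k) (sg' k') (W k Int W' k') \<otimes>\<^bsub>gsec G (W k Int W' k')\<^esub>
   gres G (W' k') (W k Int W' k') (h' k'))"
 have oW: "openin T (W k Int W' k')" if "k : K" "k' : K'" for k k' using that K K' by auto
 have cl: "gres G (W k) V (h k) : carrier (gsec G V)" "cres d (\<tau> k) (sg' k') V : carrier (gsec G V)"
   "gres G (W' k') V (h' k') : carrier (gsec G V)"
  if "k : K" "k' : K'" "openin T V" "V <= W k" "V <= W' k'" for k k' V
 proof -
  show "gres G (W k) V (h k) : carrier (gsec G V)" "gres G (W' k') V (h' k') : carrier (gsec G V)"
   using cobounds_closed(1)[OF D that(3,4,1)] cobounds_closed(1)[OF D' that(3,5,2)] .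
  show "cres d (\<tau> k) (sg' k') V : carrier (gsec G V)"
   by (rule cres_closed[OF d K(3)[OF that(1)] K'(2)[OF that(2)] that(3)
      subset_trans[OF that(4) K(5)[OF that(1)]] subset_trans[OF that(5) K'(4)[OF that(2)]]])
 qed
 have Hr: "gres G (WW (k, k')) V (H (k, k')) = gres G (W k) V (h k) \<otimes>\<^bsub>gsec G V\<^esub>
   cres d (\<tau> k) (sg' k') V \<otimes>\<^bsub>gsec G V\<^esub> gres G (W' k') V (h' k')"
  if "k : K" "k' : K'" "openin T V" "V <= W k" "V <= W' k'" for k k' V
 proof -
  let ?U = "W k Int W' k'"
  note o = oW[OF that(1,2)]
  interpret U: group "gsec G ?U" by (rule sec_group[OF o])
  have s: "V <= ?U" using that by auto
  note cl' = cl[OF that(1,2) o]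
  have r: "gres G ?U V (gres G (W k) ?U (h k)) = gres G (W k) V (h k)"
   "gres G ?U V (gres G (W' k') ?U (h' k')) = gres G (W' k') V (h' k')"
   by (rule res_comp; use K K' that o in auto)+
  have r': "gres G ?U V (cres d (\<tau> k) (sg' k') ?U) = cres d (\<tau> k) (sg' k') V"
   by (rule cres_res) (use K(1-3)[OF that(1)] K'(1-3)[OF that(2)] K(5)[OF that(1)] K'(4)[OF that(2)]
     that o d in \<open>auto\<close>)
  show ?thesis unfolding H_def WW_def using cl' r r' s that o
   by (simp add: res_mult)
 qed
 show ?thesis
 proof (rule cohomologousI[where I="K \<times> K'" and W=WW and sg="%(k,k'). sg k" and \<tau>="%(k,k'). \<tau>' k'"
    and h=H, OF c e])
  fix p q V assume pq: "p : K \<times> K'" "q : K \<times> K'" and V: "V = WW p Int WW q" "openin T V"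
  obtain k k' l l' where p: "p = (k, k')" and q: "q = (l, l')" by fastforce
  have kl: "k : K" "k' : K'" "l : K" "l' : K'" using pq p q by auto
  have s: "V <= W k" "V <= W' k'" "V <= W l" "V <= W' l'" using V p q by (auto simp: WW_def)
  interpret group "gsec G V" by (rule sec_group[OF V(2)])
  have cov: "V <= cov c (sg k)" "V <= cov c (sg l)" "V <= cov d (\<tau> k)" "V <= cov d (\<tau> l)"
   "V <= cov d (sg' k')" "V <= cov d (sg' l')" "V <= cov e (\<tau>' k')" "V <= cov e (\<tau>' l')"
   using s K(4,5) K'(4,5) kl by blast+
  have cc: "cres c (sg k) (sg l) V : carrier (gsec G V)" "cres e (\<tau>' k') (\<tau>' l') V : carrier (gsec G V)"
   "cres d (\<tau> k) (\<tau> l) V : carrier (gsec G V)" "cres d (sg' k') (sg' l') V : carrier (gsec G V)"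
   "cres d (\<tau> k) (sg' l') V : carrier (gsec G V)"
   by (rule cres_closed; use c d e V kl K(2,3) K'(2,3) cov in auto)+
  note clk = cl[OF kl(1,2) V(2) s(1,2)] and cll = cl[OF kl(3,4) V(2) s(3,4)]
  note E = eq[OF kl(1,3) V(2) s(1,3)] and E' = eq'[OF kl(2,4) V(2) s(2,4)]
  \<comment> \<open>Both sides are the transition function of d from \<open>sg' l'\<close> to
    \<open>\<tau> k\<close>, computed through two different intermediate indices.\<close>
  have M: "cres d (\<tau> k) (\<tau> l) V \<otimes>\<^bsub>gsec G V\<^esub> cres d (\<tau> l) (sg' l') V =
    cres d (\<tau> k) (sg' k') V \<otimes>\<^bsub>gsec G V\<^esub> cres d (sg' k') (sg' l') V"
   using cres_mult[OF d] K(2,3) K'(2,3) kl cov V by simp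
  let ?a = "gres G (W k) V (h k)" and ?b = "gres G (W' l') V (h' l')"
  have "cres c (sg k) (sg l) V \<otimes>\<^bsub>gsec G V\<^esub> (gres G (W l) V (h l) \<otimes>\<^bsub>gsec G V\<^esub> cres d (\<tau> l) (sg' l') V \<otimes>\<^bsub>gsec G V\<^esub> ?b)
   = (cres c (sg k) (sg l) V \<otimes>\<^bsub>gsec G V\<^esub> gres G (W l) V (h l)) \<otimes>\<^bsub>gsec G V\<^esub> cres d (\<tau> l) (sg' l') V \<otimes>\<^bsub>gsec G V\<^esub> ?b"
   using cc clk cll by (simp add: m_assoc)
  also have "\<dots> = ?a \<otimes>\<^bsub>gsec G V\<^esub> (cres d (\<tau> k) (\<tau> l) V \<otimes>\<^bsub>gsec G V\<^esub> cres d (\<tau> l) (sg' l') V) \<otimes>\<^bsub>gsec G V\<^esub> ?b"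
   unfolding E using cc clk cll by (simp add: m_assoc)
  also have "\<dots> = ?a \<otimes>\<^bsub>gsec G V\<^esub> cres d (\<tau> k) (sg' k') V \<otimes>\<^bsub>gsec G V\<^esub> (cres d (sg' k') (sg' l') V \<otimes>\<^bsub>gsec G V\<^esub> ?b)"
   unfolding M using cc clk cll by (simp add: m_assoc)
  also have "\<dots> = ?a \<otimes>\<^bsub>gsec G V\<^esub> cres d (\<tau> k) (sg' k') V \<otimes>\<^bsub>gsec G V\<^esub> gres G (W' k') V (h' k') \<otimes>\<^bsub>gsec G V\<^esub> cres e (\<tau>' k') (\<tau>' l') V"
   unfolding E' using cc clk cll by (simp add: m_assoc)
  finally show "cres c (case p of (k, k') => sg k) (case q of (k, k') => sg k) V \<otimes>\<^bsub>gsec G V\<^esub> gres G (WW q) V (H q) =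
    gres G (WW p) V (H p) \<otimes>\<^bsub>gsec G V\<^esub> cres e (case p of (k, k') => \<tau>' k') (case q of (k, k') => \<tau>' k') V"
   using Hr[OF kl(1,2) V(2) s(1,2)] Hr[OF kl(3,4) V(2) s(3,4)] p q by simp
 next
  fix p assume "p : K \<times> K'"
  then obtain k k' where p: "p = (k, k')" and kl: "k : K" "k' : K'" by auto
  have "H (k, k') : carrier (gsec G (WW (k, k')))"
   using cl[OF kl oW[OF kl]] sec_group[OF oW[OF kl]]
   by (auto simp: H_def WW_def intro!: monoid.m_closed group.is_monoid)
  then show "openin T (WW p) & (case p of (k, k') => sg k) : idx c & (case p of (k, k') => \<tau>' k') : idx e \<and>
    WW p <= cov c (case p of (k, k') => sg k) & WW p <= cov e (case p of (k, k') => \<tau>' k') \<and>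
    H p : carrier (gsec G (WW p))"
   using p oW[OF kl] K(2,4)[OF kl(1)] K'(3,5)[OF kl(2)] by (auto simp: WW_def)
 next
  have "(\<Union>k\<in>K \<times> K'. WW k) = (\<Union>k\<in>K. W k) Int (\<Union>k\<in>K'. W' k)" by (auto simp: WW_def)
  then show "(\<Union>k\<in>K \<times> K'. WW k) = topspace T" using K K' by simp
 qed
qed

lemma cohomology_equiv:
 "equiv {c. is_cocycle T G c}
  {(c :: ('p set, 'p, 'g) cocycle, d :: ('p set, 'p, 'g) cocycle).
   is_cocycle T G c & is_cocycle T G d & cohomologous T G c d}"
 by (rule equivI)
  (auto intro!: refl_onI symI transI intro: cohomologous_refl cohomologous_sym cohomologous_trans)

lemma H1_cocycle: "[|g : H1 T G; c : g|] ==> is_cocycle T G c"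
 unfolding H1_def by (auto elim!: quotientE)

lemma H1_nonempty: "g : H1 T G ==> \<exists>c. c : g"
 unfolding H1_def using cohomologous_refl by (fastforce elim!: quotientE)

lemma H1_cohomologous: "[|g : H1 T G; c : g; d : g|] ==> cohomologous T G c d"
 unfolding H1_def using quotient_eq_iff[OF cohomology_equiv] by blast

lemma H1_eqI: "[|g : H1 T G; g' : H1 T G; c : g; d : g'; cohomologous T G c d|] ==> g = g'"
 using quotient_eq_iff[OF cohomology_equiv] H1_cocycle unfolding H1_def by blast

lemma H1_classI:
 fixes c :: "('p set, 'p, 'g) cocycle"
 shows "is_cocycle T G c ==> {d. is_cocycle T G d & cohomologous T G c d} : H1 T G"
 using quotientI[of c "{c. is_cocycle T G c}" "{(c, d). is_cocycle T G c & is_cocycle T G d & cohomologous T G c d}"]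
 by (simp add: H1_def Image_def)

end

section \<open>Morphisms of presheaves of groups and the induced map on cohomology\<close>

locale group_presheaf_hom = G: group_presheaf T G + H: group_presheaf T H
 for T :: "'p topology" and G :: "('p, 'g) gsheaf" and H :: "('p, 'h) gsheaf" +
 fixes f :: "'p set => 'g => 'h"
 assumes map_hom: "openin T U ==> f U : hom (gsec G U) (gsec H U)"
  and map_res: "[|openin T U; openin T V; V <= U; g : carrier (gsec G U)|]
   ==> f V (gres G U V g) = gres H U V (f U g)"
begin

lemma map_closed: "[|openin T U; g : carrier (gsec G U)|] ==> f U g : carrier (gsec H U)"
 by (rule hom_in_carrier[OF map_hom])

lemma map_mult: "[|openin T U; g : carrier (gsec G U); h : carrier (gsec G U)|]
  ==> f U (g \<otimes>\<^bsub>gsec G U\<^esub> h) = f U g \<otimes>\<^bsub>gsec H U\<^esub> f U h"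
 by (rule hom_mult[OF map_hom])

lemma map_cres:
 assumes "is_cocycle T G c" "i : idx c" "j : idx c" "openin T V" "V <= cov c i" "V <= cov c j"
 shows "gres H (cov c i Int cov c j) V (f (cov c i Int cov c j) (trans c i j)) = f V (G.cres c i j V)"
 by (rule map_res[symmetric]) (use assms in \<open>auto simp: G.cocycle_trans intro: G.cocycle_open\<close>)

lemma map_cocycle_cocycle:
 assumes c: "is_cocycle T G c"
 shows "is_cocycle T H (map_cocycle f c)"
 unfolding is_cocycle_def Let_def
proof (intro conjI ballI)
 fix i j k assume ijk: "i : idx (map_cocycle f c)" "j : idx (map_cocycle f c)" "k : idx (map_cocycle f c)"
 let ?W = "cov c i Int cov c j Int cov c k"
 have o: "openin T ?W" using ijk c by (auto simp: map_cocycle_def intro: G.cocycle_open)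
 have "f ?W (G.cres c i j ?W) \<otimes>\<^bsub>gsec H ?W\<^esub> f ?W (G.cres c j k ?W) = f ?W (G.cres c i k ?W)"
  using ijk c o by (subst map_mult[symmetric])
   (auto simp: map_cocycle_def intro!: G.cres_closed arg_cong[of _ _ "f ?W"] G.cres_mult)
 then show "H.cres (map_cocycle f c) i j (cov (map_cocycle f c) i Int cov (map_cocycle f c) j Int cov (map_cocycle f c) k)
   \<otimes>\<^bsub>gsec H (cov (map_cocycle f c) i Int cov (map_cocycle f c) j Int cov (map_cocycle f c) k)\<^esub>
   H.cres (map_cocycle f c) j k (cov (map_cocycle f c) i Int cov (map_cocycle f c) j Int cov (map_cocycle f c) k) =
   H.cres (map_cocycle f c) i k (cov (map_cocycle f c) i Int cov (map_cocycle f c) j Int cov (map_cocycle f c) k)"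
  using ijk c o by (simp add: map_cocycle_def map_cres inf.assoc le_infI1 le_infI2)
qed (use c in \<open>auto simp: map_cocycle_def G.cocycle_cover G.cocycle_open G.cocycle_trans intro!: map_closed\<close>)

lemma map_cohomologous:
 assumes cd: "cohomologous T G c d" and c: "is_cocycle T G c" and d: "is_cocycle T G d"
 shows "cohomologous T H (map_cocycle f c) (map_cocycle f d)"
proof -
 obtain K :: "'p set set" and W sg \<tau> h where D: "G.cobounds c d K W sg \<tau> h"
  using G.cohomologousE[OF assms] by blast
 note K = G.cobounds_data[OF D] and e = G.cobounds_eq[OF D]
 show ?thesis
 proof (rule H.cohomologousI[where I=K and W=W and sg=sg and \<tau>=\<tau> and h="%k. f (W k) (h k)"])
  fix k l V assume kl: "k : K" "l : K" and V: "V = W k Int W l" "openin T V"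
  have s: "V <= W k" "V <= W l" using V by auto
  have cov: "V <= cov c (sg k)" "V <= cov c (sg l)" "V <= cov d (\<tau> k)" "V <= cov d (\<tau> l)"
   using s K kl by blast+
  note a = G.cobounds_closed(2)[OF D V(2) s(1) kl(1) c kl(2) s(2)]
    G.cobounds_closed(3)[OF D V(2) s(1) kl(1) d kl(2) s(2)]
   and h = G.cobounds_closed(1)[OF D V(2) s(1) kl(1)] G.cobounds_closed(1)[OF D V(2) s(2) kl(2)]
  have "f V (G.cres c (sg k) (sg l) V \<otimes>\<^bsub>gsec G V\<^esub> gres G (W l) V (h l)) =
    f V (gres G (W k) V (h k) \<otimes>\<^bsub>gsec G V\<^esub> G.cres d (\<tau> k) (\<tau> l) V)"
   using e[OF kl V(2) s] by simp
  then show "H.cres (map_cocycle f c) (sg k) (sg l) V \<otimes>\<^bsub>gsec H V\<^esub> gres H (W l) V (f (W l) (h l)) =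
    gres H (W k) V (f (W k) (h k)) \<otimes>\<^bsub>gsec H V\<^esub> H.cres (map_cocycle f d) (\<tau> k) (\<tau> l) V"
   using a h V(2) K kl s c d cov by (simp add: map_cocycle_def map_cres map_mult map_res)
 qed (use K map_cocycle_cocycle c d in \<open>auto simp: map_cocycle_def intro!: map_closed\<close>)
qed

text \<open>\<open>H1_map\<close> ranges over all representatives of the class. Cohomologous
  cocycles have cohomologous images, so a single representative already yields the whole image
  class.\<close>

lemma H1_map_class:
 assumes g: "g : H1 T G" and c: "c : g"
 shows "H1_map T H f g = {d. is_cocycle T H d & cohomologous T H (map_cocycle f c) d}"
proof -
 have "cohomologous T H (map_cocycle f c) d"
  if e: "e : g" and d: "is_cocycle T H d" "cohomologous T H (map_cocycle f e) d" for d e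
  by (rule H.cohomologous_trans[OF map_cohomologous[OF G.H1_cohomologous[OF g c e]] d(2)])
   (use G.H1_cocycle[OF g] c e d map_cocycle_cocycle in auto)
 then show ?thesis unfolding H1_map_def using c by blast
qed

lemma H1_map_closed: "g : H1 T G ==> H1_map T H f g : H1 T H"
 using G.H1_nonempty H1_map_class G.H1_cocycle map_cocycle_cocycle H.H1_classI by metis

lemma H1_map_cohomologous:
 "[|g : H1 T G; c : g; d : H1_map T H f g|] ==> cohomologous T H (map_cocycle f c) d"
 using H1_map_class by fastforce

lemma H1_map_cocycle: "d : H1_map T H f g ==> is_cocycle T H d"
 by (simp add: H1_map_def)

end

section \<open>Sheaves of sets and their twisted forms\<close>

locale set_sheaf =
 fixes T :: "'p topology" and F :: "'p set => 'x set" and r :: "'p set => 'p set => 'x => 'x"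
 assumes sres_closed: "[|openin T U; openin T V; V <= U; s : F U|] ==> r U V s : F V"
  and sres_id: "[|openin T U; s : F U|] ==> r U U s = s"
  and sres_comp: "[|openin T U; openin T V; openin T W; W <= V; V <= U; s : F U|]
   ==> r V W (r U V s) = r U W s"
  and sglue: "[|!!U. U : \<U> ==> openin T U; !!U. U : \<U> ==> sg U : F U;
    !!U V. [|U : \<U>; V : \<U>|] ==> r U (U Int V) (sg U) = r V (U Int V) (sg V)|]
   ==> \<exists>!a. a : F (\<Union>\<U>) & (\<forall>U\<in>\<U>. r (\<Union>\<U>) U a = sg U)"
begin

text \<open>Uniqueness of gluing, applied to the cover of W by all open sets on which a and b
  agree.\<close>

lemma sep:
 assumes W: "openin T W" and a: "a : F W" and b: "b : F W"
  and loc: "!!x. x : W ==> \<exists>V. openin T V & x : V & V <= W & r W V a = r W V b"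
 shows "a = b"
proof -
 let ?C = "{V. openin T V & V <= W & r W V a = r W V b}"
 have C: "\<Union>?C = W" using loc by auto
 have "\<exists>!e. e : F (\<Union>?C) & (\<forall>U\<in>?C. r (\<Union>?C) U e = r W U a)"
 proof (rule sglue)
  fix U V assume "U : ?C" "V : ?C"
  then show "r U (U Int V) (r W U a) = r V (U Int V) (r W V a)"
   using sres_comp[OF W, of U "U Int V" a] sres_comp[OF W, of V "U Int V" a] a
    openin_Int[of T U V] by simp
 next
  show "r W U a : F U" if "U : ?C" for U using sres_closed[OF W _ _ a] that by blast
 qed auto
 then show ?thesis unfolding C using a b by auto
qed

lemma glue_ex:
 assumes U: "!!i. i : I ==> openin T (U i)" and W: "W = (\<Union>i\<in>I. U i)"
  and s: "!!i. i : I ==> s i : F (U i)"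
  and compat: "!!i j. [|i : I; j : I|] ==> r (U i) (U i Int U j) (s i) = r (U j) (U i Int U j) (s j)"
 obtains a where "a : F W" "!!i. i : I ==> r W (U i) a = s i"
proof -
 define k where "k = inv_into I U"
 have k: "k V : I" "U (k V) = V" if "V : U ` I" for V
  using that by (auto simp: k_def inv_into_into f_inv_into_f)
 \<comment> \<open>The gluing axiom speaks of a set of opens, here of an indexed family. Two indices
   with the same open set carry the same section, by compatibility on that set, so the choice made
   by \<open>k\<close> is harmless.\<close>
 have e: "s (k (U i)) = s i" if i: "i : I" for i
 proof -
  have kU: "k (U i) : I" "U (k (U i)) = U i" using k[of "U i"] i by auto
  show ?thesis using compat[OF kU(1) i] kU(2) sres_id[OF U[OF i] s[OF i]]
    sres_id[OF U[OF i], of "s (k (U i))"] s[OF kU(1)] by simp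
 qed
 have "\<exists>!a. a : F (\<Union>(U ` I)) & (\<forall>V\<in>U ` I. r (\<Union>(U ` I)) V a = s (k V))"
 proof (rule sglue)
  fix V V' assume V: "V : U ` I" "V' : U ` I"
  show "r V (V Int V') (s (k V)) = r V' (V Int V') (s (k V'))"
   using compat[OF k(1)[OF V(1)] k(1)[OF V(2)]] k(2)[OF V(1)] k(2)[OF V(2)] by simp
 next
  show "s (k V) : F V" if "V : U ` I" for V using s[OF k(1)[OF that]] k(2)[OF that] by simp
 qed (use U in auto)
 then obtain a where a: "a : F W" "\<forall>V\<in>U ` I. r W V a = s (k V)" unfolding W by blast
 show ?thesis by (rule that[OF a(1)]) (use a(2) e in auto)
qed

end

text \<open>Kept abstract for the sake of two instances: automorphisms acting on O_C[t]/(t^n), whose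
  twisted forms are the structure sheaves of the curves C(g), and units acting on O_C by
  multiplication, whose twisted forms are line bundles.\<close>

locale twist = set_sheaf T F r + group_presheaf T G
 for T :: "'p topology" and G :: "('p, 'g) gsheaf"
  and F :: "'p set => 'x set" and r :: "'p set => 'p set => 'x => 'x" +
 fixes act :: "'p set => 'g => 'x => 'x"
 assumes act_closed: "[|openin T V; g : carrier (gsec G V); s : F V|] ==> act V g s : F V"
  and act_one: "[|openin T V; s : F V|] ==> act V \<one>\<^bsub>gsec G V\<^esub> s = s"
  and act_mult: "[|openin T V; g : carrier (gsec G V); h : carrier (gsec G V); s : F V|]
   ==> act V (g \<otimes>\<^bsub>gsec G V\<^esub> h) s = act V g (act V h s)"
  and act_res: "[|openin T U; openin T V; V <= U; g : carrier (gsec G U); s : F U|]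
   ==> r U V (act U g s) = act V (gres G U V g) (r U V s)"
begin

definition tw :: "('i, 'p, 'g) cocycle => 'p set => ('i => 'x) set" where
 "tw c W = {f : (\<Pi>\<^sub>E i\<in>idx c. F (W Int cov c i)).
   \<forall>i\<in>idx c. \<forall>j\<in>idx c. r (W Int cov c i) (W Int (cov c i Int cov c j)) (f i) =
    act (W Int (cov c i Int cov c j)) (cres c i j (W Int (cov c i Int cov c j)))
     (r (W Int cov c j) (W Int (cov c i Int cov c j)) (f j))}"

definition trs :: "('i, 'p, 'g) cocycle => 'p set => 'p set => ('i => 'x) => 'i => 'x" where
 "trs c W W' f = (\<lambda>i\<in>idx c. r (W Int cov c i) (W' Int cov c i) (f i))"

text \<open>Over an open W inside \<open>cov c i\<close> this is inverse to the projection onto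
  component i; it trivialises the twisted form there.\<close>

definition tin :: "('i, 'p, 'g) cocycle => 'i => 'p set => 'x => 'i => 'x" where
 "tin c i W s = (\<lambda>j\<in>idx c. act (W Int cov c j) (cres c j i (W Int cov c j)) (r W (W Int cov c j) s))"

text \<open>A coboundary matches the sections of two twisted forms.\<close>

definition twrel :: "('i, 'p, 'g) cocycle => ('j, 'p, 'g) cocycle => 'z set => ('z => 'p set) =>
  ('z => 'i) => ('z => 'j) => ('z => 'g) => 'p set => ('i => 'x) => ('j => 'x) => bool" where
 "twrel c d K W sg \<tau> h A f f' \<longleftrightarrow> (\<forall>k\<in>K. r (A Int cov c (sg k)) (A Int W k) (f (sg k)) =
   act (A Int W k) (gres G (W k) (A Int W k) (h k)) (r (A Int cov d (\<tau> k)) (A Int W k) (f' (\<tau> k))))"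

context
 fixes c :: "('i, 'p, 'g) cocycle"
 assumes c: "is_cocycle T G c"
begin

lemma tw_comp_closed: "[|f : tw c W; i : idx c|] ==> f i : F (W Int cov c i)"
 by (auto simp: tw_def)

lemma open_Int: "[|openin T W; i : idx c|] ==> openin T (W Int cov c i)"
 using cocycle_open[OF c] by auto

lemma tw_eqI: "[|f : tw c W; f' : tw c W; !!i. i : idx c ==> f i = f' i|] ==> f = f'"
 by (auto simp: tw_def intro: PiE_ext)

lemma tw_eq:
 assumes f: "f : tw c W" and W: "openin T W" and i: "i : idx c" "j : idx c"
  and V: "openin T V" "V <= W" "V <= cov c i" "V <= cov c j"
 shows "r (W Int cov c i) V (f i) = act V (cres c i j V) (r (W Int cov c j) V (f j))"
proof -
 let ?U = "W Int (cov c i Int cov c j)"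
 have o: "openin T ?U" "openin T (W Int cov c i)" "openin T (W Int cov c j)"
  using W i cocycle_open[OF c] by auto
 have s: "V <= ?U" "?U <= W Int cov c i" "?U <= W Int cov c j" "?U <= cov c i" "?U <= cov c j" using V by auto
 note fi = tw_comp_closed[OF f i(1)] and fj = tw_comp_closed[OF f i(2)]
 have "r (W Int cov c i) V (f i) = r ?U V (r (W Int cov c i) ?U (f i))"
  using sres_comp[OF o(2,1) V(1) s(1,2) fi] by simp
 also have "r (W Int cov c i) ?U (f i) = act ?U (cres c i j ?U) (r (W Int cov c j) ?U (f j))"
  using f i by (simp add: tw_def)
 also have "r ?U V \<dots> = act V (gres G ?U V (cres c i j ?U)) (r ?U V (r (W Int cov c j) ?U (f j)))"
  by (rule act_res[OF o(1) V(1) s(1) cres_closed[OF c i o(1) s(4,5)] sres_closed[OF o(3,1) s(3) fj]])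
 also have "gres G ?U V (cres c i j ?U) = cres c i j V"
  by (rule cres_res[OF c i o(1) s(4,5) V(1) s(1)])
 also have "r ?U V (r (W Int cov c j) ?U (f j)) = r (W Int cov c j) V (f j)"
  by (rule sres_comp[OF o(3,1) V(1) s(1,3) fj])
 finally show ?thesis .
qed

lemma trs_closed:
 assumes W: "openin T W" "openin T W'" "W' <= W" and f: "f : tw c W"
 shows "trs c W W' f : tw c W'"
proof -
 have 1: "r (W Int cov c i) (W' Int cov c i) (f i) : F (W' Int cov c i)" if "i : idx c" for i
  using W that tw_comp_closed[OF f that] by (intro sres_closed[of "W Int cov c i"] open_Int) auto
 have 2: "r (W' Int cov c i) V (r (W Int cov c i) (W' Int cov c i) (f i)) = r (W Int cov c i) V (f i)"
  if "i : idx c" "openin T V" "V <= W' Int cov c i" for i V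
  using W that tw_comp_closed[OF f that(1)] by (intro sres_comp open_Int) auto
 show ?thesis
  unfolding tw_def
 proof (intro CollectI conjI ballI)
  show "trs c W W' f : (\<Pi>\<^sub>E i\<in>idx c. F (W' Int cov c i))" using 1 by (simp add: trs_def)
  fix i j assume i: "i : idx c" "j : idx c"
  let ?V = "W' Int (cov c i Int cov c j)"
  have V: "openin T ?V" using W i cocycle_open[OF c] by auto
  have "r (W Int cov c i) ?V (f i) = act ?V (cres c i j ?V) (r (W Int cov c j) ?V (f j))"
   by (rule tw_eq[OF f W(1) i V]) (use W in auto)
  moreover have "?V <= W' Int cov c i" "?V <= W' Int cov c j" by auto
  ultimately show "r (W' Int cov c i) ?V (trs c W W' f i) =
    act ?V (cres c i j ?V) (r (W' Int cov c j) ?V (trs c W W' f j))"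
   using 2 i V by (simp add: trs_def)
 qed
qed

lemma trs_id:
 assumes W: "openin T W" and f: "f : tw c W"
 shows "trs c W W f = f"
proof
 fix i show "trs c W W f i = f i"
 proof (cases "i : idx c")
  case True
  then show ?thesis using sres_id[OF open_Int[OF W True] tw_comp_closed[OF f True]] by (simp add: trs_def)
 next
  case False
  then show ?thesis using f by (auto simp: trs_def tw_def PiE_def extensional_def)
 qed
qed

lemma trs_comp:
 assumes W: "openin T W" "openin T W'" "openin T W''" "W'' <= W'" "W' <= W" and f: "f : tw c W"
 shows "trs c W' W'' (trs c W W' f) = trs c W W'' f"
proof (rule ext)
 fix i
 have "r (W' Int cov c i) (W'' Int cov c i) (r (W Int cov c i) (W' Int cov c i) (f i)) =
  r (W Int cov c i) (W'' Int cov c i) (f i)" if "i : idx c"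
  using W that tw_comp_closed[OF f that] by (intro sres_comp open_Int) auto
 then show "trs c W' W'' (trs c W W' f) i = trs c W W'' f i" by (simp add: trs_def)
qed

text \<open>The components glue separately. The twisting condition between two glued components is
  an equation of sections, hence may be checked over each member of the cover, where it is inherited
  from the given families.\<close>

lemma tw_glue:
 assumes U: "!!U. U : \<U> ==> openin T U" and s: "!!U. U : \<U> ==> sg U : tw c U"
  and compat: "!!U V. [|U : \<U>; V : \<U>|] ==> trs c U (U Int V) (sg U) = trs c V (U Int V) (sg V)"
 shows "\<exists>!a. a : tw c (\<Union>\<U>) & (\<forall>U\<in>\<U>. trs c (\<Union>\<U>) U a = sg U)"
proof -
 let ?W = "\<Union>\<U>"
 have W: "openin T ?W" using U by auto
 have "\<exists>a. a : F (?W Int cov c i) & (\<forall>U\<in>\<U>. r (?W Int cov c i) (U Int cov c i) a = sg U i)"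
  if i: "i : idx c" for i
 proof -
  obtain a where "a : F (?W Int cov c i)"
   "!!V. V : \<U> ==> r (?W Int cov c i) (V Int cov c i) a = sg V i"
  proof (rule glue_ex[where I=\<U> and U="%V. V Int cov c i" and s="%V. sg V i" and W="?W Int cov c i"])
   show "?W Int cov c i = (\<Union>V\<in>\<U>. V Int cov c i)" by auto
   show "sg V i : F (V Int cov c i)" if "V : \<U>" for V using tw_comp_closed[OF s[OF that] i] .
   fix V V' assume V: "V : \<U>" "V' : \<U>"
   have "(V Int cov c i) Int (V' Int cov c i) = (V Int V') Int cov c i" by auto
   then show "r (V Int cov c i) (V Int cov c i Int (V' Int cov c i)) (sg V i) =
    r (V' Int cov c i) (V Int cov c i Int (V' Int cov c i)) (sg V' i)"
    using fun_cong[OF compat[OF V], of i] i by (simp add: trs_def)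
  qed (use U open_Int i in auto)
  then show ?thesis by blast
 qed
 then obtain a where a: "!!i. i : idx c ==> a i : F (?W Int cov c i)"
  "!!i U. [|i : idx c; U : \<U>|] ==> r (?W Int cov c i) (U Int cov c i) (a i) = sg U i" by metis
 let ?a = "restrict a (idx c)"
 have at: "?a : tw c ?W"
  unfolding tw_def
 proof (intro CollectI conjI ballI)
  show "?a : (\<Pi>\<^sub>E i\<in>idx c. F (?W Int cov c i))" using a by simp
  fix i j assume i: "i : idx c" "j : idx c"
  let ?V = "?W Int (cov c i Int cov c j)"
  have V: "openin T ?V" using W i cocycle_open[OF c] by auto
  have Vs: "?V <= ?W Int cov c i" "?V <= ?W Int cov c j" "?V <= cov c i" "?V <= cov c j" by auto
  note oi = open_Int[OF W i(1)] open_Int[OF W i(2)]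
  have cc: "cres c i j ?V : carrier (gsec G ?V)" by (rule cres_closed[OF c i V Vs(3,4)])
  note aj = sres_closed[OF oi(2) V Vs(2) a(1)[OF i(2)]]
  have "r (?W Int cov c i) ?V (a i) = act ?V (cres c i j ?V) (r (?W Int cov c j) ?V (a j))"
  proof (rule sep[OF V sres_closed[OF oi(1) V Vs(1) a(1)[OF i(1)]] act_closed[OF V cc aj]])
   fix x assume x: "x : ?V"
   then obtain U where Ux: "U : \<U>" "x : U" by auto
   let ?A = "U Int (cov c i Int cov c j)"
   have A: "openin T ?A" using U[OF Ux(1)] i cocycle_open[OF c] by auto
   have Xs: "?A <= ?V" "?A <= U Int cov c i" "?A <= U Int cov c j" "U Int cov c i <= ?W Int cov c i"
    "U Int cov c j <= ?W Int cov c j" "?A <= U" "?A <= cov c i" "?A <= cov c j" using Ux by auto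
   note oU = open_Int[OF U[OF Ux(1)] i(1)] open_Int[OF U[OF Ux(1)] i(2)]
   have "r ?V ?A (r (?W Int cov c i) ?V (a i)) = r (U Int cov c i) ?A (sg U i)"
    using sres_comp[OF oi(1) V A Xs(1) Vs(1) a(1)[OF i(1)]]
     sres_comp[OF oi(1) oU(1) A Xs(2) Xs(4) a(1)[OF i(1)]] a(2)[OF i(1) Ux(1)] by simp
   also have "\<dots> = act ?A (cres c i j ?A) (r (U Int cov c j) ?A (sg U j))"
    by (rule tw_eq[OF s[OF Ux(1)] U[OF Ux(1)] i A Xs(6-8)])
   also have "r (U Int cov c j) ?A (sg U j) = r ?V ?A (r (?W Int cov c j) ?V (a j))"
    using sres_comp[OF oi(2) V A Xs(1) Vs(2) a(1)[OF i(2)]]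
     sres_comp[OF oi(2) oU(2) A Xs(3) Xs(5) a(1)[OF i(2)]] a(2)[OF i(2) Ux(1)] by simp
   also have "act ?A (cres c i j ?A) \<dots> = r ?V ?A (act ?V (cres c i j ?V) (r (?W Int cov c j) ?V (a j)))"
    using act_res[OF V A Xs(1) cc aj] cres_res[OF c i V Vs(3,4) A Xs(1)] by simp
   finally show "\<exists>A. openin T A & x : A & A <= ?V & r ?V A (r (?W Int cov c i) ?V (a i)) =
     r ?V A (act ?V (cres c i j ?V) (r (?W Int cov c j) ?V (a j)))"
    using A Xs x Ux by (intro exI[of _ ?A]) auto
  qed
  then show "r (?W Int cov c i) ?V (?a i) = act ?V (cres c i j ?V) (r (?W Int cov c j) ?V (?a j))"
   using i by simp
 qed
 have ar: "trs c ?W U ?a = sg U" if "U : \<U>" for U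
 proof (rule tw_eqI[OF trs_closed[OF W U[OF that] _ at] s[OF that]])
  fix i assume "i : idx c" then show "trs c ?W U ?a i = sg U i" using a(2) that by (simp add: trs_def)
 qed (use that in auto)
 show ?thesis
 proof (rule ex1I[of _ ?a])
  fix b assume b: "b : tw c ?W & (\<forall>U\<in>\<U>. trs c ?W U b = sg U)"
  show "b = ?a"
  proof (rule tw_eqI[of b ?W, OF _ at])
   fix i assume i: "i : idx c"
   show "b i = ?a i"
   proof (rule sep[OF open_Int[OF W i]])
    fix x assume x: "x : ?W Int cov c i"
    then obtain U' where U': "U' : \<U>" "x : U'" by auto
    have "trs c ?W U' b = sg U'" using b U' by blast
    from fun_cong[OF this, of i] have "r (?W Int cov c i) (U' Int cov c i) (b i) = sg U' i"
     using i by (simp add: trs_def)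
    then show "\<exists>V. openin T V & x : V & V <= ?W Int cov c i \<and>
      r (?W Int cov c i) V (b i) = r (?W Int cov c i) V (?a i)"
     using x U' a(2)[OF i U'(1)] i open_Int[OF U[OF U'(1)] i] by (intro exI[of _ "U' Int cov c i"]) auto
   qed (use b i a tw_comp_closed in auto)
  qed (use b in auto)
 qed (use at ar in auto)
qed

lemma tw_sheaf: "set_sheaf T (tw c) (trs c)"
 by unfold_locales (fact trs_closed trs_id trs_comp tw_glue)+

text \<open>If W lies in \<open>cov c i\<close>, the equation f_j = g_ji f_i holds on all of W Int
  cov c j, so f_i determines every component.\<close>

lemma tw_proj_inj:
 assumes f: "f : tw c W" and f': "f' : tw c W" and W: "openin T W" and i: "i : idx c"
  and s: "W <= cov c i" and e: "f i = f' i"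
 shows "f = f'"
proof (rule tw_eqI[OF f f'])
 fix j assume j: "j : idx c"
 have V: "openin T (W Int cov c j)" by (rule open_Int[OF W j])
 have *: "h j = act (W Int cov c j) (cres c j i (W Int cov c j)) (r (W Int cov c i) (W Int cov c j) (h i))"
  if h: "h : tw c W" for h
  using tw_eq[OF h W j i V] sres_id[OF V tw_comp_closed[OF h j]] s by auto
 show "f j = f' j" using *[OF f] *[OF f'] e by simp
qed

text \<open>Compatibility of the components j and k is the cocycle identity g_jk g_ki = g_ji;
  component i is a itself because g_ii = 1.\<close>

lemma tin_closed:
 assumes a: "a : F W" and W: "openin T W" and i: "i : idx c" and s: "W <= cov c i"
 shows "tin c i W a : tw c W" and "tin c i W a i = a"
proof -
 have o: "openin T (W Int cov c j)" if "j : idx c" for j by (rule open_Int[OF W that])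
 have cc: "cres c j i (W Int cov c j) : carrier (gsec G (W Int cov c j))" if "j : idx c" for j
  using s by (intro cres_closed[OF c that i o[OF that]]) auto
 have rc: "r W (W Int cov c j) a : F (W Int cov c j)" if "j : idx c" for j
  by (rule sres_closed[OF W o[OF that] _ a]) auto
 have rr: "r (W Int cov c j) V (act (W Int cov c j) (cres c j i (W Int cov c j)) (r W (W Int cov c j) a)) =
  act V (cres c j i V) (r W V a)" if "j : idx c" "openin T V" "V <= W Int cov c j" for j V
 proof -
  have "gres G (W Int cov c j) V (cres c j i (W Int cov c j)) = cres c j i V"
   using s that by (intro cres_res[OF c that(1) i o[OF that(1)]]) auto
  moreover have "r (W Int cov c j) V (r W (W Int cov c j) a) = r W V a"
   by (rule sres_comp[OF W o[OF that(1)] that(2,3) _ a]) auto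
  ultimately show ?thesis using act_res[OF o[OF that(1)] that(2,3) cc[OF that(1)] rc[OF that(1)]] by simp
 qed
 show "tin c i W a : tw c W"
  unfolding tw_def
 proof (intro CollectI conjI ballI)
  show "tin c i W a : (\<Pi>\<^sub>E j\<in>idx c. F (W Int cov c j))"
   using act_closed[OF o cc rc] by (simp add: tin_def)
  fix j k assume j: "j : idx c" "k : idx c"
  let ?V = "W Int (cov c j Int cov c k)"
  have V: "openin T ?V" using W j cocycle_open[OF c] by auto
  have Vs: "?V <= cov c j" "?V <= cov c k" "?V <= cov c i" "?V <= W Int cov c j" "?V <= W Int cov c k" "?V <= W"
   using s by auto
  have "act ?V (cres c j i ?V) (r W ?V a) = act ?V (cres c j k ?V \<otimes>\<^bsub>gsec G ?V\<^esub> cres c k i ?V) (r W ?V a)"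
   using cres_mult[OF c j i V Vs(1,2,3)] by simp
  also have "\<dots> = act ?V (cres c j k ?V) (act ?V (cres c k i ?V) (r W ?V a))"
   by (rule act_mult[OF V cres_closed[OF c j V Vs(1,2)] cres_closed[OF c j(2) i V Vs(2,3)]
      sres_closed[OF W V Vs(6) a]])
  finally show "r (W Int cov c j) ?V (tin c i W a j) =
    act ?V (cres c j k ?V) (r (W Int cov c k) ?V (tin c i W a k))"
   using rr[OF j(1) V Vs(4)] rr[OF j(2) V Vs(5)] j by (simp add: tin_def)
 qed
 have "W Int cov c i = W" using s by auto
 then show "tin c i W a i = a"
  using i cres_self[OF c i W s] by (simp add: tin_def sres_id[OF W a] act_one[OF W a])
qed

end

text \<open>Over A Int W k the relation prescribes the component \<open>sg k\<close> of f, hence all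
  of f there. The coboundary equation says exactly that these local solutions agree on overlaps, so
  they glue.\<close>

lemma twrel_ex1:
 assumes c: "is_cocycle T G c" and d: "is_cocycle T G d" and D: "cobounds c d K W sg \<tau> h"
  and A: "openin T A" and f': "f' : tw d A"
 shows "\<exists>!f. f : tw c A & twrel c d K W sg \<tau> h A f f'"
proof -
 note K = cobounds_data[OF D]
 interpret C: set_sheaf T "tw c" "trs c" by (rule tw_sheaf[OF c])
 have o: "openin T (A Int W k)" if "k : K" for k using A K(1)[OF that] by auto
 have sub: "A Int W k <= cov c (sg k)" "A Int W k <= cov d (\<tau> k)" if "k : K" for k
  using K(4,5)[OF that] by auto
 define b where "b k = act (A Int W k) (gres G (W k) (A Int W k) (h k))
   (r (A Int cov d (\<tau> k)) (A Int W k) (f' (\<tau> k)))" for k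
 have hc: "gres G (W k) V (h k) : carrier (gsec G V)" if "k : K" "openin T V" "V <= W k" for k V
  by (rule cobounds_closed(1)[OF D that(2,3,1)])
 have rc: "r (A Int cov d (\<tau> k)) V (f' (\<tau> k)) : F V" if "k : K" "openin T V" "V <= A Int W k" for k V
  by (rule sres_closed[OF open_Int[OF d A K(3)[OF that(1)]] that(2) _ tw_comp_closed[OF d f' K(3)[OF that(1)]]])
   (use that sub in blast)
 have bc: "b k : F (A Int W k)" if "k : K" for k
  unfolding b_def by (rule act_closed[OF o[OF that] hc[OF that o[OF that]] rc[OF that o[OF that]]]) auto
 have br: "r (A Int W k) V (b k) = act V (gres G (W k) V (h k)) (r (A Int cov d (\<tau> k)) V (f' (\<tau> k)))"
  if k: "k : K" and V: "openin T V" "V <= A Int W k" for k V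
 proof -
  have "r (A Int W k) V (b k) = act V (gres G (A Int W k) V (gres G (W k) (A Int W k) (h k)))
    (r (A Int W k) V (r (A Int cov d (\<tau> k)) (A Int W k) (f' (\<tau> k))))"
   unfolding b_def
   by (rule act_res[OF o[OF k] V hc[OF k o[OF k]] rc[OF k o[OF k]]]) auto
  moreover have "gres G (A Int W k) V (gres G (W k) (A Int W k) (h k)) = gres G (W k) V (h k)"
   by (rule res_comp[OF K(1)[OF k] o[OF k] V _ K(6)[OF k]]) auto
  moreover have "r (A Int W k) V (r (A Int cov d (\<tau> k)) (A Int W k) (f' (\<tau> k))) = r (A Int cov d (\<tau> k)) V (f' (\<tau> k))"
   by (rule sres_comp[OF open_Int[OF d A K(3)[OF k]] o[OF k] V _ tw_comp_closed[OF d f' K(3)[OF k]]])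
    (use sub[OF k] in auto)
  ultimately show ?thesis by simp
 qed
 have rel: "twrel c d K W sg \<tau> h A f f' \<longleftrightarrow> (\<forall>k\<in>K. trs c A (A Int W k) f (sg k) = b k)" for f
  using K(2,4) unfolding twrel_def b_def trs_def by (auto simp: Int_absorb2 inf.assoc le_infI2)
 have rel': "twrel c d K W sg \<tau> h A f f' \<longleftrightarrow> (\<forall>k\<in>K. trs c A (A Int W k) f = tin c (sg k) (A Int W k) (b k))"
  if f: "f : tw c A" for f
 proof -
  have "trs c A (A Int W k) f (sg k) = b k \<longleftrightarrow> trs c A (A Int W k) f = tin c (sg k) (A Int W k) (b k)" if k: "k : K" for k
   using tw_proj_inj[OF c trs_closed[OF c A o[OF k] _ f] tin_closed(1)[OF c bc[OF k] o[OF k] K(2)[OF k] sub(1)[OF k]]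
     o[OF k] K(2)[OF k] sub(1)[OF k]] tin_closed(2)[OF c bc[OF k] o[OF k] K(2)[OF k] sub(1)[OF k]] by auto
  then show ?thesis unfolding rel by auto
 qed
 obtain a where a: "a : tw c A" "!!k. k : K ==> trs c A (A Int W k) a = tin c (sg k) (A Int W k) (b k)"
 proof (rule C.glue_ex[where I=K and U="%k. A Int W k" and s="%k. tin c (sg k) (A Int W k) (b k)" and W=A])
  show "A = (\<Union>k\<in>K. A Int W k)" using K(7) openin_subset[OF A] by auto
  show "tin c (sg k) (A Int W k) (b k) : tw c (A Int W k)" if "k : K" for k
   by (rule tin_closed(1)[OF c bc[OF that] o[OF that] K(2)[OF that] sub(1)[OF that]])
  fix k l assume kl: "k : K" "l : K"
  let ?V = "A Int W k Int (A Int W l)"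
  let ?a = "tin c (sg k) (A Int W k) (b k)" and ?b = "tin c (sg l) (A Int W l) (b l)"
  have V: "openin T ?V" using o kl by auto
  have Vs: "?V <= A Int W k" "?V <= A Int W l" "?V <= W k" "?V <= W l" "?V <= A" by auto
  have cv: "?V <= cov c (sg k)" "?V <= cov c (sg l)" "?V <= cov d (\<tau> k)" "?V <= cov d (\<tau> l)"
   using sub[OF kl(1)] sub[OF kl(2)] by auto
  note ta = tin_closed[OF c bc[OF kl(1)] o[OF kl(1)] K(2)[OF kl(1)] sub(1)[OF kl(1)]]
   and tb = tin_closed[OF c bc[OF kl(2)] o[OF kl(2)] K(2)[OF kl(2)] sub(1)[OF kl(2)]]
  have ab: "A Int W k Int cov c (sg k) = A Int W k" "A Int W l Int cov c (sg l) = A Int W l"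
   "?V Int cov c (sg k) = ?V" using sub[OF kl(1)] sub[OF kl(2)] by auto
  \<comment> \<open>It suffices to compare the component \<open>sg k\<close>. The section f' is
    carried from index \<open>\<tau> k\<close> to \<open>\<tau> l\<close> by d, the coboundary
    equation trades h_k d for c h_l, and c relates the component \<open>sg l\<close> back to
    \<open>sg k\<close>.\<close>
  show "trs c (A Int W k) ?V ?a = trs c (A Int W l) ?V ?b"
  proof (rule tw_proj_inj[OF c trs_closed[OF c o[OF kl(1)] V Vs(1) ta(1)]
     trs_closed[OF c o[OF kl(2)] V Vs(2) tb(1)] V K(2)[OF kl(1)] cv(1)])
   have "trs c (A Int W k) ?V ?a (sg k) = r (A Int W k) ?V (b k)"
    using K(2)[OF kl(1)] ta(2) by (simp add: trs_def ab)
   also have "\<dots> = act ?V (gres G (W k) ?V (h k)) (r (A Int cov d (\<tau> k)) ?V (f' (\<tau> k)))"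
    by (rule br[OF kl(1) V Vs(1)])
   also have "r (A Int cov d (\<tau> k)) ?V (f' (\<tau> k)) = act ?V (cres d (\<tau> k) (\<tau> l) ?V) (r (A Int cov d (\<tau> l)) ?V (f' (\<tau> l)))"
    by (rule tw_eq[OF d f' A K(3)[OF kl(1)] K(3)[OF kl(2)] V Vs(5) cv(3,4)])
   also have "act ?V (gres G (W k) ?V (h k)) \<dots> =
     act ?V (gres G (W k) ?V (h k) \<otimes>\<^bsub>gsec G ?V\<^esub> cres d (\<tau> k) (\<tau> l) ?V) (r (A Int cov d (\<tau> l)) ?V (f' (\<tau> l)))"
    by (rule act_mult[OF V hc[OF kl(1) V Vs(3)] cobounds_closed(3)[OF D V Vs(3) kl(1) d kl(2) Vs(4)]
       rc[OF kl(2) V Vs(2)], symmetric])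
   also have "gres G (W k) ?V (h k) \<otimes>\<^bsub>gsec G ?V\<^esub> cres d (\<tau> k) (\<tau> l) ?V =
     cres c (sg k) (sg l) ?V \<otimes>\<^bsub>gsec G ?V\<^esub> gres G (W l) ?V (h l)"
    by (rule cobounds_eq[OF D kl V Vs(3,4), symmetric])
   also have "act ?V \<dots> (r (A Int cov d (\<tau> l)) ?V (f' (\<tau> l))) =
     act ?V (cres c (sg k) (sg l) ?V) (act ?V (gres G (W l) ?V (h l)) (r (A Int cov d (\<tau> l)) ?V (f' (\<tau> l))))"
    by (rule act_mult[OF V cobounds_closed(2)[OF D V Vs(3) kl(1) c kl(2) Vs(4)] hc[OF kl(2) V Vs(4)]
       rc[OF kl(2) V Vs(2)]])
   also have "act ?V (gres G (W l) ?V (h l)) (r (A Int cov d (\<tau> l)) ?V (f' (\<tau> l))) = r (A Int W l) ?V (b l)"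
    by (rule br[OF kl(2) V Vs(2), symmetric])
   also have "\<dots> = r (A Int W l Int cov c (sg l)) ?V (?b (sg l))" by (simp add: ab tb(2))
   also have "act ?V (cres c (sg k) (sg l) ?V) \<dots> = r (A Int W l Int cov c (sg k)) ?V (?b (sg k))"
    by (rule tw_eq[OF c tb(1) o[OF kl(2)] K(2)[OF kl(1)] K(2)[OF kl(2)] V Vs(2) cv(1,2), symmetric])
   also have "\<dots> = trs c (A Int W l) ?V ?b (sg k)" using K(2)[OF kl(1)] by (simp add: trs_def ab)
   finally show "trs c (A Int W k) ?V ?a (sg k) = trs c (A Int W l) ?V ?b (sg k)" .
  qed
 qed (use o in auto)
 show ?thesis
 proof (rule ex1I[of _ a])
  fix f assume f: "f : tw c A & twrel c d K W sg \<tau> h A f f'"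
  show "f = a"
  proof (rule C.sep[OF A])
   fix x assume x: "x : A"
   then obtain k where k: "k : K" "x : W k" using K(7) openin_subset[OF A] by auto
   have "trs c A (A Int W k) f = trs c A (A Int W k) a" using rel'[of f] f a(2) k by simp
   then show "\<exists>V. openin T V & x : V & V <= A & trs c A V f = trs c A V a"
    using x k o by (intro exI[of _ "A Int W k"]) auto
  qed (use f a in auto)
 qed (use a rel'[OF a(1)] in auto)
qed

lemma twrel_sym:
 assumes c: "is_cocycle T G c" and d: "is_cocycle T G d" and D: "cobounds c d K W sg \<tau> h"
  and A: "openin T A" and f: "f : tw c A" and f': "f' : tw d A"
 shows "twrel d c K W \<tau> sg (%k. inv\<^bsub>gsec G (W k)\<^esub> (h k)) A f' f \<longleftrightarrow> twrel c d K W sg \<tau> h A f f'"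
proof -
 note K = cobounds_data[OF D]
 have "(r (A Int cov d (\<tau> k)) (A Int W k) (f' (\<tau> k)) =
   act (A Int W k) (gres G (W k) (A Int W k) (inv\<^bsub>gsec G (W k)\<^esub> (h k))) (r (A Int cov c (sg k)) (A Int W k) (f (sg k)))) \<longleftrightarrow>
   (r (A Int cov c (sg k)) (A Int W k) (f (sg k)) =
   act (A Int W k) (gres G (W k) (A Int W k) (h k)) (r (A Int cov d (\<tau> k)) (A Int W k) (f' (\<tau> k))))"
  (is "?s = act ?V ?hi ?t \<longleftrightarrow> ?t = act ?V ?h ?s") if k: "k : K" for k
 proof -
  have V: "openin T ?V" using A K(1)[OF k] by auto
  interpret group "gsec G ?V" by (rule sec_group[OF V])
  have h: "?h : carrier (gsec G ?V)" by (rule cobounds_closed(1)[OF D V _ k]) auto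
  have hi: "?hi = inv\<^bsub>gsec G ?V\<^esub> ?h" by (rule res_inv[OF K(1)[OF k] V _ K(6)[OF k]]) auto
  have s: "?s : F ?V"
   by (rule sres_closed[OF open_Int[OF d A K(3)[OF k]] V _ tw_comp_closed[OF d f' K(3)[OF k]]])
    (use K(5)[OF k] in auto)
  have t: "?t : F ?V"
   by (rule sres_closed[OF open_Int[OF c A K(2)[OF k]] V _ tw_comp_closed[OF c f K(2)[OF k]]])
    (use K(4)[OF k] in auto)
  have "act ?V ?h (act ?V ?hi ?t) = ?t" "act ?V ?hi (act ?V ?h ?s) = ?s"
   using act_mult[OF V h _ t, of "inv\<^bsub>gsec G ?V\<^esub> ?h"] act_mult[OF V _ h s, of "inv\<^bsub>gsec G ?V\<^esub> ?h"] h
    act_one[OF V s] act_one[OF V t] by (simp_all add: hi)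
  then show ?thesis by metis
 qed
 then show ?thesis unfolding twrel_def by (intro ball_cong refl)
qed

text \<open>The inverse coboundary exchanges the roles of c and d.\<close>

lemma twrel_ex1':
 assumes c: "is_cocycle T G c" and d: "is_cocycle T G d" and D: "cobounds c d K W sg \<tau> h"
  and A: "openin T A" and f: "f : tw c A"
 shows "\<exists>!f'. f' : tw d A & twrel c d K W sg \<tau> h A f f'"
 using twrel_ex1[OF d c cobounds_sym[OF D c d] A f] twrel_sym[OF c d D A f] by metis

lemma twrel_res:
 assumes c: "is_cocycle T G c" and d: "is_cocycle T G d" and D: "cobounds c d K W sg \<tau> h"
  and A: "openin T A" "openin T Y" "Y <= A" and f: "f : tw c A" and f': "f' : tw d A"
  and R: "twrel c d K W sg \<tau> h A f f'"
 shows "twrel c d K W sg \<tau> h Y (trs c A Y f) (trs d A Y f')"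
 unfolding twrel_def
proof
 note K = cobounds_data[OF D]
 fix k assume k: "k : K"
 note oc = open_Int[OF c _ K(2)[OF k]] and od = open_Int[OF d _ K(3)[OF k]]
 have o: "openin T (A Int W k)" "openin T (Y Int W k)" using A K(1)[OF k] by auto
 have s: "Y Int W k <= A Int W k" "A Int W k <= A Int cov c (sg k)" "A Int W k <= A Int cov d (\<tau> k)"
  "Y Int W k <= Y Int cov c (sg k)" "Y Int W k <= Y Int cov d (\<tau> k)" "Y Int cov c (sg k) <= A Int cov c (sg k)"
  "Y Int cov d (\<tau> k) <= A Int cov d (\<tau> k)" "Y Int W k <= W k" "A Int W k <= W k"
  using A K(4,5)[OF k] by auto
 note fc = tw_comp_closed[OF c f K(2)[OF k]] and fd = tw_comp_closed[OF d f' K(3)[OF k]]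
 have "r (A Int cov c (sg k)) (Y Int W k) (f (sg k)) = r (A Int W k) (Y Int W k) (r (A Int cov c (sg k)) (A Int W k) (f (sg k)))"
  by (rule sres_comp[OF oc[OF A(1)] o s(1,2) fc, symmetric])
 also have "r (A Int cov c (sg k)) (A Int W k) (f (sg k)) =
   act (A Int W k) (gres G (W k) (A Int W k) (h k)) (r (A Int cov d (\<tau> k)) (A Int W k) (f' (\<tau> k)))"
  using R k by (simp add: twrel_def)
 also have "r (A Int W k) (Y Int W k) \<dots> = act (Y Int W k) (gres G (A Int W k) (Y Int W k) (gres G (W k) (A Int W k) (h k)))
   (r (A Int W k) (Y Int W k) (r (A Int cov d (\<tau> k)) (A Int W k) (f' (\<tau> k))))"
  by (rule act_res[OF o s(1) cobounds_closed(1)[OF D o(1) s(9) k] sres_closed[OF od[OF A(1)] o(1) s(3) fd]])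
 also have "gres G (A Int W k) (Y Int W k) (gres G (W k) (A Int W k) (h k)) = gres G (W k) (Y Int W k) (h k)"
  by (rule res_comp[OF K(1)[OF k] o s(1,9) K(6)[OF k]])
 also have "r (A Int W k) (Y Int W k) (r (A Int cov d (\<tau> k)) (A Int W k) (f' (\<tau> k))) = r (A Int cov d (\<tau> k)) (Y Int W k) (f' (\<tau> k))"
  by (rule sres_comp[OF od[OF A(1)] o s(1,3) fd])
 finally show "r (Y Int cov c (sg k)) (Y Int W k) (trs c A Y f (sg k)) =
   act (Y Int W k) (gres G (W k) (Y Int W k) (h k)) (r (Y Int cov d (\<tau> k)) (Y Int W k) (trs d A Y f' (\<tau> k)))"
  using sres_comp[OF oc[OF A(1)] oc[OF A(2)] o(2) s(4,6) fc]
   sres_comp[OF od[OF A(1)] od[OF A(2)] o(2) s(5,7) fd] K(2,3)[OF k]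
  by (simp add: trs_def)
qed

end

section \<open>Truncated polynomial rings R[t]/(t^n)\<close>

text \<open>The exponent 1 of t and the coefficient index 1 occur throughout; keeping them in this
  form lets the rules for \<open>trunc_t\<close> and \<open>tdrop 1\<close> match.\<close>

declare One_nat_def [simp del]

text \<open>The class modulo t^n of a sequence of coefficients. Only the first n terms of c matter,
  so c itself may be any function and not just a polynomial.\<close>

definition trunc_of :: "'a ring => nat => (nat => 'a) => (nat => 'a) set" where
 "trunc_of R n c = {q : up R. \<forall>i<n. q i = c i}"

text \<open>Coefficients are read off a chosen representative. They are meaningful below n only;
  from n on the value depends on the choice but is still an element of R.\<close>

definition tcf :: "(nat => 'a) set => nat => 'a" where
 "tcf F i = (SOME p. p : F) i"

lemma up_carrier: "carrier (UP R) = up R" by (simp add: UP_def)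

lemma coeff_up: "p : up R ==> up_ring.coeff (UP R) p = p"
 by (simp add: UP_def restrict_def)

lemma monom_up: "a : carrier R ==> up_ring.monom (UP R) a m = (%i. if i = m then a else \<zero>\<^bsub>R\<^esub>)"
 by (simp add: UP_def)

lemma add_up: "[|p : up R; q : up R|] ==> p \<oplus>\<^bsub>UP R\<^esub> q = (%i. p i \<oplus>\<^bsub>R\<^esub> q i)"
 by (simp add: UP_def)

locale trunc = cring R for R :: "'a ring" (structure) + fixes n :: nat
begin

abbreviation B where "B \<equiv> trunc_ring R n"

interpretation U: UP_cring R "UP R" by unfold_locales simp

lemma up_cut: "(!!i. i < n ==> c i : carrier R) ==> (%i. if i < n then c i else \<zero>) : up R"
 by (rule mem_upI) (auto intro!: exI[of _ n] simp: bound_def)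

lemma up_tail:
 assumes p: "p : up R"
 shows "(%i. p (i + k)) : up R"
proof (rule mem_upI)
 obtain n where "bound \<zero> n p" using p by blast
 then have "bound \<zero> n (%i. p (i + k))" by (auto simp: bound_def)
 then show "\<exists>n. bound \<zero> n (%i. p (i + k))" by blast
qed (use p in auto)

lemma coeff_monom_mult_general:
 assumes a: "a : carrier R" and p: "p : up R"
 shows "(up_ring.monom (UP R) a m \<otimes>\<^bsub>UP R\<^esub> p) k = (if k < m then \<zero> else a \<otimes> p (k - m))"
proof -
 have pU: "p : carrier (UP R)" using p by (simp add: up_carrier)
 have c: "up_ring.monom (UP R) a m \<otimes>\<^bsub>UP R\<^esub> p : up R" using U.UP_mult_closed[OF U.monom_closed[OF a] pU] by (simp only: up_carrier)
 have "(up_ring.monom (UP R) a m \<otimes>\<^bsub>UP R\<^esub> p) k = up_ring.coeff (UP R) (up_ring.monom (UP R) a m \<otimes>\<^bsub>UP R\<^esub> p) k"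
  using c by (simp add: coeff_up)
 also have "\<dots> = (if k < m then \<zero> else a \<otimes> p (k - m))"
 proof (cases "k < m")
  case True
  have "up_ring.coeff (UP R) (up_ring.monom (UP R) a m \<otimes>\<^bsub>UP R\<^esub> p) k =
   (\<Oplus>i\<in>{..k}. up_ring.coeff (UP R) (up_ring.monom (UP R) a m) i \<otimes> up_ring.coeff (UP R) p (k - i))"
   using a pU by (simp del: U.coeff_monom)
  also have "\<dots> = (\<Oplus>i\<in>{..k}. \<zero>)"
   using True a pU by (intro finsum_cong') auto
  finally show ?thesis using True by simp
 next
  case False
  then show ?thesis using U.coeff_monom_mult[OF a pU, of m "k - m"] p by (simp add: coeff_up)
 qed
 finally show ?thesis .
qed

lemma monom_in_up: "a : carrier R ==> up_ring.monom (UP R) a m : up R"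
 by (subst up_carrier[symmetric]) (rule U.monom_closed)

text \<open>Division by t^n is a shift of the coefficients, so vanishing of the low coefficients
  already gives a multiple of t^n.\<close>

lemma tpow_ideal_eq: "tpow_ideal R n = {p : up R. \<forall>i<n. p i = \<zero>}"
proof -
 let ?m = "up_ring.monom (UP R) \<one> n"
 have "tpow_ideal R n = {x \<otimes>\<^bsub>UP R\<^esub> ?m |x. x : up R}"
  using U.P.cgenideal_eq_genideal[of ?m] by (simp add: cgenideal_def up_carrier monom_in_up)
 also have "\<dots> = {p : up R. \<forall>i<n. p i = \<zero>}"
 proof (intro equalityI subsetI)
  fix p assume "p : {x \<otimes>\<^bsub>UP R\<^esub> ?m |x. x : up R}"
  then obtain x where x: "x : up R" "p = x \<otimes>\<^bsub>UP R\<^esub> ?m" by blast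
  then have "p = ?m \<otimes>\<^bsub>UP R\<^esub> x" using U.UP_m_comm[of x ?m] by (simp add: up_carrier monom_in_up)
  moreover have "?m \<otimes>\<^bsub>UP R\<^esub> x : up R"
   using x U.UP_mult_closed[of ?m x] by (simp add: up_carrier monom_in_up)
  ultimately show "p : {p : up R. \<forall>i<n. p i = \<zero>}"
   using x by (simp add: coeff_monom_mult_general)
 next
  fix p assume p: "p : {p : up R. \<forall>i<n. p i = \<zero>}"
  let ?x = "%i. p (i + n)"
  have x: "?x : up R" using p up_tail by blast
  have "?m \<otimes>\<^bsub>UP R\<^esub> ?x = p"
  proof
   fix k show "(?m \<otimes>\<^bsub>UP R\<^esub> ?x) k = p k"
    using p x mem_upD[of p R] by (auto simp: coeff_monom_mult_general)
  qed
  then have "p = ?x \<otimes>\<^bsub>UP R\<^esub> ?m" using U.UP_m_comm[of ?x ?m] x by (simp add: up_carrier monom_in_up)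
  then show "p : {x \<otimes>\<^bsub>UP R\<^esub> ?m |x. x : up R}" using x by blast
 qed
 finally show ?thesis .
qed

lemma tpow_ideal_ideal: "ideal (tpow_ideal R n) (UP R)"
 by (rule U.P.genideal_ideal) (simp add: up_carrier monom_in_up)

interpretation I: ideal "tpow_ideal R n" "UP R" by (rule tpow_ideal_ideal)

lemma trunc_ring_cring: "cring B"
 unfolding trunc_ring_def by (rule I.quotient_is_cring) (rule U.P.cring_axioms)

sublocale B: cring B by (rule trunc_ring_cring)

lemma coset_trunc_of:
 assumes p: "p : up R"
 shows "tpow_ideal R n +>\<^bsub>UP R\<^esub> p = trunc_of R n p"
proof (intro equalityI subsetI)
 fix q assume "q : tpow_ideal R n +>\<^bsub>UP R\<^esub> p"
 then obtain h where h: "h : tpow_ideal R n" "q = h \<oplus>\<^bsub>UP R\<^esub> p" by (auto simp: a_r_coset_def')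
 then have hu: "h : up R" "\<forall>i<n. h i = \<zero>" by (auto simp: tpow_ideal_eq)
 have "q : up R" using h hu p U.UP_a_closed[of h p] by (simp add: up_carrier)
 then show "q : trunc_of R n p"
  using h hu p mem_upD[of p R] by (simp add: trunc_of_def add_up)
next
 fix q assume q: "q : trunc_of R n p"
 let ?h = "%i. q i \<ominus> p i"
 have h: "?h : up R" using q p by (auto simp: trunc_of_def intro: up_minus_closed)
 then have "?h : tpow_ideal R n" using q p by (auto simp: trunc_of_def tpow_ideal_eq mem_upD)
 moreover have "q = ?h \<oplus>\<^bsub>UP R\<^esub> p"
  using q p h by (auto simp: trunc_of_def add_up mem_upD a_minus_def a_assoc l_neg)
 ultimately show "q : tpow_ideal R n +>\<^bsub>UP R\<^esub> p" by (auto simp: a_r_coset_def')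
qed

lemma trunc_of_cong: "(!!i. i < n ==> c i = d i) ==> trunc_of R n c = trunc_of R n d"
 by (auto simp: trunc_of_def)

lemma trunc_of_cut: "trunc_of R n c = trunc_of R n (%i. if i < n then c i else \<zero>)"
 by (rule trunc_of_cong) simp

lemma carrier_trunc: "carrier B = {trunc_of R n p |p. p : up R}"
 by (auto simp: trunc_ring_def FactRing_def A_RCOSETS_def' up_carrier coset_trunc_of)

lemma trunc_of_closed: "(!!i. i < n ==> c i : carrier R) ==> trunc_of R n c : carrier B"
 by (subst trunc_of_cut, subst carrier_trunc) (blast intro: up_cut)

lemma trunc_of_nonempty: "(!!i. i < n ==> c i : carrier R) ==> \<exists>p. p : trunc_of R n c"
 using up_cut[of c] by (force simp: trunc_of_def)

lemma tcf_trunc_of: "[|!!i. i < n ==> c i : carrier R; i < n|] ==> tcf (trunc_of R n c) i = c i"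
 using someI_ex[OF trunc_of_nonempty[of c]] by (auto simp: tcf_def trunc_of_def)

lemma rep_in:
 assumes F: "F : carrier B"
 shows "(SOME p. p : F) : F"
proof -
 obtain p where "p : up R" "F = trunc_of R n p" using F by (auto simp: carrier_trunc)
 then have "p : F" by (simp add: trunc_of_def)
 then show ?thesis by (rule someI[of "%p. p : F"])
qed

lemma tcf_up:
 assumes F: "F : carrier B"
 shows "tcf F : up R"
proof -
 obtain p where "F = trunc_of R n p" using F by (auto simp: carrier_trunc)
 then have "(SOME p. p : F) : trunc_of R n p" using rep_in[OF F] by simp
 then show ?thesis by (simp add: trunc_of_def tcf_def[abs_def])
qed

lemma tcf_closed [simp, intro]: "F : carrier B ==> tcf F i : carrier R"
 using tcf_up by blast

lemma trunc_of_tcf: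
 assumes F: "F : carrier B"
 shows "trunc_of R n (tcf F) = F"
proof -
 obtain p where p: "F = trunc_of R n p" using F by (auto simp: carrier_trunc)
 then have "(SOME p. p : F) : trunc_of R n p" using rep_in[OF F] by simp
 then have "trunc_of R n (tcf F) = trunc_of R n p"
  by (intro trunc_of_cong) (simp add: trunc_of_def tcf_def)
 then show ?thesis using p by simp
qed

lemma trunc_eqI: "[|F : carrier B; G : carrier B; !!i. i < n ==> tcf F i = tcf G i|] ==> F = G"
 using trunc_of_tcf trunc_of_cong by metis

lemma tcf_mem: "[|F : carrier B; p : F; i < n|] ==> p i = tcf F i"
 using trunc_of_tcf[of F] by (auto simp: trunc_of_def)

lemma trunc_of_add:
 "[|p : up R; q : up R|] ==> trunc_of R n p \<oplus>\<^bsub>B\<^esub> trunc_of R n q = trunc_of R n (p \<oplus>\<^bsub>UP R\<^esub> q)"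
 using I.a_rcos_sum[of p q] U.UP_a_closed[of p q]
 by (simp add: trunc_ring_def FactRing_def up_carrier coset_trunc_of)

lemma trunc_of_mult:
 "[|p : up R; q : up R|] ==> trunc_of R n p \<otimes>\<^bsub>B\<^esub> trunc_of R n q = trunc_of R n (p \<otimes>\<^bsub>UP R\<^esub> q)"
 using I.rcoset_mult_add[of p q] U.UP_mult_closed[of p q]
 by (simp add: trunc_ring_def FactRing_def up_carrier coset_trunc_of)

lemma tcf_trunc_of_up: "[|p : up R; i < n|] ==> tcf (trunc_of R n p) i = p i"
 by (rule tcf_trunc_of) auto

lemma tcf_add [simp]:
 assumes "F : carrier B" "G : carrier B" "i < n"
 shows "tcf (F \<oplus>\<^bsub>B\<^esub> G) i = tcf F i \<oplus> tcf G i"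
proof -
 have "F \<oplus>\<^bsub>B\<^esub> G = trunc_of R n (tcf F \<oplus>\<^bsub>UP R\<^esub> tcf G)"
  using trunc_of_add[OF tcf_up tcf_up] trunc_of_tcf assms by simp
 then show ?thesis using assms tcf_up U.UP_a_closed[of "tcf F" "tcf G"]
  by (simp add: tcf_trunc_of_up up_carrier) (simp add: add_up)
qed

lemma tcf_zero [simp]: "i < n ==> tcf \<zero>\<^bsub>B\<^esub> i = \<zero>"
 using tcf_add[of "\<zero>\<^bsub>B\<^esub>" "\<zero>\<^bsub>B\<^esub>" i] by simp

lemma tcf_minus [simp]: "[|F : carrier B; i < n|] ==> tcf (\<ominus>\<^bsub>B\<^esub> F) i = \<ominus> tcf F i"
 using tcf_add[of F "\<ominus>\<^bsub>B\<^esub> F" i] by (simp add: B.r_neg minus_equality a_comm sum_zero_eq_neg)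

lemma trunc_monom_eq: "a : carrier R ==> trunc_monom R n a m = trunc_of R n (%i. if i = m then a else \<zero>)"
 unfolding trunc_monom_def by (simp add: coset_trunc_of monom_in_up) (simp add: monom_up)

lemma trunc_monom_closed [simp, intro]: "a : carrier R ==> trunc_monom R n a m : carrier B"
 by (simp add: trunc_monom_eq) (rule trunc_of_closed, simp)

lemma tcf_monom [simp]:
 "[|a : carrier R; i < n|] ==> tcf (trunc_monom R n a m) i = (if i = m then a else \<zero>)"
 using tcf_trunc_of[of "%i. if i = m then a else \<zero>" i] by (simp add: trunc_monom_eq)

text \<open>Products with monomials have a simple coefficient formula. General products are reached
  from them by induction over ring generators, which avoids convolution sums.\<close>

lemma tcf_monom_mult [simp]:
 assumes a: "a : carrier R" and F: "F : carrier B" and i: "i < n"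
 shows "tcf (trunc_monom R n a m \<otimes>\<^bsub>B\<^esub> F) i = (if i < m then \<zero> else a \<otimes> tcf F (i - m))"
proof -
 have "trunc_monom R n a m \<otimes>\<^bsub>B\<^esub> F = trunc_of R n (up_ring.monom (UP R) a m \<otimes>\<^bsub>UP R\<^esub> tcf F)"
  using trunc_of_mult[OF monom_in_up[OF a] tcf_up[OF F]] trunc_of_tcf[OF F] a
  by (simp add: trunc_monom_def coset_trunc_of monom_in_up)
 moreover have "up_ring.monom (UP R) a m \<otimes>\<^bsub>UP R\<^esub> tcf F : up R"
  using U.UP_mult_closed[of "up_ring.monom (UP R) a m" "tcf F"] a F by (simp add: up_carrier monom_in_up tcf_up)
 ultimately show ?thesis
  using i a F by (simp add: tcf_trunc_of_up coeff_monom_mult_general tcf_up)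
qed

lemma one_trunc_monom: "\<one>\<^bsub>B\<^esub> = trunc_monom R n \<one> 0"
 by (simp add: trunc_monom_def trunc_ring_def FactRing_def)

lemma tcf_one [simp]: "i < n ==> tcf \<one>\<^bsub>B\<^esub> i = (if i = 0 then \<one> else \<zero>)"
 by (simp add: one_trunc_monom)

abbreviation tt where "tt \<equiv> trunc_t R n"
abbreviation tconst where "tconst a \<equiv> trunc_monom R n a 0"

lemma tconst_hom: "(%a. tconst a) : ring_hom R B"
 by (rule ring_hom_memI) (simp_all add: one_trunc_monom trunc_eqI)

lemma tt_pow: "tt [^]\<^bsub>B\<^esub> (k::nat) = trunc_monom R n \<one> k"
proof (induction k)
 case (Suc k)
 have "tt [^]\<^bsub>B\<^esub> Suc k = tt \<otimes>\<^bsub>B\<^esub> trunc_monom R n \<one> k" by (simp add: Suc B.m_comm)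
 also have "\<dots> = trunc_monom R n \<one> (Suc k)" by (rule trunc_eqI) auto
 finally show ?case .
qed (simp add: one_trunc_monom)

text \<open>Division by t^k of an element of (t^k). The quotient is determined modulo t^(n-k) only;
  its remaining top coefficients are set to zero.\<close>

definition tdrop :: "nat => (nat => 'a) set => (nat => 'a) set" where
 "tdrop k F = trunc_of R n (%i. if i + k < n then tcf F (i + k) else \<zero>)"

lemma tdrop_closed [simp, intro]: "F : carrier B ==> tdrop k F : carrier B"
 unfolding tdrop_def by (rule trunc_of_closed) auto

lemma tcf_tdrop [simp]:
 "[|F : carrier B; i < n|] ==> tcf (tdrop k F) i = (if i + k < n then tcf F (i + k) else \<zero>)"
 unfolding tdrop_def by (subst tcf_trunc_of) auto

definition tvan :: "nat => (nat => 'a) set => bool" where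
 "tvan k F \<longleftrightarrow> (\<forall>i<n. i < k \<longrightarrow> tcf F i = \<zero>)"

lemma tvan_monom_mult: "[|a : carrier R; F : carrier B|] ==> tvan k (trunc_monom R n a k \<otimes>\<^bsub>B\<^esub> F)"
 by (simp add: tvan_def)

lemma tvan_factor:
 assumes "F : carrier B" "tvan k F"
 shows "F = tt [^]\<^bsub>B\<^esub> k \<otimes>\<^bsub>B\<^esub> tdrop k F"
 using assms by (intro trunc_eqI) (auto simp: tt_pow tvan_def)

lemma tvan_mult:
 assumes F: "F : carrier B" "tvan k F" and G: "G : carrier B" "tvan l G"
 shows "tvan (k + l) (F \<otimes>\<^bsub>B\<^esub> G)"
proof -
 have "F \<otimes>\<^bsub>B\<^esub> G = (tt [^]\<^bsub>B\<^esub> k \<otimes>\<^bsub>B\<^esub> tdrop k F) \<otimes>\<^bsub>B\<^esub> (tt [^]\<^bsub>B\<^esub> l \<otimes>\<^bsub>B\<^esub> tdrop l G)"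
  using F G tvan_factor by metis
 also have "\<dots> = (tt [^]\<^bsub>B\<^esub> k \<otimes>\<^bsub>B\<^esub> tt [^]\<^bsub>B\<^esub> l) \<otimes>\<^bsub>B\<^esub> (tdrop k F \<otimes>\<^bsub>B\<^esub> tdrop l G)"
  using F G by (simp add: B.m_ac)
 also have "\<dots> = tt [^]\<^bsub>B\<^esub> (k + l) \<otimes>\<^bsub>B\<^esub> (tdrop k F \<otimes>\<^bsub>B\<^esub> tdrop l G)"
  by (simp add: B.nat_pow_mult)
 finally show ?thesis using F G by (simp add: tt_pow tvan_monom_mult)
qed

lemma tvan_0 [simp]: "tvan 0 F" by (simp add: tvan_def)

lemma tvan_pow:
 assumes F: "F : carrier B" "tvan 1 F"
 shows "tvan k (F [^]\<^bsub>B\<^esub> (k::nat))"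
proof (induction k)
 case (Suc k)
 then have "tvan (k + 1) (F [^]\<^bsub>B\<^esub> k \<otimes>\<^bsub>B\<^esub> F)" using tvan_mult[of "F [^]\<^bsub>B\<^esub> k" k F 1] F by simp
 then show ?case by (simp only: Suc_eq_plus1[symmetric] B.nat_pow_Suc)
qed simp

lemma tvan_eq_zero: "[|F : carrier B; tvan n F|] ==> F = \<zero>\<^bsub>B\<^esub>"
 by (rule trunc_eqI) (auto simp: tvan_def)

text \<open>Together with \<open>tt_pow_zero_imp\<close> this pins down n: the n-th power of every
  element of (t) vanishes, while no smaller power of t does. The multiplicity of a curve is
  recovered in this way.\<close>

lemma tvan_nilpotent: "[|F : carrier B; tvan 1 F|] ==> F [^]\<^bsub>B\<^esub> n = \<zero>\<^bsub>B\<^esub>"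
 by (simp add: tvan_eq_zero tvan_pow)

lemma tt_pow_zero_imp: "[|\<one> \<noteq> \<zero>; tt [^]\<^bsub>B\<^esub> (k::nat) = \<zero>\<^bsub>B\<^esub>|] ==> n \<le> k"
 using tcf_monom[of \<one> k k] tcf_zero[of k] by (fastforce simp: tt_pow)

lemma trunc_decomp: "F : carrier B ==> F = tconst (tcf F 0) \<oplus>\<^bsub>B\<^esub> tt \<otimes>\<^bsub>B\<^esub> tdrop 1 F"
 by (rule trunc_eqI) auto

text \<open>Horner's scheme: F = F_0 + t F', where F' has one coefficient fewer. Hence constants and
  t generate the ring, and the induction runs over the number of possibly nonzero
  coefficients.\<close>

lemma trunc_induct [consumes 1, case_names const t add mult]:
 assumes F: "F : carrier B"
  and c: "!!a. a : carrier R ==> P (tconst a)" and t: "P tt"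
  and a: "!!F G. [|F : carrier B; G : carrier B; P F; P G|] ==> P (F \<oplus>\<^bsub>B\<^esub> G)"
  and m: "!!F G. [|F : carrier B; G : carrier B; P F; P G|] ==> P (F \<otimes>\<^bsub>B\<^esub> G)"
 shows "P F"
proof -
 have "P F" if "F : carrier B" "\<forall>i<n. k \<le> i \<longrightarrow> tcf F i = \<zero>" for k F
  using that
 proof (induction k arbitrary: F)
  case 0
  then have "F = tconst \<zero>" by (intro trunc_eqI) auto
  then show ?case using c by simp
 next
  case (Suc k)
  have "P (tdrop 1 F)" by (rule Suc.IH) (use Suc.prems in auto)
  then have "P (tconst (tcf F 0) \<oplus>\<^bsub>B\<^esub> tt \<otimes>\<^bsub>B\<^esub> tdrop 1 F)"
   using Suc.prems by (intro a m c t) auto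
  then show ?case using trunc_decomp[OF Suc.prems(1)] by simp
 qed
 from this[OF F, of n] show ?thesis by simp
qed

lemma tcf_mult_0:
 assumes F: "F : carrier B" and G: "G : carrier B" and n: "0 < n"
 shows "tcf (F \<otimes>\<^bsub>B\<^esub> G) 0 = tcf F 0 \<otimes> tcf G 0"
proof -
 have "F \<otimes>\<^bsub>B\<^esub> G = tconst (tcf F 0) \<otimes>\<^bsub>B\<^esub> G \<oplus>\<^bsub>B\<^esub> tt \<otimes>\<^bsub>B\<^esub> (tdrop 1 F \<otimes>\<^bsub>B\<^esub> G)"
  using trunc_decomp[OF F] F G
  by (metis B.l_distr B.m_assoc B.m_closed one_closed tcf_closed tdrop_closed trunc_monom_closed)
 then show ?thesis using F G n by simp
qed

lemma at_zero_eq: "[|F : carrier B; 0 < n|] ==> at_zero R F = tcf F 0"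
proof -
 assume F: "F : carrier B" and n: "0 < n"
 have u: "p : up R" if "p : F" for p using that F by (auto simp: carrier_trunc trunc_of_def)
 obtain p where p: "p : F" using rep_in[OF F] by blast
 show ?thesis unfolding at_zero_def
 proof (rule the_equality)
  show "\<exists>q\<in>F. tcf F 0 = up_ring.coeff (UP R) q 0"
   using u[OF p] tcf_mem[OF F p n] by (intro bexI[OF _ p]) (simp add: coeff_up)
  show "a = tcf F 0" if "\<exists>p\<in>F. a = up_ring.coeff (UP R) p 0" for a
   using that u tcf_mem[OF F _ n] by (auto simp: coeff_up)
 qed
qed

text \<open>A ring homomorphism of coefficients induces coefficientwise homomorphisms, possibly
 truncating further.\<close>

lemma trunc_coef_hom:
 assumes S: "cring S" and f: "f : ring_hom R S" and k: "k \<le> n"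
 shows "(%F. trunc_of S k (%i. f (tcf F i))) : ring_hom B (trunc_ring S k)"
proof -
 interpret S: trunc S k using S by (simp add: trunc_def)
 interpret f: ring_hom_cring R S f
  by (rule ring_hom_cringI[OF is_cring S f])
 let ?h = "%F. trunc_of S k (%i. f (tcf F i))"
 have cl: "?h F : carrier S.B" if "F : carrier B" for F
  using that by (intro S.trunc_of_closed) auto
 have cf: "tcf (?h F) i = f (tcf F i)" if "F : carrier B" "i < k" for F i
  using that by (intro S.tcf_trunc_of) auto
 have ad: "?h (F \<oplus>\<^bsub>B\<^esub> G) = ?h F \<oplus>\<^bsub>S.B\<^esub> ?h G" if "F : carrier B" "G : carrier B" for F G
  using that k by (intro S.trunc_eqI) (auto simp: cl cf)
 have mo: "?h (trunc_monom R n a m \<otimes>\<^bsub>B\<^esub> F) = trunc_monom S k (f a) m \<otimes>\<^bsub>S.B\<^esub> ?h F"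
  if "a : carrier R" "F : carrier B" for a m F
  using that k by (intro S.trunc_eqI) (auto simp: cl cf)
 have m1: "?h (trunc_monom R n a m) = trunc_monom S k (f a) m" if "a : carrier R" for a m
  using that k by (intro S.trunc_eqI) (auto simp: cl cf)
 \<comment> \<open>G is kept universally quantified so that, for a product F F', the hypothesis on F
   can be applied with F' G as the other factor.\<close>
 have mu: "\<forall>G\<in>carrier B. ?h (F \<otimes>\<^bsub>B\<^esub> G) = ?h F \<otimes>\<^bsub>S.B\<^esub> ?h G" if "F : carrier B" for F
  using that
 proof (induction rule: trunc_induct)
  case (add F G) then show ?case by (auto simp: ad cl B.l_distr S.B.l_distr)
 next
  case (mult F G) then show ?case by (auto simp: cl B.m_assoc S.B.m_assoc)
 qed (auto simp: mo m1)
 show ?thesis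
  by (rule ring_hom_memI) (use cl ad mu in \<open>auto simp: one_trunc_monom S.one_trunc_monom m1\<close>)
qed

text \<open>\<open>trunc_map\<close> yields a union of classes, one for each representative of F.
  They all coincide because representatives agree in degrees below n.\<close>

lemma trunc_map_eq:
 assumes S: "cring S" and f: "f : ring_hom R S" and F: "F : carrier B"
 shows "trunc_map S n f F = trunc_of S n (%i. f (tcf F i))"
proof -
 interpret S: trunc S n using S by (simp add: trunc_def)
 interpret f: ring_hom_cring R S f
  by (rule ring_hom_cringI[OF is_cring S f])
 have fu: "(%i. f (p i)) : up S" if p: "p : up R" for p
 proof (rule mem_upI)
  obtain n where "bound \<zero> n p" using p by blast
  then have "bound \<zero>\<^bsub>S\<^esub> n (%i. f (p i))" by (auto simp: bound_def)
  then show "\<exists>n. bound \<zero>\<^bsub>S\<^esub> n (%i. f (p i))" by blast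
 qed (use p in auto)
 have Fu: "p : up R" if "p : F" for p using that F by (auto simp: carrier_trunc trunc_of_def)
 have "trunc_map S n f F = (\<Union>p\<in>F. tpow_ideal S n +>\<^bsub>UP S\<^esub> (%i. f (p i)))"
  by (auto simp: trunc_map_def set_add_def' a_r_coset_def')
 also have "\<dots> = (\<Union>p\<in>F. trunc_of S n (%i. f (p i)))"
  using Fu fu by (simp add: S.coset_trunc_of)
 also have "\<dots> = (\<Union>p\<in>F. trunc_of S n (%i. f (tcf F i)))"
  using tcf_mem[OF F] by (intro SUP_cong refl S.trunc_of_cong) simp
 also have "\<dots> = trunc_of S n (%i. f (tcf F i))" using rep_in[OF F] by auto
 finally show ?thesis .
qed

lemma trunc_red_eq:
 assumes F: "F : carrier B" and k: "k \<le> n"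
 shows "trunc_red R k F = trunc_of R k (tcf F)"
proof -
 interpret K: trunc R k by unfold_locales
 have Fu: "p : up R" if "p : F" for p using that F by (auto simp: carrier_trunc trunc_of_def)
 have "trunc_red R k F = (\<Union>p\<in>F. tpow_ideal R k +>\<^bsub>UP R\<^esub> p)"
  by (auto simp: trunc_red_def set_add_def' a_r_coset_def')
 also have "\<dots> = (\<Union>p\<in>F. trunc_of R k p)" using Fu by (simp add: K.coset_trunc_of)
 also have "\<dots> = (\<Union>p\<in>F. trunc_of R k (tcf F))"
  using tcf_mem[OF F] k by (intro SUP_cong refl K.trunc_of_cong) simp
 also have "\<dots> = trunc_of R k (tcf F)" using rep_in[OF F] by auto
 finally show ?thesis .
qed

lemma trunc_red_hom: "k \<le> n ==> trunc_red R k : ring_hom B (trunc_ring R k)"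
 using trunc_coef_hom[of R "%x. x" k] is_cring trunc_red_eq
 by (simp add: ring_hom_def is_cring Pi_iff)

lemma tcf_red:
 "[|F : carrier B; k \<le> n; i < k|] ==> tcf (trunc_red R k F) i = tcf F i"
 by (simp add: trunc_red_eq) (rule trunc.tcf_trunc_of, unfold_locales, auto)

lemma trunc_map_hom:
 "[|cring S; f : ring_hom R S|] ==> trunc_map S n f : ring_hom B (trunc_ring S n)"
 using trunc_coef_hom[of S f n] trunc_map_eq[of S f]
 by (simp add: ring_hom_def Pi_iff)

lemma tcf_map:
 "[|cring S; f : ring_hom R S; F : carrier B; i < n|] ==> tcf (trunc_map S n f F) i = f (tcf F i)"
 by (simp add: trunc_map_eq) (rule trunc.tcf_trunc_of, simp add: trunc_def, auto intro: ring_hom_closed)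

text \<open>Universal property of R[t]/(t^n): evaluation at \<tau> kills t^n. It later produces the
  lift of an automorphism from its values on constants and on t.\<close>

lemma trunc_eval:
 assumes D: "cring D" and f: "f : ring_hom R D" and t: "\<tau> : carrier D" "\<tau> [^]\<^bsub>D\<^esub> n = \<zero>\<^bsub>D\<^esub>"
 obtains \<Phi> where "\<Phi> : ring_hom B D" "!!a. a : carrier R ==> \<Phi> (tconst a) = f a" "\<Phi> tt = \<tau>"
proof -
 interpret D: cring D by (rule D)
 interpret f: ring_hom_cring R D f
  by (rule ring_hom_cringI[OF is_cring D f])
 interpret E: UP_pre_univ_prop R D f "UP R" by unfold_locales simp
 let ?e = "UnivPoly.eval R D f \<tau>"
 have e: "?e : ring_hom (UP R) D" by (rule E.eval_ring_hom[OF t(1)])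
 interpret e: ring_hom_cring "UP R" D ?e
  by (rule ring_hom_cringI[OF U.P.is_cring D e])
 let ?m = "up_ring.monom (UP R) \<one> n"
 have em: "?e ?m = \<zero>\<^bsub>D\<^esub>"
 proof -
  have "?m = up_ring.monom (UP R) \<one> 1 [^]\<^bsub>UP R\<^esub> n" using U.monom_pow[of \<one> 1 n] by simp
  then have "?e ?m = ?e (up_ring.monom (UP R) \<one> 1) [^]\<^bsub>D\<^esub> n" using e.hom_pow by simp
  then show ?thesis using E.eval_monom1[OF t(1)] t(2) by simp
 qed
 have ei: "?e h = \<zero>\<^bsub>D\<^esub>" if "h : tpow_ideal R n" for h
 proof -
  have "h : {x \<otimes>\<^bsub>UP R\<^esub> ?m |x. x : up R}"
   using that U.P.cgenideal_eq_genideal[of ?m] by (simp add: cgenideal_def up_carrier monom_in_up)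
  then obtain x where "x : up R" "h = x \<otimes>\<^bsub>UP R\<^esub> ?m" by blast
  then show ?thesis using em by (simp add: up_carrier monom_in_up)
 qed
 define \<Phi> where "\<Phi> = (%F. ?e (tcf F))"
 have co: "\<Phi> (trunc_of R n p) = ?e p" if p: "p : up R" for p
 proof -
  let ?q = "tcf (trunc_of R n p)"
  have cl: "trunc_of R n p : carrier B" using p by (auto simp: carrier_trunc)
  then have q: "?q : up R" "?q : tpow_ideal R n +>\<^bsub>UP R\<^esub> p"
   using tcf_up rep_in[OF cl] p by (auto simp: coset_trunc_of tcf_def[abs_def])
  then obtain h where h: "h : tpow_ideal R n" "?q = h \<oplus>\<^bsub>UP R\<^esub> p" by (auto simp: a_r_coset_def')
  moreover have "h : carrier (UP R)" using h I.Icarr by blast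
  ultimately show ?thesis using p ei[OF h(1)] by (simp add: \<Phi>_def up_carrier)
 qed
 show ?thesis
 proof
  show "\<Phi> : ring_hom B D"
  proof (rule ring_hom_memI)
   fix F assume F: "F : carrier B"
   then show "\<Phi> F : carrier D" using tcf_up[OF F] by (simp add: \<Phi>_def up_carrier)
   fix G assume G: "G : carrier B"
   have u: "tcf F : up R" "tcf G : up R" using F G tcf_up by auto
   have "\<Phi> (F \<otimes>\<^bsub>B\<^esub> G) = ?e (tcf F \<otimes>\<^bsub>UP R\<^esub> tcf G)"
    using co[of "tcf F \<otimes>\<^bsub>UP R\<^esub> tcf G"] u trunc_of_mult[OF u] trunc_of_tcf F G
     U.UP_mult_closed[of "tcf F" "tcf G"] by (simp add: up_carrier)
   then show "\<Phi> (F \<otimes>\<^bsub>B\<^esub> G) = \<Phi> F \<otimes>\<^bsub>D\<^esub> \<Phi> G" using u by (simp add: \<Phi>_def up_carrier)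
   have "\<Phi> (F \<oplus>\<^bsub>B\<^esub> G) = ?e (tcf F \<oplus>\<^bsub>UP R\<^esub> tcf G)"
    using co[of "tcf F \<oplus>\<^bsub>UP R\<^esub> tcf G"] u trunc_of_add[OF u] trunc_of_tcf F G
     U.UP_a_closed[of "tcf F" "tcf G"] by (simp add: up_carrier)
   then show "\<Phi> (F \<oplus>\<^bsub>B\<^esub> G) = \<Phi> F \<oplus>\<^bsub>D\<^esub> \<Phi> G" using u by (simp add: \<Phi>_def up_carrier)
  next
   have "\<Phi> \<one>\<^bsub>B\<^esub> = ?e (up_ring.monom (UP R) \<one> 0)"
    using co[OF monom_in_up[OF one_closed, of 0]]
    by (simp only: one_trunc_monom trunc_monom_def coset_trunc_of[OF monom_in_up[OF one_closed]])
   then show "\<Phi> \<one>\<^bsub>B\<^esub> = \<one>\<^bsub>D\<^esub>" using E.eval_const[OF t(1), of \<one>] by simp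
  qed
  show "\<Phi> (tconst a) = f a" if "a : carrier R" for a
   using co[OF monom_in_up[OF that, of 0]] that E.eval_const[OF t(1) that]
   by (simp add: trunc_monom_def coset_trunc_of monom_in_up)
  show "\<Phi> tt = \<tau>"
   using co[OF monom_in_up[of \<one> 1]] E.eval_monom1[OF t(1)]
   by (simp add: trunc_monom_def coset_trunc_of monom_in_up)
 qed
qed

lemma trunc_hom_eqI:
 assumes D: "cring D" and f: "f : ring_hom B D" and g: "g : ring_hom B D"
  and c: "!!a. a : carrier R ==> f (tconst a) = g (tconst a)" and t: "f tt = g tt"
  and F: "F : carrier B"
 shows "f F = g F"
 using F
proof (induction rule: trunc_induct)
 case (add F G) then show ?case by (simp add: ring_hom_add[OF f] ring_hom_add[OF g])
next
 case (mult F G) then show ?case by (simp add: ring_hom_mult[OF f] ring_hom_mult[OF g])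
qed (use c t in auto)

end

context trunc
begin

context
 fixes ph
 assumes ph: "ph : ring_hom B B" and ph0: "!!F. F : carrier B ==> tcf (ph F) 0 = tcf F 0" and n: "0 < n"
begin

interpretation ph: ring_hom_cring B B ph
 by (rule ring_hom_cringI[OF B.is_cring B.is_cring ph])

lemma tvan_hom_t: "tvan 1 (ph tt)"
 using ph0[of tt] n by (simp add: tvan_def)

text \<open>Since the image of t lies in (t), the image of t^k F' lies in (t^k).\<close>

lemma tvan_hom:
 assumes F: "F : carrier B" "tvan k F"
 shows "tvan k (ph F)"
proof -
 have "ph F = ph tt [^]\<^bsub>B\<^esub> k \<otimes>\<^bsub>B\<^esub> ph (tdrop k F)"
  using arg_cong[OF tvan_factor[OF F], of ph] F by simp
 then show ?thesis
  using tvan_mult[OF _ tvan_pow[OF _ tvan_hom_t], of k "ph (tdrop k F)" 0] F by simp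
qed

text \<open>Write F = t F' and ph t = t \<nu>. Then ph F = t \<nu> ph F', and the constant term of
  \<nu> ph F' is \<nu>_0 F'_0. This makes \<open>xi\<close> multiplicative and makes it the
  multiplier of the conormal sheaf.\<close>

lemma tcf_1_hom:
 assumes F: "F : carrier B" "tvan 1 F" and n1: "1 < n"
 shows "tcf (ph F) 1 = tcf (ph tt) 1 \<otimes> tcf F 1"
proof -
 have "F = tt \<otimes>\<^bsub>B\<^esub> tdrop 1 F" using tvan_factor[OF F] by simp
 then have "ph F = ph (tt \<otimes>\<^bsub>B\<^esub> tdrop 1 F)" by (rule arg_cong)
 then have "ph F = ph tt \<otimes>\<^bsub>B\<^esub> ph (tdrop 1 F)" using F by simp
 moreover have "ph tt = tt \<otimes>\<^bsub>B\<^esub> tdrop 1 (ph tt)"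
  using tvan_factor[of "ph tt" 1] tvan_hom_t by simp
 ultimately have "ph F = tt \<otimes>\<^bsub>B\<^esub> (tdrop 1 (ph tt) \<otimes>\<^bsub>B\<^esub> ph (tdrop 1 F))"
  using F by (metis B.m_assoc ph.hom_closed one_closed tdrop_closed trunc_monom_closed)
 then have "tcf (ph F) 1 = tcf (tdrop 1 (ph tt) \<otimes>\<^bsub>B\<^esub> ph (tdrop 1 F)) 0"
  using F n1 by simp
 also have "\<dots> = tcf (ph tt) 1 \<otimes> tcf F 1"
  using F n1 by (simp add: tcf_mult_0 ph0)
 finally show ?thesis .
qed

end

end

lemma (in ringed_cspace) structure_sheaf: "set_sheaf (topo S) (%U. carrier (sect S U)) (rest S)"
proof
 fix U V s assume "openin (topo S) U" "openin (topo S) V" "V <= U" "s : carrier (sect S U)"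
 then show "rest S U V s : carrier (sect S V)" using rest_hom ring_hom_closed by metis
qed (fact rest_id rest_comp glue)+

section \<open>The sheaf O_C[t]/(t^n) and its automorphisms\<close>

locale thickening = ringed_cspace C for C :: "('p, 'a) cspace" +
 fixes n :: nat
 assumes n_pos: "0 < n"
begin

abbreviation th where "th U \<equiv> trunc_ring (sect C U) n"
abbreviation thr where "thr U V \<equiv> trunc_map (sect C V) n (rest C U V)"
abbreviation op where "op \<equiv> openin (topo C)"

lemma thick_simps [simp]:
 "sect (thick C n) U = th U" "rest (thick C n) U V = thr U V" "topo (thick C n) = topo C"
 "scal (thick C n) U c = trunc_monom (sect C U) n (scal C U c) 0"
 by (simp_all add: thick_def)

lemma tr: "op U ==> trunc (sect C U)"
 by (simp add: trunc_def sect_cring)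

lemma th_cring: "op U ==> cring (th U)"
 by (rule trunc.trunc_ring_cring[OF tr])

lemma rest_closed: "[|op U; op V; V <= U; s : carrier (sect C U)|] ==> rest C U V s : carrier (sect C V)"
 by (rule ring_hom_closed[OF rest_hom])

lemma thr_hom: "[|op U; op V; V <= U|] ==> thr U V : ring_hom (th U) (th V)"
 by (rule trunc.trunc_map_hom[OF tr sect_cring rest_hom])

lemma thr_closed: "[|op U; op V; V <= U; F : carrier (th U)|] ==> thr U V F : carrier (th V)"
 by (rule ring_hom_closed[OF thr_hom])

lemma tcf_thr:
 "[|op U; op V; V <= U; F : carrier (th U); i < n|] ==> tcf (thr U V F) i = rest C U V (tcf F i)"
 by (rule trunc.tcf_map[OF tr sect_cring rest_hom])

lemma tcf_in: "[|op U; F : carrier (th U)|] ==> tcf F i : carrier (sect C U)"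
 by (rule trunc.tcf_closed[OF tr])

lemma th_eqI:
 "[|op U; F : carrier (th U); G : carrier (th U); !!i. i < n ==> tcf F i = tcf G i|] ==> F = G"
 by (rule trunc.trunc_eqI[OF tr])

lemma rest_zero: "[|op U; op V; V <= U|] ==> rest C U V \<zero>\<^bsub>sect C U\<^esub> = \<zero>\<^bsub>sect C V\<^esub>"
 using rest_hom[of U V] sect_cring by (intro ring_hom_zero) (auto simp: cring_def)

lemma rest_one: "[|op U; op V; V <= U|] ==> rest C U V \<one>\<^bsub>sect C U\<^esub> = \<one>\<^bsub>sect C V\<^esub>"
 by (rule ring_hom_one[OF rest_hom])

lemma thr_monom:
 assumes U: "op U" "op V" "V <= U" and a: "a : carrier (sect C U)"
 shows "thr U V (trunc_monom (sect C U) n a m) = trunc_monom (sect C V) n (rest C U V a) m"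
proof -
 interpret U: trunc "sect C U" n by (rule tr[OF U(1)])
 interpret V: trunc "sect C V" n by (rule tr[OF U(2)])
 show ?thesis
  using U a by (intro th_eqI[OF U(2)] thr_closed) (auto simp: tcf_thr rest_closed rest_zero)
qed

lemma scal_in: "op U ==> scal C U c : carrier (sect C U)"
 using ring_hom_closed[OF scal_hom, of U c] by (simp add: ring_of_type_algebra_def)

interpretation O: set_sheaf "topo C" "%U. carrier (sect C U)" "rest C"
 by (rule structure_sheaf)

text \<open>A section is its list of n coefficients and restriction acts on each of them, so gluing
  takes place coefficientwise in O_C.\<close>

lemma thick_sheaf: "set_sheaf (topo C) (%U. carrier (th U)) thr"
proof
 fix U s assume U: "op U" and s: "s : carrier (th U)"
 show "thr U U s = s" using U s by (intro th_eqI[OF U]) (auto simp: tcf_thr thr_closed rest_id tcf_in)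
next
 fix U V W s assume "op U" "op V" "op W" "W <= V" "V <= U" "s : carrier (th U)"
 moreover from this have "W <= U" by auto
 ultimately show "thr V W (thr U V s) = thr U W s"
  by (intro th_eqI[of W]) (auto simp: tcf_thr thr_closed rest_comp tcf_in)
next
 fix \<U> sg
 assume U: "!!U. U : \<U> ==> op U" and s: "!!U. U : \<U> ==> sg U : carrier (th U)"
  and compat: "!!U V. [|U : \<U>; V : \<U>|] ==> thr U (U Int V) (sg U) = thr V (U Int V) (sg V)"
 let ?W = "\<Union>\<U>"
 have W: "op ?W" using U by auto
 interpret W: trunc "sect C ?W" n by (rule tr[OF W])
 have Us: "U <= ?W" if "U : \<U>" for U using that by auto
 have "\<exists>!a. a : carrier (sect C ?W) & (\<forall>U\<in>\<U>. rest C ?W U a = tcf (sg U) i)" if i: "i < n" for i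
 proof (rule glue)
  fix U V assume UV: "U : \<U>" "V : \<U>"
  show "rest C U (U Int V) (tcf (sg U) i) = rest C V (U Int V) (tcf (sg V) i)"
   using tcf_thr[OF U[OF UV(1)] openin_Int[OF U[OF UV(1)] U[OF UV(2)]] _ s[OF UV(1)] i]
    tcf_thr[OF U[OF UV(2)] openin_Int[OF U[OF UV(1)] U[OF UV(2)]] _ s[OF UV(2)] i] compat[OF UV] by simp
 qed (use U s tcf_in in auto)
 then have a: "\<forall>i<n. \<exists>!a. a : carrier (sect C ?W) & (\<forall>U\<in>\<U>. rest C ?W U a = tcf (sg U) i)" by blast
 then obtain a where a': "!!i. i < n ==> a i : carrier (sect C ?W)"
  "!!i U. [|i < n; U : \<U>|] ==> rest C ?W U (a i) = tcf (sg U) i" by metis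
 let ?F = "trunc_of (sect C ?W) n a"
 have F: "?F : carrier (th ?W)" "!!i. i < n ==> tcf ?F i = a i"
  using a'(1) by (auto intro: W.trunc_of_closed W.tcf_trunc_of)
 show "\<exists>!a. a : carrier (th ?W) & (\<forall>U\<in>\<U>. thr ?W U a = sg U)"
 proof (rule ex1I[of _ ?F])
  show "?F : carrier (th ?W) & (\<forall>U\<in>\<U>. thr ?W U ?F = sg U)"
  proof (intro conjI ballI F(1))
   fix U' assume U': "U' : \<U>"
   show "thr ?W U' ?F = sg U'"
    by (rule th_eqI[OF U[OF U'] thr_closed[OF W U[OF U'] Us[OF U'] F(1)] s[OF U']])
     (simp add: tcf_thr[OF W U[OF U'] Us[OF U'] F(1)] F(2) a'(2) U')
  qed
  fix G assume G: "G : carrier (th ?W) & (\<forall>U\<in>\<U>. thr ?W U G = sg U)"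
  show "G = ?F"
  proof (rule th_eqI[OF W _ F(1)])
   fix i assume i: "i < n"
   have "rest C ?W U (tcf G i) = tcf (sg U) i" if "U : \<U>" for U
    using tcf_thr[OF W U[OF that] Us[OF that] _ i, of G] G that by simp
   then show "tcf G i = tcf ?F i"
    using a i a' F(2) G tcf_in[OF W, of G i] by (metis (no_types, lifting))
  qed (use G in auto)
 qed
qed (fact thr_closed)

subsection \<open>Automorphisms of the thickening\<close>

lemma opens_iff: "V : opens_in C U \<longleftrightarrow> op V & V <= U" by (simp add: opens_in_def)

lemma at_zero_th: "[|op U; F : carrier (th U)|] ==> at_zero (sect C U) F = tcf F 0"
 by (rule trunc.at_zero_eq[OF tr _ n_pos])

lemma
 assumes ph: "ph : aut_set C n U" and V: "op V" "V <= U"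
 shows aut_iso: "ph V : ring_iso (th V) (th V)"
  and aut_hom: "ph V : ring_hom (th V) (th V)"
  and aut_bij: "bij_betw (ph V) (carrier (th V)) (carrier (th V))"
  and aut_closed: "F : carrier (th V) ==> ph V F : carrier (th V)"
  and aut_ext: "ph V : extensional (carrier (th V))"
  and aut_scal: "ph V (trunc_monom (sect C V) n (scal C V c) 0) = trunc_monom (sect C V) n (scal C V c) 0"
  and aut_zero: "F : carrier (th V) ==> tcf (ph V F) 0 = tcf F 0"
  and aut_res: "[|op V'; V' <= V; F : carrier (th V)|] ==> ph V' (thr V V' F) = thr V V' (ph V F)"
proof -
 have "V : opens_in C U" using V by (simp add: opens_iff)
 note D = ph[unfolded aut_set_def] this
 show 1: "ph V : ring_iso (th V) (th V)" using D by auto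
 then show 2: "ph V : ring_hom (th V) (th V)" "bij_betw (ph V) (carrier (th V)) (carrier (th V))"
  by (auto simp: ring_iso_def)
 then show 3: "F : carrier (th V) ==> ph V F : carrier (th V)" by (simp add: ring_hom_closed)
 show "ph V : extensional (carrier (th V))"
  "ph V (trunc_monom (sect C V) n (scal C V c) 0) = trunc_monom (sect C V) n (scal C V c) 0"
  using D by auto
 show "F : carrier (th V) ==> tcf (ph V F) 0 = tcf F 0"
  using D 3 by (auto simp: at_zero_th[OF V(1), symmetric])
 show "[|op V'; V' <= V; F : carrier (th V)|] ==> ph V' (thr V V' F) = thr V V' (ph V F)"
  using D by (auto simp: opens_iff)
qed

lemma aut_setI:
 assumes U: "op U" and ext: "ph : extensional (opens_in C U)"
  and e: "!!V. [|op V; V <= U|] ==> ph V : extensional (carrier (th V))"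
  and h: "!!V. [|op V; V <= U|] ==> ph V : ring_hom (th V) (th V)"
  and b: "!!V. [|op V; V <= U|] ==> bij_betw (ph V) (carrier (th V)) (carrier (th V))"
  and sc: "!!V c. [|op V; V <= U|] ==> ph V (trunc_monom (sect C V) n (scal C V c) 0) = trunc_monom (sect C V) n (scal C V c) 0"
  and z: "!!V F. [|op V; V <= U; F : carrier (th V)|] ==> tcf (ph V F) 0 = tcf F 0"
  and r: "!!V V' F. [|op V; V <= U; op V'; V' <= V; F : carrier (th V)|] ==> ph V' (thr V V' F) = thr V V' (ph V F)"
 shows "ph : aut_set C n U"
proof -
 have "at_zero (sect C V) (ph V F) = at_zero (sect C V) F" if "op V" "V <= U" "F : carrier (th V)" for V F
  using z[OF that] ring_hom_closed[OF h[OF that(1,2)] that(3)] that by (simp add: at_zero_th)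
 then show ?thesis
  unfolding aut_set_def using assms by (auto simp: opens_iff ring_iso_def)
qed

lemma aut_eqI:
 assumes ph: "ph : aut_set C n U" and \<psi>: "\<psi> : aut_set C n U"
  and e: "!!V F. [|op V; V <= U; F : carrier (th V)|] ==> ph V F = \<psi> V F"
 shows "ph = \<psi>"
proof (rule extensionalityI[where A="opens_in C U"])
 show "ph : extensional (opens_in C U)" "\<psi> : extensional (opens_in C U)"
  using ph \<psi> by (auto simp: aut_set_def)
 fix V assume "V : opens_in C U"
 then have V: "op V" "V <= U" by (auto simp: opens_iff)
 show "ph V = \<psi> V"
  by (rule extensionalityI[OF aut_ext[OF ph V] aut_ext[OF \<psi> V] e[OF V]])
qed

abbreviation GG where "GG \<equiv> aut_sheaf C n"

lemma aut_carrier: "carrier (gsec GG U) = aut_set C n U" by (simp add: aut_sheaf_def)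

lemma aut_mult_app:
 "[|op V; V <= U; F : carrier (th V)|] ==> (ph \<otimes>\<^bsub>gsec GG U\<^esub> \<psi>) V F = ph V (\<psi> V F)"
 by (simp add: aut_sheaf_def opens_iff compose_def)

lemma aut_one_app:
 "[|op V; V <= U; F : carrier (th V)|] ==> \<one>\<^bsub>gsec GG U\<^esub> V F = F"
 by (simp add: aut_sheaf_def opens_iff)

lemma aut_gres_app: "[|op V'; V' <= V|] ==> gres GG U V ph V' = ph V'"
 by (simp add: aut_sheaf_def opens_iff)

lemma aut_group:
 assumes U: "op U"
 shows "group (gsec GG U)"
proof (rule groupI)
 fix ph \<psi> assume "ph : carrier (gsec GG U)" "\<psi> : carrier (gsec GG U)"
 then have ph: "ph : aut_set C n U" and \<psi>: "\<psi> : aut_set C n U" by (auto simp: aut_carrier)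
 let ?m = "ph \<otimes>\<^bsub>gsec GG U\<^esub> \<psi>"
 have m: "?m V = compose (carrier (th V)) (ph V) (\<psi> V)" if "op V" "V <= U" for V
  using that by (simp add: aut_sheaf_def opens_iff)
 have sc: "trunc_monom (sect C V) n (scal C V c) 0 : carrier (th V)" if "op V" for V c
  using trunc.trunc_monom_closed[OF tr[OF that] scal_in[OF that]] .
 have "?m : aut_set C n U"
 proof (rule aut_setI[OF U])
  show "?m : extensional (opens_in C U)" by (simp add: aut_sheaf_def)
 next
  fix V assume V: "op V" "V <= U"
  show "?m V : extensional (carrier (th V))" by (simp add: m[OF V])
  show "bij_betw (?m V) (carrier (th V)) (carrier (th V))"
   unfolding m[OF V] by (rule bij_betw_compose[OF aut_bij[OF \<psi> V] aut_bij[OF ph V]])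
  show "?m V : ring_hom (th V) (th V)"
   using aut_hom[OF ph V] aut_hom[OF \<psi> V] th_cring[OF V(1)]
   by (intro ring_hom_memI)
    (auto simp: m[OF V] compose_def ring_hom_closed ring_hom_mult ring_hom_add ring_hom_one
     cring.axioms(1) ring.ring_simprules)
  show "?m V (trunc_monom (sect C V) n (scal C V c) 0) = trunc_monom (sect C V) n (scal C V c) 0" for c
   using sc[OF V(1)] by (simp add: m[OF V] compose_def aut_scal[OF ph V] aut_scal[OF \<psi> V])
  show "tcf (?m V F) 0 = tcf F 0" if "F : carrier (th V)" for F
   using that by (simp add: m[OF V] compose_def aut_zero[OF ph V] aut_zero[OF \<psi> V] aut_closed[OF \<psi> V])
  show "?m V' (thr V V' F) = thr V V' (?m V F)" if V': "op V'" "V' <= V" and F: "F : carrier (th V)" for V' F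
  proof -
   have V'': "V' <= U" using V V' by auto
   show ?thesis
    using F thr_closed[OF V(1) V' F]
    by (simp add: m[OF V] m[OF V'(1) V''] compose_def aut_res[OF ph V V'] aut_res[OF \<psi> V V'] aut_closed[OF \<psi> V])
  qed
 qed
 then show "?m : carrier (gsec GG U)" by (simp add: aut_carrier)
next
 let ?e = "\<one>\<^bsub>gsec GG U\<^esub>"
 have e: "?e V = (\<lambda>F\<in>carrier (th V). F)" if "op V" "V <= U" for V
  using that by (simp add: aut_sheaf_def opens_iff)
 have "?e : aut_set C n U"
 proof (rule aut_setI[OF U])
  show "?e : extensional (opens_in C U)" by (simp add: aut_sheaf_def)
 next
  fix V assume V: "op V" "V <= U"
  interpret V: trunc "sect C V" n by (rule tr[OF V(1)])
  show "?e V : extensional (carrier (th V))" by (simp add: e[OF V])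
  show "bij_betw (?e V) (carrier (th V)) (carrier (th V))"
   unfolding e[OF V] by (simp add: bij_betw_def inj_on_def)
  show "?e V : ring_hom (th V) (th V)" by (intro ring_hom_memI) (auto simp: e[OF V])
  show "?e V (trunc_monom (sect C V) n (scal C V c) 0) = trunc_monom (sect C V) n (scal C V c) 0" for c
   by (simp add: e[OF V] V.trunc_monom_closed scal_in[OF V(1)])
  show "tcf (?e V F) 0 = tcf F 0" if "F : carrier (th V)" for F
   using that by (simp add: e[OF V])
  show "?e V' (thr V V' F) = thr V V' (?e V F)" if V': "op V'" "V' <= V" and F: "F : carrier (th V)" for V' F
   using F thr_closed[OF V(1) V' F] V V' by (simp add: e[OF V] e subset_trans[OF V'(2) V(2)])
 qed
 then show "?e : carrier (gsec GG U)" by (simp add: aut_carrier)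
next
 fix x y z assume x: "x : carrier (gsec GG U)" "y : carrier (gsec GG U)" "z : carrier (gsec GG U)"
 then show "x \<otimes>\<^bsub>gsec GG U\<^esub> y \<otimes>\<^bsub>gsec GG U\<^esub> z = x \<otimes>\<^bsub>gsec GG U\<^esub> (y \<otimes>\<^bsub>gsec GG U\<^esub> z)"
  by (auto simp: aut_sheaf_def compose_def fun_eq_iff aut_closed opens_iff restrict_def)
next
 fix ph assume "ph : carrier (gsec GG U)"
 then have ph: "ph : aut_set C n U" by (simp add: aut_carrier)
 have "(\<one>\<^bsub>gsec GG U\<^esub> \<otimes>\<^bsub>gsec GG U\<^esub> ph) V = ph V" for V
 proof (cases "op V & V <= U")
  case True
  then have V: "op V" "V <= U" by auto
  show ?thesis
   using aut_ext[OF ph V] aut_closed[OF ph V] V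
   by (auto simp: aut_sheaf_def opens_iff compose_def extensional_def fun_eq_iff)
 next
  case False
  then show ?thesis using ph by (auto simp: aut_sheaf_def aut_set_def opens_iff extensional_def)
 qed
 then show "\<one>\<^bsub>gsec GG U\<^esub> \<otimes>\<^bsub>gsec GG U\<^esub> ph = ph" by (simp add: fun_eq_iff)
 \<comment> \<open>The inverse is formed open by open. Each condition on it, naturality included, is
   transported back through the bijection \<open>ph V\<close>.\<close>
 let ?i = "\<lambda>V\<in>opens_in C U. \<lambda>F\<in>carrier (th V). inv_into (carrier (th V)) (ph V) F"
 have iV: "?i V = (\<lambda>F\<in>carrier (th V). inv_into (carrier (th V)) (ph V) F)" if "op V" "V <= U" for V
  using that by (simp add: opens_iff)
 have i: "?i V F : carrier (th V)" "ph V (?i V F) = F" "?i V (ph V F) = F"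
  if V: "op V" "V <= U" and F: "F : carrier (th V)" for V F
  using aut_bij[OF ph V] F aut_closed[OF ph V F] iV[OF V]
  by (auto simp: bij_betw_def inv_into_into f_inv_into_f)
 have inj: "F = G" if "op V" "V <= U" "ph V F = ph V G" "F : carrier (th V)" "G : carrier (th V)" for V F G
  using aut_bij[OF ph that(1,2)] that by (auto simp: bij_betw_def inj_on_def)
 have ia: "?i : aut_set C n U"
 proof (rule aut_setI[OF U])
  fix V assume V: "op V" "V <= U"
  interpret V: trunc "sect C V" n by (rule tr[OF V(1)])
  show "?i V : extensional (carrier (th V))" unfolding iV[OF V] by simp
  show "bij_betw (?i V) (carrier (th V)) (carrier (th V))"
   by (rule bij_betw_byWitness[where f'="ph V"]) (use i[OF V] aut_closed[OF ph V] in auto)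
  show "?i V : ring_hom (th V) (th V)"
  proof (rule ring_hom_memI)
   fix F G assume F: "F : carrier (th V)" and G: "G : carrier (th V)"
   show "?i V F : carrier (th V)" by (rule i(1)[OF V F])
   show "?i V (F \<otimes>\<^bsub>th V\<^esub> G) = ?i V F \<otimes>\<^bsub>th V\<^esub> ?i V G"
    by (rule inj[OF V]) (use F G i[OF V] aut_hom[OF ph V] in \<open>simp_all add: ring_hom_mult\<close>)
   show "?i V (F \<oplus>\<^bsub>th V\<^esub> G) = ?i V F \<oplus>\<^bsub>th V\<^esub> ?i V G"
    by (rule inj[OF V]) (use F G i[OF V] aut_hom[OF ph V] in \<open>simp_all add: ring_hom_add\<close>)
  next
   show "?i V \<one>\<^bsub>th V\<^esub> = \<one>\<^bsub>th V\<^esub>"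
    using i(3)[OF V, of "\<one>\<^bsub>th V\<^esub>"] ring_hom_one[OF aut_hom[OF ph V]] by simp
  qed
  show "?i V (trunc_monom (sect C V) n (scal C V c) 0) = trunc_monom (sect C V) n (scal C V c) 0" for c
   using i(3)[OF V V.trunc_monom_closed[OF scal_in[OF V(1)]], of c 0] aut_scal[OF ph V, of c] by simp
  show "tcf (?i V F) 0 = tcf F 0" if "F : carrier (th V)" for F
   using aut_zero[OF ph V i(1)[OF V that]] i(2)[OF V that] by simp
  show "?i V' (thr V V' F) = thr V V' (?i V F)" if V': "op V'" "V' <= V" and F: "F : carrier (th V)" for V' F
  proof -
   have V'': "V' <= U" using V V' by auto
   show ?thesis
    by (rule inj[OF V'(1) V''])
     (use thr_closed[OF V(1) V' F] i[OF V'(1) V''] i[OF V F] aut_res[OF ph V V' i(1)[OF V F]]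
       thr_closed[OF V(1) V' i(1)[OF V F]] in simp_all)
  qed
 qed simp
 have "(?i \<otimes>\<^bsub>gsec GG U\<^esub> ph) V = \<one>\<^bsub>gsec GG U\<^esub> V" for V
  using i(3)[of V] by (auto simp: aut_sheaf_def opens_iff compose_def fun_eq_iff restrict_def)
 then show "\<exists>\<psi>\<in>carrier (gsec GG U). \<psi> \<otimes>\<^bsub>gsec GG U\<^esub> ph = \<one>\<^bsub>gsec GG U\<^esub>"
  using ia by (auto simp: aut_carrier fun_eq_iff)
qed

lemma aut_presheaf: "group_presheaf (topo C) GG"
proof (rule group_presheaf.intro)
 fix U V assume U: "op U" "op V" "V <= U"
 have s: "opens_in C V <= opens_in C U" using U(3) unfolding opens_in_def by blast
 show "gres GG U V : hom (gsec GG U) (gsec GG V)"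
 proof (rule homI)
  fix ph assume "ph : carrier (gsec GG U)"
  then have ph: "ph : aut_set C n U" by (simp add: aut_carrier)
  have "gres GG U V ph : aut_set C n V"
  proof (rule aut_setI[OF U(2)])
   show "gres GG U V ph : extensional (opens_in C V)" by (simp add: aut_sheaf_def)
   fix V' assume V': "op V'" "V' <= V"
   then have V'': "V' <= U" using U by auto
   show "gres GG U V ph Y (thr V' Y F) = thr V' Y (gres GG U V ph V' F)"
    if "op Y" "Y <= V'" "F : carrier (th V')" for Y F
    using that V' aut_res[OF ph V'(1) V'' that] subset_trans[OF that(2) V'(2)]
    by (simp add: aut_gres_app)
  qed (use U aut_ext[OF ph] aut_hom[OF ph] aut_bij[OF ph] aut_scal[OF ph] aut_zero[OF ph]
    in \<open>simp_all add: aut_gres_app subset_trans[OF _ U(3)]\<close>)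
  then show "gres GG U V ph : carrier (gsec GG V)" by (simp add: aut_carrier)
 qed (use s in \<open>auto simp: aut_sheaf_def fun_eq_iff restrict_def\<close>)
next
 fix U ph assume "op U" "ph : carrier (gsec GG U)"
 then show "gres GG U U ph = ph"
  by (auto simp: aut_carrier aut_set_def aut_sheaf_def extensional_restrict)
next
 fix U V W ph assume "op W" "W <= V" "V <= U"
 then have "opens_in C W <= opens_in C V" unfolding opens_in_def by blast
 then show "gres GG V W (gres GG U V ph) = gres GG U W ph"
  by (auto simp: aut_sheaf_def restrict_def fun_eq_iff)
qed (fact aut_group)

lemma aut_twist: "twist (topo C) GG (%U. carrier (th U)) thr (%V ph F. ph V F)"
proof -
 interpret set_sheaf "topo C" "%U. carrier (th U)" thr by (rule thick_sheaf)
 interpret group_presheaf "topo C" GG by (rule aut_presheaf)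
 show ?thesis
  by unfold_locales
   (auto simp: aut_carrier aut_closed aut_one_app aut_mult_app aut_gres_app aut_res)
qed

subsection \<open>Units\<close>

lemma unit_presheaf: "group_presheaf (topo C) (unit_sheaf C)"
proof (rule group_presheaf.intro)
 fix U assume U: "op U"
 interpret cring "sect C U" by (rule sect_cring[OF U])
 show "group (gsec (unit_sheaf C) U)" by (simp add: unit_sheaf_def units_group)
next
 fix U V assume U: "op U" "op V" "V <= U"
 interpret U: cring "sect C U" by (rule sect_cring[OF U(1)])
 interpret V: cring "sect C V" by (rule sect_cring[OF U(2)])
 have "rest C U V u : Units (sect C V)" if u: "u : Units (sect C U)" for u
 proof -
  obtain v where v: "v : carrier (sect C U)" "u \<otimes>\<^bsub>sect C U\<^esub> v = \<one>\<^bsub>sect C U\<^esub>"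
   using u by (auto simp: Units_def)
  have "rest C U V u \<otimes>\<^bsub>sect C V\<^esub> rest C U V v = \<one>\<^bsub>sect C V\<^esub>"
   using ring_hom_mult[OF rest_hom[OF U], of u v] v u rest_one[OF U] U.Units_closed by simp
  then show ?thesis
   using rest_closed[OF U] v u by (auto simp: Units_def V.m_comm intro!: bexI[of _ "rest C U V v"])
 qed
 then show "gres (unit_sheaf C) U V : hom (gsec (unit_sheaf C) U) (gsec (unit_sheaf C) V)"
  using ring_hom_mult[OF rest_hom[OF U]] U.Units_closed
  by (intro homI) (auto simp: unit_sheaf_def units_of_def)
next
 fix U s assume U: "op U" "s : carrier (gsec (unit_sheaf C) U)"
 then show "gres (unit_sheaf C) U U s = s"
  by (auto simp: unit_sheaf_def units_of_def Units_def rest_id)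
next
 fix U V W s assume "op U" "op V" "op W" "W <= V" "V <= U" "s : carrier (gsec (unit_sheaf C) U)"
 then show "gres (unit_sheaf C) V W (gres (unit_sheaf C) U V s) = gres (unit_sheaf C) U W s"
  by (auto simp: unit_sheaf_def units_of_def Units_def rest_comp)
qed

lemma unit_twist: "twist (topo C) (unit_sheaf C) (%U. carrier (sect C U)) (rest C) (%V u s. u \<otimes>\<^bsub>sect C V\<^esub> s)"
proof -
 interpret group_presheaf "topo C" "unit_sheaf C" by (rule unit_presheaf)
 show ?thesis
 proof unfold_locales
  fix V g s assume V: "op V" "g : carrier (gsec (unit_sheaf C) V)" "s : carrier (sect C V)"
  interpret cring "sect C V" by (rule sect_cring[OF V(1)])
  show "g \<otimes>\<^bsub>sect C V\<^esub> s : carrier (sect C V)" using V by (auto simp: unit_sheaf_def units_of_def)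
 next
  fix V s assume V: "op V" "s : carrier (sect C V)"
  interpret cring "sect C V" by (rule sect_cring[OF V(1)])
  show "\<one>\<^bsub>gsec (unit_sheaf C) V\<^esub> \<otimes>\<^bsub>sect C V\<^esub> s = s" using V by (auto simp: unit_sheaf_def units_of_def)
 next
  fix V g h s assume V: "op V" "g : carrier (gsec (unit_sheaf C) V)" "h : carrier (gsec (unit_sheaf C) V)"
   "s : carrier (sect C V)"
  interpret cring "sect C V" by (rule sect_cring[OF V(1)])
  show "g \<otimes>\<^bsub>gsec (unit_sheaf C) V\<^esub> h \<otimes>\<^bsub>sect C V\<^esub> s = g \<otimes>\<^bsub>sect C V\<^esub> (h \<otimes>\<^bsub>sect C V\<^esub> s)"
   using V by (auto simp: unit_sheaf_def units_of_def m_assoc Units_closed)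
 next
  fix U V g s assume U: "op U" "op V" "V <= U" "g : carrier (gsec (unit_sheaf C) U)" "s : carrier (sect C U)"
  interpret cring "sect C U" by (rule sect_cring[OF U(1)])
  show "rest C U V (g \<otimes>\<^bsub>sect C U\<^esub> s) = gres (unit_sheaf C) U V g \<otimes>\<^bsub>sect C V\<^esub> rest C U V s"
   using U ring_hom_mult[OF rest_hom[OF U(1-3)]] by (auto simp: unit_sheaf_def units_of_def)
 qed
qed

text \<open>In ph t = \<nu> t the factor \<nu> is determined modulo t^(n-1) only. For n > 1 its
  value at t = 0 is well defined nevertheless: it is the coefficient of t in ph t.\<close>

lemma xi_eq:
 assumes ph: "ph : aut_set C n U" and U: "op U" and n1: "1 < n"
 shows "xi C n U ph = tcf (ph U (trunc_t (sect C U) n)) 1"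
proof -
 interpret U: trunc "sect C U" n by (rule tr[OF U])
 note h = aut_hom[OF ph U subset_refl] and z = aut_zero[OF ph U subset_refl]
 have c: "ph U U.tt : carrier U.B" using aut_closed[OF ph U] by simp
 show ?thesis
  unfolding xi_def thick_simps
 proof (rule the_equality)
  show "\<exists>\<nu>\<in>carrier U.B. ph U U.tt = \<nu> \<otimes>\<^bsub>U.B\<^esub> U.tt & tcf (ph U U.tt) 1 = at_zero (sect C U) \<nu>"
  proof (intro bexI conjI)
   show "ph U U.tt = U.tdrop 1 (ph U U.tt) \<otimes>\<^bsub>U.B\<^esub> U.tt"
    using U.tvan_factor[OF c U.tvan_hom_t[OF h z n_pos]] c by (simp add: U.B.m_comm)
   show "tcf (ph U U.tt) 1 = at_zero (sect C U) (U.tdrop 1 (ph U U.tt))"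
    using c n1 by (simp add: at_zero_th[OF U])
  qed (use c in simp)
  fix a assume "\<exists>\<nu>\<in>carrier U.B. ph U U.tt = \<nu> \<otimes>\<^bsub>U.B\<^esub> U.tt & a = at_zero (sect C U) \<nu>"
  then obtain \<nu> where \<nu>: "\<nu> : carrier U.B" "ph U U.tt = \<nu> \<otimes>\<^bsub>U.B\<^esub> U.tt" "a = at_zero (sect C U) \<nu>" by blast
  then have "ph U U.tt = U.tt \<otimes>\<^bsub>U.B\<^esub> \<nu>" by (simp add: U.B.m_comm)
  then show "a = tcf (ph U U.tt) 1" using \<nu> n1 by (simp add: at_zero_th[OF U])
 qed
qed

lemma xi_presheaf_hom:
 assumes n1: "1 < n"
 shows "group_presheaf_hom (topo C) GG (unit_sheaf C) (xi C n)"
proof -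
 interpret G: group_presheaf "topo C" GG by (rule aut_presheaf)
 interpret H: group_presheaf "topo C" "unit_sheaf C" by (rule unit_presheaf)
 show ?thesis
 proof unfold_locales
  fix U assume U: "op U"
  interpret U: trunc "sect C U" n by (rule tr[OF U])
  interpret GU: group "gsec GG U" by (rule aut_group[OF U])
  have xm: "xi C n U (ph \<otimes>\<^bsub>gsec GG U\<^esub> \<psi>) = xi C n U ph \<otimes>\<^bsub>sect C U\<^esub> xi C n U \<psi>"
   if ph: "ph : aut_set C n U" and \<psi>: "\<psi> : aut_set C n U" for ph \<psi>
  proof -
   have m: "ph \<otimes>\<^bsub>gsec GG U\<^esub> \<psi> : aut_set C n U" using GU.m_closed ph \<psi> by (simp add: aut_carrier)
   have "xi C n U (ph \<otimes>\<^bsub>gsec GG U\<^esub> \<psi>) = tcf (ph U (\<psi> U U.tt)) 1"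
    using xi_eq[OF m U n1] U by (simp add: aut_mult_app)
   then show ?thesis
    using U.tcf_1_hom[OF aut_hom[OF ph U subset_refl] aut_zero[OF ph U subset_refl] n_pos
      aut_closed[OF \<psi> U subset_refl] U.tvan_hom_t[OF aut_hom[OF \<psi> U subset_refl] aut_zero[OF \<psi> U subset_refl] n_pos] n1]
    by (simp add: xi_eq[OF ph U n1] xi_eq[OF \<psi> U n1])
  qed
  have xc: "xi C n U ph : carrier (sect C U)" if ph: "ph : aut_set C n U" for ph
   using xi_eq[OF ph U n1] aut_closed[OF ph U subset_refl] by simp
  have x1: "xi C n U \<one>\<^bsub>gsec GG U\<^esub> = \<one>\<^bsub>sect C U\<^esub>"
   using xi_eq[of "\<one>\<^bsub>gsec GG U\<^esub>", OF _ U n1] GU.one_closed U n1 by (simp add: aut_carrier aut_one_app)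
  \<comment> \<open>Multiplicativity applied to the inverse automorphism provides the inverse of the
    coefficient.\<close>
  have "xi C n U ph : Units (sect C U)" if ph: "ph : aut_set C n U" for ph
  proof -
   have i: "inv\<^bsub>gsec GG U\<^esub> ph : aut_set C n U" using GU.inv_closed[of ph] ph by (simp add: aut_carrier)
   show ?thesis
    using xm[OF ph i] xm[OF i ph] xc[OF ph] xc[OF i] x1 ph
    by (auto simp: aut_carrier Units_def intro!: bexI[of _ "xi C n U (inv\<^bsub>gsec GG U\<^esub> ph)"])
  qed
  then show "xi C n U : hom (gsec GG U) (gsec (unit_sheaf C) U)"
   using xm by (intro homI) (auto simp: aut_carrier unit_sheaf_def units_of_def)
 next
  fix U V ph assume U: "op U" "op V" "V <= U" and "ph : carrier (gsec GG U)"
  then have ph: "ph : aut_set C n U" by (simp add: aut_carrier)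
  have ph': "gres GG U V ph : aut_set C n V" using G.res_closed[OF U] ph by (simp add: aut_carrier)
  interpret U: trunc "sect C U" n by (rule tr[OF U(1)])
  have t: "thr U V U.tt = trunc_t (sect C V) n" using thr_monom[OF U] by (simp add: rest_one[OF U])
  show "xi C n V (gres GG U V ph) = gres (unit_sheaf C) U V (xi C n U ph)"
   using aut_res[OF ph U(1) subset_refl U(2,3), of U.tt] t aut_closed[OF ph U(1) subset_refl, of U.tt] n1
   by (simp add: xi_eq[OF ph U(1) n1] xi_eq[OF ph' U(2) n1] aut_gres_app U unit_sheaf_def tcf_thr[OF U, symmetric])
 qed
qed

end

lemma (in trunc) tcf_diff [simp]:
 "[|F : carrier B; G : carrier B; i < n|] ==> tcf (F \<ominus>\<^bsub>B\<^esub> G) i = tcf F i \<ominus> tcf G i"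
 by (simp add: a_minus_def)

section \<open>Operations and constants on twisted forms\<close>

context twist
begin

context
 fixes p :: "'p set => 'x => 'x => 'x"
 assumes p_closed: "!!U a b. [|openin T U; a : F U; b : F U|] ==> p U a b : F U"
  and p_res: "!!U V a b. [|openin T U; openin T V; V <= U; a : F U; b : F U|]
   ==> r U V (p U a b) = p V (r U V a) (r U V b)"
  and p_act: "!!V g a b. [|openin T V; g : carrier (gsec G V); a : F V; b : F V|]
   ==> act V g (p V a b) = p V (act V g a) (act V g b)"
begin

text \<open>An operation that commutes with restriction and with the group action respects the
  twisting condition componentwise. The ring operations of O_C[t]/(t^n) qualify because the group
  acts by ring automorphisms, addition in O_C because units act linearly.\<close>

lemma tw_bop:
 assumes c: "is_cocycle T G c" and W: "openin T W" and f: "f : tw c W" and f': "f' : tw c W"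
 shows "(\<lambda>i\<in>idx c. p (W Int cov c i) (f i) (f' i)) : tw c W"
 unfolding tw_def
proof (intro CollectI conjI ballI)
 note oi = open_Int[OF c W] and fc = tw_comp_closed[OF c f] and fc' = tw_comp_closed[OF c f']
 show "(\<lambda>i\<in>idx c. p (W Int cov c i) (f i) (f' i)) : (\<Pi>\<^sub>E i\<in>idx c. F (W Int cov c i))"
  using p_closed oi fc fc' by simp
 fix i j assume i: "i : idx c" "j : idx c"
 let ?V = "W Int (cov c i Int cov c j)"
 have V: "openin T ?V" using W i cocycle_open[OF c] by auto
 have s: "?V <= W" "?V <= cov c i" "?V <= cov c j" "?V <= W Int cov c i" "?V <= W Int cov c j" by auto
 have fj: "r (W Int cov c j) ?V (f j) : F ?V" "r (W Int cov c j) ?V (f' j) : F ?V"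
  by (rule sres_closed[OF oi[OF i(2)] V s(5)], rule fc[OF i(2)], rule sres_closed[OF oi[OF i(2)] V s(5)], rule fc'[OF i(2)])
 show "r (W Int cov c i) ?V ((\<lambda>i\<in>idx c. p (W Int cov c i) (f i) (f' i)) i) =
   act ?V (cres c i j ?V) (r (W Int cov c j) ?V ((\<lambda>i\<in>idx c. p (W Int cov c i) (f i) (f' i)) j))"
  using i p_res[OF oi[OF i(1)] V s(4) fc[OF i(1)] fc'[OF i(1)]]
   p_res[OF oi[OF i(2)] V s(5) fc[OF i(2)] fc'[OF i(2)]]
   p_act[OF V cres_closed[OF c i V s(2,3)] fj]
   tw_eq[OF c f W i V s(1-3)] tw_eq[OF c f' W i V s(1-3)] by simp
qed

lemma twrel_bop:
 assumes c: "is_cocycle T G c" and d: "is_cocycle T G d" and D: "cobounds c d K W sg \<tau> h"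
  and A: "openin T A" and f: "f : tw c A" "e : tw c A" and f': "f' : tw d A" "e' : tw d A"
  and R: "twrel c d K W sg \<tau> h A f f'" "twrel c d K W sg \<tau> h A e e'"
 shows "twrel c d K W sg \<tau> h A (\<lambda>i\<in>idx c. p (A Int cov c i) (f i) (e i)) (\<lambda>i\<in>idx d. p (A Int cov d i) (f' i) (e' i))"
 unfolding twrel_def
proof
 note K = cobounds_data[OF D]
 fix k assume k: "k : K"
 let ?V = "A Int W k"
 have V: "openin T ?V" using A K(1)[OF k] by auto
 note oc = open_Int[OF c A K(2)[OF k]] and od = open_Int[OF d A K(3)[OF k]]
 have s: "?V <= A Int cov c (sg k)" "?V <= A Int cov d (\<tau> k)" "?V <= W k" using K(4,5)[OF k] by auto
 have fd: "r (A Int cov d (\<tau> k)) ?V (f' (\<tau> k)) : F ?V" "r (A Int cov d (\<tau> k)) ?V (e' (\<tau> k)) : F ?V"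
  using tw_comp_closed[OF d _ K(3)[OF k]] f' sres_closed[OF od V s(2)] by auto
 show "r (A Int cov c (sg k)) ?V ((\<lambda>i\<in>idx c. p (A Int cov c i) (f i) (e i)) (sg k)) =
   act ?V (gres G (W k) ?V (h k)) (r (A Int cov d (\<tau> k)) ?V ((\<lambda>i\<in>idx d. p (A Int cov d i) (f' i) (e' i)) (\<tau> k)))"
  using K(2,3)[OF k] R k p_act[OF V cobounds_closed(1)[OF D V s(3) k] fd]
   p_res[OF oc V s(1) tw_comp_closed[OF c f(1) K(2)[OF k]] tw_comp_closed[OF c f(2) K(2)[OF k]]]
   p_res[OF od V s(2) tw_comp_closed[OF d f'(1) K(3)[OF k]] tw_comp_closed[OF d f'(2) K(3)[OF k]]]
  by (simp add: twrel_def)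
qed

end

context
 fixes p :: "'p set => 'x"
 assumes p_closed: "!!U. openin T U ==> p U : F U"
  and p_res: "!!U V. [|openin T U; openin T V; V <= U|] ==> r U V (p U) = p V"
  and p_act: "!!V g. [|openin T V; g : carrier (gsec G V)|] ==> act V g (p V) = p V"
begin

lemma tw_const:
 assumes c: "is_cocycle T G c" and W: "openin T W"
 shows "(\<lambda>i\<in>idx c. p (W Int cov c i)) : tw c W"
 unfolding tw_def
proof (intro CollectI conjI ballI)
 note oi = open_Int[OF c W]
 show "(\<lambda>i\<in>idx c. p (W Int cov c i)) : (\<Pi>\<^sub>E i\<in>idx c. F (W Int cov c i))"
  using p_closed oi by simp
 fix i j assume i: "i : idx c" "j : idx c"
 let ?V = "W Int (cov c i Int cov c j)"
 have V: "openin T ?V" using W i cocycle_open[OF c] by auto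
 have s: "?V <= cov c i" "?V <= cov c j" "?V <= W Int cov c i" "?V <= W Int cov c j" by auto
 show "r (W Int cov c i) ?V ((\<lambda>i\<in>idx c. p (W Int cov c i)) i) =
   act ?V (cres c i j ?V) (r (W Int cov c j) ?V ((\<lambda>i\<in>idx c. p (W Int cov c i)) j))"
  using i p_res[OF oi[OF i(1)] V s(3)] p_res[OF oi[OF i(2)] V s(4)]
   p_act[OF V cres_closed[OF c i V s(1,2)]] by simp
qed

lemma twrel_const:
 assumes c: "is_cocycle T G c" and d: "is_cocycle T G d" and D: "cobounds c d K W sg \<tau> h"
  and A: "openin T A"
 shows "twrel c d K W sg \<tau> h A (\<lambda>i\<in>idx c. p (A Int cov c i)) (\<lambda>i\<in>idx d. p (A Int cov d i))"
 unfolding twrel_def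
proof
 note K = cobounds_data[OF D]
 fix k assume k: "k : K"
 let ?V = "A Int W k"
 have V: "openin T ?V" using A K(1)[OF k] by auto
 note oc = open_Int[OF c A K(2)[OF k]] and od = open_Int[OF d A K(3)[OF k]]
 have s: "?V <= A Int cov c (sg k)" "?V <= A Int cov d (\<tau> k)" "?V <= W k" using K(4,5)[OF k] by auto
 show "r (A Int cov c (sg k)) ?V ((\<lambda>i\<in>idx c. p (A Int cov c i)) (sg k)) =
   act ?V (gres G (W k) ?V (h k)) (r (A Int cov d (\<tau> k)) ?V ((\<lambda>i\<in>idx d. p (A Int cov d i)) (\<tau> k)))"
  using K(2,3)[OF k] p_act[OF V cobounds_closed(1)[OF D V s(3) k]] p_res[OF oc V s(1)] p_res[OF od V s(2)]
  by simp
qed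

end

end

section \<open>The curve C(g) as a twisted form, and its restriction to C\<close>

context thickening
begin

sublocale Tw: twist "topo C" GG "%U. carrier (th U)" thr "%V ph F. ph V F"
 by (rule aut_twist)

sublocale Un: twist "topo C" "unit_sheaf C" "%U. carrier (sect C U)" "rest C" "%V u s. u \<otimes>\<^bsub>sect C V\<^esub> s"
 by (rule unit_twist)

lemma pc_topo [simp]: "topo (prim_curve C n gm) = topo C"
 by (simp add: prim_curve_def)

lemma pc_rest: "rest (prim_curve C n gm) = Tw.trs gm"
 by (intro ext) (simp add: prim_curve_def Tw.trs_def)

lemma pc_ops:
 "f \<otimes>\<^bsub>sect (prim_curve C n gm) W\<^esub> h = (\<lambda>i\<in>idx gm. f i \<otimes>\<^bsub>th (W Int cov gm i)\<^esub> h i)"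
 "f \<oplus>\<^bsub>sect (prim_curve C n gm) W\<^esub> h = (\<lambda>i\<in>idx gm. f i \<oplus>\<^bsub>th (W Int cov gm i)\<^esub> h i)"
 "\<one>\<^bsub>sect (prim_curve C n gm) W\<^esub> = (\<lambda>i\<in>idx gm. \<one>\<^bsub>th (W Int cov gm i)\<^esub>)"
 "\<zero>\<^bsub>sect (prim_curve C n gm) W\<^esub> = (\<lambda>i\<in>idx gm. \<zero>\<^bsub>th (W Int cov gm i)\<^esub>)"
 "scal (prim_curve C n gm) W c = (\<lambda>i\<in>idx gm. trunc_monom (sect C (W Int cov gm i)) n (scal C (W Int cov gm i) c) 0)"
 by (simp_all add: prim_curve_def)

lemma th_bops:
 assumes "op U" "a : carrier (th U)" "b : carrier (th U)"
 shows "a \<otimes>\<^bsub>th U\<^esub> b : carrier (th U)" "a \<oplus>\<^bsub>th U\<^esub> b : carrier (th U)" "\<ominus>\<^bsub>th U\<^esub> a : carrier (th U)"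
proof -
 interpret cring "th U" by (rule th_cring[OF assms(1)])
 show "a \<otimes>\<^bsub>th U\<^esub> b : carrier (th U)" "a \<oplus>\<^bsub>th U\<^esub> b : carrier (th U)" "\<ominus>\<^bsub>th U\<^esub> a : carrier (th U)"
  using assms by auto
qed

lemma th_consts:
 assumes "op U"
 shows "\<one>\<^bsub>th U\<^esub> : carrier (th U)" "\<zero>\<^bsub>th U\<^esub> : carrier (th U)"
  "trunc_monom (sect C U) n (scal C U c) 0 : carrier (th U)"
proof -
 interpret trunc "sect C U" n by (rule tr[OF assms(1)])
 show "\<one>\<^bsub>th U\<^esub> : carrier (th U)" "\<zero>\<^bsub>th U\<^esub> : carrier (th U)"
  "trunc_monom (sect C U) n (scal C U c) 0 : carrier (th U)"
  using scal_in[OF assms] by auto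
qed

lemma thr_ops:
 assumes U: "op U" "op V" "V <= U" and ab: "a : carrier (th U)" "b : carrier (th U)"
 shows "thr U V (a \<otimes>\<^bsub>th U\<^esub> b) = thr U V a \<otimes>\<^bsub>th V\<^esub> thr U V b" "thr U V (a \<oplus>\<^bsub>th U\<^esub> b) = thr U V a \<oplus>\<^bsub>th V\<^esub> thr U V b"
  "thr U V (\<ominus>\<^bsub>th U\<^esub> a) = \<ominus>\<^bsub>th V\<^esub> thr U V a"
proof -
 interpret ring_hom_cring "th U" "th V" "thr U V"
  by (rule ring_hom_cringI[OF th_cring[OF U(1)] th_cring[OF U(2)] thr_hom[OF U]])
 show "thr U V (a \<otimes>\<^bsub>th U\<^esub> b) = thr U V a \<otimes>\<^bsub>th V\<^esub> thr U V b" "thr U V (a \<oplus>\<^bsub>th U\<^esub> b) = thr U V a \<oplus>\<^bsub>th V\<^esub> thr U V b"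
  "thr U V (\<ominus>\<^bsub>th U\<^esub> a) = \<ominus>\<^bsub>th V\<^esub> thr U V a"
  using ab by auto
qed

lemma thr_consts:
 assumes U: "op U" "op V" "V <= U"
 shows "thr U V \<one>\<^bsub>th U\<^esub> = \<one>\<^bsub>th V\<^esub>" "thr U V \<zero>\<^bsub>th U\<^esub> = \<zero>\<^bsub>th V\<^esub>"
  "thr U V (trunc_monom (sect C U) n (scal C U c) 0) = trunc_monom (sect C V) n (scal C V c) 0"
proof -
 interpret ring_hom_cring "th U" "th V" "thr U V"
  by (rule ring_hom_cringI[OF th_cring[OF U(1)] th_cring[OF U(2)] thr_hom[OF U]])
 show "thr U V \<one>\<^bsub>th U\<^esub> = \<one>\<^bsub>th V\<^esub>" "thr U V \<zero>\<^bsub>th U\<^esub> = \<zero>\<^bsub>th V\<^esub>" by auto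
 show "thr U V (trunc_monom (sect C U) n (scal C U c) 0) = trunc_monom (sect C V) n (scal C V c) 0"
  using thr_monom[OF U scal_in[OF U(1)]] scal_rest[OF U] by simp
qed

lemma aut_ops:
 assumes V: "op V" and ph: "ph : carrier (gsec GG V)" and ab: "a : carrier (th V)" "b : carrier (th V)"
 shows "ph V (a \<otimes>\<^bsub>th V\<^esub> b) = ph V a \<otimes>\<^bsub>th V\<^esub> ph V b" "ph V (a \<oplus>\<^bsub>th V\<^esub> b) = ph V a \<oplus>\<^bsub>th V\<^esub> ph V b"
  "ph V (\<ominus>\<^bsub>th V\<^esub> a) = \<ominus>\<^bsub>th V\<^esub> ph V a"
proof -
 interpret ring_hom_cring "th V" "th V" "ph V"
  using ph by (intro ring_hom_cringI th_cring V aut_hom[OF _ V subset_refl]) (simp add: aut_carrier)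
 show "ph V (a \<otimes>\<^bsub>th V\<^esub> b) = ph V a \<otimes>\<^bsub>th V\<^esub> ph V b" "ph V (a \<oplus>\<^bsub>th V\<^esub> b) = ph V a \<oplus>\<^bsub>th V\<^esub> ph V b"
  "ph V (\<ominus>\<^bsub>th V\<^esub> a) = \<ominus>\<^bsub>th V\<^esub> ph V a"
  using ab by auto
qed

lemma aut_consts:
 assumes V: "op V" and ph: "ph : carrier (gsec GG V)"
 shows "ph V \<one>\<^bsub>th V\<^esub> = \<one>\<^bsub>th V\<^esub>" "ph V \<zero>\<^bsub>th V\<^esub> = \<zero>\<^bsub>th V\<^esub>"
  "ph V (trunc_monom (sect C V) n (scal C V c) 0) = trunc_monom (sect C V) n (scal C V c) 0"
proof -
 interpret ring_hom_cring "th V" "th V" "ph V"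
  using ph by (intro ring_hom_cringI th_cring V aut_hom[OF _ V subset_refl]) (simp add: aut_carrier)
 show "ph V \<one>\<^bsub>th V\<^esub> = \<one>\<^bsub>th V\<^esub>" "ph V \<zero>\<^bsub>th V\<^esub> = \<zero>\<^bsub>th V\<^esub>" by auto
 show "ph V (trunc_monom (sect C V) n (scal C V c) 0) = trunc_monom (sect C V) n (scal C V c) 0"
  using aut_scal[OF _ V subset_refl] ph by (simp add: aut_carrier)
qed

context
 fixes c :: "('i, 'p, ('p, 'a) taut) cocycle" and d :: "('j, 'p, ('p, 'a) taut) cocycle"
  and K :: "'z set" and W sg \<tau> h A
 assumes c: "is_cocycle (topo C) GG c" and d: "is_cocycle (topo C) GG d"
  and D: "Tw.cobounds c d K W sg \<tau> h" and A: "op A"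
begin

abbreviation rel where "rel \<equiv> Tw.twrel c d K W sg \<tau> h A"

lemma twrel_ops:
 assumes f: "f : Tw.tw c A" "e : Tw.tw c A" and f': "f' : Tw.tw d A" "e' : Tw.tw d A"
  and R: "rel f f'" "rel e e'"
 shows "rel (\<lambda>i\<in>idx c. f i \<otimes>\<^bsub>th (A Int cov c i)\<^esub> e i) (\<lambda>i\<in>idx d. f' i \<otimes>\<^bsub>th (A Int cov d i)\<^esub> e' i)"
  and "rel (\<lambda>i\<in>idx c. f i \<oplus>\<^bsub>th (A Int cov c i)\<^esub> e i) (\<lambda>i\<in>idx d. f' i \<oplus>\<^bsub>th (A Int cov d i)\<^esub> e' i)"
  by (rule Tw.twrel_bop[where p="%U a b. a \<otimes>\<^bsub>th U\<^esub> b"]; (assumption | rule th_bops thr_ops aut_ops c d D A f f' R)+)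
   (rule Tw.twrel_bop[where p="%U a b. a \<oplus>\<^bsub>th U\<^esub> b"]; (assumption | rule th_bops thr_ops aut_ops c d D A f f' R)+)

lemma twrel_consts:
 shows "rel (\<lambda>i\<in>idx c. \<one>\<^bsub>th (A Int cov c i)\<^esub>) (\<lambda>i\<in>idx d. \<one>\<^bsub>th (A Int cov d i)\<^esub>)"
  and "rel (\<lambda>i\<in>idx c. trunc_monom (sect C (A Int cov c i)) n (scal C (A Int cov c i) z) 0)
   (\<lambda>i\<in>idx d. trunc_monom (sect C (A Int cov d i)) n (scal C (A Int cov d i) z) 0)"
 by (rule Tw.twrel_const[where p="%U. \<one>\<^bsub>th U\<^esub>"]; (rule th_consts thr_consts aut_consts c d D A | assumption)+)
   (rule Tw.twrel_const[where p="%U. trunc_monom (sect C U) n (scal C U z) 0"];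
    (rule th_consts thr_consts aut_consts c d D A | assumption)+)

end

context
 fixes gm :: "('i, 'p, ('p, 'a) taut) cocycle"
 assumes gm: "is_cocycle (topo C) GG gm"
begin

text \<open>\<open>prim_curve\<close> applies the family \<open>trans gm i j\<close> at V without
  restricting it first. Restriction of such a family only forgets larger open sets, so the two
  conditions agree.\<close>

lemma pc_carrier:
 assumes W: "op W"
 shows "carrier (sect (prim_curve C n gm) W) = Tw.tw gm W"
proof -
 have "gres GG (cov gm i Int cov gm j) (W Int (cov gm i Int cov gm j)) (trans gm i j) (W Int (cov gm i Int cov gm j)) =
  trans gm i j (W Int (cov gm i Int cov gm j))" if "i : idx gm" "j : idx gm" for i j
  using W that Tw.cocycle_open[OF gm] by (intro aut_gres_app) auto
 then show ?thesis by (auto simp: prim_curve_def Tw.tw_def Let_def)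
qed

lemma op_Int: "[|op W; i : idx gm|] ==> op (W Int cov gm i)"
 by (rule Tw.open_Int[OF gm])

lemmas tw_closed = Tw.tw_comp_closed[OF gm]

lemma tw_ops:
 assumes W: "op W" and f: "f : Tw.tw gm W" and h: "h : Tw.tw gm W"
 shows tw_mult: "(\<lambda>i\<in>idx gm. f i \<otimes>\<^bsub>th (W Int cov gm i)\<^esub> h i) : Tw.tw gm W"
  and tw_add: "(\<lambda>i\<in>idx gm. f i \<oplus>\<^bsub>th (W Int cov gm i)\<^esub> h i) : Tw.tw gm W"
  and tw_minus: "(\<lambda>i\<in>idx gm. \<ominus>\<^bsub>th (W Int cov gm i)\<^esub> f i) : Tw.tw gm W"
proof -
 show "(\<lambda>i\<in>idx gm. f i \<otimes>\<^bsub>th (W Int cov gm i)\<^esub> h i) : Tw.tw gm W"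
  by (rule Tw.tw_bop[where p="%U a b. a \<otimes>\<^bsub>th U\<^esub> b"]; (assumption | rule th_bops thr_ops aut_ops gm W f h)+)
 show "(\<lambda>i\<in>idx gm. f i \<oplus>\<^bsub>th (W Int cov gm i)\<^esub> h i) : Tw.tw gm W"
  by (rule Tw.tw_bop[where p="%U a b. a \<oplus>\<^bsub>th U\<^esub> b"]; (assumption | rule th_bops thr_ops aut_ops gm W f h)+)
 \<comment> \<open>Negation is fed to the rule for binary operations as one that ignores its second
   argument.\<close>
 show "(\<lambda>i\<in>idx gm. \<ominus>\<^bsub>th (W Int cov gm i)\<^esub> f i) : Tw.tw gm W"
  by (rule Tw.tw_bop[where p="%U a b. \<ominus>\<^bsub>th U\<^esub> a" and f'=f]; (assumption | rule th_bops thr_ops aut_ops gm W f h)+)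
qed

lemma tw_consts:
 assumes W: "op W"
 shows tw_one: "(\<lambda>i\<in>idx gm. \<one>\<^bsub>th (W Int cov gm i)\<^esub>) : Tw.tw gm W"
  and tw_zero: "(\<lambda>i\<in>idx gm. \<zero>\<^bsub>th (W Int cov gm i)\<^esub>) : Tw.tw gm W"
  and tw_scal: "(\<lambda>i\<in>idx gm. trunc_monom (sect C (W Int cov gm i)) n (scal C (W Int cov gm i) c) 0) : Tw.tw gm W"
proof -
 show "(\<lambda>i\<in>idx gm. \<one>\<^bsub>th (W Int cov gm i)\<^esub>) : Tw.tw gm W"
  by (rule Tw.tw_const[where p="%U. \<one>\<^bsub>th U\<^esub>"]; (rule th_consts thr_consts aut_consts gm W | assumption)+)
 show "(\<lambda>i\<in>idx gm. \<zero>\<^bsub>th (W Int cov gm i)\<^esub>) : Tw.tw gm W"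
  by (rule Tw.tw_const[where p="%U. \<zero>\<^bsub>th U\<^esub>"]; (rule th_consts thr_consts aut_consts gm W | assumption)+)
 show "(\<lambda>i\<in>idx gm. trunc_monom (sect C (W Int cov gm i)) n (scal C (W Int cov gm i) c) 0) : Tw.tw gm W"
  by (rule Tw.tw_const[where p="%U. trunc_monom (sect C U) n (scal C U c) 0"];
    (rule th_consts thr_consts aut_consts gm W | assumption)+)
qed

lemma pc_cring:
 assumes W: "op W"
 shows "cring (sect (prim_curve C n gm) W)" (is "cring ?S")
proof -
 have R: "cring (th (W Int cov gm i))" if "i : idx gm" for i by (rule th_cring[OF op_Int[OF W that]])
 note rs = cring.cring_simprules[OF R]
 note m = tw_mult[OF W] and a = tw_add[OF W] and mi = tw_minus[OF W]
  and o = tw_one[OF W] and z = tw_zero[OF W]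
 note S = pc_carrier[OF W] pc_ops
 note cl = tw_closed[where W=W]
 show ?thesis
 proof (rule cringI)
  show "abelian_group ?S"
  proof (rule abelian_groupI)
   fix x y u assume "x : carrier ?S" "y : carrier ?S" "u : carrier ?S"
   then have xyu: "x : Tw.tw gm W" "y : Tw.tw gm W" "u : Tw.tw gm W" by (simp_all add: S)
   note c = cl[OF xyu(1)] cl[OF xyu(2)] cl[OF xyu(3)]
   show "x \<oplus>\<^bsub>?S\<^esub> y \<oplus>\<^bsub>?S\<^esub> u = x \<oplus>\<^bsub>?S\<^esub> (y \<oplus>\<^bsub>?S\<^esub> u)"
    unfolding S by (rule Tw.tw_eqI[OF gm a[OF a[OF xyu(1,2)] xyu(3)] a[OF xyu(1) a[OF xyu(2,3)]]])
     (use c rs in simp)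
  next
   fix x y assume "x : carrier ?S" "y : carrier ?S"
   then have xy: "x : Tw.tw gm W" "y : Tw.tw gm W" by (simp_all add: S)
   note c = cl[OF xy(1)] cl[OF xy(2)]
   show "x \<oplus>\<^bsub>?S\<^esub> y : carrier ?S" unfolding S by (rule a[OF xy])
   show "x \<oplus>\<^bsub>?S\<^esub> y = y \<oplus>\<^bsub>?S\<^esub> x"
    unfolding S by (rule Tw.tw_eqI[OF gm a[OF xy] a[OF xy(2,1)]]) (simp add: rs(10)[OF _ c])
  next
   show "\<zero>\<^bsub>?S\<^esub> : carrier ?S" unfolding S by (rule z)
  next
   fix x assume "x : carrier ?S"
   then have x: "x : Tw.tw gm W" by (simp add: S)
   show "\<zero>\<^bsub>?S\<^esub> \<oplus>\<^bsub>?S\<^esub> x = x"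
    unfolding S by (rule Tw.tw_eqI[OF gm a[OF z x] x]) (use cl[OF x] rs in simp)
   show "\<exists>y\<in>carrier ?S. y \<oplus>\<^bsub>?S\<^esub> x = \<zero>\<^bsub>?S\<^esub>"
    unfolding S by (rule bexI[OF _ mi[OF x x]], rule Tw.tw_eqI[OF gm a[OF mi[OF x x] x] z])
     (use cl[OF x] rs in simp)
  qed
  show "comm_monoid ?S"
  proof (rule comm_monoidI)
   fix x y u assume "x : carrier ?S" "y : carrier ?S" "u : carrier ?S"
   then have xyu: "x : Tw.tw gm W" "y : Tw.tw gm W" "u : Tw.tw gm W" by (simp_all add: S)
   note c = cl[OF xyu(1)] cl[OF xyu(2)] cl[OF xyu(3)]
   show "x \<otimes>\<^bsub>?S\<^esub> y \<otimes>\<^bsub>?S\<^esub> u = x \<otimes>\<^bsub>?S\<^esub> (y \<otimes>\<^bsub>?S\<^esub> u)"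
    unfolding S by (rule Tw.tw_eqI[OF gm m[OF m[OF xyu(1,2)] xyu(3)] m[OF xyu(1) m[OF xyu(2,3)]]])
     (use c rs in simp)
  next
   fix x y assume "x : carrier ?S" "y : carrier ?S"
   then have xy: "x : Tw.tw gm W" "y : Tw.tw gm W" by (simp_all add: S)
   note c = cl[OF xy(1)] cl[OF xy(2)]
   show "x \<otimes>\<^bsub>?S\<^esub> y : carrier ?S" unfolding S by (rule m[OF xy])
   show "x \<otimes>\<^bsub>?S\<^esub> y = y \<otimes>\<^bsub>?S\<^esub> x"
    unfolding S by (rule Tw.tw_eqI[OF gm m[OF xy] m[OF xy(2,1)]]) (simp add: rs(14)[OF _ c])
  next
   show "\<one>\<^bsub>?S\<^esub> : carrier ?S" unfolding S by (rule o)
  next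
   fix x assume "x : carrier ?S"
   then have x: "x : Tw.tw gm W" by (simp add: S)
   show "\<one>\<^bsub>?S\<^esub> \<otimes>\<^bsub>?S\<^esub> x = x"
    unfolding S by (rule Tw.tw_eqI[OF gm m[OF o x] x]) (use cl[OF x] rs in simp)
  qed
  fix x y u assume "x : carrier ?S" "y : carrier ?S" "u : carrier ?S"
  then have xyu: "x : Tw.tw gm W" "y : Tw.tw gm W" "u : Tw.tw gm W" by (simp_all add: S)
  note c = cl[OF xyu(1)] cl[OF xyu(2)] cl[OF xyu(3)]
  show "(x \<oplus>\<^bsub>?S\<^esub> y) \<otimes>\<^bsub>?S\<^esub> u = x \<otimes>\<^bsub>?S\<^esub> u \<oplus>\<^bsub>?S\<^esub> y \<otimes>\<^bsub>?S\<^esub> u"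
   unfolding S by (rule Tw.tw_eqI[OF gm m[OF a[OF xyu(1,2)] xyu(3)] a[OF m[OF xyu(1,3)] m[OF xyu(2,3)]]])
    (use c rs in simp)
 qed
qed

lemma trs_ops:
 assumes W: "op W" "op V" "V <= W" and f: "f : Tw.tw gm W" and h: "h : Tw.tw gm W"
 shows "Tw.trs gm W V (\<lambda>i\<in>idx gm. f i \<otimes>\<^bsub>th (W Int cov gm i)\<^esub> h i) =
   (\<lambda>i\<in>idx gm. Tw.trs gm W V f i \<otimes>\<^bsub>th (V Int cov gm i)\<^esub> Tw.trs gm W V h i)"
  and "Tw.trs gm W V (\<lambda>i\<in>idx gm. f i \<oplus>\<^bsub>th (W Int cov gm i)\<^esub> h i) =
   (\<lambda>i\<in>idx gm. Tw.trs gm W V f i \<oplus>\<^bsub>th (V Int cov gm i)\<^esub> Tw.trs gm W V h i)"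
 using thr_ops(1,2)[OF op_Int[OF W(1)] op_Int[OF W(2)] _ tw_closed[OF f] tw_closed[OF h]] W(3)
 by (auto simp: Tw.trs_def fun_eq_iff le_infI1 restrict_def)

lemma pc_ringed: "ringed_cspace (prim_curve C n gm)"
proof (rule ringed_cspace.intro)
 interpret T: set_sheaf "topo C" "Tw.tw gm" "Tw.trs gm" by (rule Tw.tw_sheaf[OF gm])
 let ?P = "prim_curve C n gm"
 fix U V assume "openin (topo ?P) U" "openin (topo ?P) V" and s: "V <= U"
 then have U: "op U" "op V" by simp_all
 have s': "V Int cov gm i <= U Int cov gm i" for i using s by auto
 show "rest ?P U V : ring_hom (sect ?P U) (sect ?P V)"
 proof (rule ring_hom_memI)
  fix x y assume "x : carrier (sect ?P U)" "y : carrier (sect ?P U)"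
  then have xy: "x : Tw.tw gm U" "y : Tw.tw gm U" by (simp_all add: pc_carrier[OF U(1)])
  show "rest ?P U V (x \<otimes>\<^bsub>sect ?P U\<^esub> y) = rest ?P U V x \<otimes>\<^bsub>sect ?P V\<^esub> rest ?P U V y"
   "rest ?P U V (x \<oplus>\<^bsub>sect ?P U\<^esub> y) = rest ?P U V x \<oplus>\<^bsub>sect ?P V\<^esub> rest ?P U V y"
   unfolding pc_ops pc_rest by (rule trs_ops[OF U s xy])+
 next
  fix x assume "x : carrier (sect ?P U)"
  then show "rest ?P U V x : carrier (sect ?P V)"
   using Tw.trs_closed[OF gm U s] by (simp add: pc_carrier U pc_rest)
 next
  show "rest ?P U V \<one>\<^bsub>sect ?P U\<^esub> = \<one>\<^bsub>sect ?P V\<^esub>"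
   using thr_consts(1)[OF op_Int[OF U(1)] op_Int[OF U(2)] s']
   by (auto simp: pc_ops pc_rest Tw.trs_def fun_eq_iff restrict_def)
 qed
 show "rest ?P U V (scal ?P U c) = scal ?P V c" for c
  using thr_consts(3)[OF op_Int[OF U(1)] op_Int[OF U(2)] s']
  by (auto simp: pc_ops pc_rest Tw.trs_def fun_eq_iff restrict_def)
next
 let ?P = "prim_curve C n gm"
 fix U assume "openin (topo ?P) U"
 then have U: "op U" by simp
 show "cring (sect ?P U)" by (rule pc_cring[OF U])
 show "rest ?P U U s = s" if "s : carrier (sect ?P U)" for s
  using that Tw.trs_id[OF gm U] by (simp add: pc_rest pc_carrier[OF U])
 show "scal ?P U : ring_hom complex_ring (sect ?P U)"
 proof (rule ring_hom_memI)
  have h: "(%c. trunc_monom (sect C V) n (scal C V c) 0) : ring_hom complex_ring (th V)" if V: "op V" for V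
   using ring_hom_trans[OF scal_hom[OF V] trunc.tconst_hom[OF tr[OF V]]] by (simp add: comp_def)
  fix x y :: complex
  show "scal ?P U (x \<otimes>\<^bsub>complex_ring\<^esub> y) = scal ?P U x \<otimes>\<^bsub>sect ?P U\<^esub> scal ?P U y"
   "scal ?P U (x \<oplus>\<^bsub>complex_ring\<^esub> y) = scal ?P U x \<oplus>\<^bsub>sect ?P U\<^esub> scal ?P U y"
   "scal ?P U \<one>\<^bsub>complex_ring\<^esub> = \<one>\<^bsub>sect ?P U\<^esub>"
   using ring_hom_mult[OF h[OF op_Int[OF U]], of _ x y] ring_hom_add[OF h[OF op_Int[OF U]], of _ x y]
    ring_hom_one[OF h[OF op_Int[OF U]]]
   by (auto simp: pc_ops fun_eq_iff restrict_def ring_of_type_algebra_def)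
  show "scal ?P U x : carrier (sect ?P U)" using tw_scal[OF U] by (simp add: pc_carrier[OF U] pc_ops)
 qed
next
 let ?P = "prim_curve C n gm"
 fix U V W s assume "openin (topo ?P) U" "openin (topo ?P) V" "openin (topo ?P) W" "W <= V" "V <= U"
  "s : carrier (sect ?P U)"
 then show "rest ?P V W (rest ?P U V s) = rest ?P U W s"
  using Tw.trs_comp[OF gm, of U V W s] by (simp add: pc_rest pc_carrier)
next
 let ?P = "prim_curve C n gm"
 fix \<U> sg assume "!!U. U : \<U> ==> openin (topo ?P) U" "!!U. U : \<U> ==> sg U : carrier (sect ?P U)"
  and e: "!!U V. [|U : \<U>; V : \<U>|] ==> rest ?P U (U Int V) (sg U) = rest ?P V (U Int V) (sg V)"
 then have U: "!!U. U : \<U> ==> op U" "!!U. U : \<U> ==> sg U : Tw.tw gm U" by (simp_all add: pc_carrier)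
 have W: "op (\<Union>\<U>)" using U by auto
 show "\<exists>!a. a : carrier (sect ?P (\<Union>\<U>)) & (\<forall>U\<in>\<U>. rest ?P (\<Union>\<U>) U a = sg U)"
  unfolding pc_carrier[OF W] pc_rest
  by (rule Tw.tw_glue[OF gm U e[unfolded pc_rest]])
qed

subsection \<open>The inclusion of the core\<close>

definition core :: "'p set => ('i => (nat => 'a) set) => 'a" where
 "core W f = snd (core_incl C gm) W f"

text \<open>Transition automorphisms preserve the value at t = 0, so the constant terms of the
  components agree on overlaps and glue to a section of O_C. Hence the description in
  \<open>core_incl\<close> determines a section.\<close>

lemma core_ex1:
 assumes W: "op W" and f: "f : Tw.tw gm W"
 shows "\<exists>!s. s : carrier (sect C W) & (\<forall>i\<in>idx gm. rest C W (W Int cov gm i) s = tcf (f i) 0)"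
proof -
 note oi = op_Int[OF W]
 have Wc: "W = (\<Union>i\<in>idx gm. W Int cov gm i)" using Tw.cocycle_cover[OF gm] openin_subset[OF W] by auto
 obtain s where s: "s : carrier (sect C W)" "!!i. i : idx gm ==> rest C W (W Int cov gm i) s = tcf (f i) 0"
 proof (rule Un.glue_ex[where I="idx gm" and U="%i. W Int cov gm i" and s="%i. tcf (f i) 0", OF oi Wc])
  show "tcf (f i) 0 : carrier (sect C (W Int cov gm i))" if "i : idx gm" for i
   by (rule tcf_in[OF oi[OF that] tw_closed[OF f that]])
  fix i j assume i: "i : idx gm" "j : idx gm"
  let ?V = "W Int cov gm i Int (W Int cov gm j)"
  have V: "op ?V" using oi i by auto
  have s: "?V <= W" "?V <= cov gm i" "?V <= cov gm j" "?V <= W Int cov gm i" "?V <= W Int cov gm j" by auto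
  have "rest C (W Int cov gm i) ?V (tcf (f i) 0) = tcf (thr (W Int cov gm i) ?V (f i)) 0"
   by (rule tcf_thr[OF oi[OF i(1)] V s(4) tw_closed[OF f i(1)] n_pos, symmetric])
  also have "\<dots> = tcf (Tw.cres gm i j ?V ?V (thr (W Int cov gm j) ?V (f j))) 0"
   using Tw.tw_eq[OF gm f W i V s(1-3)] by simp
  also have "\<dots> = tcf (thr (W Int cov gm j) ?V (f j)) 0"
   using Tw.cres_closed[OF gm i V s(2,3)]
   by (intro aut_zero[OF _ V subset_refl] thr_closed[OF oi[OF i(2)] V s(5) tw_closed[OF f i(2)]])
    (simp add: aut_carrier)
  also have "\<dots> = rest C (W Int cov gm j) ?V (tcf (f j) 0)"
   by (rule tcf_thr[OF oi[OF i(2)] V s(5) tw_closed[OF f i(2)] n_pos])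
  finally show "rest C (W Int cov gm i) ?V (tcf (f i) 0) = rest C (W Int cov gm j) ?V (tcf (f j) 0)" .
 qed (assumption, rule that, assumption, simp)
 show ?thesis
 proof (rule ex1I[of _ s])
  fix s' assume s': "s' : carrier (sect C W) & (\<forall>i\<in>idx gm. rest C W (W Int cov gm i) s' = tcf (f i) 0)"
  show "s' = s"
  proof (rule Un.sep[OF W])
   fix x assume "x : W"
   then obtain i where "i : idx gm" "x : W Int cov gm i" using Wc by auto
   then show "\<exists>V. op V & x : V & V <= W & rest C W V s' = rest C W V s"
    using oi s' s(2) by (intro exI[of _ "W Int cov gm i"]) auto
  qed (use s s' in auto)
 qed (use s in auto)
qed

lemma core_eq: "[|op W; f : Tw.tw gm W|] ==> core W f =
  (THE s. s : carrier (sect C W) & (\<forall>i\<in>idx gm. rest C W (W Int cov gm i) s = tcf (f i) 0))"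
 unfolding core_def core_incl_def snd_conv
 using at_zero_th[OF op_Int tw_closed] by (intro arg_cong[where f=The] ext conj_cong ball_cong) auto

lemma core_closed: "[|op W; f : Tw.tw gm W|] ==> core W f : carrier (sect C W)"
 and core_rest_cov: "[|op W; f : Tw.tw gm W; i : idx gm|] ==> rest C W (W Int cov gm i) (core W f) = tcf (f i) 0"
 using theI'[OF core_ex1[of W f]] by (auto simp: core_eq)

lemma core_eqI:
 "[|op W; f : Tw.tw gm W; s : carrier (sect C W);
  !!i. i : idx gm ==> rest C W (W Int cov gm i) s = tcf (f i) 0|] ==> core W f = s"
 using core_ex1[of W f] core_closed[of W f] core_rest_cov[of W f] by blast

lemma core_res:
 assumes W: "op W" "op V" "V <= W" and f: "f : Tw.tw gm W"
 shows "rest C W V (core W f) = core V (Tw.trs gm W V f)"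
proof (rule core_eqI[OF W(2) Tw.trs_closed[OF gm W f], symmetric])
 fix i assume i: "i : idx gm"
 have s: "V Int cov gm i <= V" "V Int cov gm i <= W" "V Int cov gm i <= W Int cov gm i" "W Int cov gm i <= W" using W by auto
 have "rest C V (V Int cov gm i) (rest C W V (core W f)) = rest C (W Int cov gm i) (V Int cov gm i) (rest C W (W Int cov gm i) (core W f))"
  using rest_comp[OF W(1,2) op_Int[OF W(2) i] s(1) W(3) core_closed[OF W(1) f]]
   rest_comp[OF W(1) op_Int[OF W(1) i] op_Int[OF W(2) i] s(3,4) core_closed[OF W(1) f]] by simp
 then show "rest C V (V Int cov gm i) (rest C W V (core W f)) = tcf (Tw.trs gm W V f i) 0"
  using core_rest_cov[OF W(1) f i] tcf_thr[OF op_Int[OF W(1) i] op_Int[OF W(2) i] s(3) tw_closed[OF f i] n_pos] i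
  by (simp add: Tw.trs_def)
qed (use rest_closed[OF W core_closed[OF W(1) f]] in auto)

lemma core_local:
 assumes W: "op W" and f: "f : Tw.tw gm W" and i: "i : idx gm" "W <= cov gm i"
 shows "core W f = tcf (f i) 0"
proof -
 have "W Int cov gm i = W" using i by auto
 then show ?thesis using core_rest_cov[OF W f i(1)] rest_id[OF W core_closed[OF W f]] by simp
qed

lemma core_ideal_eq:
 assumes W: "op W"
 shows "core_ideal C n gm W = {f : Tw.tw gm W. \<forall>i\<in>idx gm. tcf (f i) 0 = \<zero>\<^bsub>sect C (W Int cov gm i)\<^esub>}"
proof -
 have z: "\<zero>\<^bsub>sect C W\<^esub> : carrier (sect C W)" using sect_cring[OF W] by (simp add: cring.cring_simprules)
 have "core W f = \<zero>\<^bsub>sect C W\<^esub> \<longleftrightarrow> (\<forall>i\<in>idx gm. tcf (f i) 0 = \<zero>\<^bsub>sect C (W Int cov gm i)\<^esub>)" if f: "f : Tw.tw gm W" for f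
  using core_rest_cov[OF W f] core_eqI[OF W f z] rest_zero[OF W op_Int[OF W]] by auto
 then show ?thesis
  by (auto simp: core_ideal_def a_kernel_def' pc_carrier[OF W] core_def[symmetric])
qed

end

end

section \<open>Reduction from multiplicity n to multiplicity k\<close>

locale thickening_pair = N: thickening C n + K: thickening C k
 for C :: "('p, 'a) cspace" and n :: nat and k :: nat +
 assumes kn: "k \<le> n"
begin

lemma red_hom: "openin (topo C) V ==> trunc_red (sect C V) k : ring_hom (N.th V) (K.th V)"
 by (rule trunc.trunc_red_hom[OF N.tr kn])

lemma red_closed: "[|openin (topo C) V; F : carrier (N.th V)|] ==> trunc_red (sect C V) k F : carrier (K.th V)"
 by (rule ring_hom_closed[OF red_hom])

lemma tcf_red: "[|openin (topo C) V; F : carrier (N.th V); i < k|] ==> tcf (trunc_red (sect C V) k F) i = tcf F i"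
 by (rule trunc.tcf_red[OF N.tr _ kn])

lemma red_surj:
 assumes V: "openin (topo C) V" and F: "F : carrier (K.th V)"
 obtains E where "E : carrier (N.th V)" "F = trunc_red (sect C V) k E"
proof
 interpret V: trunc "sect C V" n by (rule N.tr[OF V])
 show 1: "trunc_of (sect C V) n (tcf F) : carrier (N.th V)"
  using K.tcf_in[OF V F] by (rule V.trunc_of_closed)
 show "F = trunc_red (sect C V) k (trunc_of (sect C V) n (tcf F))"
  by (rule K.th_eqI[OF V F red_closed[OF V 1]])
   (use tcf_red[OF V 1] V.tcf_trunc_of[OF K.tcf_in[OF V F]] kn in auto)
qed

lemma red_res:
 assumes U: "openin (topo C) U" "openin (topo C) V" "V <= U" and F: "F : carrier (N.th U)"
 shows "trunc_red (sect C V) k (N.thr U V F) = K.thr U V (trunc_red (sect C U) k F)"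
 by (rule K.th_eqI[OF U(2) red_closed[OF U(2) N.thr_closed[OF U F]] K.thr_closed[OF U red_closed[OF U(1) F]]])
  (use kn in \<open>simp add: tcf_red[OF U(2) N.thr_closed[OF U F]] K.tcf_thr[OF U red_closed[OF U(1) F]]
   tcf_red[OF U(1) F] N.tcf_thr[OF U F]\<close>)

lemma red_eq_iff:
 assumes V: "openin (topo C) V" and F: "F : carrier (N.th V)" "G : carrier (N.th V)"
 shows "trunc_red (sect C V) k F = trunc_red (sect C V) k G \<longleftrightarrow> (\<forall>i<k. tcf F i = tcf G i)"
 using K.th_eqI[OF V red_closed[OF V F(1)] red_closed[OF V F(2)]] tcf_red[OF V F(1)] tcf_red[OF V F(2)] by metis

text \<open>An automorphism maps (t^k) into itself, hence acts on classes modulo t^k. This justifies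
  the choice of a representative in \<open>aut_red\<close>.\<close>

lemma red_aut_cong:
 assumes ph: "ph : aut_set C n U" and V: "openin (topo C) V" "V <= U"
  and F: "F : carrier (N.th V)" "G : carrier (N.th V)"
  and e: "trunc_red (sect C V) k F = trunc_red (sect C V) k G"
 shows "trunc_red (sect C V) k (ph V F) = trunc_red (sect C V) k (ph V G)"
proof -
 interpret V: trunc "sect C V" n by (rule N.tr[OF V(1)])
 interpret ph: ring_hom_cring V.B V.B "ph V"
  by (rule ring_hom_cringI[OF V.B.is_cring V.B.is_cring N.aut_hom[OF ph V]])
 let ?D = "F \<ominus>\<^bsub>V.B\<^esub> G"
 have "V.tvan k ?D"
  using e F kn by (auto simp: red_eq_iff[OF V(1) F] V.tvan_def)
 then have "V.tvan k (ph V ?D)"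
  using F by (intro V.tvan_hom[OF N.aut_hom[OF ph V] N.aut_zero[OF ph V] N.n_pos]) auto
 moreover have "ph V ?D = ph V F \<ominus>\<^bsub>V.B\<^esub> ph V G" using F by (simp add: a_minus_def)
 ultimately have "tcf (ph V F) i = tcf (ph V G) i" if "i < k" for i
  using that F kn by (auto simp: V.tvan_def)
 then show ?thesis using F by (simp add: red_eq_iff[OF V(1)])
qed

lemma aut_red_app:
 assumes ph: "ph : aut_set C n U" and V: "openin (topo C) V" "V <= U" and E: "E : carrier (N.th V)"
 shows "aut_red C n k U ph V (trunc_red (sect C V) k E) = trunc_red (sect C V) k (ph V E)"
proof -
 have "(THE F'. \<exists>E'\<in>carrier (N.th V). trunc_red (sect C V) k E = trunc_red (sect C V) k E' \<and>
   F' = trunc_red (sect C V) k (ph V E')) = trunc_red (sect C V) k (ph V E)"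
 proof (rule the_equality)
  fix F' assume "\<exists>E'\<in>carrier (N.th V). trunc_red (sect C V) k E = trunc_red (sect C V) k E' \<and>
   F' = trunc_red (sect C V) k (ph V E')"
  then show "F' = trunc_red (sect C V) k (ph V E)" using red_aut_cong[OF ph V E] by metis
 qed (use E in blast)
 then show ?thesis
  using V red_closed[OF V(1) E] by (simp add: aut_red_def N.opens_iff)
qed

lemma aut_red_closed:
 assumes ph: "ph : aut_set C n U" and U: "openin (topo C) U"
 shows "aut_red C n k U ph : aut_set C k U"
proof (rule K.aut_setI[OF U])
 show "aut_red C n k U ph : extensional (opens_in C U)" by (simp add: aut_red_def)
 fix V assume V: "openin (topo C) V" "V <= U"
 interpret V: trunc "sect C V" n by (rule N.tr[OF V(1)])
 interpret W: trunc "sect C V" k by (rule N.tr[OF V(1)])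
 interpret r: ring_hom_cring V.B W.B "trunc_red (sect C V) k"
  by (rule ring_hom_cringI[OF V.B.is_cring W.B.is_cring red_hom[OF V(1)]])
 interpret ph: ring_hom_cring V.B V.B "ph V"
  by (rule ring_hom_cringI[OF V.B.is_cring V.B.is_cring N.aut_hom[OF ph V]])
 note app = aut_red_app[OF ph V]
 show "aut_red C n k U ph V : extensional (carrier W.B)"
  using V by (simp add: aut_red_def N.opens_iff)
 have cl: "aut_red C n k U ph V F : carrier W.B" if F: "F : carrier W.B" for F
  by (rule red_surj[OF V(1) F]) (simp add: app)
 show "aut_red C n k U ph V : ring_hom W.B W.B"
 proof (rule ring_hom_memI)
  fix F G assume F: "F : carrier W.B" and G: "G : carrier W.B"
  obtain E where E: "E : carrier V.B" "F = trunc_red (sect C V) k E" by (rule red_surj[OF V(1) F])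
  obtain D where D: "D : carrier V.B" "G = trunc_red (sect C V) k D" by (rule red_surj[OF V(1) G])
  show "aut_red C n k U ph V F : carrier W.B" by (rule cl[OF F])
  show "aut_red C n k U ph V (F \<otimes>\<^bsub>W.B\<^esub> G) = aut_red C n k U ph V F \<otimes>\<^bsub>W.B\<^esub> aut_red C n k U ph V G"
   using app[of "E \<otimes>\<^bsub>V.B\<^esub> D"] E D by (simp add: app)
  show "aut_red C n k U ph V (F \<oplus>\<^bsub>W.B\<^esub> G) = aut_red C n k U ph V F \<oplus>\<^bsub>W.B\<^esub> aut_red C n k U ph V G"
   using app[of "E \<oplus>\<^bsub>V.B\<^esub> D"] E D by (simp add: app)
 next
  show "aut_red C n k U ph V \<one>\<^bsub>W.B\<^esub> = \<one>\<^bsub>W.B\<^esub>" using app[of "\<one>\<^bsub>V.B\<^esub>"] by simp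
 qed
 show "bij_betw (aut_red C n k U ph V) (carrier W.B) (carrier W.B)"
 proof -
  \<comment> \<open>The reduction of the inverse automorphism is a two-sided inverse of the
    reduction.\<close>
  interpret G: group "gsec N.GG U" by (rule N.aut_group[OF U])
  let ?\<psi> = "inv\<^bsub>gsec N.GG U\<^esub> ph"
  have \<psi>: "?\<psi> : aut_set C n U" using G.inv_closed ph by (simp add: N.aut_carrier)
  have "ph V (?\<psi> V E) = E" "?\<psi> V (ph V E) = E" if "E : carrier V.B" for E
   using G.r_inv[of ph] G.l_inv[of ph] ph N.aut_mult_app[OF V that, of ph ?\<psi>] N.aut_mult_app[OF V that, of ?\<psi> ph]
    N.aut_one_app[OF V that] by (auto simp: N.aut_carrier)
  then have "aut_red C n k U ph V (aut_red C n k U ?\<psi> V F) = F"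
   "aut_red C n k U ?\<psi> V (aut_red C n k U ph V F) = F" "aut_red C n k U ?\<psi> V F : carrier W.B"
   if F: "F : carrier W.B" for F
   using red_surj[OF V(1) F] app aut_red_app[OF \<psi> V] N.aut_closed[OF \<psi> V] N.aut_closed[OF ph V] red_closed[OF V(1)]
   by metis+
  then show ?thesis using cl by (intro bij_betw_byWitness[where f'="aut_red C n k U ?\<psi> V"]) auto
 qed
 show "aut_red C n k U ph V (trunc_monom (sect C V) k (scal C V c) 0) = trunc_monom (sect C V) k (scal C V c) 0" for c
 proof -
  have "trunc_red (sect C V) k (trunc_monom (sect C V) n (scal C V c) 0) = trunc_monom (sect C V) k (scal C V c) 0"
   using kn N.scal_in[OF V(1)] by (intro K.th_eqI[OF V(1)]) (auto simp: tcf_red[OF V(1)])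
  then show ?thesis using app[OF V.trunc_monom_closed[OF N.scal_in[OF V(1)]], of c 0] N.aut_scal[OF ph V] by simp
 qed
 show "tcf (aut_red C n k U ph V F) 0 = tcf F 0" if F: "F : carrier W.B" for F
  by (rule red_surj[OF V(1) F]) (simp add: app tcf_red[OF V(1)] K.n_pos N.aut_zero[OF ph V])
 show "aut_red C n k U ph V' (K.thr V V' F) = K.thr V V' (aut_red C n k U ph V F)"
  if V': "openin (topo C) V'" "V' <= V" and F: "F : carrier W.B" for V' F
 proof -
  obtain E where E: "E : carrier V.B" "F = trunc_red (sect C V) k E" by (rule red_surj[OF V(1) F])
  have V'': "V' <= U" using V V' by auto
  show ?thesis
   using E by (simp add: red_res[OF V(1) V', symmetric] app aut_red_app[OF ph V'(1) V'']
     N.thr_closed[OF V(1) V'] N.aut_res[OF ph V V'])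
 qed
qed

lemma aut_red_presheaf_hom: "group_presheaf_hom (topo C) N.GG K.GG (aut_red C n k)"
proof (intro group_presheaf_hom.intro group_presheaf_hom_axioms.intro N.aut_presheaf K.aut_presheaf)
 fix U assume U: "openin (topo C) U"
 interpret G: group "gsec N.GG U" by (rule N.aut_group[OF U])
 interpret H: group "gsec K.GG U" by (rule K.aut_group[OF U])
 show "aut_red C n k U : hom (gsec N.GG U) (gsec K.GG U)"
 proof (rule homI)
  fix ph \<psi> assume "ph : carrier (gsec N.GG U)" "\<psi> : carrier (gsec N.GG U)"
  then have ph: "ph : aut_set C n U" and \<psi>: "\<psi> : aut_set C n U" by (auto simp: N.aut_carrier)
  have m: "ph \<otimes>\<^bsub>gsec N.GG U\<^esub> \<psi> : aut_set C n U" using G.m_closed ph \<psi> by (simp add: N.aut_carrier)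
  have m': "aut_red C n k U ph \<otimes>\<^bsub>gsec K.GG U\<^esub> aut_red C n k U \<psi> : aut_set C k U"
   using H.m_closed aut_red_closed[OF ph U] aut_red_closed[OF \<psi> U] by (simp add: K.aut_carrier)
  show "aut_red C n k U (ph \<otimes>\<^bsub>gsec N.GG U\<^esub> \<psi>) = aut_red C n k U ph \<otimes>\<^bsub>gsec K.GG U\<^esub> aut_red C n k U \<psi>"
  proof (rule K.aut_eqI[OF aut_red_closed[OF m U] m'])
   fix V F assume V: "openin (topo C) V" "V <= U" and F: "F : carrier (K.th V)"
   obtain E where E: "E : carrier (N.th V)" "F = trunc_red (sect C V) k E" by (rule red_surj[OF V(1) F])
   show "aut_red C n k U (ph \<otimes>\<^bsub>gsec N.GG U\<^esub> \<psi>) V F = (aut_red C n k U ph \<otimes>\<^bsub>gsec K.GG U\<^esub> aut_red C n k U \<psi>) V F"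
    using E F by (simp add: aut_red_app[OF m V] aut_red_app[OF ph V] aut_red_app[OF \<psi> V] N.aut_mult_app[OF V]
      K.aut_mult_app[OF V] N.aut_closed[OF \<psi> V])
  qed
 qed (simp add: aut_red_closed U N.aut_carrier K.aut_carrier)
next
 fix U V ph assume U: "openin (topo C) U" "openin (topo C) V" "V <= U" and "ph : carrier (gsec N.GG U)"
 then have ph: "ph : aut_set C n U" by (simp add: N.aut_carrier)
 have r: "gres N.GG U V ph : aut_set C n V" "gres K.GG U V (aut_red C n k U ph) : aut_set C k V"
  using N.Tw.res_closed[OF U] K.Tw.res_closed[OF U] ph aut_red_closed[OF ph U(1)]
  by (auto simp: N.aut_carrier K.aut_carrier)
 show "aut_red C n k V (gres N.GG U V ph) = gres K.GG U V (aut_red C n k U ph)"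
 proof (rule K.aut_eqI[OF aut_red_closed[OF r(1) U(2)] r(2)])
  fix V' F assume V': "openin (topo C) V'" "V' <= V" and F: "F : carrier (K.th V')"
  obtain E where E: "E : carrier (N.th V')" "F = trunc_red (sect C V') k E" by (rule red_surj[OF V'(1) F])
  have V'': "V' <= U" using U V' by auto
  show "aut_red C n k V (gres N.GG U V ph) V' F = gres K.GG U V (aut_red C n k U ph) V' F"
   using E by (simp add: aut_red_app[OF r(1) V'] aut_red_app[OF ph V'(1) V''] N.aut_gres_app[OF V'] K.aut_gres_app[OF V'])
 qed
qed

sublocale red: group_presheaf_hom "topo C" N.GG K.GG "aut_red C n k" by (rule aut_red_presheaf_hom)

end

section \<open>Stalks, ideal presheaves and quotient sheaves\<close>

context ringed_cspace
begin

abbreviation oS where "oS \<equiv> openin (topo S)"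

lemma srest_closed: "[|oS U; oS V; V <= U; s : carrier (sect S U)|] ==> rest S U V s : carrier (sect S V)"
 by (rule ring_hom_closed[OF rest_hom])

lemma germ_eq_iff:
 assumes U: "oS U" "x : U" "s : carrier (sect S U)" and V: "oS V" "x : V" "r : carrier (sect S V)"
 shows "germ S x U s = germ S x V r \<longleftrightarrow> (\<exists>W. oS W & x : W & W <= U Int V & rest S U W s = rest S V W r)"
proof
 assume e: "germ S x U s = germ S x V r"
 have "(V, r) : germ S x V r" using V by (auto simp: germ_def)
 then have "(V, r) : germ S x U s" using e by simp
 then show "\<exists>W. oS W & x : W & W <= U Int V & rest S U W s = rest S V W r" by (simp add: germ_def)
next
 assume "\<exists>W. oS W & x : W & W <= U Int V & rest S U W s = rest S V W r"
 then obtain W where W: "oS W" "x : W" "W <= U" "W <= V" "rest S U W s = rest S V W r" by auto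
 \<comment> \<open>Stated for an arbitrary pair of sections agreeing on W, because the inclusion of
   germs is used in both directions.\<close>
 have *: "(P, q) : germ S x V' t'" if V': "oS U'" "oS V'" "W <= U'" "W <= V'"
  "t : carrier (sect S U')" "t' : carrier (sect S V')"
  and e: "rest S U' W t = rest S V' W t'" and pq: "(P, q) : germ S x U' t" for U' V' t t' P q
 proof -
  obtain Y where Y: "oS Y" "x : Y" "Y <= U'" "Y <= P" "rest S U' Y t = rest S P Y q"
   and P: "oS P" "x : P" "q : carrier (sect S P)" using pq by (auto simp: germ_def)
  let ?Z = "W Int Y"
  have Z: "oS ?Z" "?Z <= W" "?Z <= Y" "?Z <= V'" "?Z <= P" "x : ?Z" using W Y V' by auto
  have "rest S V' ?Z t' = rest S W ?Z (rest S V' W t')"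
   by (rule rest_comp[OF V'(2) W(1) Z(1,2) V'(4,6), symmetric])
  also have "\<dots> = rest S U' ?Z t" unfolding e[symmetric] by (rule rest_comp[OF V'(1) W(1) Z(1,2) V'(3,5)])
  also have "\<dots> = rest S Y ?Z (rest S U' Y t)"
   by (rule rest_comp[OF V'(1) Y(1) Z(1,3) Y(3) V'(5), symmetric])
  also have "\<dots> = rest S P ?Z q" unfolding Y(5) by (rule rest_comp[OF P(1) Y(1) Z(1,3) Y(4) P(3)])
  finally show ?thesis using Z P by (auto simp: germ_def)
 qed
 show "germ S x U s = germ S x V r"
  using *[OF U(1) V(1) W(3,4) U(3) V(3) W(5)] *[OF V(1) U(1) W(4,3) V(3) U(3) W(5)[symmetric]] by auto
qed

lemma germ_rest:
 assumes U: "oS U" "oS V" "V <= U" "x : V" "s : carrier (sect S U)"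
 shows "germ S x V (rest S U V s) = germ S x U s"
proof -
 have "x : U" using U by auto
 moreover have "rest S V V (rest S U V s) = rest S U V s" by (rule rest_id[OF U(2) srest_closed[OF U(1-3,5)]])
 ultimately show ?thesis
  using U srest_closed[OF U(1-3,5)] by (subst germ_eq_iff) (auto intro!: exI[of _ V])
qed

text \<open>Any two pairs of representatives agree on a common neighbourhood of x, and so do the
  results. With the operation left general this covers sum and product of germs alike.\<close>

lemma germ_op_eq:
 assumes U: "oS U" "x : U" "s : carrier (sect S U)" "r : carrier (sect S U)"
  and cl: "!!U a b. [|oS U; a : carrier (sect S U); b : carrier (sect S U)|] ==> opn (sect S U) a b : carrier (sect S U)"
  and re: "!!U V a b. [|oS U; oS V; V <= U; a : carrier (sect S U); b : carrier (sect S U)|]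
    ==> rest S U V (opn (sect S U) a b) = opn (sect S V) (rest S U V a) (rest S U V b)"
 shows "germ_op S x opn (germ S x U s) (germ S x U r) = germ S x U (opn (sect S U) s r)"
 unfolding germ_op_def
proof (rule the_equality)
 show "\<exists>U' s' r'. oS U' & x : U' & s' : carrier (sect S U') & r' : carrier (sect S U') \<and>
   germ S x U s = germ S x U' s' & germ S x U r = germ S x U' r' \<and>
   germ S x U (opn (sect S U) s r) = germ S x U' (opn (sect S U') s' r')"
  using U by blast
 fix c assume "\<exists>U' s' r'. oS U' & x : U' & s' : carrier (sect S U') & r' : carrier (sect S U') \<and>
   germ S x U s = germ S x U' s' & germ S x U r = germ S x U' r' & c = germ S x U' (opn (sect S U') s' r')"
 then obtain U' s' r' where U': "oS U'" "x : U'" "s' : carrier (sect S U')" "r' : carrier (sect S U')"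
  and e: "germ S x U s = germ S x U' s'" "germ S x U r = germ S x U' r'" and c: "c = germ S x U' (opn (sect S U') s' r')"
  by blast
 obtain W where W: "oS W" "x : W" "W <= U" "W <= U'" "rest S U W s = rest S U' W s'"
  using germ_eq_iff[OF U(1-3) U'(1-3)] e(1) by auto
 obtain Y where Y: "oS Y" "x : Y" "Y <= U" "Y <= U'" "rest S U Y r = rest S U' Y r'"
  using germ_eq_iff[OF U(1,2,4) U'(1,2,4)] e(2) by auto
 let ?Z = "W Int Y"
 have Z: "oS ?Z" "?Z <= W" "?Z <= Y" "?Z <= U" "?Z <= U'" "x : ?Z" using W Y by auto
 have "rest S U ?Z s = rest S U' ?Z s'"
  using rest_comp[OF U(1) W(1) Z(1,2) W(3) U(3)] rest_comp[OF U'(1) W(1) Z(1,2) W(4) U'(3)] W(5) by simp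
 moreover have "rest S U ?Z r = rest S U' ?Z r'"
  using rest_comp[OF U(1) Y(1) Z(1,3) Y(3) U(4)] rest_comp[OF U'(1) Y(1) Z(1,3) Y(4) U'(4)] Y(5) by simp
 ultimately have "rest S U ?Z (opn (sect S U) s r) = rest S U' ?Z (opn (sect S U') s' r')"
  using re[OF U(1) Z(1,4) U(3,4)] re[OF U'(1) Z(1,5) U'(3,4)] by simp
 then show "c = germ S x U (opn (sect S U) s r)"
  unfolding c using Z U U' cl by (subst germ_eq_iff) (auto intro!: exI[of _ ?Z])
qed

lemma cr: "oS U ==> cring (sect S U)" by (rule sect_cring)

lemma rest_ops:
 assumes U: "oS U" "oS V" "V <= U" and a: "a : carrier (sect S U)" "b : carrier (sect S U)"
 shows "rest S U V (a \<otimes>\<^bsub>sect S U\<^esub> b) = rest S U V a \<otimes>\<^bsub>sect S V\<^esub> rest S U V b"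
  and "rest S U V (a \<oplus>\<^bsub>sect S U\<^esub> b) = rest S U V a \<oplus>\<^bsub>sect S V\<^esub> rest S U V b"
  and "rest S U V (a \<ominus>\<^bsub>sect S U\<^esub> b) = rest S U V a \<ominus>\<^bsub>sect S V\<^esub> rest S U V b"
  and "rest S U V \<one>\<^bsub>sect S U\<^esub> = \<one>\<^bsub>sect S V\<^esub>"
  and "rest S U V \<zero>\<^bsub>sect S U\<^esub> = \<zero>\<^bsub>sect S V\<^esub>"
proof -
 interpret ring_hom_cring "sect S U" "sect S V" "rest S U V"
  by (rule ring_hom_cringI[OF cr[OF U(1)] cr[OF U(2)] rest_hom[OF U]])
 show "rest S U V (a \<otimes>\<^bsub>sect S U\<^esub> b) = rest S U V a \<otimes>\<^bsub>sect S V\<^esub> rest S U V b"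
  "rest S U V (a \<oplus>\<^bsub>sect S U\<^esub> b) = rest S U V a \<oplus>\<^bsub>sect S V\<^esub> rest S U V b"
  "rest S U V (a \<ominus>\<^bsub>sect S U\<^esub> b) = rest S U V a \<ominus>\<^bsub>sect S V\<^esub> rest S U V b"
  "rest S U V \<one>\<^bsub>sect S U\<^esub> = \<one>\<^bsub>sect S V\<^esub>" "rest S U V \<zero>\<^bsub>sect S U\<^esub> = \<zero>\<^bsub>sect S V\<^esub>"
  using a by (auto simp: a_minus_def)
qed

lemma rest_consts:
 assumes U: "oS U" "oS V" "V <= U"
 shows "rest S U V \<one>\<^bsub>sect S U\<^esub> = \<one>\<^bsub>sect S V\<^esub>" and "rest S U V \<zero>\<^bsub>sect S U\<^esub> = \<zero>\<^bsub>sect S V\<^esub>"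
 using rest_ops(4,5)[OF U] cring.cring_simprules(2)[OF cr[OF U(1)]] by auto

lemma in_stalk: "[|oS U; x : U; s : carrier (sect S U)|] ==> germ S x U s : carrier (stalk S x)"
 by (auto simp: stalk_def)

lemma stalkE:
 assumes "a : carrier (stalk S x)"
 obtains U s where "oS U" "x : U" "s : carrier (sect S U)" "a = germ S x U s"
 using assms by (auto simp: stalk_def)

lemma stalkE2:
 assumes "a : carrier (stalk S x)" "b : carrier (stalk S x)"
 obtains U s r where "oS U" "x : U" "s : carrier (sect S U)" "r : carrier (sect S U)"
  "a = germ S x U s" "b = germ S x U r"
proof -
 obtain U s where U: "oS U" "x : U" "s : carrier (sect S U)" "a = germ S x U s" by (rule stalkE[OF assms(1)])
 obtain V r where V: "oS V" "x : V" "r : carrier (sect S V)" "b = germ S x V r" by (rule stalkE[OF assms(2)])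
 have W: "oS (U Int V)" "U Int V <= U" "U Int V <= V" "x : U Int V" using U V by auto
 show ?thesis
  by (rule that[OF W(1,4) srest_closed[OF U(1) W(1,2) U(3)] srest_closed[OF V(1) W(1,3) V(3)]])
   (simp_all add: germ_rest[OF U(1) W(1,2,4) U(3)] germ_rest[OF V(1) W(1,3,4) V(3)] U V)
qed

lemma stalkE3:
 assumes "a : carrier (stalk S x)" "b : carrier (stalk S x)" "c : carrier (stalk S x)"
 obtains U s r t where "oS U" "x : U" "s : carrier (sect S U)" "r : carrier (sect S U)"
  "t : carrier (sect S U)" "a = germ S x U s" "b = germ S x U r" "c = germ S x U t"
proof -
 obtain U s r where U: "oS U" "x : U" "s : carrier (sect S U)" "r : carrier (sect S U)"
  "a = germ S x U s" "b = germ S x U r" by (rule stalkE2[OF assms(1,2)])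
 obtain V t where V: "oS V" "x : V" "t : carrier (sect S V)" "c = germ S x V t" by (rule stalkE[OF assms(3)])
 have W: "oS (U Int V)" "U Int V <= U" "U Int V <= V" "x : U Int V" using U V by auto
 show ?thesis
  by (rule that[OF W(1,4) srest_closed[OF U(1) W(1,2) U(3)] srest_closed[OF U(1) W(1,2) U(4)]
     srest_closed[OF V(1) W(1,3) V(3)]])
   (simp_all add: germ_rest[OF U(1) W(1,2,4)] germ_rest[OF V(1) W(1,3,4) V(3)] U V)
qed

lemma germ_ops:
 assumes U: "oS U" "x : U" and s: "s : carrier (sect S U)" "r : carrier (sect S U)"
 shows germ_mult: "germ S x U s \<otimes>\<^bsub>stalk S x\<^esub> germ S x U r = germ S x U (s \<otimes>\<^bsub>sect S U\<^esub> r)"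
  and germ_add: "germ S x U s \<oplus>\<^bsub>stalk S x\<^esub> germ S x U r = germ S x U (s \<oplus>\<^bsub>sect S U\<^esub> r)"
 using germ_op_eq[OF U s, of monoid.mult] germ_op_eq[OF U s, of add] cr rest_ops
 by (auto simp: stalk_def cring.cring_simprules)

lemma germ_consts:
 assumes U: "oS U" "x : U"
 shows germ_one: "\<one>\<^bsub>stalk S x\<^esub> = germ S x U \<one>\<^bsub>sect S U\<^esub>"
  and germ_zero: "\<zero>\<^bsub>stalk S x\<^esub> = germ S x U \<zero>\<^bsub>sect S U\<^esub>"
proof -
 have P: "oS (points S)" "U <= points S" using openin_subset[OF U(1)] by auto
 note c = cring.cring_simprules[OF cr[OF P(1)]]
 show "\<one>\<^bsub>stalk S x\<^esub> = germ S x U \<one>\<^bsub>sect S U\<^esub>" "\<zero>\<^bsub>stalk S x\<^esub> = germ S x U \<zero>\<^bsub>sect S U\<^esub>"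
  using germ_rest[OF P(1) U(1) P(2) U(2) c(6)] germ_rest[OF P(1) U(1) P(2) U(2) c(2)]
   rest_consts[OF P(1) U(1) P(2)] by (auto simp: stalk_def)
qed

lemma stalk_cring:
 assumes x: "x : points S"
 shows "cring (stalk S x)"
proof (rule cringI)
 have P: "oS (points S)" by simp
 note one = germ_one[OF _ ] and zero = germ_zero
 show "abelian_group (stalk S x)"
 proof (rule abelian_groupI)
  fix a b c assume abc: "a : carrier (stalk S x)" "b : carrier (stalk S x)" "c : carrier (stalk S x)"
  obtain U s r t where U: "oS U" "x : U" and s: "s : carrier (sect S U)" "r : carrier (sect S U)"
   "t : carrier (sect S U)" and e: "a = germ S x U s" "b = germ S x U r" "c = germ S x U t" by (rule stalkE3[OF abc])
  interpret cring "sect S U" by (rule cr[OF U(1)])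
  show "a \<oplus>\<^bsub>stalk S x\<^esub> b \<oplus>\<^bsub>stalk S x\<^esub> c = a \<oplus>\<^bsub>stalk S x\<^esub> (b \<oplus>\<^bsub>stalk S x\<^esub> c)"
   unfolding e using s by (simp add: germ_add[OF U] a_assoc)
 next
  fix a b assume ab: "a : carrier (stalk S x)" "b : carrier (stalk S x)"
  obtain U s r where U: "oS U" "x : U" and s: "s : carrier (sect S U)" "r : carrier (sect S U)"
   and e: "a = germ S x U s" "b = germ S x U r" by (rule stalkE2[OF ab])
  interpret cring "sect S U" by (rule cr[OF U(1)])
  show "a \<oplus>\<^bsub>stalk S x\<^esub> b : carrier (stalk S x)"
   unfolding e using s by (simp add: germ_add[OF U] in_stalk[OF U])
  show "a \<oplus>\<^bsub>stalk S x\<^esub> b = b \<oplus>\<^bsub>stalk S x\<^esub> a"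
   unfolding e using s by (simp add: germ_add[OF U] a_comm)
 next
  show "\<zero>\<^bsub>stalk S x\<^esub> : carrier (stalk S x)"
   using germ_zero[OF P x] in_stalk[OF P x] cring.cring_simprules(2)[OF cr[OF P]] by simp
 next
  fix a assume a: "a : carrier (stalk S x)"
  obtain U s where U: "oS U" "x : U" and s: "s : carrier (sect S U)" and e: "a = germ S x U s" by (rule stalkE[OF a])
  interpret cring "sect S U" by (rule cr[OF U(1)])
  show "\<zero>\<^bsub>stalk S x\<^esub> \<oplus>\<^bsub>stalk S x\<^esub> a = a"
   unfolding e germ_zero[OF U] using s by (simp add: germ_add[OF U])
  show "\<exists>y\<in>carrier (stalk S x). y \<oplus>\<^bsub>stalk S x\<^esub> a = \<zero>\<^bsub>stalk S x\<^esub>"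
   unfolding e germ_zero[OF U] using s
   by (intro bexI[of _ "germ S x U (\<ominus>\<^bsub>sect S U\<^esub> s)"]) (auto simp: germ_add[OF U] l_neg in_stalk[OF U])
 qed
 show "comm_monoid (stalk S x)"
 proof (rule comm_monoidI)
  fix a b c assume abc: "a : carrier (stalk S x)" "b : carrier (stalk S x)" "c : carrier (stalk S x)"
  obtain U s r t where U: "oS U" "x : U" and s: "s : carrier (sect S U)" "r : carrier (sect S U)"
   "t : carrier (sect S U)" and e: "a = germ S x U s" "b = germ S x U r" "c = germ S x U t" by (rule stalkE3[OF abc])
  interpret cring "sect S U" by (rule cr[OF U(1)])
  show "a \<otimes>\<^bsub>stalk S x\<^esub> b \<otimes>\<^bsub>stalk S x\<^esub> c = a \<otimes>\<^bsub>stalk S x\<^esub> (b \<otimes>\<^bsub>stalk S x\<^esub> c)"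
   unfolding e using s by (simp add: germ_mult[OF U] m_assoc)
 next
  fix a b assume ab: "a : carrier (stalk S x)" "b : carrier (stalk S x)"
  obtain U s r where U: "oS U" "x : U" and s: "s : carrier (sect S U)" "r : carrier (sect S U)"
   and e: "a = germ S x U s" "b = germ S x U r" by (rule stalkE2[OF ab])
  interpret cring "sect S U" by (rule cr[OF U(1)])
  show "a \<otimes>\<^bsub>stalk S x\<^esub> b : carrier (stalk S x)"
   unfolding e using s by (simp add: germ_mult[OF U] in_stalk[OF U])
  show "a \<otimes>\<^bsub>stalk S x\<^esub> b = b \<otimes>\<^bsub>stalk S x\<^esub> a"
   unfolding e using s by (simp add: germ_mult[OF U] m_comm)
 next
  show "\<one>\<^bsub>stalk S x\<^esub> : carrier (stalk S x)"
   using germ_one[OF P x] in_stalk[OF P x] cring.cring_simprules(6)[OF cr[OF P]] by simp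
 next
  fix a assume a: "a : carrier (stalk S x)"
  obtain U s where U: "oS U" "x : U" and s: "s : carrier (sect S U)" and e: "a = germ S x U s" by (rule stalkE[OF a])
  interpret cring "sect S U" by (rule cr[OF U(1)])
  show "\<one>\<^bsub>stalk S x\<^esub> \<otimes>\<^bsub>stalk S x\<^esub> a = a"
   unfolding e germ_one[OF U] using s by (simp add: germ_mult[OF U])
 qed
 fix a b c assume abc: "a : carrier (stalk S x)" "b : carrier (stalk S x)" "c : carrier (stalk S x)"
 obtain U s r t where U: "oS U" "x : U" and s: "s : carrier (sect S U)" "r : carrier (sect S U)"
  "t : carrier (sect S U)" and e: "a = germ S x U s" "b = germ S x U r" "c = germ S x U t" by (rule stalkE3[OF abc])
 interpret cring "sect S U" by (rule cr[OF U(1)])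
 show "(a \<oplus>\<^bsub>stalk S x\<^esub> b) \<otimes>\<^bsub>stalk S x\<^esub> c = a \<otimes>\<^bsub>stalk S x\<^esub> c \<oplus>\<^bsub>stalk S x\<^esub> b \<otimes>\<^bsub>stalk S x\<^esub> c"
  unfolding e using s by (simp add: germ_mult[OF U] germ_add[OF U] l_distr)
qed

end

locale ideal_presheaf = ringed_cspace S for S :: "('p, 'a) cspace" +
 fixes J :: "('p, 'a) ideal_sheaf"
 assumes J_ideal: "oS U ==> ideal (J U) (sect S U)"
  and J_rest: "[|oS U; oS V; V <= U; s : J U|] ==> rest S U V s : J V"
begin

lemma J_carrier: "[|oS U; s : J U|] ==> s : carrier (sect S U)"
 using ideal.Icarr[OF J_ideal] .

lemma stalk_idealE:
 assumes "a : stalk_ideal S J x"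
 obtains U s where "oS U" "x : U" "s : J U" "a = germ S x U s"
 using assms by (auto simp: stalk_ideal_def)

lemma germ_stalk_ideal:
 assumes U: "oS U" "x : U" "s : carrier (sect S U)"
 shows "germ S x U s : stalk_ideal S J x \<longleftrightarrow> (\<exists>W. oS W & x : W & W <= U & rest S U W s : J W)"
proof
 assume "germ S x U s : stalk_ideal S J x"
 then obtain V r where V: "oS V" "x : V" "r : J V" "germ S x U s = germ S x V r" by (rule stalk_idealE)
 then obtain W where "oS W" "x : W" "W <= U" "W <= V" "rest S U W s = rest S V W r"
  using germ_eq_iff[OF U V(1,2) J_carrier[OF V(1,3)]] by auto
 then show "\<exists>W. oS W & x : W & W <= U & rest S U W s : J W" using J_rest[OF V(1) _ _ V(3), of W] by auto
next
 assume "\<exists>W. oS W & x : W & W <= U & rest S U W s : J W"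
 then obtain W where "oS W" "x : W" "W <= U" "rest S U W s : J W" by blast
 then show "germ S x U s : stalk_ideal S J x"
  using germ_rest[OF U(1) _ _ _ U(3), of W x] by (auto simp: stalk_ideal_def)
qed

lemma stalk_ideal_ideal:
 assumes x: "x : points S"
 shows "ideal (stalk_ideal S J x) (stalk S x)"
proof -
 interpret St: cring "stalk S x" by (rule stalk_cring[OF x])
 have sub: "stalk_ideal S J x <= carrier (stalk S x)"
  by (auto elim!: stalk_idealE intro: in_stalk J_carrier)
 have mul: "b \<otimes>\<^bsub>stalk S x\<^esub> a : stalk_ideal S J x" if a: "a : stalk_ideal S J x" and b: "b : carrier (stalk S x)" for a b
 proof -
  obtain U s r where U: "oS U" "x : U" and s: "s : carrier (sect S U)" "r : carrier (sect S U)"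
   and e: "a = germ S x U s" "b = germ S x U r" by (rule stalkE2[OF subsetD[OF sub a] b])
  then obtain W where W: "oS W" "x : W" "W <= U" "rest S U W s : J W"
   using a germ_stalk_ideal[OF U s(1)] by auto
  interpret J: ideal "J W" "sect S W" by (rule J_ideal[OF W(1)])
  interpret cring "sect S U" by (rule cr[OF U(1)])
  have "rest S U W (r \<otimes>\<^bsub>sect S U\<^esub> s) : J W"
   using rest_ops(1)[OF U(1) W(1,3) s(2,1)] J.I_l_closed[OF W(4) srest_closed[OF U(1) W(1,3) s(2)]] by simp
  then show ?thesis unfolding e germ_mult[OF U s(2,1)]
   using W s by (subst germ_stalk_ideal[OF U]) auto
 qed
 show ?thesis
 proof (rule idealI[OF St.ring_axioms])
  show "subgroup (stalk_ideal S J x) (add_monoid (stalk S x))"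
  proof (rule St.add.subgroupI)
   have P: "oS (points S)" by simp
   interpret J: ideal "J (points S)" "sect S (points S)" by (rule J_ideal[OF P])
   have "germ S x (points S) \<zero>\<^bsub>sect S (points S)\<^esub> : stalk_ideal S J x"
    unfolding stalk_ideal_def
    by (rule CollectI, rule exI[of _ "points S"], rule exI[of _ "\<zero>\<^bsub>sect S (points S)\<^esub>"])
     (simp add: x J.zero_closed)
   then show "stalk_ideal S J x \<noteq> {}" by blast
   fix a assume a: "a : stalk_ideal S J x"
   have "\<ominus>\<^bsub>stalk S x\<^esub> a = (\<ominus>\<^bsub>stalk S x\<^esub> \<one>\<^bsub>stalk S x\<^esub>) \<otimes>\<^bsub>stalk S x\<^esub> a"
    using subsetD[OF sub a] by (simp add: St.l_minus)
   then show "\<ominus>\<^bsub>stalk S x\<^esub> a : stalk_ideal S J x" using mul[OF a] by simp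
   fix b assume b: "b : stalk_ideal S J x"
   obtain U s r where U: "oS U" "x : U" and s: "s : carrier (sect S U)" "r : carrier (sect S U)"
    and e: "a = germ S x U s" "b = germ S x U r" by (rule stalkE2[OF subsetD[OF sub a] subsetD[OF sub b]])
   obtain W where W: "oS W" "x : W" "W <= U" "rest S U W s : J W"
    using a e germ_stalk_ideal[OF U s(1)] by auto
   obtain Y where Y: "oS Y" "x : Y" "Y <= U" "rest S U Y r : J Y"
    using b e germ_stalk_ideal[OF U s(2)] by auto
   let ?Z = "W Int Y"
   have Z: "oS ?Z" "x : ?Z" "?Z <= W" "?Z <= Y" "?Z <= U" using W Y by auto
   interpret JZ: ideal "J ?Z" "sect S ?Z" by (rule J_ideal[OF Z(1)])
   interpret cring "sect S U" by (rule cr[OF U(1)])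
   have "rest S U ?Z s : J ?Z" "rest S U ?Z r : J ?Z"
    using J_rest[OF W(1) Z(1,3) W(4)] J_rest[OF Y(1) Z(1,4) Y(4)]
     rest_comp[OF U(1) W(1) Z(1,3) W(3) s(1)] rest_comp[OF U(1) Y(1) Z(1,4) Y(3) s(2)] by auto
   then have "rest S U ?Z (s \<oplus>\<^bsub>sect S U\<^esub> r) : J ?Z" by (simp add: rest_ops(2)[OF U(1) Z(1,5) s] JZ.a_closed)
   then show "a \<oplus>\<^bsub>stalk S x\<^esub> b : stalk_ideal S J x"
    unfolding e germ_add[OF U s] using Z s by (subst germ_stalk_ideal[OF U]) auto
  qed (rule sub)
 next
  fix a b assume a: "a : stalk_ideal S J x" and b: "b : carrier (stalk S x)"
  show "b \<otimes>\<^bsub>stalk S x\<^esub> a : stalk_ideal S J x" by (rule mul[OF a b])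
  then show "a \<otimes>\<^bsub>stalk S x\<^esub> b : stalk_ideal S J x" using St.m_comm[OF b] subsetD[OF sub a] by simp
 qed
qed

lemma
 assumes U: "oS U" "x : U"
 shows quot_germ_hom: "quot_germ S J x U : ring_hom (sect S U) (stalk_quot S J x)"
  and quot_germ_one: "\<one>\<^bsub>stalk_quot S J x\<^esub> = quot_germ S J x U \<one>\<^bsub>sect S U\<^esub>"
  and quot_germ_zero: "\<zero>\<^bsub>stalk_quot S J x\<^esub> = quot_germ S J x U \<zero>\<^bsub>sect S U\<^esub>"
proof -
 have x: "x : points S" using U openin_subset by blast
 interpret St: cring "stalk S x" by (rule stalk_cring[OF x])
 interpret I: ideal "stalk_ideal S J x" "stalk S x" by (rule stalk_ideal_ideal[OF x])
 have "germ S x U : ring_hom (sect S U) (stalk S x)"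
  by (rule ring_hom_memI) (auto simp: in_stalk[OF U] germ_mult[OF U] germ_add[OF U] germ_one[OF U])
 from ring_hom_trans[OF this I.rcos_ring_hom]
 show h: "quot_germ S J x U : ring_hom (sect S U) (stalk_quot S J x)"
  by (simp add: quot_germ_def[abs_def] comp_def)
 show "\<one>\<^bsub>stalk_quot S J x\<^esub> = quot_germ S J x U \<one>\<^bsub>sect S U\<^esub>" using ring_hom_one[OF h] by simp
 show "\<zero>\<^bsub>stalk_quot S J x\<^esub> = quot_germ S J x U \<zero>\<^bsub>sect S U\<^esub>"
  using ring_hom_zero[OF h cring.axioms(1)[OF cr[OF U(1)]] I.quotient_is_ring] by simp
qed

lemma quot_germ_closed:
 "[|oS U; x : U; s : carrier (sect S U)|] ==> quot_germ S J x U s : carrier (stalk_quot S J x)"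
 by (rule ring_hom_closed[OF quot_germ_hom])

lemma quot_germ_rest:
 "[|oS U; oS V; V <= U; x : V; s : carrier (sect S U)|] ==> quot_germ S J x V (rest S U V s) = quot_germ S J x U s"
 by (simp add: quot_germ_def germ_rest)

lemma quot_germ_eq_iff:
 assumes U: "oS U" "x : U" and s: "s : carrier (sect S U)" "r : carrier (sect S U)"
 shows "quot_germ S J x U s = quot_germ S J x U r \<longleftrightarrow>
   (\<exists>W. oS W & x : W & W <= U & rest S U W s \<ominus>\<^bsub>sect S W\<^esub> rest S U W r : J W)"
proof -
 have x: "x : points S" using U openin_subset by blast
 interpret St: cring "stalk S x" by (rule stalk_cring[OF x])
 interpret I: ideal "stalk_ideal S J x" "stalk S x" by (rule stalk_ideal_ideal[OF x])
 interpret cring "sect S U" by (rule cr[OF U(1)])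
 have "germ S x U s \<ominus>\<^bsub>stalk S x\<^esub> germ S x U r = germ S x U (s \<ominus>\<^bsub>sect S U\<^esub> r)"
 proof -
  have "germ S x U (\<ominus>\<^bsub>sect S U\<^esub> r) \<oplus>\<^bsub>stalk S x\<^esub> germ S x U r = \<zero>\<^bsub>stalk S x\<^esub>"
   using s by (simp add: germ_add[OF U] germ_zero[OF U] l_neg)
  then have "\<ominus>\<^bsub>stalk S x\<^esub> germ S x U r = germ S x U (\<ominus>\<^bsub>sect S U\<^esub> r)"
   using s by (intro St.minus_equality) (auto simp: in_stalk[OF U])
  then show ?thesis using s by (simp add: a_minus_def germ_add[OF U])
 qed
 moreover have "quot_germ S J x U s = quot_germ S J x U r \<longleftrightarrow>
   germ S x U s \<ominus>\<^bsub>stalk S x\<^esub> germ S x U r : stalk_ideal S J x"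
  unfolding quot_germ_def using St.quotient_eq_iff_same_a_r_cos[OF stalk_ideal_ideal[OF x], of "germ S x U s" "germ S x U r"]
   in_stalk[OF U] s by auto
 ultimately show ?thesis
  using germ_stalk_ideal[OF U, of "s \<ominus>\<^bsub>sect S U\<^esub> r"] s rest_ops(3)[OF U(1) _ _ s] by auto
qed

end

text \<open>A locally surjective map \<open>\<pi>\<close> from an ideal sheaf to a sheaf \<open>M\<close>, two sections having the
 same image iff they differ by a section of \<open>J\<close>, identifies the quotient sheaf with \<open>M\<close>.\<close>

locale quot_map = ideal_presheaf S J + M: set_sheaf "topo S" M mr
 for S :: "('p, 'a) cspace" and J and M :: "'p set => 'm set" and mr :: "'p set => 'p set => 'm => 'm" +
 fixes I :: "('p, 'a) ideal_sheaf" and \<pi> :: "'p set => 'a => 'm"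
 assumes I_carrier: "[|oS U; s : I U|] ==> s : carrier (sect S U)"
  and I_rest: "[|oS U; oS V; V <= U; s : I U|] ==> rest S U V s : I V"
  and pi_closed: "[|oS U; s : I U|] ==> \<pi> U s : M U"
  and pi_res: "[|oS U; oS V; V <= U; s : I U|] ==> \<pi> V (rest S U V s) = mr U V (\<pi> U s)"
  and pi_ker: "[|oS U; s : I U; r : I U|] ==> \<pi> U s = \<pi> U r \<longleftrightarrow> s \<ominus>\<^bsub>sect S U\<^esub> r : J U"
  and pi_surj: "[|oS U; m : M U; x : U|] ==> \<exists>V r. oS V & x : V & V <= U & r : I V & \<pi> V r = mr U V m"
begin

text \<open>s and m correspond when, near every point, both come from one section of I. It is a
  relation and not a map because such sections of I exist only locally; existence and uniqueness in
  each direction turn it into a bijection.\<close>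

definition qrel :: "'p set => ('p => ('p set \<times> 'a) set set) => 'm => bool" where
 "qrel W s m \<longleftrightarrow> (\<forall>y\<in>W. \<exists>V r. oS V & y : V & V <= W & r : I V & \<pi> V r = mr W V m \<and>
   (\<forall>z\<in>V. s z = quot_germ S J z V r))"

lemma qrelE:
 assumes "qrel W s m" "y : W"
 obtains V r where "oS V" "y : V" "V <= W" "r : I V" "\<pi> V r = mr W V m" "\<forall>z\<in>V. s z = quot_germ S J z V r"
proof -
 have "\<exists>V r. oS V & y : V & V <= W & r : I V & \<pi> V r = mr W V m & (\<forall>z\<in>V. s z = quot_germ S J z V r)"
  by (rule bspec[OF assms(1)[unfolded qrel_def] assms(2)])
 then show ?thesis by (elim exE conjE) (rule that)
qed

lemma quot_germ_pi:
 assumes U: "oS U" "oS V" "x : U" "x : V" and s: "s : I U" "r : I V"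
 shows "quot_germ S J x U s = quot_germ S J x V r \<longleftrightarrow>
  (\<exists>W. oS W & x : W & W <= U Int V & mr U W (\<pi> U s) = mr V W (\<pi> V r))"
proof -
 let ?Y = "U Int V"
 have Y: "oS ?Y" "?Y <= U" "?Y <= V" "x : ?Y" using U by auto
 have i: "rest S U ?Y s : I ?Y" "rest S V ?Y r : I ?Y" using I_rest U s Y by auto
 note c = I_carrier[OF Y(1) i(1)] I_carrier[OF Y(1) i(2)]
 have "quot_germ S J x U s = quot_germ S J x V r \<longleftrightarrow>
   quot_germ S J x ?Y (rest S U ?Y s) = quot_germ S J x ?Y (rest S V ?Y r)"
  using quot_germ_rest[OF U(1) Y(1,2,4) I_carrier[OF U(1) s(1)]]
   quot_germ_rest[OF U(2) Y(1,3,4) I_carrier[OF U(2) s(2)]] by simp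
 also have "\<dots> \<longleftrightarrow> (\<exists>W. oS W & x : W & W <= ?Y & mr U W (\<pi> U s) = mr V W (\<pi> V r))"
  unfolding quot_germ_eq_iff[OF Y(1,4) c]
 proof (intro ex_cong1 conj_cong refl)
  fix W assume W: "oS W" "W <= ?Y"
  have W': "W <= U" "W <= V" using W by auto
  have "rest S ?Y W (rest S U ?Y s) = rest S U W s" "rest S ?Y W (rest S V ?Y r) = rest S V W r"
   using rest_comp[OF U(1) Y(1) W Y(2) I_carrier[OF U(1) s(1)]]
    rest_comp[OF U(2) Y(1) W Y(3) I_carrier[OF U(2) s(2)]] by auto
  then show "rest S ?Y W (rest S U ?Y s) \<ominus>\<^bsub>sect S W\<^esub> rest S ?Y W (rest S V ?Y r) : J W \<longleftrightarrow>
    mr U W (\<pi> U s) = mr V W (\<pi> V r)"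
   using pi_ker[OF W(1) I_rest[OF U(1) W(1) W'(1) s(1)] I_rest[OF U(2) W(1) W'(2) s(2)]]
    pi_res[OF U(1) W(1) W'(1) s(1)] pi_res[OF U(2) W(1) W'(2) s(2)] by simp
 qed
 finally show ?thesis .
qed

text \<open>Local lifts of m exist by \<open>pi_surj\<close>. Two lifts differ by a section of J on
  the overlap, so their classes in the quotient stalks agree and define s.\<close>

lemma qrel_ex1:
 assumes W: "oS W" and m: "m : M W"
 shows "\<exists>!s. s : quot_sections S I J W & qrel W s m"
proof -
 obtain V r where V: "!!y. y : W ==> oS (V y) & y : V y & V y <= W & r y : I (V y) & \<pi> (V y) (r y) = mr W (V y) m"
  using pi_surj[OF W m] by metis
 have key: "quot_germ S J z U t = quot_germ S J z U' t'"
  if "oS U" "oS U'" "U <= W" "U' <= W" "z : U" "z : U'" "t : I U" "t' : I U'" "\<pi> U t = mr W U m" "\<pi> U' t' = mr W U' m"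
  for z U U' t t'
 proof -
  have o: "oS (U Int U')" "U Int U' <= U" "U Int U' <= U'" using that by auto
  have "mr U (U Int U') (\<pi> U t) = mr U' (U Int U') (\<pi> U' t')"
   using M.sres_comp[OF W that(1) o(1,2) that(3) m] M.sres_comp[OF W that(2) o(1,3) that(4) m] that by simp
  then show ?thesis using quot_germ_pi[OF that(1,2,5,6,7,8)] o that by auto
 qed
 define s where "s = (\<lambda>y\<in>W. quot_germ S J y (V y) (r y))"
 have rel: "qrel W s m"
  unfolding qrel_def
 proof
  fix y assume y: "y : W"
  have "s z = quot_germ S J z (V y) (r y)" if z: "z : V y" for z
   using key[of "V z" "V y" z "r z" "r y"] V[OF y] V[of z] z by (auto simp: s_def)
  then show "\<exists>V r. oS V & y : V & V <= W & r : I V & \<pi> V r = mr W V m & (\<forall>z\<in>V. s z = quot_germ S J z V r)"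
   using V[OF y] by (intro exI[of _ "V y"] exI[of _ "r y"]) simp
 qed
 have sq: "s : quot_sections S I J W"
  unfolding quot_sections_def
 proof (intro CollectI conjI ballI)
  show "s : (\<Pi>\<^sub>E y\<in>W. carrier (stalk_quot S J y))"
   using V quot_germ_closed I_carrier by (auto simp: s_def)
  fix y assume y: "y : W"
  obtain V r where "oS V" "y : V" "V <= W" "r : I V" "\<forall>z\<in>V. s z = quot_germ S J z V r"
   by (rule qrelE[OF rel y])
  then show "\<exists>V r. oS V & y : V & r : I V & (\<forall>z\<in>V Int W. s z = quot_germ S J z V r)"
   by (intro exI[of _ V] exI[of _ r]) simp
 qed
 have "t = s" if t: "t : quot_sections S I J W" "qrel W t m" for t
 proof
  fix y show "t y = s y"
  proof (cases "y : W")
   case True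
   obtain U u where "oS U" "y : U" "U <= W" "u : I U" "\<pi> U u = mr W U m" "t y = quot_germ S J y U u"
    using qrelE[OF t(2) True] by metis
   then show ?thesis using key[of U "V y" y u "r y"] V[OF True] True by (simp add: s_def)
  next
   case False
   then show ?thesis using t(1) by (auto simp: quot_sections_def s_def PiE_def extensional_def)
  qed
 qed
 then show ?thesis using sq rel by blast
qed

text \<open>Local representatives of s with equal classes in the quotient stalks differ by a section
  of J near each point. Their images under \<pi> therefore agree on overlaps and glue in the sheaf
  M.\<close>

lemma qrel_ex1':
 assumes W: "oS W" and s: "s : quot_sections S I J W"
 shows "\<exists>!m. m : M W & qrel W s m"
proof -
 have "\<exists>V r. oS V & y : V & V <= W & r : I V & (\<forall>z\<in>V. s z = quot_germ S J z V r)" if y: "y : W" for y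
 proof -
  obtain V r where V: "oS V" "y : V" "r : I V" "!!z. z : V Int W ==> s z = quot_germ S J z V r"
  proof -
   have "\<exists>V r. oS V & y : V & r : I V & (\<forall>z\<in>V Int W. s z = quot_germ S J z V r)"
    using s y by (simp add: quot_sections_def)
   then show ?thesis by (elim exE conjE) (rule that, assumption, assumption, assumption, erule bspec, assumption)
  qed
  have o: "oS (V Int W)" "V Int W <= V" using V W by auto
  have "s z = quot_germ S J z (V Int W) (rest S V (V Int W) r)" if "z : V Int W" for z
   using V(4)[OF that] quot_germ_rest[OF V(1) o that I_carrier[OF V(1,3)]] by simp
  then show ?thesis using I_rest[OF V(1) o V(3)] o V y by (intro exI[of _ "V Int W"] exI conjI) auto
 qed
 then obtain V r where V: "!!y. y : W ==> oS (V y) & y : V y & V y <= W & r y : I (V y) \<and>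
   (\<forall>z\<in>V y. s z = quot_germ S J z (V y) (r y))" by metis
 have agree: "mr U (U Int U') (\<pi> U t) = mr U' (U Int U') (\<pi> U' t')"
  if U: "oS U" "oS U'" "t : I U" "t' : I U'" "\<forall>z\<in>U. s z = quot_germ S J z U t" "\<forall>z\<in>U'. s z = quot_germ S J z U' t'"
  for U U' t t'
 proof -
  have o: "oS (U Int U')" "U Int U' <= U" "U Int U' <= U'" using U by auto
  note p = pi_closed[OF U(1,3)] pi_closed[OF U(2,4)]
  show ?thesis
  proof (rule M.sep[OF o(1) M.sres_closed[OF U(1) o(1,2) p(1)] M.sres_closed[OF U(2) o(1,3) p(2)]])
   fix z assume z: "z : U Int U'"
   then have "quot_germ S J z U t = quot_germ S J z U' t'" using U by (metis IntD1 IntD2)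
   then obtain Y where Y: "oS Y" "z : Y" "Y <= U Int U'" "mr U Y (\<pi> U t) = mr U' Y (\<pi> U' t')"
    using quot_germ_pi[OF U(1,2) _ _ U(3,4), of z] z by auto
   then show "\<exists>Y. oS Y & z : Y & Y <= U Int U' & mr (U Int U') Y (mr U (U Int U') (\<pi> U t)) =
     mr (U Int U') Y (mr U' (U Int U') (\<pi> U' t'))"
    using M.sres_comp[OF U(1) o(1) Y(1,3) o(2) p(1)] M.sres_comp[OF U(2) o(1) Y(1,3) o(3) p(2)] by auto
  qed
 qed
 have Wc: "W = (\<Union>y\<in>W. V y)" using V by blast
 obtain m where m: "m : M W" "!!y. y : W ==> mr W (V y) m = \<pi> (V y) (r y)"
 proof (rule M.glue_ex[where I=W and U=V and s="%y. \<pi> (V y) (r y)" and W=W])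
  show "W = (\<Union>y\<in>W. V y)" by (rule Wc)
  show "oS (V y)" if "y : W" for y using V[OF that] by blast
  show "\<pi> (V y) (r y) : M (V y)" if "y : W" for y using V[OF that] pi_closed by blast
  show "mr (V y) (V y Int V y') (\<pi> (V y) (r y)) = mr (V y') (V y Int V y') (\<pi> (V y') (r y'))"
   if "y : W" "y' : W" for y y'
   using V[OF that(1)] V[OF that(2)] by (intro agree) auto
 qed (rule that, assumption, simp)
 have rel: "qrel W s m" unfolding qrel_def
 proof
  fix y assume "y : W"
  then show "\<exists>V r. oS V & y : V & V <= W & r : I V & \<pi> V r = mr W V m & (\<forall>z\<in>V. s z = quot_germ S J z V r)"
   using V[of y] m(2)[of y] by (intro exI[of _ "V y"] exI[of _ "r y"]) simp
 qed
 have "m' = m" if m': "m' : M W" "qrel W s m'" for m'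
 proof (rule M.sep[OF W m'(1) m(1)])
  fix y assume y: "y : W"
  obtain U u where U: "oS U" "y : U" "U <= W" "u : I U" "\<pi> U u = mr W U m'" "\<forall>z\<in>U. s z = quot_germ S J z U u"
   by (rule qrelE[OF m'(2) y])
  let ?Y = "U Int V y"
  have V': "oS (V y)" "V y <= W" "y : V y" "r y : I (V y)" "\<forall>z\<in>V y. s z = quot_germ S J z (V y) (r y)" using V[OF y] by auto
  have o: "oS ?Y" "?Y <= U" "?Y <= V y" using U V' by auto
  have "mr W ?Y m' = mr W ?Y m"
   using agree[OF U(1) V'(1) U(4) V'(4) U(6) V'(5)] m(2)[OF y] U(5)
    M.sres_comp[OF W U(1) o(1,2) U(3) m'(1)] M.sres_comp[OF W V'(1) o(1,3) V'(2) m(1)] by simp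
  then show "\<exists>Y. oS Y & y : Y & Y <= W & mr W Y m' = mr W Y m" using o U V' by (intro exI[of _ ?Y]) auto
 qed
 then show ?thesis using m rel by blast
qed

lemma qrel_shrink:
 assumes W: "oS W" "oS Y" "Y <= W" and m: "m : M W" and R: "qrel W s m" and y: "y : Y"
 obtains V r where "oS V" "y : V" "V <= Y" "r : I V" "\<pi> V r = mr W V m" "!!z. z : V ==> s z = quot_germ S J z V r"
proof -
 have "y : W" using W y by auto
 then obtain V r where V: "oS V" "y : V" "V <= W" "r : I V" "\<pi> V r = mr W V m" "\<forall>z\<in>V. s z = quot_germ S J z V r"
  by (rule qrelE[OF R])
 let ?V = "V Int Y"
 have o: "oS ?V" "?V <= V" using V W by auto
 show ?thesis
 proof (rule that[OF o(1) _ _ I_rest[OF V(1) o V(4)]])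
  show "\<pi> ?V (rest S V ?V r) = mr W ?V m"
   using pi_res[OF V(1) o V(4)] M.sres_comp[OF W(1) V(1) o V(3) m] V(5) by simp
  show "s z = quot_germ S J z ?V (rest S V ?V r)" if "z : ?V" for z
   using quot_germ_rest[OF V(1) o that I_carrier[OF V(1,4)]] V(6) that by simp
 qed (use V y in auto)
qed

lemma qrel_restrict:
 assumes W: "oS W" "oS Y" "Y <= W" and m: "m : M W" and R: "qrel W s m"
 shows "qrel Y (restrict s Y) (mr W Y m)"
 unfolding qrel_def
proof
 fix y assume y: "y : Y"
 obtain V r where V: "oS V" "y : V" "V <= Y" "r : I V" "\<pi> V r = mr W V m" "!!z. z : V ==> s z = quot_germ S J z V r"
  using qrel_shrink[OF W m R y] by blast
 then show "\<exists>V r. oS V & y : V & V <= Y & r : I V & \<pi> V r = mr Y V (mr W Y m) \<and>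
    (\<forall>z\<in>V. restrict s Y z = quot_germ S J z V r)"
  using M.sres_comp[OF W(1,2) V(1,3) W(3) m] by (intro exI[of _ V] exI[of _ r]) auto
qed

text \<open>The operation is left general: it serves for sums, for products and, as an operation
  ignoring its second argument, for multiplication by a fixed scalar.\<close>

lemma qrel_bop:
 assumes W: "oS W" and m: "m : M W" "m' : M W" and R: "qrel W s m" "qrel W s' m'"
  and pS: "!!U a b. [|oS U; U <= W; a : I U; b : I U|] ==> pS U a b : I U"
  and pQ: "!!U z a b. [|oS U; U <= W; z : U; a : I U; b : I U|] ==>
   pQ z (quot_germ S J z U a) (quot_germ S J z U b) = quot_germ S J z U (pS U a b)"
  and ppi: "!!U a b. [|oS U; U <= W; a : I U; b : I U|] ==> \<pi> U (pS U a b) = pM U (\<pi> U a) (\<pi> U b)"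
  and pM: "!!U. [|oS U; U <= W|] ==> mr W U (pM W m m') = pM U (mr W U m) (mr W U m')"
 shows "qrel W (\<lambda>y\<in>W. pQ y (s y) (s' y)) (pM W m m')"
 unfolding qrel_def
proof
 fix y assume y: "y : W"
 obtain V r where V: "oS V" "y : V" "V <= W" "r : I V" "\<pi> V r = mr W V m" "!!z. z : V ==> s z = quot_germ S J z V r"
  using qrel_shrink[OF W W subset_refl m(1) R(1) y] by blast
 obtain U t where U: "oS U" "y : U" "U <= V" "t : I U" "\<pi> U t = mr W U m'" "!!z. z : U ==> s' z = quot_germ S J z U t"
  using qrel_shrink[OF W V(1,3) m(2) R(2) V(2)] by blast
 let ?r = "rest S V U r"
 have UW: "U <= W" using U V by auto
 have r: "?r : I U" "\<pi> U ?r = mr W U m" "!!z. z : U ==> s z = quot_germ S J z U ?r"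
  using I_rest[OF V(1) U(1,3) V(4)] pi_res[OF V(1) U(1,3) V(4)] M.sres_comp[OF W V(1) U(1,3) V(3) m(1)] V(5,6)
   quot_germ_rest[OF V(1) U(1,3) _ I_carrier[OF V(1,4)]] U(3) by auto
 show "\<exists>V r. oS V & y : V & V <= W & r : I V & \<pi> V r = mr W V (pM W m m') \<and>
    (\<forall>z\<in>V. (\<lambda>y\<in>W. pQ y (s y) (s' y)) z = quot_germ S J z V r)"
  using U r UW pS[OF U(1) UW r(1) U(4)] ppi[OF U(1) UW r(1) U(4)] pM[OF U(1) UW] pQ[OF U(1) UW _ r(1) U(4)]
  by (intro exI[of _ U] exI[of _ "pS U ?r t"]) auto
qed

lemma qrel_local:
 assumes W: "oS W" and r: "r : I W"
 shows "qrel W (\<lambda>y\<in>W. quot_germ S J y W r) (\<pi> W r)"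
 unfolding qrel_def using W r M.sres_id[OF W pi_closed[OF W r]] by (intro ballI exI[of _ W] exI[of _ r]) auto

end

section \<open>The isomorphism of twisted forms given by a coboundary\<close>

context twist
begin

definition tht :: "('i, 'p, 'g) cocycle => ('j, 'p, 'g) cocycle => 'z set => ('z => 'p set) =>
  ('z => 'i) => ('z => 'j) => ('z => 'g) => 'p set => ('j => 'x) => 'i => 'x" where
 "tht c d K W sg \<tau> h A f' = (THE f. f : tw c A & twrel c d K W sg \<tau> h A f f')"

context
 fixes c :: "('i, 'p, 'g) cocycle" and d :: "('j, 'p, 'g) cocycle"
  and K :: "'z set" and W sg \<tau> h
 assumes c: "is_cocycle T G c" and d: "is_cocycle T G d" and D: "cobounds c d K W sg \<tau> h"
begin

abbreviation "\<Theta> \<equiv> tht c d K W sg \<tau> h"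

lemma tht_closed: "[|openin T A; f' : tw d A|] ==> \<Theta> A f' : tw c A"
 and tht_rel: "[|openin T A; f' : tw d A|] ==> twrel c d K W sg \<tau> h A (\<Theta> A f') f'"
 using theI'[OF twrel_ex1[OF c d D, of A f']] by (auto simp: tht_def)

lemma tht_eqI: "[|openin T A; f' : tw d A; f : tw c A; twrel c d K W sg \<tau> h A f f'|] ==> \<Theta> A f' = f"
 using twrel_ex1[OF c d D, of A f'] tht_closed[of A f'] tht_rel[of A f'] by blast

lemma tht_bij:
 assumes A: "openin T A"
 shows "bij_betw (\<Theta> A) (tw d A) (tw c A)"
proof (rule bij_betw_imageI)
 show "inj_on (\<Theta> A) (tw d A)"
 proof (rule inj_onI)
  fix f f' assume "f : tw d A" "f' : tw d A" "\<Theta> A f = \<Theta> A f'"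
  then show "f = f'"
   using twrel_ex1'[OF c d D A tht_closed[OF A, of f]] tht_rel[OF A, of f] tht_rel[OF A, of f'] by metis
 qed
 show "\<Theta> A ` tw d A = tw c A"
 proof (intro equalityI subsetI)
  fix f assume f: "f : tw c A"
  obtain f' where "f' : tw d A" "twrel c d K W sg \<tau> h A f f'" using twrel_ex1'[OF c d D A f] by blast
  then show "f : \<Theta> A ` tw d A" using tht_eqI[OF A _ f] by blast
 qed (use tht_closed[OF A] in auto)
qed

lemma tht_res:
 "[|openin T A; openin T B; B <= A; f' : tw d A|] ==> \<Theta> B (trs d A B f') = trs c A B (\<Theta> A f')"
 by (intro tht_eqI trs_closed[OF c] trs_closed[OF d] twrel_res[OF c d D] tht_closed tht_rel)

end

end

section \<open>Local triviality of C(g) and the powers of the ideal of C\<close>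

context thickening
begin

context
 fixes gm :: "('i, 'p, ('p, 'a) taut) cocycle"
 assumes gm: "is_cocycle (topo C) GG gm"
begin

lemma pc_mult: "[|op W; f : Tw.tw gm W; h : Tw.tw gm W|] ==> f \<otimes>\<^bsub>sect (prim_curve C n gm) W\<^esub> h : Tw.tw gm W"
 and pc_add: "[|op W; f : Tw.tw gm W; h : Tw.tw gm W|] ==> f \<oplus>\<^bsub>sect (prim_curve C n gm) W\<^esub> h : Tw.tw gm W"
 and pc_one: "op W ==> \<one>\<^bsub>sect (prim_curve C n gm) W\<^esub> : Tw.tw gm W"
 and pc_zero: "op W ==> \<zero>\<^bsub>sect (prim_curve C n gm) W\<^esub> : Tw.tw gm W"
 and pc_scal: "op W ==> scal (prim_curve C n gm) W c : Tw.tw gm W"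
 by (simp_all add: pc_ops tw_mult[OF gm] tw_add[OF gm] tw_one[OF gm] tw_zero[OF gm] tw_scal[OF gm])

lemma pc_diff_comp:
 assumes W: "op W" and f: "f : Tw.tw gm W" and h: "h : Tw.tw gm W" and i: "i : idx gm"
 shows "(f \<ominus>\<^bsub>sect (prim_curve C n gm) W\<^esub> h) i = f i \<ominus>\<^bsub>th (W Int cov gm i)\<^esub> h i"
proof -
 interpret P: cring "sect (prim_curve C n gm) W" by (rule pc_cring[OF gm W])
 interpret R: cring "th (W Int cov gm i)" by (rule th_cring[OF op_Int[OF gm W i]])
 let ?m = "\<lambda>i\<in>idx gm. \<ominus>\<^bsub>th (W Int cov gm i)\<^esub> h i"
 have m: "?m : Tw.tw gm W" by (rule tw_minus[OF gm W h h])
 have "?m \<oplus>\<^bsub>sect (prim_curve C n gm) W\<^esub> h = \<zero>\<^bsub>sect (prim_curve C n gm) W\<^esub>"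
  using tw_closed[OF gm h] cring.cring_simprules(9)[OF th_cring[OF op_Int[OF gm W]]]
  by (intro Tw.tw_eqI[OF gm pc_add[OF W m h] pc_zero[OF W]]) (simp add: pc_ops)
 then have "\<ominus>\<^bsub>sect (prim_curve C n gm) W\<^esub> h = ?m"
  using m h by (intro P.minus_equality) (simp_all add: pc_carrier[OF gm W])
 then show ?thesis using i by (simp add: a_minus_def pc_ops)
qed

text \<open>Local triviality: over an open subset of one member of the cover the curve is the
  product with Z_n.\<close>

lemma pc_proj:
 assumes V: "op V" and i: "i : idx gm" "V <= cov gm i"
 shows pc_proj_iso: "(%f. f i) : ring_iso (sect (prim_curve C n gm) V) (th V)"
  and pc_tin_iso: "Tw.tin gm i V : ring_iso (th V) (sect (prim_curve C n gm) V)"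
  and pc_tin_proj: "f : Tw.tw gm V ==> Tw.tin gm i V (f i) = f"
proof -
 have Vi: "V Int cov gm i = V" using i by auto
 let ?P = "sect (prim_curve C n gm) V"
 note cl = tw_closed[OF gm, of _ V i, unfolded Vi, OF _ i(1)]
 note ti = Tw.tin_closed[OF gm _ V i]
 note inj = Tw.tw_proj_inj[OF gm _ _ V i]
 show tp: "Tw.tin gm i V (f i) = f" if "f : Tw.tw gm V" for f
  using ti[OF cl[OF that]] that by (intro inj) auto
 have po: "(f \<otimes>\<^bsub>?P\<^esub> h) i = f i \<otimes>\<^bsub>th V\<^esub> h i" "(f \<oplus>\<^bsub>?P\<^esub> h) i = f i \<oplus>\<^bsub>th V\<^esub> h i" "\<one>\<^bsub>?P\<^esub> i = \<one>\<^bsub>th V\<^esub>" for f h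
  using i Vi by (simp_all add: pc_ops)
 have b: "bij_betw (%f. f i) (Tw.tw gm V) (carrier (th V))" "bij_betw (Tw.tin gm i V) (carrier (th V)) (Tw.tw gm V)"
  by (rule bij_betw_byWitness[where f'="Tw.tin gm i V"]; use tp ti cl in auto)
    (rule bij_betw_byWitness[where f'="%f. f i"]; use tp ti cl in auto)
 have "(%f. f i) : ring_hom ?P (th V)"
  by (rule ring_hom_memI) (auto simp: pc_carrier[OF gm V] cl po)
 then show "(%f. f i) : ring_iso ?P (th V)" using b by (simp add: ring_iso_def pc_carrier[OF gm V])
 interpret R: cring "th V" by (rule th_cring[OF V])
 have "Tw.tin gm i V : ring_hom (th V) ?P"
 proof (rule ring_hom_memI)
  fix a b assume a: "a : carrier (th V)" and b: "b : carrier (th V)"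
  show "Tw.tin gm i V (a \<otimes>\<^bsub>th V\<^esub> b) = Tw.tin gm i V a \<otimes>\<^bsub>?P\<^esub> Tw.tin gm i V b"
   by (rule inj) (use a b ti po pc_mult[OF V] in auto)
  show "Tw.tin gm i V (a \<oplus>\<^bsub>th V\<^esub> b) = Tw.tin gm i V a \<oplus>\<^bsub>?P\<^esub> Tw.tin gm i V b"
   by (rule inj) (use a b ti po pc_add[OF V] in auto)
 next
  show "Tw.tin gm i V \<one>\<^bsub>th V\<^esub> = \<one>\<^bsub>?P\<^esub>" by (rule inj) (use ti po pc_one[OF V] in auto)
 qed (use ti in \<open>auto simp: pc_carrier[OF gm V]\<close>)
 then show "Tw.tin gm i V : ring_iso (th V) ?P" using b by (simp add: ring_iso_def pc_carrier[OF gm V])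
qed

lemma core_zero_iff:
 assumes W: "op W"
 shows "f : core_ideal C n gm W \<longleftrightarrow> f : Tw.tw gm W & core gm W f = \<zero>\<^bsub>sect C W\<^esub>"
 by (auto simp: core_ideal_def a_kernel_def' pc_carrier[OF gm W] core_def[OF gm, symmetric])

lemma tin_tt_core:
 assumes V: "op V" and i: "i : idx gm" "V <= cov gm i"
 shows "Tw.tin gm i V (trunc_t (sect C V) n) : core_ideal C n gm V"
proof -
 interpret V: trunc "sect C V" n by (rule tr[OF V])
 have t: "Tw.tin gm i V V.tt : Tw.tw gm V" "Tw.tin gm i V V.tt i = V.tt"
  using Tw.tin_closed[OF gm V.trunc_monom_closed[OF V.one_closed] V i] by auto
 then show ?thesis
  using core_local[OF gm V t(1) i] n_pos by (simp add: core_zero_iff[OF V])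
qed

lemma ideal_power_van:
 assumes V: "op V" and f: "f : ideal_power (sect (prim_curve C n gm) V) (core_ideal C n gm V) l"
 shows "f : Tw.tw gm V & (\<forall>i\<in>idx gm. \<forall>j<n. j < l \<longrightarrow> tcf (f i) j = \<zero>\<^bsub>sect C (V Int cov gm i)\<^esub>)"
 using f
proof (induction l arbitrary: f)
 case 0
 then show ?case by (simp add: pc_carrier[OF gm V])
next
 case (Suc l)
 from Suc.prems have "f : ideal_prod (sect (prim_curve C n gm) V)
  (ideal_power (sect (prim_curve C n gm) V) (core_ideal C n gm V) l) (core_ideal C n gm V)" by simp
 then show ?case
 proof (induction rule: ideal_prod.induct)
  case (prod a b)
  note a = Suc.IH[OF prod(1)]
  have b: "b : Tw.tw gm V" "!!i. i : idx gm ==> tcf (b i) 0 = \<zero>\<^bsub>sect C (V Int cov gm i)\<^esub>"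
   using prod(2) by (auto simp: core_ideal_eq[OF gm V])
  have "tcf ((a \<otimes>\<^bsub>sect (prim_curve C n gm) V\<^esub> b) i) j = \<zero>\<^bsub>sect C (V Int cov gm i)\<^esub>"
   if i: "i : idx gm" and j: "j < n" "j < Suc l" for i j
  proof -
   interpret U: trunc "sect C (V Int cov gm i)" n by (rule tr[OF op_Int[OF gm V i]])
   have "U.tvan (l + 1) (a i \<otimes>\<^bsub>U.B\<^esub> b i)"
    using a b i tw_closed[OF gm] by (intro U.tvan_mult) (auto simp: U.tvan_def)
   then show ?thesis using i j by (simp add: U.tvan_def pc_ops)
  qed
  then show ?case using pc_mult[OF V] a b by blast
 next
  case (sum a b)
  have "tcf ((a \<oplus>\<^bsub>sect (prim_curve C n gm) V\<^esub> b) i) j = \<zero>\<^bsub>sect C (V Int cov gm i)\<^esub>"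
   if i: "i : idx gm" and j: "j < n" "j < Suc l" for i j
  proof -
   interpret U: trunc "sect C (V Int cov gm i)" n by (rule tr[OF op_Int[OF gm V i]])
   show ?thesis using sum i j tw_closed[OF gm, of a V i] tw_closed[OF gm, of b V i] by (simp add: pc_ops)
  qed
  then show ?case using pc_add[OF V] sum by blast
 qed
qed

text \<open>Over an open set inside one chart, t is a section of the ideal of C by
  \<open>tin_tt_core\<close>. With \<open>ideal_power_van\<close>, the l-th power of the ideal is
  (t^l) there.\<close>

lemma tin_ideal_power:
 assumes V: "op V" and i: "i : idx gm" "V <= cov gm i" and F: "F : carrier (th V)"
 shows "Tw.tin gm i V (trunc_t (sect C V) n [^]\<^bsub>th V\<^esub> l \<otimes>\<^bsub>th V\<^esub> F)
  : ideal_power (sect (prim_curve C n gm) V) (core_ideal C n gm V) l"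
 using F
proof (induction l arbitrary: F)
 interpret V: trunc "sect C V" n by (rule tr[OF V])
 note h = pc_tin_iso[OF V i, unfolded ring_iso_def, THEN CollectD, THEN conjunct1]
 {
  case 0
  then show ?case using Tw.tin_closed(1)[OF gm _ V i, of F] by (simp add: pc_carrier[OF gm V])
 next
  case (Suc l)
  have "V.tt [^]\<^bsub>V.B\<^esub> Suc l \<otimes>\<^bsub>V.B\<^esub> F = (V.tt [^]\<^bsub>V.B\<^esub> l \<otimes>\<^bsub>V.B\<^esub> F) \<otimes>\<^bsub>V.B\<^esub> V.tt"
   using Suc.prems by (simp add: V.B.m_ac)
  then have "Tw.tin gm i V (V.tt [^]\<^bsub>V.B\<^esub> Suc l \<otimes>\<^bsub>V.B\<^esub> F) = Tw.tin gm i V (V.tt [^]\<^bsub>V.B\<^esub> l \<otimes>\<^bsub>V.B\<^esub> F)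
    \<otimes>\<^bsub>sect (prim_curve C n gm) V\<^esub> Tw.tin gm i V V.tt"
   using ring_hom_mult[OF h, of "V.tt [^]\<^bsub>V.B\<^esub> l \<otimes>\<^bsub>V.B\<^esub> F" V.tt] Suc.prems by simp
  then show ?case using ideal_prod.prod[OF Suc.IH[OF Suc.prems] tin_tt_core[OF V i]] by simp
 }
qed

text \<open>From left to right, vanishing of a coefficient is a local condition and so can be read
  off where f lies in the power of the ideal of sections. From right to left, on each chart f is t^k
  times a section.\<close>

lemma core_power_eq:
 assumes U: "op U" and k: "k \<le> n"
 shows "core_ideal_power C n gm k U =
  {f : Tw.tw gm U. \<forall>i\<in>idx gm. \<forall>j<k. tcf (f i) j = \<zero>\<^bsub>sect C (U Int cov gm i)\<^esub>}"
proof (intro equalityI subsetI)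
 fix f assume "f : core_ideal_power C n gm k U"
 then have f: "f : Tw.tw gm U" and loc: "!!x. x : U ==> \<exists>V. op V & x : V & V <= U \<and>
   Tw.trs gm U V f : ideal_power (sect (prim_curve C n gm) V) (core_ideal C n gm V) k"
  by (auto simp: ideal_sheaf_power_def pc_carrier[OF gm U] pc_rest)
 have "tcf (f i) j = \<zero>\<^bsub>sect C (U Int cov gm i)\<^esub>" if i: "i : idx gm" and j: "j < k" for i j
 proof (rule Un.sep[OF op_Int[OF gm U i] tcf_in[OF op_Int[OF gm U i] tw_closed[OF gm f i]]])
  have o: "op (U Int cov gm i)" by (rule op_Int[OF gm U i])
  show "\<zero>\<^bsub>sect C (U Int cov gm i)\<^esub> : carrier (sect C (U Int cov gm i))"
   by (rule cring.cring_simprules(2)[OF sect_cring[OF o]])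
  fix x assume x: "x : U Int cov gm i"
  then obtain V where V: "op V" "x : V" "V <= U"
   "Tw.trs gm U V f : ideal_power (sect (prim_curve C n gm) V) (core_ideal C n gm V) k" using loc by blast
  have oV: "op (V Int cov gm i)" by (rule op_Int[OF gm V(1) i])
  have s: "V Int cov gm i <= U Int cov gm i" using V by auto
  have "tcf (Tw.trs gm U V f i) j = \<zero>\<^bsub>sect C (V Int cov gm i)\<^esub>"
   using ideal_power_van[OF V(1,4)] i j k by auto
  then have "rest C (U Int cov gm i) (V Int cov gm i) (tcf (f i) j) = \<zero>\<^bsub>sect C (V Int cov gm i)\<^esub>"
   using tcf_thr[OF o oV s tw_closed[OF gm f i], of j] i j k by (simp add: Tw.trs_def)
  then show "\<exists>V. op V & x : V & V <= U Int cov gm i \<and>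
    rest C (U Int cov gm i) V (tcf (f i) j) = rest C (U Int cov gm i) V \<zero>\<^bsub>sect C (U Int cov gm i)\<^esub>"
   using oV s x V by (intro exI[of _ "V Int cov gm i"]) (auto simp: rest_zero[OF o oV s])
 qed
 then show "f : {f : Tw.tw gm U. \<forall>i\<in>idx gm. \<forall>j<k. tcf (f i) j = \<zero>\<^bsub>sect C (U Int cov gm i)\<^esub>}" using f by blast
next
 fix f assume "f : {f : Tw.tw gm U. \<forall>i\<in>idx gm. \<forall>j<k. tcf (f i) j = \<zero>\<^bsub>sect C (U Int cov gm i)\<^esub>}"
 then have f: "f : Tw.tw gm U" and v: "!!i j. [|i : idx gm; j < k|] ==> tcf (f i) j = \<zero>\<^bsub>sect C (U Int cov gm i)\<^esub>" by auto
 have "\<exists>V. op V & x : V & V <= U \<and>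
   Tw.trs gm U V f : ideal_power (sect (prim_curve C n gm) V) (core_ideal C n gm V) k" if x: "x : U" for x
 proof -
  obtain i where i: "i : idx gm" "x : cov gm i" using x Tw.cocycle_cover[OF gm] openin_subset[OF U] by blast
  let ?V = "U Int cov gm i"
  have V: "op ?V" by (rule op_Int[OF gm U i(1)])
  have Vs: "?V <= U" "?V <= cov gm i" "?V Int cov gm i = ?V" by auto
  interpret V: trunc "sect C ?V" n by (rule tr[OF V])
  let ?g = "Tw.trs gm U ?V f"
  have g: "?g : Tw.tw gm ?V" by (rule Tw.trs_closed[OF gm U V Vs(1) f])
  have fi: "f i : carrier V.B" by (rule tw_closed[OF gm f i(1)])
  have gi: "?g i = f i" using i(1) Tw.sres_id[OF V fi] by (simp add: Tw.trs_def Vs(3))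
  have "f i = V.tt [^]\<^bsub>V.B\<^esub> k \<otimes>\<^bsub>V.B\<^esub> V.tdrop k (f i)"
   using v[OF i(1)] by (intro V.tvan_factor[OF fi]) (auto simp: V.tvan_def)
  then have "?g = Tw.tin gm i ?V (V.tt [^]\<^bsub>V.B\<^esub> k \<otimes>\<^bsub>V.B\<^esub> V.tdrop k (f i))"
   using pc_tin_proj[OF V i(1) Vs(2) g] gi by simp
  then show ?thesis
   using tin_ideal_power[OF V i(1) Vs(2) V.tdrop_closed[OF fi], of k k] V x i by (intro exI[of _ ?V]) auto
 qed
 then show "f : core_ideal_power C n gm k U"
  using f by (auto simp: ideal_sheaf_power_def pc_carrier[OF gm U] pc_rest)
qed

lemma pc_preim: "op V ==> preim (prim_curve C n gm) (%x. x) V = V"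
 using openin_subset[of "topo C" V] by (auto simp: preim_def)

end

subsection \<open>Cohomologous cocycles define isomorphic curves\<close>

context
 fixes c :: "('i, 'p, ('p, 'a) taut) cocycle" and d :: "('j, 'p, ('p, 'a) taut) cocycle"
  and K :: "'z set" and W sg \<tau> h
 assumes c: "is_cocycle (topo C) GG c" and d: "is_cocycle (topo C) GG d"
  and D: "Tw.cobounds c d K W sg \<tau> h"
begin

abbreviation "TH \<equiv> Tw.tht c d K W sg \<tau> h"

lemma tht_iso:
 assumes A: "op A"
 shows "TH A : ring_iso (sect (prim_curve C n d) A) (sect (prim_curve C n c) A)"
proof -
 note cl = Tw.tht_closed[OF c d D A] and re = Tw.tht_rel[OF c d D A] and eqI = Tw.tht_eqI[OF c d D A]
 have "TH A : ring_hom (sect (prim_curve C n d) A) (sect (prim_curve C n c) A)"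
 proof (rule ring_hom_memI; (unfold pc_carrier[OF c A] pc_carrier[OF d A])?)
  fix f e assume f: "f : Tw.tw d A" "e : Tw.tw d A"
  show "TH A (f \<otimes>\<^bsub>sect (prim_curve C n d) A\<^esub> e) = TH A f \<otimes>\<^bsub>sect (prim_curve C n c) A\<^esub> TH A e"
   using twrel_ops(1)[OF c d D A cl[OF f(1)] cl[OF f(2)] f re[OF f(1)] re[OF f(2)]]
   by (intro eqI pc_mult[OF d A f] pc_mult[OF c A cl[OF f(1)] cl[OF f(2)]]) (simp add: pc_ops)
  show "TH A (f \<oplus>\<^bsub>sect (prim_curve C n d) A\<^esub> e) = TH A f \<oplus>\<^bsub>sect (prim_curve C n c) A\<^esub> TH A e"
   using twrel_ops(2)[OF c d D A cl[OF f(1)] cl[OF f(2)] f re[OF f(1)] re[OF f(2)]]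
   by (intro eqI pc_add[OF d A f] pc_add[OF c A cl[OF f(1)] cl[OF f(2)]]) (simp add: pc_ops)
 next
  show "TH A \<one>\<^bsub>sect (prim_curve C n d) A\<^esub> = \<one>\<^bsub>sect (prim_curve C n c) A\<^esub>"
   using twrel_consts(1)[OF c d D A] by (intro eqI pc_one[OF d A] pc_one[OF c A]) (simp add: pc_ops)
 qed (use cl in auto)
 then show ?thesis
  using Tw.tht_bij[OF c d D A] by (simp add: ring_iso_def pc_carrier[OF c A] pc_carrier[OF d A])
qed

lemma tht_scal:
 assumes A: "op A"
 shows "TH A (scal (prim_curve C n d) A z) = scal (prim_curve C n c) A z"
 using twrel_consts(2)[OF c d D A]
 by (intro Tw.tht_eqI[OF c d D A] pc_scal[OF d A] pc_scal[OF c A]) (simp add: pc_ops)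

text \<open>Over A Int W k the two sections are related by the automorphism h k, which preserves the
  value at t = 0.\<close>

lemma tht_core:
 assumes A: "op A" and f: "f : Tw.tw d A"
 shows "core c A (TH A f) = core d A f"
proof (rule Un.sep[OF A core_closed[OF c A Tw.tht_closed[OF c d D A f]] core_closed[OF d A f]])
 note K = Tw.cobounds_data[OF D]
 note cl = Tw.tht_closed[OF c d D A f] and re = Tw.tht_rel[OF c d D A f]
 fix x assume x: "x : A"
 then obtain k where k: "k : K" "x : W k" using K(7) openin_subset[OF A] by blast
 let ?V = "A Int W k"
 have V: "op ?V" using A K(1)[OF k(1)] by auto
 have s: "?V <= A" "?V <= cov c (sg k)" "?V <= cov d (\<tau> k)" "?V <= W k"
  "?V <= A Int cov c (sg k)" "?V <= A Int cov d (\<tau> k)" using K(4,5)[OF k(1)] by auto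
 have h: "gres GG (W k) ?V (h k) : aut_set C n ?V"
  using Tw.cobounds_closed(1)[OF D V s(4) k(1)] by (simp add: aut_carrier)
 have V': "?V Int cov c (sg k) = ?V" "?V Int cov d (\<tau> k) = ?V" using s by auto
 have fd: "thr (A Int cov d (\<tau> k)) ?V (f (\<tau> k)) : carrier (th ?V)"
  by (rule thr_closed[OF op_Int[OF d A K(3)[OF k(1)]] V s(6) tw_closed[OF d f K(3)[OF k(1)]]])
 have "rest C A ?V (core c A (TH A f)) = tcf (Tw.trs c A ?V (TH A f) (sg k)) 0"
  using core_res[OF c A V s(1) cl] core_local[OF c V Tw.trs_closed[OF c A V s(1) cl] K(2)[OF k(1)] s(2)] by simp
 also have "\<dots> = tcf (thr (A Int cov d (\<tau> k)) ?V (f (\<tau> k))) 0"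
  using re[unfolded Tw.twrel_def, rule_format, OF k(1)] K(2)[OF k(1)] aut_zero[OF h V subset_refl fd]
  by (simp add: Tw.trs_def V')
 also have "\<dots> = rest C A ?V (core d A f)"
  using core_res[OF d A V s(1) f] core_local[OF d V Tw.trs_closed[OF d A V s(1) f] K(3)[OF k(1)] s(3)]
   K(3)[OF k(1)] by (simp add: Tw.trs_def V')
 finally show "\<exists>V. op V & x : V & V <= A & rest C A V (core c A (TH A f)) = rest C A V (core d A f)"
  using V x k by (intro exI[of _ ?V]) auto
qed

end

lemma core_incl_simps: "fst (core_incl C gm) = (%x. x)" by (simp add: core_incl_def)

lemma iso_over_coreI:
 assumes c: "is_cocycle (topo C) GG c" and d: "is_cocycle (topo C) GG d"
  and coh: "cohomologous (topo C) GG c d"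
 shows "iso_over_core C n c n d"
proof -
 obtain K :: "'p set set" and W sg \<tau> h where D: "Tw.cobounds c d K W sg \<tau> h"
  by (rule Tw.cohomologousE[OF coh c d])
 let ?TH = "Tw.tht c d K W sg \<tau> h"
 note P = pc_preim[OF c]
 show ?thesis
  unfolding iso_over_core_def
 proof (intro exI[of _ "(%x. x, ?TH)"] conjI)
  show "cspace_iso (prim_curve C n c) (prim_curve C n d) (%x. x, ?TH)"
   unfolding cspace_iso_def prod.case pc_topo
  proof (intro conjI allI impI)
   show "homeomorphic_map (topo C) (topo C) (%x. x)"
    using homeomorphic_map_id[of "topo C" "topo C"] by (simp add: id_def)
   fix V assume V: "op V"
   show "?TH V : ring_iso (sect (prim_curve C n d) V) (sect (prim_curve C n c) (preim (prim_curve C n c) (%x. x) V))"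
    "?TH V (scal (prim_curve C n d) V z) = scal (prim_curve C n c) (preim (prim_curve C n c) (%x. x) V) z" for z
    using tht_iso[OF c d D V] tht_scal[OF c d D V] by (simp_all add: P[OF V])
  next
   fix V V' s assume as: "op V & op V' & V' <= V & s : carrier (sect (prim_curve C n d) V)"
   then have "op V" by blast
   with as have "op V" "op V'" "V' <= V" "s : Tw.tw d V" by (auto simp: pc_carrier[OF d])
   then show "?TH V' (rest (prim_curve C n d) V V' s) = rest (prim_curve C n c) (preim (prim_curve C n c) (%x. x) V)
     (preim (prim_curve C n c) (%x. x) V') (?TH V s)"
    using Tw.tht_res[OF c d D, of V V' s] by (simp add: P pc_rest pc_carrier[OF d])
  qed
  show "mor_eq C (prim_curve C n d) (mor_comp (prim_curve C n c) (%x. x, ?TH) (core_incl C c)) (core_incl C d)"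
   using tht_core[OF c d D] by (auto simp: mor_eq_def mor_comp_def core_incl_simps P pc_carrier[OF d] core_def[OF c] core_def[OF d])
 qed
qed

end

subsection \<open>Isomorphic curves have cohomologous cocycles\<close>

locale core_iso = N: thickening C n + M: thickening C m
 for C :: "('p, 'a) cspace" and n m :: nat +
 fixes gm :: "('i, 'p, ('p, 'a) taut) cocycle" and gm' :: "('j, 'p, ('p, 'a) taut) cocycle" and \<psi>
 assumes gm: "is_cocycle (topo C) N.GG gm" and gm': "is_cocycle (topo C) M.GG gm'"
  and iso: "cspace_iso (prim_curve C n gm) (prim_curve C m gm') \<psi>"
  and over: "mor_eq C (prim_curve C m gm') (mor_comp (prim_curve C n gm) \<psi> (core_incl C gm)) (core_incl C gm')"
begin

abbreviation ph where "ph \<equiv> snd \<psi>"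

lemma fst_id: "x : points C ==> fst \<psi> x = x"
 using over by (simp add: mor_eq_def mor_comp_def N.core_incl_simps)

lemma preim_id:
 assumes V: "openin (topo C) V"
 shows "preim (prim_curve C n gm) (fst \<psi>) V = V"
 using fst_id openin_subset[OF V] by (auto simp: preim_def)

lemma phi_iso: "openin (topo C) V ==> ph V : ring_iso (sect (prim_curve C m gm') V) (sect (prim_curve C n gm) V)"
 and phi_scal: "openin (topo C) V ==> ph V (scal (prim_curve C m gm') V z) = scal (prim_curve C n gm) V z"
 using iso by (auto simp: cspace_iso_def preim_id split: prod.splits) (metis preim_id snd_conv fst_conv)+

lemma phi_res:
 assumes "openin (topo C) V" "openin (topo C) W" "W <= V" "s : M.Tw.tw gm' V"
 shows "ph W (M.Tw.trs gm' V W s) = N.Tw.trs gm V W (ph V s)"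
proof -
 have "ph W (rest (prim_curve C m gm') V W s) =
  rest (prim_curve C n gm) (preim (prim_curve C n gm) (fst \<psi>) V) (preim (prim_curve C n gm) (fst \<psi>) W) (ph V s)"
  using iso assms by (simp add: cspace_iso_def M.pc_carrier[OF gm'] split: prod.splits)
 then show ?thesis using assms by (simp add: preim_id N.pc_rest M.pc_rest)
qed

lemma phi_core: "[|openin (topo C) V; s : M.Tw.tw gm' V|] ==> N.core gm V (ph V s) = M.core gm' V s"
 using over by (simp add: mor_eq_def mor_comp_def preim_id M.pc_carrier[OF gm'] N.core_def[OF gm] M.core_def[OF gm'])

lemma phi_closed: "[|openin (topo C) V; s : M.Tw.tw gm' V|] ==> ph V s : N.Tw.tw gm V"
 using phi_iso[of V] ring_hom_closed[of "ph V" "sect (prim_curve C m gm') V" "sect (prim_curve C n gm) V" s]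
 by (simp add: ring_iso_def N.pc_carrier[OF gm] M.pc_carrier[OF gm'])

text \<open>The isomorphism read in the charts i and j: over V inside both members it is a map from
  O(V)[t]/(t^m) to O(V)[t]/(t^n). For m = n these maps will form the coboundary.\<close>

definition loc :: "'i => 'j => 'p set => (nat => 'a) set => (nat => 'a) set" where
 "loc i j V F = ph V (M.Tw.tin gm' j V F) i"

context
 fixes i j V
 assumes i: "i : idx gm" and j: "j : idx gm'" and V: "openin (topo C) V" "V <= cov gm i" "V <= cov gm' j"
begin

lemma loc_iso: "loc i j V : ring_iso (M.th V) (N.th V)"
 using ring_iso_set_trans[OF ring_iso_set_trans[OF M.pc_tin_iso[OF gm' V(1) j V(3)] phi_iso[OF V(1)]]
   N.pc_proj_iso[OF gm V(1) i V(2)]]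
 by (simp add: loc_def[abs_def] comp_def)

lemma tin': "F : carrier (M.th V) ==> M.Tw.tin gm' j V F : M.Tw.tw gm' V"
 and tin'_j: "F : carrier (M.th V) ==> M.Tw.tin gm' j V F j = F"
 using M.Tw.tin_closed[OF gm' _ V(1) j V(3)] by auto

lemma loc_closed: "F : carrier (M.th V) ==> loc i j V F : carrier (N.th V)"
 using loc_iso ring_hom_closed by (auto simp: ring_iso_def)

lemma loc_zero:
 assumes F: "F : carrier (M.th V)"
 shows "tcf (loc i j V F) 0 = tcf F 0"
 using N.core_local[OF gm V(1) phi_closed[OF V(1) tin'[OF F]] i V(2)]
  M.core_local[OF gm' V(1) tin'[OF F] j V(3)] phi_core[OF V(1) tin'[OF F]] tin'_j[OF F]
 by (simp add: loc_def)

lemma loc_scal: "loc i j V (trunc_monom (sect C V) m (scal C V z) 0) = trunc_monom (sect C V) n (scal C V z) 0"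
proof -
 have Vi: "V Int cov gm i = V" "V Int cov gm' j = V" using V by auto
 have "M.Tw.tin gm' j V (trunc_monom (sect C V) m (scal C V z) 0) = scal (prim_curve C m gm') V z"
  using M.pc_tin_proj[OF gm' V(1) j V(3) M.pc_scal[OF gm' V(1), of z]] j by (simp add: M.pc_ops Vi)
 then show ?thesis using phi_scal[OF V(1), of z] i by (simp add: loc_def N.pc_ops Vi)
qed

lemma loc_res:
 assumes V': "openin (topo C) V'" "V' <= V" and F: "F : carrier (M.th V)"
 shows "loc i j V' (M.thr V V' F) = N.thr V V' (loc i j V F)"
proof -
 have s: "V' <= cov gm' j" "V Int cov gm' j = V" "V' Int cov gm' j = V'" "V Int cov gm i = V" "V' Int cov gm i = V'"
  using V V' by auto
 have "M.Tw.trs gm' V V' (M.Tw.tin gm' j V F) j = M.thr V V' F"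
  using j tin'_j[OF F] by (simp add: M.Tw.trs_def s)
 then have "M.Tw.tin gm' j V' (M.thr V V' F) = M.Tw.trs gm' V V' (M.Tw.tin gm' j V F)"
  using M.pc_tin_proj[OF gm' V'(1) j s(1) M.Tw.trs_closed[OF gm' V(1) V'(1,2) tin'[OF F]]] by simp
 then show ?thesis
  using phi_res[OF V(1) V'(1,2) tin'[OF F]] i by (simp add: loc_def N.Tw.trs_def s)
qed

text \<open>Chart changes on both sides commute with the global isomorphism. For n = m this is the
  coboundary equation between the two cocycles.\<close>

lemma loc_trans:
 assumes i': "i' : idx gm" "V <= cov gm i'" and j': "j' : idx gm'" "V <= cov gm' j'"
  and F: "F : carrier (M.th V)"
 shows "N.Tw.cres gm i' i V V (loc i j V F) = loc i' j' V (M.Tw.cres gm' j' j V V F)"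
proof -
 let ?f = "M.Tw.tin gm' j V F"
 have Vi: "V Int cov gm i = V" "V Int cov gm i' = V" "V Int cov gm' j = V" "V Int cov gm' j' = V" using V i' j' by auto
 have cl: "ph V ?f i : carrier (N.th V)" "ph V ?f i' : carrier (N.th V)" "?f j' : carrier (M.th V)"
  using N.tw_closed[OF gm phi_closed[OF V(1) tin'[OF F]] i] N.tw_closed[OF gm phi_closed[OF V(1) tin'[OF F]] i'(1)]
   M.tw_closed[OF gm' tin'[OF F] j'(1)] by (simp_all only: Vi)
 have "ph V ?f i' = N.Tw.cres gm i' i V V (ph V ?f i)"
  using N.Tw.tw_eq[OF gm phi_closed[OF V(1) tin'[OF F]] V(1) i'(1) i V(1) subset_refl i'(2) V(2)]
   N.Tw.sres_id[OF V(1)] cl by (simp add: Vi)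
 moreover have "?f j' = M.Tw.cres gm' j' j V V F"
  using M.Tw.tw_eq[OF gm' tin'[OF F] V(1) j'(1) j V(1) subset_refl j'(2) V(3)]
   M.Tw.sres_id[OF V(1)] cl(3) F tin'_j[OF F] by (simp add: Vi)
 moreover have "M.Tw.tin gm' j' V (?f j') = ?f" by (rule M.pc_tin_proj[OF gm' V(1) j' tin'[OF F]])
 ultimately show ?thesis by (simp add: loc_def)
qed

text \<open>The maximal nilpotency index of a section vanishing at \<open>t = 0\<close> recovers the multiplicity.\<close>

lemma loc_mult_eq:
 assumes nz: "\<one>\<^bsub>sect C V\<^esub> \<noteq> \<zero>\<^bsub>sect C V\<^esub>"
 shows "n = m"
proof (rule antisym)
 interpret A: trunc "sect C V" n by (rule N.tr[OF V(1)])
 interpret B: trunc "sect C V" m by (rule N.tr[OF V(1)])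
 interpret l: ring_hom_cring B.B A.B "loc i j V"
  using loc_iso by (intro ring_hom_cringI B.B.is_cring A.B.is_cring) (simp add: ring_iso_def)
 have b: "bij_betw (loc i j V) (carrier B.B) (carrier A.B)" using loc_iso by (simp add: ring_iso_def)
 \<comment> \<open>The image of t still vanishes at t = 0, so its n-th power is zero. Since
   \<open>loc\<close> is injective, t^n vanishes already modulo t^m.\<close>
 have "loc i j V B.tt [^]\<^bsub>A.B\<^esub> n = \<zero>\<^bsub>A.B\<^esub>"
  using loc_zero[of B.tt] N.n_pos M.n_pos by (intro A.tvan_nilpotent) (auto simp: A.tvan_def)
 then have "loc i j V (B.tt [^]\<^bsub>B.B\<^esub> n) = loc i j V \<zero>\<^bsub>B.B\<^esub>" by simp
 then have "B.tt [^]\<^bsub>B.B\<^esub> n = \<zero>\<^bsub>B.B\<^esub>" using b by (auto simp: bij_betw_def inj_on_def)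
 then show "m \<le> n" by (rule B.tt_pow_zero_imp[OF nz])
 obtain F where F: "F : carrier B.B" "loc i j V F = A.tt"
 proof -
  have "A.tt : loc i j V ` carrier B.B"
   using b A.trunc_monom_closed[OF A.one_closed] by (simp add: bij_betw_def)
  then show ?thesis using that by (metis imageE)
 qed
 have "F [^]\<^bsub>B.B\<^esub> m = \<zero>\<^bsub>B.B\<^esub>"
  using loc_zero[OF F(1)] F N.n_pos M.n_pos by (intro B.tvan_nilpotent) (auto simp: B.tvan_def)
 then have "loc i j V (F [^]\<^bsub>B.B\<^esub> m) = \<zero>\<^bsub>A.B\<^esub>" by simp
 then have "A.tt [^]\<^bsub>A.B\<^esub> m = \<zero>\<^bsub>A.B\<^esub>" using F by simp
 then show "n \<le> m" by (rule A.tt_pow_zero_imp[OF nz])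
qed

end

lemma multiplicity_eq:
 assumes nz: "!!V. [|openin (topo C) V; V \<noteq> {}|] ==> \<one>\<^bsub>sect C V\<^esub> \<noteq> \<zero>\<^bsub>sect C V\<^esub>" and ne: "points C \<noteq> {}"
 shows "n = m"
proof -
 obtain x where x: "x : points C" using ne by blast
 obtain i where i: "i : idx gm" "x : cov gm i" using x N.Tw.cocycle_cover[OF gm] by blast
 obtain j where j: "j : idx gm'" "x : cov gm' j" using x M.Tw.cocycle_cover[OF gm'] by blast
 have V: "openin (topo C) (cov gm i Int cov gm' j)"
  using N.Tw.cocycle_open[OF gm i(1)] M.Tw.cocycle_open[OF gm' j(1)] by auto
 show ?thesis using loc_mult_eq[OF i(1) j(1) V _ _ nz[OF V]] i j by auto
qed

end

text \<open>The common refinement consists of the pairwise intersections of the two covers, and the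
  cochain is the isomorphism read in the corresponding charts, cut down to the domains that
  \<open>aut_set\<close> requires.\<close>

lemma (in thickening) iso_over_coreD:
 assumes c: "is_cocycle (topo C) GG c" and d: "is_cocycle (topo C) GG d" and iso: "iso_over_core C n c n d"
 shows "cohomologous (topo C) GG c d"
proof -
 obtain \<psi> where "core_iso C n n c d \<psi>"
  using iso c d thickening_axioms by (auto simp: iso_over_core_def core_iso_def core_iso_axioms_def)
 then interpret I: core_iso C n n c d \<psi> .
 define h where "h = (%(i, j). \<lambda>V\<in>opens_in C (cov c i Int cov d j). \<lambda>F\<in>carrier (th V). I.loc i j V F)"
 have h_app: "h (i, j) V F = I.loc i j V F" if "op V" "V <= cov c i Int cov d j" "F : carrier (th V)" for i j V F
  using that by (simp add: h_def opens_iff)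
 have op: "op (cov c i Int cov d j)" if "i : idx c" "j : idx d" for i j
  using that Tw.cocycle_open[OF c] Tw.cocycle_open[OF d] by auto
 have hin: "h (i, j) : aut_set C n (cov c i Int cov d j)" if i: "i : idx c" and j: "j : idx d" for i j
 proof (rule aut_setI[OF op[OF i j]])
  show "h (i, j) : extensional (opens_in C (cov c i Int cov d j))" by (simp add: h_def)
  fix V assume V: "op V" "V <= cov c i Int cov d j"
  then have Vs: "V <= cov c i" "V <= cov d j" by auto
  interpret V: trunc "sect C V" n by (rule tr[OF V(1)])
  note iso = I.loc_iso[OF i j V(1) Vs] and lc = I.loc_closed[OF i j V(1) Vs]
  have hV: "h (i, j) V = (\<lambda>F\<in>carrier (th V). I.loc i j V F)" using V by (simp add: h_def opens_iff)
  show "h (i, j) V : extensional (carrier (th V))" by (simp add: hV)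
  have lh: "I.loc i j V : ring_hom (th V) (th V)" using iso by (simp add: ring_iso_def)
  show "h (i, j) V : ring_hom (th V) (th V)"
   by (rule ring_hom_memI)
    (auto simp: hV lc ring_hom_mult[OF lh] ring_hom_add[OF lh] ring_hom_one[OF lh])
  have "bij_betw (I.loc i j V) (carrier (th V)) (carrier (th V))" using iso by (simp add: ring_iso_def)
  then show "bij_betw (h (i, j) V) (carrier (th V)) (carrier (th V))"
   by (rule bij_betw_cong[THEN iffD1, rotated]) (simp add: hV)
  show "h (i, j) V (trunc_monom (sect C V) n (scal C V z) 0) = trunc_monom (sect C V) n (scal C V z) 0" for z
   using I.loc_scal[OF i j V(1) Vs] V.trunc_monom_closed[OF scal_in[OF V(1)]] by (simp add: hV)
  show "tcf (h (i, j) V F) 0 = tcf F 0" if "F : carrier (th V)" for F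
   using I.loc_zero[OF i j V(1) Vs that] that by (simp add: hV)
  show "h (i, j) V' (thr V V' F) = thr V V' (h (i, j) V F)" if V': "op V'" "V' <= V" and F: "F : carrier (th V)" for V' F
   using I.loc_res[OF i j V(1) Vs V' F] h_app[OF V'(1) subset_trans[OF V'(2) V(2)] thr_closed[OF V(1) V' F]]
    h_app[OF V F] by simp
 qed
 show ?thesis
 proof (rule Tw.cohomologousI[where I="idx c \<times> idx d" and W="%(i, j). cov c i Int cov d j"
    and sg=fst and \<tau>=snd and h=h, OF c d])
  show "(\<Union>(i, j)\<in>idx c \<times> idx d. cov c i Int cov d j) = points C"
   using Tw.cocycle_cover[OF c] Tw.cocycle_cover[OF d] by blast
  fix k assume "k : idx c \<times> idx d"
  then show "op (case k of (i, j) => cov c i Int cov d j) & fst k : idx c & snd k : idx d \<and>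
     (case k of (i, j) => cov c i Int cov d j) <= cov c (fst k) \<and>
     (case k of (i, j) => cov c i Int cov d j) <= cov d (snd k) \<and>
     h k : carrier (gsec GG (case k of (i, j) => cov c i Int cov d j))"
   using hin op by (auto simp: aut_carrier)
 next
  fix k l V assume kl: "k : idx c \<times> idx d" "l : idx c \<times> idx d"
   and V: "V = (case k of (i, j) => cov c i Int cov d j) Int (case l of (i, j) => cov c i Int cov d j)" "op V"
  obtain i j i' j' where e: "k = (i, j)" "l = (i', j')" by fastforce
  have i: "i : idx c" "j : idx d" "i' : idx c" "j' : idx d" using kl e by auto
  have s: "V <= cov c i" "V <= cov d j" "V <= cov c i'" "V <= cov d j'" "V <= cov c i Int cov d j" "V <= cov c i' Int cov d j'"
   using V e by auto
  interpret GV: group "gsec GG V" by (rule aut_group[OF V(2)])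
  have cl: "Tw.cres c i i' V : carrier (gsec GG V)" "Tw.cres d j j' V : carrier (gsec GG V)"
   "gres GG (cov c i' Int cov d j') V (h l) : carrier (gsec GG V)" "gres GG (cov c i Int cov d j) V (h k) : carrier (gsec GG V)"
   using Tw.cres_closed[OF c i(1,3) V(2) s(1,3)] Tw.cres_closed[OF d i(2,4) V(2) s(2,4)]
    Tw.res_closed[OF op[OF i(3,4)] V(2) s(6)] Tw.res_closed[OF op[OF i(1,2)] V(2) s(5)] hin i e
   by (auto simp: aut_carrier)
  have "Tw.cres c i i' V \<otimes>\<^bsub>gsec GG V\<^esub> gres GG (cov c i' Int cov d j') V (h l) =
     gres GG (cov c i Int cov d j) V (h k) \<otimes>\<^bsub>gsec GG V\<^esub> Tw.cres d j j' V"
  proof (rule aut_eqI)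
   fix Y F assume Y: "op Y" "Y <= V" and F: "F : carrier (th Y)"
   have sY: "Y <= cov c i" "Y <= cov d j" "Y <= cov c i'" "Y <= cov d j'" "Y <= cov c i Int cov d j"
    "Y <= cov c i' Int cov d j'" "Y <= cov c i Int cov c i'" "Y <= cov d j Int cov d j'" using s Y by auto
   have dF: "Tw.cres d j j' V Y F : carrier (th Y)" using aut_closed[OF _ Y F] cl(2) by (simp add: aut_carrier)
   have "Tw.cres c i i' V Y (I.loc i' j' Y F) = I.loc i j Y (Tw.cres d j j' V Y F)"
    using I.loc_trans[OF i(3,4) Y(1) sY(3,4) i(1) sY(1) i(2) sY(2) F] Y
    by (simp add: aut_gres_app sY)
   then show "(Tw.cres c i i' V \<otimes>\<^bsub>gsec GG V\<^esub> gres GG (cov c i' Int cov d j') V (h l)) Y F =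
     (gres GG (cov c i Int cov d j) V (h k) \<otimes>\<^bsub>gsec GG V\<^esub> Tw.cres d j j' V) Y F"
    using h_app[OF Y(1) sY(6) F] h_app[OF Y(1) sY(5) dF] e
    by (simp add: aut_mult_app[OF Y F] aut_gres_app[OF Y])
  qed (use cl GV.m_closed in \<open>auto simp: aut_carrier\<close>)
  then show "Tw.cres c (fst k) (fst l) V \<otimes>\<^bsub>gsec GG V\<^esub> gres GG (case l of (i, j) => cov c i Int cov d j) V (h l) =
     gres GG (case k of (i, j) => cov c i Int cov d j) V (h k) \<otimes>\<^bsub>gsec GG V\<^esub> Tw.cres d (snd k) (snd l) V"
   using e by simp
 qed
qed

section \<open>The bijection between quotient sections and sections of the target\<close>

context quot_map
begin

definition qmap :: "'p set => ('p => ('p set \<times> 'a) set set) => 'm" where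
 "qmap W s = (THE m. m : M W & qrel W s m)"

lemma qmap_closed: "[|oS W; s : quot_sections S I J W|] ==> qmap W s : M W"
 and qmap_rel: "[|oS W; s : quot_sections S I J W|] ==> qrel W s (qmap W s)"
 using theI'[OF qrel_ex1'[of W s]] by (auto simp: qmap_def)

lemma qmap_eqI: "[|oS W; s : quot_sections S I J W; m : M W; qrel W s m|] ==> qmap W s = m"
 using qrel_ex1'[of W s] qmap_closed[of W s] qmap_rel[of W s] by blast

lemma qmap_bij:
 assumes W: "oS W"
 shows "bij_betw (qmap W) (quot_sections S I J W) (M W)"
proof (rule bij_betw_imageI)
 show "inj_on (qmap W) (quot_sections S I J W)"
 proof (rule inj_onI)
  fix s s' assume s: "s : quot_sections S I J W" "s' : quot_sections S I J W" and e: "qmap W s = qmap W s'"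
  show "s = s'"
   using qrel_ex1[OF W qmap_closed[OF W s(1)]] s qmap_rel[OF W s(1)] qmap_rel[OF W s(2)] e by auto
 qed
 show "qmap W ` quot_sections S I J W = M W"
 proof (intro equalityI subsetI)
  fix m assume m: "m : M W"
  then obtain s where "s : quot_sections S I J W" "qrel W s m" using qrel_ex1[OF W m] by blast
  then show "m : qmap W ` quot_sections S I J W" using qmap_eqI[OF W _ m] by blast
 qed (use qmap_closed[OF W] in auto)
qed

lemma quot_sections_restrict:
 assumes W: "oS W" "oS V" "V <= W" and s: "s : quot_sections S I J W"
 shows "restrict s V : quot_sections S I J V"
proof -
 obtain t where t: "t : quot_sections S I J V" "qrel V t (mr W V (qmap W s))"
  using qrel_ex1[OF W(2) M.sres_closed[OF W qmap_closed[OF W(1) s]]] by blast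
 note R = qrel_restrict[OF W qmap_closed[OF W(1) s] qmap_rel[OF W(1) s]]
 have sV: "restrict s V : (\<Pi>\<^sub>E y\<in>V. carrier (stalk_quot S J y))"
  using s W(3) by (auto simp: quot_sections_def)
 show ?thesis
  unfolding quot_sections_def
 proof (intro CollectI conjI sV ballI)
  fix y assume y: "y : V"
  obtain U r where "oS U" "y : U" "U <= V" "r : I U" "\<forall>z\<in>U. restrict s V z = quot_germ S J z U r"
   by (rule qrelE[OF R y])
  then show "\<exists>U r. oS U & y : U & r : I U & (\<forall>z\<in>U Int V. restrict s V z = quot_germ S J z U r)"
   by (intro exI[of _ U] exI[of _ r]) auto
 qed
qed

lemma qmap_restrict:
 assumes W: "oS W" "oS V" "V <= W" and s: "s : quot_sections S I J W"
 shows "qmap V (restrict s V) = mr W V (qmap W s)"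
 by (rule qmap_eqI[OF W(2) quot_sections_restrict[OF W s] M.sres_closed[OF W qmap_closed[OF W(1) s]]
    qrel_restrict[OF W qmap_closed[OF W(1) s] qmap_rel[OF W(1) s]]])

lemma qrel_quot_sections:
 assumes W: "oS W" and R: "qrel W s m" and e: "s : extensional W"
 shows "s : quot_sections S I J W"
 unfolding quot_sections_def
proof (intro CollectI conjI ballI PiE_I)
 fix y assume y: "y : W"
 obtain U r where U: "oS U" "y : U" "U <= W" "r : I U" "\<forall>z\<in>U. s z = quot_germ S J z U r"
  by (rule qrelE[OF R y])
 then show "\<exists>U r. oS U & y : U & r : I U & (\<forall>z\<in>U Int W. s z = quot_germ S J z U r)"
  by (intro exI[of _ U] exI[of _ r]) simp
 show "s y : carrier (stalk_quot S J y)" using U quot_germ_closed I_carrier by auto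
qed (use e in \<open>auto simp: extensional_def\<close>)

lemma qmap_bop:
 assumes W: "oS W" and s: "s : quot_sections S I J W" "s' : quot_sections S I J W"
  and pS: "!!U a b. [|oS U; U <= W; a : I U; b : I U|] ==> pS U a b : I U"
  and pQ: "!!U z a b. [|oS U; U <= W; z : U; a : I U; b : I U|] ==>
   pQ z (quot_germ S J z U a) (quot_germ S J z U b) = quot_germ S J z U (pS U a b)"
  and ppi: "!!U a b. [|oS U; U <= W; a : I U; b : I U|] ==> \<pi> U (pS U a b) = pM U (\<pi> U a) (\<pi> U b)"
  and pM: "!!U. [|oS U; U <= W|] ==> mr W U (pM W (qmap W s) (qmap W s')) = pM U (mr W U (qmap W s)) (mr W U (qmap W s'))"
  and pc: "pM W (qmap W s) (qmap W s') : M W"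
 shows "(\<lambda>y\<in>W. pQ y (s y) (s' y)) : quot_sections S I J W"
  and "qmap W (\<lambda>y\<in>W. pQ y (s y) (s' y)) = pM W (qmap W s) (qmap W s')"
proof -
 have R: "qrel W (\<lambda>y\<in>W. pQ y (s y) (s' y)) (pM W (qmap W s) (qmap W s'))"
  by (rule qrel_bop[where pS=pS and pM=pM, OF W qmap_closed[OF W s(1)] qmap_closed[OF W s(2)] qmap_rel[OF W s(1)] qmap_rel[OF W s(2)]
    pS pQ ppi pM])
 then show 1: "(\<lambda>y\<in>W. pQ y (s y) (s' y)) : quot_sections S I J W"
  by (rule qrel_quot_sections[OF W]) simp
 show "qmap W (\<lambda>y\<in>W. pQ y (s y) (s' y)) = pM W (qmap W s) (qmap W s')"
  by (rule qmap_eqI[OF W 1 pc R])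
qed

end

section \<open>Reducing the sections of C(g) modulo t^k\<close>

context thickening_pair
begin

context
 fixes gm :: "('i, 'p, ('p, 'a) taut) cocycle"
 assumes gm: "is_cocycle (topo C) N.GG gm"
begin

abbreviation "rgm \<equiv> map_cocycle (aut_red C n k) gm"

lemma rgm: "is_cocycle (topo C) K.GG rgm" by (rule red.map_cocycle_cocycle[OF gm])

lemma rgm_simps [simp]: "idx rgm = idx gm" "cov rgm = cov gm" by (simp_all add: map_cocycle_def)

definition rd :: "'p set => ('i => (nat => 'a) set) => 'i => (nat => 'a) set" where
 "rd W f = (\<lambda>i\<in>idx gm. trunc_red (sect C (W Int cov gm i)) k (f i))"

lemma rd_closed:
 assumes W: "openin (topo C) W" and f: "f : N.Tw.tw gm W"
 shows "rd W f : K.Tw.tw rgm W"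
 unfolding K.Tw.tw_def
proof (intro CollectI conjI ballI)
 note o = N.op_Int[OF gm W] and cl = N.tw_closed[OF gm f]
 show "rd W f : (\<Pi>\<^sub>E i\<in>idx rgm. carrier (K.th (W Int cov rgm i)))"
  using red_closed[OF o cl] by (simp add: rd_def)
 fix i j assume "i : idx rgm" "j : idx rgm"
 then have i: "i : idx gm" "j : idx gm" by simp_all
 let ?V = "W Int (cov gm i Int cov gm j)"
 have V: "openin (topo C) ?V" using W i N.Tw.cocycle_open[OF gm] by auto
 have s: "?V <= W" "?V <= cov gm i" "?V <= cov gm j" "?V <= W Int cov gm i" "?V <= W Int cov gm j" by auto
 have g: "N.Tw.cres gm i j ?V : aut_set C n ?V"
  using N.Tw.cres_closed[OF gm i V s(2,3)] by (simp add: N.aut_carrier)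
 have fj: "N.thr (W Int cov gm j) ?V (f j) : carrier (N.th ?V)"
  by (rule N.thr_closed[OF o[OF i(2)] V s(5) cl[OF i(2)]])
 have "K.thr (W Int cov gm i) ?V (rd W f i) = trunc_red (sect C ?V) k (N.thr (W Int cov gm i) ?V (f i))"
  using i red_res[OF o[OF i(1)] V s(4) cl[OF i(1)]] by (simp add: rd_def)
 also have "\<dots> = trunc_red (sect C ?V) k (N.Tw.cres gm i j ?V ?V (N.thr (W Int cov gm j) ?V (f j)))"
  using N.Tw.tw_eq[OF gm f W i V s(1-3)] by simp
 also have "\<dots> = aut_red C n k ?V (N.Tw.cres gm i j ?V) ?V (trunc_red (sect C ?V) k (N.thr (W Int cov gm j) ?V (f j)))"
  by (rule aut_red_app[OF g V subset_refl fj, symmetric])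
 also have "aut_red C n k ?V (N.Tw.cres gm i j ?V) = K.Tw.cres rgm i j ?V"
  using red.map_cres[OF gm i V s(2,3)] by (simp add: map_cocycle_def)
 also have "trunc_red (sect C ?V) k (N.thr (W Int cov gm j) ?V (f j)) = K.thr (W Int cov gm j) ?V (rd W f j)"
  using i red_res[OF o[OF i(2)] V s(5) cl[OF i(2)]] by (simp add: rd_def)
 finally show "K.thr (W Int cov rgm i) (W Int (cov rgm i Int cov rgm j)) (rd W f i) =
   K.Tw.cres rgm i j (W Int (cov rgm i Int cov rgm j)) (W Int (cov rgm i Int cov rgm j))
    (K.thr (W Int cov rgm j) (W Int (cov rgm i Int cov rgm j)) (rd W f j))"
  by simp
qed

lemma rd_res:
 assumes W: "openin (topo C) W" "openin (topo C) V" "V <= W" and f: "f : N.Tw.tw gm W"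
 shows "rd V (N.Tw.trs gm W V f) = K.Tw.trs rgm W V (rd W f)"
proof
 fix i
 have s: "V Int cov gm i <= W Int cov gm i" using W by auto
 show "rd V (N.Tw.trs gm W V f) i = K.Tw.trs rgm W V (rd W f) i"
  using red_res[OF N.op_Int[OF gm W(1)] N.op_Int[OF gm W(2)] s N.tw_closed[OF gm f]]
  by (simp add: rd_def N.Tw.trs_def K.Tw.trs_def)
qed

lemma rd_hom:
 assumes W: "openin (topo C) W"
 shows "rd W : ring_hom (sect (prim_curve C n gm) W) (sect (prim_curve C k rgm) W)"
proof -
 note h = red_hom[OF N.op_Int[OF gm W]] and cl = N.tw_closed[OF gm]
 show ?thesis
 proof (rule ring_hom_memI; (unfold N.pc_carrier[OF gm W] K.pc_carrier[OF rgm W])?)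
  fix f e assume f: "f : N.Tw.tw gm W" "e : N.Tw.tw gm W"
  show "rd W f : K.Tw.tw rgm W" by (rule rd_closed[OF W f(1)])
  show "rd W (f \<otimes>\<^bsub>sect (prim_curve C n gm) W\<^esub> e) = rd W f \<otimes>\<^bsub>sect (prim_curve C k rgm) W\<^esub> rd W e"
   using ring_hom_mult[OF h cl[OF f(1)] cl[OF f(2)]] by (auto simp: rd_def N.pc_ops K.pc_ops intro!: restrict_ext)
  show "rd W (f \<oplus>\<^bsub>sect (prim_curve C n gm) W\<^esub> e) = rd W f \<oplus>\<^bsub>sect (prim_curve C k rgm) W\<^esub> rd W e"
   using ring_hom_add[OF h cl[OF f(1)] cl[OF f(2)]] by (auto simp: rd_def N.pc_ops K.pc_ops intro!: restrict_ext)
 next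
  show "rd W \<one>\<^bsub>sect (prim_curve C n gm) W\<^esub> = \<one>\<^bsub>sect (prim_curve C k rgm) W\<^esub>"
   using ring_hom_one[OF h] by (auto simp: rd_def N.pc_ops K.pc_ops intro!: restrict_ext)
 qed
qed

lemma rd_scal:
 assumes W: "openin (topo C) W"
 shows "rd W (scal (prim_curve C n gm) W z) = scal (prim_curve C k rgm) W z"
proof
 fix i
 have "trunc_red (sect C V) k (trunc_monom (sect C V) n (scal C V z) 0) = trunc_monom (sect C V) k (scal C V z) 0"
  if V: "openin (topo C) V" for V
 proof -
  interpret V: trunc "sect C V" n by (rule N.tr[OF V])
  interpret W: trunc "sect C V" k by (rule N.tr[OF V])
  show ?thesis
   using kn N.scal_in[OF V] by (intro K.th_eqI[OF V] red_closed[OF V]) (auto simp: tcf_red[OF V])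
 qed
 then show "rd W (scal (prim_curve C n gm) W z) i = scal (prim_curve C k rgm) W z i"
  using N.op_Int[OF gm W] by (simp add: rd_def N.pc_ops K.pc_ops)
qed

lemma rd_core:
 assumes W: "openin (topo C) W" and f: "f : N.Tw.tw gm W"
 shows "K.core rgm W (rd W f) = N.core gm W f"
proof (rule K.core_eqI[OF rgm W rd_closed[OF W f] N.core_closed[OF gm W f]])
 fix i assume "i : idx rgm"
 then have i: "i : idx gm" by simp
 show "rest C W (W Int cov rgm i) (N.core gm W f) = tcf (rd W f i) 0"
  using N.core_rest_cov[OF gm W f i] tcf_red[OF N.op_Int[OF gm W i] N.tw_closed[OF gm f i] K.n_pos] i
  by (simp add: rd_def)
qed

lemma rd_eq_iff:
 assumes W: "openin (topo C) W" and f: "f : N.Tw.tw gm W" and h: "h : N.Tw.tw gm W"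
 shows "rd W f = rd W h \<longleftrightarrow> f \<ominus>\<^bsub>sect (prim_curve C n gm) W\<^esub> h : core_ideal_power C n gm k W"
proof -
 interpret P: cring "sect (prim_curve C n gm) W" by (rule N.pc_cring[OF gm W])
 have d: "f \<ominus>\<^bsub>sect (prim_curve C n gm) W\<^esub> h : N.Tw.tw gm W"
  using P.minus_closed[of f h] f h by (simp add: N.pc_carrier[OF gm W])
 have "tcf ((f \<ominus>\<^bsub>sect (prim_curve C n gm) W\<^esub> h) i) j = \<zero>\<^bsub>sect C (W Int cov gm i)\<^esub> \<longleftrightarrow> tcf (f i) j = tcf (h i) j"
  if i: "i : idx gm" and j: "j < k" for i j
 proof -
  interpret U: trunc "sect C (W Int cov gm i)" n by (rule N.tr[OF N.op_Int[OF gm W i]])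
  show ?thesis
   using N.tw_closed[OF gm f i] N.tw_closed[OF gm h i] j kn by (simp add: N.pc_diff_comp[OF gm W f h i])
 qed
 moreover have "rd W f = rd W h \<longleftrightarrow> (\<forall>i\<in>idx gm. \<forall>j<k. tcf (f i) j = tcf (h i) j)"
  using red_eq_iff[OF N.op_Int[OF gm W] N.tw_closed[OF gm f] N.tw_closed[OF gm h]]
  by (simp add: rd_def fun_eq_iff restrict_def) (metis (mono_tags, lifting))
 ultimately show ?thesis using d by (simp add: N.core_power_eq[OF gm W kn])
qed

text \<open>Over an open set inside one chart the curve is a product, and a class modulo t^k lifts
  to a class modulo t^n through any representative. Only this local surjectivity enters the
  description of the quotient sheaf.\<close>

lemma rd_surj:
 assumes V: "openin (topo C) V" and i: "i : idx gm" "V <= cov gm i" and m: "m : K.Tw.tw rgm V"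
 shows "\<exists>r\<in>N.Tw.tw gm V. rd V r = m"
proof -
 have Vi: "V Int cov gm i = V" using i by auto
 have mi: "m i : carrier (K.th V)" using K.tw_closed[OF rgm m, of i] i Vi by simp
 obtain E where E: "E : carrier (N.th V)" "m i = trunc_red (sect C V) k E" by (rule red_surj[OF V mi])
 let ?r = "N.Tw.tin gm i V E"
 have r: "?r : N.Tw.tw gm V" "?r i = E" using N.Tw.tin_closed[OF gm E(1) V i] by auto
 have "rd V ?r = m"
  by (rule K.Tw.tw_proj_inj[OF rgm rd_closed[OF V r(1)] m V])
   (use i E r Vi in \<open>auto simp: rd_def\<close>)
 then show ?thesis using r by blast
qed

text \<open>It is the kernel of the reduction to multiplicity k.\<close>

lemma core_power_ideal:
 assumes W: "openin (topo C) W"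
 shows "ideal (core_ideal_power C n gm k W) (sect (prim_curve C n gm) W)"
proof -
 interpret h: ring_hom_cring "sect (prim_curve C n gm) W" "sect (prim_curve C k rgm) W" "rd W"
  by (rule ring_hom_cringI[OF N.pc_cring[OF gm W] K.pc_cring[OF rgm W] rd_hom[OF W]])
 have "f : core_ideal_power C n gm k W \<longleftrightarrow> f : a_kernel (sect (prim_curve C n gm) W) (sect (prim_curve C k rgm) W) (rd W)" for f
 proof (cases "f : N.Tw.tw gm W")
  case True
  have z: "\<zero>\<^bsub>sect (prim_curve C n gm) W\<^esub> : N.Tw.tw gm W" by (rule N.pc_zero[OF gm W])
  have "f \<ominus>\<^bsub>sect (prim_curve C n gm) W\<^esub> \<zero>\<^bsub>sect (prim_curve C n gm) W\<^esub> = f"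
   using True by (simp add: a_minus_def N.pc_carrier[OF gm W])
  from rd_eq_iff[OF W True z, unfolded this]
  have "rd W f = \<zero>\<^bsub>sect (prim_curve C k rgm) W\<^esub> \<longleftrightarrow> f : core_ideal_power C n gm k W"
   by (simp only: h.hom_zero)
  then show ?thesis using True by (simp only: a_kernel_def' N.pc_carrier[OF gm W] mem_Collect_eq simp_thms)
 next
  case False
  then show ?thesis
   by (simp only: a_kernel_def' N.pc_carrier[OF gm W] N.core_power_eq[OF gm W kn] mem_Collect_eq simp_thms)
 qed
 then have "core_ideal_power C n gm k W = a_kernel (sect (prim_curve C n gm) W) (sect (prim_curve C k rgm) W) (rd W)"
  by (simp only: set_eq_iff simp_thms)
 then show ?thesis
  using ring_hom_ring.kernel_is_ideal[OF ring_hom_ringI2[OF cring.axioms(1)[OF N.pc_cring[OF gm W]]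
     cring.axioms(1)[OF K.pc_cring[OF rgm W]] rd_hom[OF W]]] by simp
qed

lemma core_power_res:
 assumes W: "openin (topo C) W" "openin (topo C) V" "V <= W" and f: "f : core_ideal_power C n gm k W"
 shows "N.Tw.trs gm W V f : core_ideal_power C n gm k V"
proof -
 have fw: "f : N.Tw.tw gm W" "!!i j. [|i : idx gm; j < k|] ==> tcf (f i) j = \<zero>\<^bsub>sect C (W Int cov gm i)\<^esub>"
  using f by (auto simp: N.core_power_eq[OF gm W(1) kn])
 have "tcf (N.Tw.trs gm W V f i) j = \<zero>\<^bsub>sect C (V Int cov gm i)\<^esub>" if i: "i : idx gm" and j: "j < k" for i j
 proof -
  have s: "V Int cov gm i <= W Int cov gm i" using W by auto
  show ?thesis
   using N.tcf_thr[OF N.op_Int[OF gm W(1) i] N.op_Int[OF gm W(2) i] s N.tw_closed[OF gm fw(1) i], of j] i j kn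
    fw(2)[OF i j] N.rest_zero[OF N.op_Int[OF gm W(1) i] N.op_Int[OF gm W(2) i] s] by (simp add: N.Tw.trs_def)
 qed
 then show ?thesis using N.Tw.trs_closed[OF gm W fw(1)] by (simp add: N.core_power_eq[OF gm W(2) kn])
qed

lemma core_power_presheaf: "ideal_presheaf (prim_curve C n gm) (core_ideal_power C n gm k)"
proof -
 interpret ringed_cspace "prim_curve C n gm" by (rule N.pc_ringed[OF gm])
 show ?thesis
  by (intro ideal_presheaf.intro ideal_presheaf_axioms.intro ringed_cspace_axioms)
   (simp_all add: core_power_ideal core_power_res N.pc_rest)
qed

end

end

context thickening_pair
begin

context
 fixes gm :: "('i, 'p, ('p, 'a) taut) cocycle"
 assumes gm: "is_cocycle (topo C) N.GG gm"
begin

lemmas RG = rgm[OF gm] and Rd_closed = rd_closed[OF gm] and Rd_res = rd_res[OF gm] and Rd_hom = rd_hom[OF gm]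
 and Rd_scal = rd_scal[OF gm] and Rd_core = rd_core[OF gm] and Rd_eq_iff = rd_eq_iff[OF gm] and Rd_surj = rd_surj[OF gm]
 and power_presheaf = core_power_presheaf[OF gm]

abbreviation RG where "RG \<equiv> map_cocycle (aut_red C n k) gm"
abbreviation RD where "RD \<equiv> rd gm"

subsection \<open>The subcurve of smaller multiplicity\<close>

text \<open>Since \<delta> is merely cohomologous to the reduced cocycle, the map used is reduction
  modulo t^k followed by the isomorphism of a coboundary. It is locally surjective and identifies
  two sections iff they differ by a section of I_C^k, so \<open>quot_map\<close> identifies the
  structure sheaf of the closed subscheme with that of C(\<delta>).\<close>

lemma is_sub_curveI:
 assumes nz: "!!V. [|openin (topo C) V; V \<noteq> {}|] ==> \<one>\<^bsub>sect C V\<^esub> \<noteq> \<zero>\<^bsub>sect C V\<^esub>"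
  and \<delta>: "is_cocycle (topo C) K.GG \<delta>" and coh: "cohomologous (topo C) K.GG RG \<delta>"
 shows "is_sub_curve C n gm k \<delta>"
proof -
 obtain L :: "'p set set" and W sg \<tau> h where D: "K.Tw.cobounds \<delta> RG L W sg \<tau> h"
  by (rule K.Tw.cohomologousE[OF K.Tw.cohomologous_sym[OF coh RG \<delta>] \<delta> RG])
 let ?T = "K.Tw.tht \<delta> RG L W sg \<tau> h"
 let ?S = "prim_curve C n gm" and ?J = "core_ideal_power C n gm k" and ?M = "prim_curve C k \<delta>"
 define \<pi> where "\<pi> = (%W f. ?T W (RD W f))"
 note tcl = K.Tw.tht_closed[OF \<delta> RG D] and tres = K.Tw.tht_res[OF \<delta> RG D]
 interpret Ip: ideal_presheaf ?S ?J by (rule power_presheaf)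
 interpret M: set_sheaf "topo ?S" "K.Tw.tw \<delta>" "K.Tw.trs \<delta>" using K.Tw.tw_sheaf[OF \<delta>] by simp
 have pi_closed: "\<pi> U s : K.Tw.tw \<delta> U" if "openin (topo C) U" "s : N.Tw.tw gm U" for U s
  unfolding \<pi>_def by (rule tcl[OF that(1) Rd_closed[OF that]])
 have pi_inj: "\<pi> U s = \<pi> U r \<longleftrightarrow> RD U s = RD U r" if "openin (topo C) U" "s : N.Tw.tw gm U" "r : N.Tw.tw gm U" for U s r
  using K.Tw.tht_bij[OF \<delta> RG D that(1)] Rd_closed[OF that(1,2)] Rd_closed[OF that(1,3)]
  by (auto simp: \<pi>_def bij_betw_def inj_on_def)
 have pi_res: "\<pi> V (N.Tw.trs gm U V s) = K.Tw.trs \<delta> U V (\<pi> U s)"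
  if "openin (topo C) U" "openin (topo C) V" "V <= U" "s : N.Tw.tw gm U" for U V s
  unfolding \<pi>_def Rd_res[OF that] by (rule tres[OF that(1-3) Rd_closed[OF that(1,4)]])
 have pi_surj: "\<exists>V r. openin (topo C) V & x : V & V <= U & r : N.Tw.tw gm V & \<pi> V r = K.Tw.trs \<delta> U V m"
  if U: "openin (topo C) U" and m: "m : K.Tw.tw \<delta> U" and x: "x : U" for U m x
 proof -
  obtain i where i: "i : idx gm" "x : cov gm i" using x N.Tw.cocycle_cover[OF gm] openin_subset[OF U] by blast
  let ?V = "U Int cov gm i"
  have V: "openin (topo C) ?V" by (rule N.op_Int[OF gm U i(1)])
  have m': "K.Tw.trs \<delta> U ?V m : K.Tw.tw \<delta> ?V" by (rule K.Tw.trs_closed[OF \<delta> U V _ m]) auto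
  then have "K.Tw.trs \<delta> U ?V m : ?T ?V ` K.Tw.tw RG ?V"
   using K.Tw.tht_bij[OF \<delta> RG D V] by (simp only: bij_betw_def)
  then obtain m1 where m1: "m1 : K.Tw.tw RG ?V" "?T ?V m1 = K.Tw.trs \<delta> U ?V m" by (rule imageE) (rule that, simp_all)
  obtain r where "r : N.Tw.tw gm ?V" "RD ?V r = m1" using Rd_surj[OF V i(1) _ m1(1)] by auto
  then show ?thesis using V x i m1 by (intro exI[of _ ?V] exI[of _ r]) (auto simp: \<pi>_def)
 qed
 interpret Q: quot_map ?S ?J "K.Tw.tw \<delta>" "K.Tw.trs \<delta>" "unit_ideal ?S" \<pi>
 proof unfold_locales
  fix U s r assume "openin (topo ?S) U" "s : carrier (sect ?S U)" "r : carrier (sect ?S U)"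
  then have U: "openin (topo C) U" "s : N.Tw.tw gm U" "r : N.Tw.tw gm U" by (simp_all add: N.pc_carrier[OF gm])
  show "\<pi> U s = \<pi> U r \<longleftrightarrow> s \<ominus>\<^bsub>sect ?S U\<^esub> r : ?J U" using pi_inj[OF U] Rd_eq_iff[OF U] by simp
 next
  fix U m x assume "openin (topo ?S) U" "m : K.Tw.tw \<delta> U" "x : U"
  then have "\<exists>V r. openin (topo C) V & x : V & V <= U & r : N.Tw.tw gm V & \<pi> V r = K.Tw.trs \<delta> U V m"
   using pi_surj by simp
  then obtain V r where "openin (topo C) V" "x : V" "V <= U" "r : N.Tw.tw gm V" "\<pi> V r = K.Tw.trs \<delta> U V m" by blast
  then show "\<exists>V r. openin (topo ?S) V & x : V & V <= U & r : carrier (sect ?S V) & \<pi> V r = K.Tw.trs \<delta> U V m"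
   by (intro exI[of _ V] exI[of _ r]) (simp add: N.pc_carrier[OF gm])
 qed (simp_all add: N.pc_carrier[OF gm] pi_closed pi_res N.Tw.trs_closed[OF gm] N.pc_rest)
 have oS: "openin (topo ?S) = openin (topo C)" by simp
 have pih: "\<pi> U : ring_hom (sect ?S U) (sect ?M U)" if U: "openin (topo C) U" for U
  using ring_hom_trans[OF Rd_hom[OF U] K.tht_iso[OF \<delta> RG D U, unfolded ring_iso_def, THEN CollectD, THEN conjunct1]]
  by (simp add: \<pi>_def comp_def)
 have piscal: "\<pi> U (scal ?S U z) = scal ?M U z" if U: "openin (topo C) U" for U z
  using Rd_scal[OF U] K.tht_scal[OF \<delta> RG D U] by (simp add: \<pi>_def)
 have picore: "K.core \<delta> U (\<pi> U f) = N.core gm U f" if "openin (topo C) U" "f : N.Tw.tw gm U" for U f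
  using K.tht_core[OF \<delta> RG D that(1) Rd_closed[OF that]] Rd_core[OF that] by (simp add: \<pi>_def)
 \<comment> \<open>The closed subscheme lives on all of C: if the germ of 1 were in the stalk of the
   ideal at x, the constant term of 1 would vanish near x, that is 1 = 0 in O_C.\<close>
 have support: "{x : points ?S. stalk_ideal ?S ?J x \<noteq> carrier (stalk ?S x)} = points C"
 proof -
  have "stalk_ideal ?S ?J x \<noteq> carrier (stalk ?S x)" if x: "x : points C" for x
  proof
   assume "stalk_ideal ?S ?J x = carrier (stalk ?S x)"
   moreover have P: "openin (topo ?S) (points C)" "openin (topo C) (points C)" by simp_all
   moreover have one: "\<one>\<^bsub>sect ?S (points C)\<^esub> : carrier (sect ?S (points C))"
    using cring.cring_simprules(6)[OF N.pc_cring[OF gm P(2)]] .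
   ultimately obtain V where V: "openin (topo C) V" "x : V" "V <= points C"
    "rest ?S (points C) V \<one>\<^bsub>sect ?S (points C)\<^esub> : ?J V"
    using Ip.germ_stalk_ideal[OF P(1) x one] Ip.in_stalk[OF P(1) x one] by auto
   then have "\<one>\<^bsub>sect ?S V\<^esub> : ?J V" using Ip.rest_consts(1)[OF P(1) _ V(3)] by simp
   then have J1: "!!i. i : idx gm ==> tcf (\<one>\<^bsub>sect ?S V\<^esub> i) 0 = \<zero>\<^bsub>sect C (V Int cov gm i)\<^esub>"
    using K.n_pos by (auto simp: N.core_power_eq[OF gm V(1) kn])
   obtain i where i: "i : idx gm" "x : cov gm i" using x N.Tw.cocycle_cover[OF gm] by blast
   note o = N.op_Int[OF gm V(1) i(1)]
   interpret U: trunc "sect C (V Int cov gm i)" n by (rule N.tr[OF o])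
   show False using J1[OF i(1)] nz[OF o] i V N.n_pos by (auto simp: N.pc_ops)
  qed
  then show ?thesis by auto
 qed
 have ts: "topo (sub_curve C n gm k) = topo C"
  unfolding sub_curve_def closed_subspace_def cspace.select_convs support by simp
 have sc: "carrier (sect (sub_curve C n gm k) W) = quot_sections ?S (unit_ideal ?S) ?J W" for W
  by (simp add: sub_curve_def closed_subspace_def)
 have so: "s \<otimes>\<^bsub>sect (sub_curve C n gm k) W\<^esub> r = (\<lambda>y\<in>W. s y \<otimes>\<^bsub>stalk_quot ?S ?J y\<^esub> r y)"
  "s \<oplus>\<^bsub>sect (sub_curve C n gm k) W\<^esub> r = (\<lambda>y\<in>W. s y \<oplus>\<^bsub>stalk_quot ?S ?J y\<^esub> r y)"
  "\<one>\<^bsub>sect (sub_curve C n gm k) W\<^esub> = (\<lambda>y\<in>W. \<one>\<^bsub>stalk_quot ?S ?J y\<^esub>)"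
  "rest (sub_curve C n gm k) W W' s = restrict s W'"
  "scal (sub_curve C n gm k) W z = (\<lambda>y\<in>W. quot_germ ?S ?J y (points C) (scal ?S (points C) z))" for s r W W' z
  by (simp_all add: sub_curve_def closed_subspace_def)
 \<comment> \<open>Quotient sections with a single representative r over U correspond to \<pi> r.
   The unit, the scalars and the pullbacks along the inclusion are all of this kind.\<close>
 have loc: "(\<lambda>y\<in>U. quot_germ ?S ?J y U r) : quot_sections ?S (unit_ideal ?S) ?J U \<and>
   Q.qmap U (\<lambda>y\<in>U. quot_germ ?S ?J y U r) = \<pi> U r" if U: "openin (topo C) U" and r: "r : carrier (sect ?S U)" for U r
 proof -
  have U': "openin (topo ?S) U" using U by simp
  note R = Q.qrel_local[OF U' r]
  have 1: "(\<lambda>y\<in>U. quot_germ ?S ?J y U r) : quot_sections ?S (unit_ideal ?S) ?J U"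
   by (rule Q.qrel_quot_sections[OF U' R]) simp
  show ?thesis using 1 Q.qmap_eqI[OF U' 1 Q.pi_closed[OF U' r] R] by simp
 qed
 have qhom: "Q.qmap W : ring_hom (sect (sub_curve C n gm k) W) (sect ?M W)" if W: "openin (topo C) W" for W
 proof (rule ring_hom_memI; (unfold sc)?)
  have W': "openin (topo ?S) W" using W by simp
  fix s s' assume s: "s : quot_sections ?S (unit_ideal ?S) ?J W" "s' : quot_sections ?S (unit_ideal ?S) ?J W"
  note qc = Q.qmap_closed[OF W' s(1)] Q.qmap_closed[OF W' s(2)]
  have cS: "cring (sect ?S U)" if "openin (topo C) U" for U by (rule N.pc_cring[OF gm that])
  show "Q.qmap W (s \<otimes>\<^bsub>sect (sub_curve C n gm k) W\<^esub> s') = Q.qmap W s \<otimes>\<^bsub>sect ?M W\<^esub> Q.qmap W s'"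
   unfolding so
  proof (rule Q.qmap_bop(2)[where pS="%U a b. a \<otimes>\<^bsub>sect ?S U\<^esub> b" and pM="%U a b. a \<otimes>\<^bsub>sect ?M U\<^esub> b"
     and pQ="%y a b. a \<otimes>\<^bsub>stalk_quot ?S ?J y\<^esub> b", OF W' s])
   show "K.Tw.trs \<delta> W U (Q.qmap W s \<otimes>\<^bsub>sect ?M W\<^esub> Q.qmap W s') =
     K.Tw.trs \<delta> W U (Q.qmap W s) \<otimes>\<^bsub>sect ?M U\<^esub> K.Tw.trs \<delta> W U (Q.qmap W s')"
    if "openin (topo ?S) U" "U <= W" for U
    using K.trs_ops(1)[OF \<delta> W _ that(2) qc] that by (simp add: K.pc_ops)
  qed (use cS pih K.pc_mult[OF \<delta> W qc] in \<open>simp_all add: cring.cring_simprules ring_hom_mult ring_hom_mult[OF Ip.quot_germ_hom, symmetric]\<close>)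
  show "Q.qmap W (s \<oplus>\<^bsub>sect (sub_curve C n gm k) W\<^esub> s') = Q.qmap W s \<oplus>\<^bsub>sect ?M W\<^esub> Q.qmap W s'"
   unfolding so
  proof (rule Q.qmap_bop(2)[where pS="%U a b. a \<oplus>\<^bsub>sect ?S U\<^esub> b" and pM="%U a b. a \<oplus>\<^bsub>sect ?M U\<^esub> b"
     and pQ="%y a b. a \<oplus>\<^bsub>stalk_quot ?S ?J y\<^esub> b", OF W' s])
   show "K.Tw.trs \<delta> W U (Q.qmap W s \<oplus>\<^bsub>sect ?M W\<^esub> Q.qmap W s') =
     K.Tw.trs \<delta> W U (Q.qmap W s) \<oplus>\<^bsub>sect ?M U\<^esub> K.Tw.trs \<delta> W U (Q.qmap W s')"
    if "openin (topo ?S) U" "U <= W" for U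
    using K.trs_ops(2)[OF \<delta> W _ that(2) qc] that by (simp add: K.pc_ops)
  qed (use cS pih K.pc_add[OF \<delta> W qc] in \<open>simp_all add: cring.cring_simprules ring_hom_add ring_hom_add[OF Ip.quot_germ_hom, symmetric]\<close>)
 next
  fix s assume "s : quot_sections ?S (unit_ideal ?S) ?J W"
  then show "Q.qmap W s : carrier (sect ?M W)" using Q.qmap_closed W by (simp add: K.pc_carrier[OF \<delta> W])
 next
  have one: "\<one>\<^bsub>sect ?S W\<^esub> : carrier (sect ?S W)" using cring.cring_simprules(6)[OF N.pc_cring[OF gm W]] .
  have "\<one>\<^bsub>sect (sub_curve C n gm k) W\<^esub> = (\<lambda>y\<in>W. quot_germ ?S ?J y W \<one>\<^bsub>sect ?S W\<^esub>)"
   unfolding so using Ip.quot_germ_one[of W] W by (intro restrict_ext) simp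
  then show "Q.qmap W \<one>\<^bsub>sect (sub_curve C n gm k) W\<^esub> = \<one>\<^bsub>sect ?M W\<^esub>"
   using loc[OF W one] ring_hom_one[OF pih[OF W]] by simp
 qed
 show ?thesis
  unfolding is_sub_curve_def
 proof (intro exI[of _ "(%x. x, Q.qmap)"] conjI)
  have pre: "preim ?M (%x. x) V = V" if "openin (topo C) V" for V using K.pc_preim[OF \<delta> that] .
  show "cspace_iso ?M (sub_curve C n gm k) (%x. x, Q.qmap)"
   unfolding cspace_iso_def prod.case ts K.pc_topo
  proof (intro conjI allI impI)
   show "homeomorphic_map (topo C) (topo C) (%x. x)"
    using homeomorphic_map_id[of "topo C" "topo C"] by (simp add: id_def)
   fix V assume V: "openin (topo C) V"
   then have V': "openin (topo ?S) V" by simp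
   show "Q.qmap V : ring_iso (sect (sub_curve C n gm k) V) (sect ?M (preim ?M (%x. x) V))"
    using qhom[OF V] Q.qmap_bij[OF V'] by (simp add: pre[OF V] ring_iso_def sc K.pc_carrier[OF \<delta> V])
   fix z
   have P: "openin (topo ?S) (points C)" "V <= points C" using openin_subset[OF V] by auto
   have sin: "scal ?S U z : carrier (sect ?S U)" if "openin (topo C) U" for U
    using N.pc_scal[OF gm that] by (simp add: N.pc_carrier[OF gm that])
   have "scal (sub_curve C n gm k) V z = (\<lambda>y\<in>V. quot_germ ?S ?J y V (scal ?S V z))"
    unfolding so
   proof (intro restrict_ext)
    fix y assume y: "y : V"
    show "quot_germ ?S ?J y (points C) (scal ?S (points C) z) = quot_germ ?S ?J y V (scal ?S V z)"
     using Ip.quot_germ_rest[OF P(1) V' P(2) y sin] Ip.scal_rest[OF P(1) V' P(2)] by simp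
   qed
   then show "Q.qmap V (scal (sub_curve C n gm k) V z) = scal ?M (preim ?M (%x. x) V) z"
    using loc[OF V sin[OF V]] piscal[OF V] by (simp add: pre[OF V])
  next
   fix V V' s assume as: "openin (topo C) V & openin (topo C) V' & V' <= V & s : carrier (sect (sub_curve C n gm k) V)"
   then have V: "openin (topo ?S) V" "openin (topo ?S) V'" "V' <= V" "s : quot_sections ?S (unit_ideal ?S) ?J V"
    by (auto simp: sc)
   show "Q.qmap V' (rest (sub_curve C n gm k) V V' s) =
     rest ?M (preim ?M (%x. x) V) (preim ?M (%x. x) V') (Q.qmap V s)"
    using Q.qmap_restrict[OF V] as pre by (simp add: so K.pc_rest)
  qed
  show "mor_eq C ?S (mor_comp ?M (mor_comp (sub_curve C n gm k) (sub_incl C n gm k) (%x. x, Q.qmap)) (core_incl C \<delta>))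
    (core_incl C gm)"
   unfolding mor_eq_def
  proof (intro conjI allI impI ballI)
   fix x assume "x : points C"
   show "fst (mor_comp ?M (mor_comp (sub_curve C n gm k) (sub_incl C n gm k) (%x. x, Q.qmap)) (core_incl C \<delta>)) x =
     fst (core_incl C gm) x"
    by (simp add: mor_comp_def N.core_incl_simps sub_incl_def closed_incl_def)
  next
   fix V s assume "openin (topo ?S) V" and s: "s : carrier (sect ?S V)"
   then have V: "openin (topo C) V" by simp
   have Vp: "V Int points C = V" using openin_subset[OF V] by auto
   have p1: "preim (sub_curve C n gm k) (%x. x) V = V" using openin_subset[OF V] by (auto simp: preim_def ts)
   have pts: "points (closed_subspace ?S ?J) = points C" using ts by (simp add: sub_curve_def)
   have "snd (mor_comp ?M (mor_comp (sub_curve C n gm k) (sub_incl C n gm k) (%x. x, Q.qmap)) (core_incl C \<delta>)) V s =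
     K.core \<delta> V (Q.qmap V (\<lambda>y\<in>V. quot_germ ?S ?J y V s))"
    by (simp add: mor_comp_def sub_incl_def closed_incl_def p1 pre[OF V] K.core_def[OF \<delta>] pts Vp)
   also have "\<dots> = N.core gm V s" using loc[OF V s] picore[OF V] s by (simp add: N.pc_carrier[OF gm V])
   finally show "snd (mor_comp ?M (mor_comp (sub_curve C n gm k) (sub_incl C n gm k) (%x. x, Q.qmap)) (core_incl C \<delta>)) V s =
     snd (core_incl C gm) V s" by (simp add: N.core_def[OF gm])
  qed
 qed
qed

end

end

section \<open>Line bundles and the conormal sheaf\<close>

context thickening
begin

lemma rest_ops:
 assumes U: "op U" "op V" "V <= U" and a: "a : carrier (sect C U)" "b : carrier (sect C U)"
 shows rest_mult: "rest C U V (a \<otimes>\<^bsub>sect C U\<^esub> b) = rest C U V a \<otimes>\<^bsub>sect C V\<^esub> rest C U V b"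
  and rest_add: "rest C U V (a \<oplus>\<^bsub>sect C U\<^esub> b) = rest C U V a \<oplus>\<^bsub>sect C V\<^esub> rest C U V b"
 using ring_hom_mult[OF rest_hom[OF U] a] ring_hom_add[OF rest_hom[OF U] a] by simp_all

lemma unit_in: "g : carrier (gsec (unit_sheaf C) V) ==> g : carrier (sect C V)"
 by (simp add: unit_sheaf_def units_of_def Units_def)

context
 fixes \<mu> :: "('j, 'p, 'a) cocycle"
 assumes \<mu>: "is_cocycle (topo C) (unit_sheaf C) \<mu>"
begin

lemma lb_carrier: "carrier (msec (line_bundle C \<mu>) W) = Un.tw \<mu> W"
 unfolding Un.tw_def by (simp add: line_bundle_def Let_def unit_sheaf_def)

text \<open>The scalar is a section of O_C and not of the twisted form, so it is no operand for
  \<open>tw_bop\<close>; by commutativity it moves past the transition units.\<close>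

lemma lb_smult_closed:
 assumes W: "op W" and a: "a : carrier (sect C W)" and m: "m : Un.tw \<mu> W"
 shows "(\<lambda>i\<in>idx \<mu>. rest C W (W Int cov \<mu> i) a \<otimes>\<^bsub>sect C (W Int cov \<mu> i)\<^esub> m i) : Un.tw \<mu> W" (is "?m : _")
 unfolding Un.tw_def
proof (intro CollectI conjI ballI)
 note oi = Un.open_Int[OF \<mu> W] and mc = Un.tw_comp_closed[OF \<mu> m]
 have ai: "rest C W (W Int cov \<mu> i) a : carrier (sect C (W Int cov \<mu> i))" if "i : idx \<mu>" for i
  by (rule rest_closed[OF W oi[OF that] _ a]) auto
 show "?m : (\<Pi>\<^sub>E i\<in>idx \<mu>. carrier (sect C (W Int cov \<mu> i)))"
  using cring.cring_simprules(5)[OF sect_cring[OF oi] ai mc] by simp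
 fix i j assume i: "i : idx \<mu>" "j : idx \<mu>"
 let ?V = "W Int (cov \<mu> i Int cov \<mu> j)"
 have V: "op ?V" using W i Un.cocycle_open[OF \<mu>] by auto
 have s: "?V <= W" "?V <= cov \<mu> i" "?V <= cov \<mu> j" "?V <= W Int cov \<mu> i" "?V <= W Int cov \<mu> j"
  "W Int cov \<mu> i <= W" "W Int cov \<mu> j <= W" by auto
 interpret V: cring "sect C ?V" by (rule sect_cring[OF V])
 have c: "Un.cres \<mu> i j ?V : carrier (sect C ?V)" by (rule unit_in[OF Un.cres_closed[OF \<mu> i V s(2,3)]])
 have aV: "rest C W ?V a : carrier (sect C ?V)" by (rule rest_closed[OF W V s(1) a])
 have mV: "rest C (W Int cov \<mu> j) ?V (m j) : carrier (sect C ?V)"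
  by (rule rest_closed[OF oi[OF i(2)] V s(5) mc[OF i(2)]])
 have "rest C (W Int cov \<mu> i) ?V (?m i) = rest C W ?V a \<otimes>\<^bsub>sect C ?V\<^esub> rest C (W Int cov \<mu> i) ?V (m i)"
  using i rest_mult[OF oi[OF i(1)] V s(4) ai[OF i(1)] mc[OF i(1)]]
   rest_comp[OF W oi[OF i(1)] V s(4,6) a] by simp
 also have "rest C (W Int cov \<mu> i) ?V (m i) = Un.cres \<mu> i j ?V \<otimes>\<^bsub>sect C ?V\<^esub> rest C (W Int cov \<mu> j) ?V (m j)"
  by (rule Un.tw_eq[OF \<mu> m W i V s(1-3)])
 also have "rest C W ?V a \<otimes>\<^bsub>sect C ?V\<^esub> (Un.cres \<mu> i j ?V \<otimes>\<^bsub>sect C ?V\<^esub> rest C (W Int cov \<mu> j) ?V (m j)) =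
   Un.cres \<mu> i j ?V \<otimes>\<^bsub>sect C ?V\<^esub> (rest C W ?V a \<otimes>\<^bsub>sect C ?V\<^esub> rest C (W Int cov \<mu> j) ?V (m j))"
  using c aV mV by (simp add: V.m_ac)
 also have "rest C W ?V a \<otimes>\<^bsub>sect C ?V\<^esub> rest C (W Int cov \<mu> j) ?V (m j) = rest C (W Int cov \<mu> j) ?V (?m j)"
  using i rest_mult[OF oi[OF i(2)] V s(5) ai[OF i(2)] mc[OF i(2)]]
   rest_comp[OF W oi[OF i(2)] V s(5,7) a] by simp
 finally show "rest C (W Int cov \<mu> i) ?V (?m i) = Un.cres \<mu> i j ?V \<otimes>\<^bsub>sect C ?V\<^esub> rest C (W Int cov \<mu> j) ?V (?m j)" .
qed

lemma lb_add_closed: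
 assumes W: "op W" and f: "f : Un.tw \<mu> W" and h: "h : Un.tw \<mu> W"
 shows "(\<lambda>i\<in>idx \<mu>. f i \<oplus>\<^bsub>sect C (W Int cov \<mu> i)\<^esub> h i) : Un.tw \<mu> W"
proof (rule Un.tw_bop[where p="%U a b. a \<oplus>\<^bsub>sect C U\<^esub> b", OF _ _ _ \<mu> W f h])
 fix V g a b assume V: "op V" "g : carrier (gsec (unit_sheaf C) V)" "a : carrier (sect C V)" "b : carrier (sect C V)"
 interpret cring "sect C V" by (rule sect_cring[OF V(1)])
 show "g \<otimes>\<^bsub>sect C V\<^esub> (a \<oplus>\<^bsub>sect C V\<^esub> b) = g \<otimes>\<^bsub>sect C V\<^esub> a \<oplus>\<^bsub>sect C V\<^esub> g \<otimes>\<^bsub>sect C V\<^esub> b"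
  using V unit_in[OF V(2)] by (simp add: r_distr)
qed (simp_all add: rest_add cring.cring_simprules(1)[OF sect_cring])

end

context
 fixes c :: "('i, 'p, 'a) cocycle" and d :: "('j, 'p, 'a) cocycle" and K :: "'z set" and W sg \<tau> h
 assumes c: "is_cocycle (topo C) (unit_sheaf C) c" and d: "is_cocycle (topo C) (unit_sheaf C) d"
  and D: "Un.cobounds c d K W sg \<tau> h"
begin

abbreviation "UT \<equiv> Un.tht c d K W sg \<tau> h"

lemma lb_tht_add:
 assumes A: "op A" and f: "f : Un.tw d A" "e : Un.tw d A"
 shows "UT A (\<lambda>i\<in>idx d. f i \<oplus>\<^bsub>sect C (A Int cov d i)\<^esub> e i) = (\<lambda>i\<in>idx c. UT A f i \<oplus>\<^bsub>sect C (A Int cov c i)\<^esub> UT A e i)"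
proof (rule Un.tht_eqI[OF c d D A lb_add_closed[OF d A f]])
 note cl = Un.tht_closed[OF c d D A f(1)] Un.tht_closed[OF c d D A f(2)]
 show "(\<lambda>i\<in>idx c. UT A f i \<oplus>\<^bsub>sect C (A Int cov c i)\<^esub> UT A e i) : Un.tw c A" by (rule lb_add_closed[OF c A cl])
 show "Un.twrel c d K W sg \<tau> h A (\<lambda>i\<in>idx c. UT A f i \<oplus>\<^bsub>sect C (A Int cov c i)\<^esub> UT A e i)
   (\<lambda>i\<in>idx d. f i \<oplus>\<^bsub>sect C (A Int cov d i)\<^esub> e i)"
 proof (rule Un.twrel_bop[where p="%U a b. a \<oplus>\<^bsub>sect C U\<^esub> b", OF _ _ _ c d D A cl f
    Un.tht_rel[OF c d D A f(1)] Un.tht_rel[OF c d D A f(2)]])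
  fix V g a b assume V: "op V" "g : carrier (gsec (unit_sheaf C) V)" "a : carrier (sect C V)" "b : carrier (sect C V)"
  interpret cring "sect C V" by (rule sect_cring[OF V(1)])
  show "g \<otimes>\<^bsub>sect C V\<^esub> (a \<oplus>\<^bsub>sect C V\<^esub> b) = g \<otimes>\<^bsub>sect C V\<^esub> a \<oplus>\<^bsub>sect C V\<^esub> g \<otimes>\<^bsub>sect C V\<^esub> b"
   using V unit_in[OF V(2)] by (simp add: r_distr)
 qed (simp_all add: rest_add cring.cring_simprules(1)[OF sect_cring])
qed

lemma lb_tht_smult:
 assumes A: "op A" and a: "a : carrier (sect C A)" and f: "f : Un.tw d A"
 shows "UT A (\<lambda>i\<in>idx d. rest C A (A Int cov d i) a \<otimes>\<^bsub>sect C (A Int cov d i)\<^esub> f i) =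
   (\<lambda>i\<in>idx c. rest C A (A Int cov c i) a \<otimes>\<^bsub>sect C (A Int cov c i)\<^esub> UT A f i)"
proof (rule Un.tht_eqI[OF c d D A lb_smult_closed[OF d A a f] lb_smult_closed[OF c A a Un.tht_closed[OF c d D A f]]])
 note K = Un.cobounds_data[OF D]
 note cl = Un.tht_closed[OF c d D A f] and re = Un.tht_rel[OF c d D A f]
 show "Un.twrel c d K W sg \<tau> h A (\<lambda>i\<in>idx c. rest C A (A Int cov c i) a \<otimes>\<^bsub>sect C (A Int cov c i)\<^esub> UT A f i)
   (\<lambda>i\<in>idx d. rest C A (A Int cov d i) a \<otimes>\<^bsub>sect C (A Int cov d i)\<^esub> f i)"
  unfolding Un.twrel_def
 proof
  fix k assume k: "k : K"
  let ?V = "A Int W k"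
  have V: "op ?V" using A K(1)[OF k] by auto
  note oc = Un.open_Int[OF c A K(2)[OF k]] and od = Un.open_Int[OF d A K(3)[OF k]]
  have s: "?V <= A Int cov c (sg k)" "?V <= A Int cov d (\<tau> k)" "?V <= W k" "A Int cov c (sg k) <= A" "A Int cov d (\<tau> k) <= A" "?V <= A"
   using K(4,5)[OF k] by auto
  interpret V: cring "sect C ?V" by (rule sect_cring[OF V])
  have hk: "gres (unit_sheaf C) (W k) ?V (h k) : carrier (sect C ?V)"
   by (rule unit_in[OF Un.cobounds_closed(1)[OF D V s(3) k]])
  note ac = rest_closed[OF A oc s(4) a] and ad = rest_closed[OF A od s(5) a]
  note fc = Un.tw_comp_closed[OF c cl K(2)[OF k]] and fd = Un.tw_comp_closed[OF d f K(3)[OF k]]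
  show "rest C (A Int cov c (sg k)) ?V ((\<lambda>i\<in>idx c. rest C A (A Int cov c i) a \<otimes>\<^bsub>sect C (A Int cov c i)\<^esub> UT A f i) (sg k)) =
    gres (unit_sheaf C) (W k) ?V (h k) \<otimes>\<^bsub>sect C ?V\<^esub>
    rest C (A Int cov d (\<tau> k)) ?V ((\<lambda>i\<in>idx d. rest C A (A Int cov d i) a \<otimes>\<^bsub>sect C (A Int cov d i)\<^esub> f i) (\<tau> k))"
   using K(2,3)[OF k] rest_mult[OF oc V s(1) ac fc] rest_mult[OF od V s(2) ad fd]
    rest_comp[OF A oc V s(1,4) a] rest_comp[OF A od V s(2,5) a] re[unfolded Un.twrel_def, rule_format, OF k]
    hk rest_closed[OF A V s(6) a] rest_closed[OF od V s(2) fd]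
   by (simp add: V.m_ac)
 qed
qed

end

context
 fixes gm :: "('i, 'p, ('p, 'a) taut) cocycle"
 assumes gm: "is_cocycle (topo C) GG gm" and n1: "1 < n"
begin

abbreviation "xgm \<equiv> map_cocycle (xi C n) gm"

lemma xgm: "is_cocycle (topo C) (unit_sheaf C) xgm"
 by (rule group_presheaf_hom.map_cocycle_cocycle[OF xi_presheaf_hom[OF n1] gm])

lemma xgm_simps [simp]: "idx xgm = idx gm" "cov xgm = cov gm" by (simp_all add: map_cocycle_def)

definition c1 :: "'p set => ('i => (nat => 'a) set) => 'i => 'a" where
 "c1 W f = (\<lambda>i\<in>idx gm. tcf (f i) 1)"

lemma core_ideal_res:
 assumes W: "op W" "op V" "V <= W" and f: "f : core_ideal C n gm W"
 shows "Tw.trs gm W V f : core_ideal C n gm V"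
 using f core_res[OF gm W, of f] Tw.trs_closed[OF gm W, of f] rest_zero[OF W]
 by (auto simp: core_zero_iff[OF gm W(1)] core_zero_iff[OF gm W(2)])

lemma core_idealD:
 assumes "op W" "f : core_ideal C n gm W"
 shows "f : Tw.tw gm W" "i : idx gm ==> tcf (f i) 0 = \<zero>\<^bsub>sect C (W Int cov gm i)\<^esub>"
 using assms by (auto simp: core_ideal_eq[OF gm])

text \<open>On elements with zero constant term the transition automorphism multiplies the
  coefficient of t by its value under \<open>xi\<close>, by \<open>tcf_1_hom\<close>. So the
  coefficients of t form a section of the line bundle of the image cocycle.\<close>

lemma c1_closed:
 assumes W: "op W" and f: "f : core_ideal C n gm W"
 shows "c1 W f : Un.tw xgm W"
 unfolding Un.tw_def
proof (intro CollectI conjI ballI)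
 note fw = core_idealD[OF W f]
 note o = op_Int[OF gm W] and cl = tw_closed[OF gm fw(1)]
 show "c1 W f : (\<Pi>\<^sub>E i\<in>idx xgm. carrier (sect C (W Int cov xgm i)))"
  using tcf_in[OF o cl] by (simp add: c1_def)
 fix i j assume "i : idx xgm" "j : idx xgm"
 then have i: "i : idx gm" "j : idx gm" by simp_all
 let ?V = "W Int (cov gm i Int cov gm j)"
 have V: "op ?V" using W i Tw.cocycle_open[OF gm] by auto
 have s: "?V <= W" "?V <= cov gm i" "?V <= cov gm j" "?V <= W Int cov gm i" "?V <= W Int cov gm j" by auto
 interpret V: trunc "sect C ?V" n by (rule tr[OF V])
 have g: "Tw.cres gm i j ?V : aut_set C n ?V"
  using Tw.cres_closed[OF gm i V s(2,3)] by (simp add: aut_carrier)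
 let ?fj = "thr (W Int cov gm j) ?V (f j)"
 have fj: "?fj : carrier (th ?V)" by (rule thr_closed[OF o[OF i(2)] V s(5) cl[OF i(2)]])
 have v: "V.tvan 1 ?fj"
  using tcf_thr[OF o[OF i(2)] V s(5) cl[OF i(2)] n_pos] fw(2)[OF i(2)] rest_zero[OF o[OF i(2)] V s(5)]
  by (simp add: V.tvan_def)
 have "rest C (W Int cov gm i) ?V (tcf (f i) 1) = tcf (thr (W Int cov gm i) ?V (f i)) 1"
  by (rule tcf_thr[OF o[OF i(1)] V s(4) cl[OF i(1)] n1, symmetric])
 also have "\<dots> = tcf (Tw.cres gm i j ?V ?V ?fj) 1" using Tw.tw_eq[OF gm fw(1) W i V s(1-3)] by simp
 also have "\<dots> = tcf (Tw.cres gm i j ?V ?V V.tt) 1 \<otimes>\<^bsub>sect C ?V\<^esub> tcf ?fj 1"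
  by (rule V.tcf_1_hom[OF aut_hom[OF g V subset_refl] aut_zero[OF g V subset_refl] n_pos fj v n1])
 also have "tcf (Tw.cres gm i j ?V ?V V.tt) 1 = xi C n ?V (Tw.cres gm i j ?V)"
  by (rule xi_eq[OF g V n1, symmetric])
 also have "\<dots> = Un.cres xgm i j ?V"
  using group_presheaf_hom.map_cres[OF xi_presheaf_hom[OF n1] gm i V s(2,3)] by (simp add: map_cocycle_def)
 also have "tcf ?fj 1 = rest C (W Int cov gm j) ?V (tcf (f j) 1)"
  by (rule tcf_thr[OF o[OF i(2)] V s(5) cl[OF i(2)] n1])
 finally show "rest C (W Int cov xgm i) (W Int (cov xgm i Int cov xgm j)) (c1 W f i) =
   Un.cres xgm i j (W Int (cov xgm i Int cov xgm j)) \<otimes>\<^bsub>sect C (W Int (cov xgm i Int cov xgm j))\<^esub>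
   rest C (W Int cov xgm j) (W Int (cov xgm i Int cov xgm j)) (c1 W f j)"
  using i by (simp add: c1_def)
qed

lemma c1_res:
 assumes W: "op W" "op V" "V <= W" and f: "f : core_ideal C n gm W"
 shows "c1 V (Tw.trs gm W V f) = Un.trs xgm W V (c1 W f)"
proof
 fix i
 have s: "V Int cov gm i <= W Int cov gm i" using W by auto
 show "c1 V (Tw.trs gm W V f) i = Un.trs xgm W V (c1 W f) i"
  using tcf_thr[OF op_Int[OF gm W(1)] op_Int[OF gm W(2)] s tw_closed[OF gm core_idealD(1)[OF W(1) f]] n1]
  by (simp add: c1_def Tw.trs_def Un.trs_def)
qed

lemma c1_add:
 assumes W: "op W" and f: "f : Tw.tw gm W" "e : Tw.tw gm W"
 shows "c1 W (f \<oplus>\<^bsub>sect (prim_curve C n gm) W\<^esub> e) =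
  (\<lambda>i\<in>idx xgm. c1 W f i \<oplus>\<^bsub>sect C (W Int cov xgm i)\<^esub> c1 W e i)"
 unfolding c1_def xgm_simps pc_ops
proof (intro restrict_ext)
 fix i assume i: "i : idx gm"
 interpret U: trunc "sect C (W Int cov gm i)" n by (rule tr[OF op_Int[OF gm W i]])
 show "tcf ((\<lambda>i\<in>idx gm. f i \<oplus>\<^bsub>th (W Int cov gm i)\<^esub> e i) i) 1 =
  (\<lambda>i\<in>idx gm. tcf (f i) 1) i \<oplus>\<^bsub>sect C (W Int cov gm i)\<^esub> (\<lambda>i\<in>idx gm. tcf (e i) 1) i"
  using i n1 tw_closed[OF gm f(1) i] tw_closed[OF gm f(2) i] by simp
qed

text \<open>With f = t f', the coefficient of t in a f is the product of the constant terms of a and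
  f'. Thus the structure sheaf of the curve acts through its quotient O_C.\<close>

lemma c1_mult:
 assumes W: "op W" and a: "a : Tw.tw gm W" and f: "f : core_ideal C n gm W"
 shows "c1 W (a \<otimes>\<^bsub>sect (prim_curve C n gm) W\<^esub> f) =
  (\<lambda>i\<in>idx xgm. rest C W (W Int cov xgm i) (core gm W a) \<otimes>\<^bsub>sect C (W Int cov xgm i)\<^esub> c1 W f i)"
 unfolding c1_def xgm_simps pc_ops
proof (intro restrict_ext)
 fix i assume i: "i : idx gm"
 interpret U: trunc "sect C (W Int cov gm i)" n by (rule tr[OF op_Int[OF gm W i]])
 have cl: "a i : carrier U.B" "f i : carrier U.B"
  using tw_closed[OF gm a i] tw_closed[OF gm core_idealD(1)[OF W f] i] .
 have "U.tvan 1 (f i)" using core_idealD(2)[OF W f i] by (simp add: U.tvan_def)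
 from U.tvan_factor[OF cl(2) this] have "f i = U.tt \<otimes>\<^bsub>U.B\<^esub> U.tdrop 1 (f i)" by simp
 then have "a i \<otimes>\<^bsub>U.B\<^esub> f i = a i \<otimes>\<^bsub>U.B\<^esub> (U.tt \<otimes>\<^bsub>U.B\<^esub> U.tdrop 1 (f i))" by (rule arg_cong)
 also have "\<dots> = U.tt \<otimes>\<^bsub>U.B\<^esub> (a i \<otimes>\<^bsub>U.B\<^esub> U.tdrop 1 (f i))" using cl by (simp add: U.B.m_lcomm)
 finally have "tcf (a i \<otimes>\<^bsub>U.B\<^esub> f i) 1 = tcf (a i) 0 \<otimes>\<^bsub>sect C (W Int cov gm i)\<^esub> tcf (f i) 1"
  using cl n1 by (simp add: U.tcf_mult_0)
 then show "tcf ((\<lambda>i\<in>idx gm. a i \<otimes>\<^bsub>th (W Int cov gm i)\<^esub> f i) i) 1 =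
  rest C W (W Int cov gm i) (core gm W a) \<otimes>\<^bsub>sect C (W Int cov gm i)\<^esub> (\<lambda>i\<in>idx gm. tcf (f i) 1) i"
  using i core_rest_cov[OF gm W a i] by simp
qed

text \<open>Both sections have zero constant term, so modulo t^2 they can differ in the coefficient
  of t alone.\<close>

lemma c1_eq_iff:
 assumes W: "op W" and f: "f : core_ideal C n gm W" and h: "h : core_ideal C n gm W"
 shows "c1 W f = c1 W h \<longleftrightarrow> f \<ominus>\<^bsub>sect (prim_curve C n gm) W\<^esub> h : core_ideal_power C n gm 2 W"
proof -
 interpret P: cring "sect (prim_curve C n gm) W" by (rule pc_cring[OF gm W])
 note fw = core_idealD[OF W f] and hw = core_idealD[OF W h]
 have d: "f \<ominus>\<^bsub>sect (prim_curve C n gm) W\<^esub> h : Tw.tw gm W"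
  using P.minus_closed[of f h] fw hw by (simp add: pc_carrier[OF gm W])
 have "(\<forall>j<2. tcf ((f \<ominus>\<^bsub>sect (prim_curve C n gm) W\<^esub> h) i) j = \<zero>\<^bsub>sect C (W Int cov gm i)\<^esub>) \<longleftrightarrow> tcf (f i) 1 = tcf (h i) 1"
  if i: "i : idx gm" for i
 proof -
  interpret U: trunc "sect C (W Int cov gm i)" n by (rule tr[OF op_Int[OF gm W i]])
  have "j < 2 \<longleftrightarrow> j = 0 \<or> j = 1" for j :: nat by auto
  then show ?thesis
   using tw_closed[OF gm fw(1) i] tw_closed[OF gm hw(1) i] n1 fw(2)[OF i] hw(2)[OF i]
   by (auto simp: pc_diff_comp[OF gm W fw(1) hw(1) i])
 qed
 then show ?thesis
  using d n1 by (auto simp: core_power_eq[OF gm W] c1_def fun_eq_iff restrict_def)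
qed

lemma c1_surj:
 assumes V: "op V" and i: "i : idx gm" "V <= cov gm i" and m: "m : Un.tw xgm V"
 shows "\<exists>r\<in>core_ideal C n gm V. c1 V r = m"
proof -
 have Vi: "V Int cov gm i = V" using i by auto
 interpret V: trunc "sect C V" n by (rule tr[OF V])
 have mi: "m i : carrier (sect C V)" using Un.tw_comp_closed[OF xgm m, of i] i Vi by simp
 let ?F = "trunc_monom (sect C V) n (m i) 1"
 let ?r = "Tw.tin gm i V ?F"
 have r: "?r : Tw.tw gm V" "?r i = ?F" using Tw.tin_closed[OF gm V.trunc_monom_closed[OF mi] V i] by auto
 have ri: "?r : core_ideal C n gm V"
  using core_local[OF gm V r(1) i] r n_pos mi by (simp add: core_zero_iff[OF gm V])
 have "c1 V ?r = m"
  by (rule Un.tw_proj_inj[OF xgm c1_closed[OF V ri] m V]) (use i r mi n1 in \<open>auto simp: c1_def\<close>)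
 then show ?thesis using ri by blast
qed

text \<open>The coefficient of t, followed by the isomorphism of a coboundary from the image cocycle
  to \<mu>, is locally surjective on I_C and identifies two sections iff they differ by a section of
  I_C^2. So \<open>quot_map\<close> applies with M the line bundle.\<close>

lemma conormal_isoI:
 assumes \<mu>: "is_cocycle (topo C) (unit_sheaf C) \<mu>" and coh: "cohomologous (topo C) (unit_sheaf C) xgm \<mu>"
 shows "conormal_iso C n gm \<mu>"
proof -
 \<comment> \<open>Reduction to multiplicity 2 shows that I_C^2 is a presheaf of ideals.\<close>
 interpret P2: thickening_pair C n 2
  using n1 by unfold_locales auto
 obtain L :: "'p set set" and W sg \<tau> h where D: "Un.cobounds \<mu> xgm L W sg \<tau> h"
  by (rule Un.cohomologousE[OF Un.cohomologous_sym[OF coh xgm \<mu>] \<mu> xgm])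
 let ?T = "Un.tht \<mu> xgm L W sg \<tau> h"
 let ?S = "prim_curve C n gm" and ?J = "core_ideal_power C n gm 2" and ?I = "core_ideal C n gm"
 define \<pi> where "\<pi> = (%W f. ?T W (c1 W f))"
 note tcl = Un.tht_closed[OF \<mu> xgm D] and tres = Un.tht_res[OF \<mu> xgm D]
 interpret Ip: ideal_presheaf ?S ?J by (rule P2.core_power_presheaf[OF gm])
 interpret M: set_sheaf "topo ?S" "Un.tw \<mu>" "Un.trs \<mu>" using Un.tw_sheaf[OF \<mu>] by simp
 have pi_closed: "\<pi> U s : Un.tw \<mu> U" if "op U" "s : ?I U" for U s
  unfolding \<pi>_def by (rule tcl[OF that(1) c1_closed[OF that]])
 have pi_inj: "\<pi> U s = \<pi> U r \<longleftrightarrow> c1 U s = c1 U r" if "op U" "s : ?I U" "r : ?I U" for U s r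
  using Un.tht_bij[OF \<mu> xgm D that(1)] c1_closed[OF that(1,2)] c1_closed[OF that(1,3)]
  by (auto simp: \<pi>_def bij_betw_def inj_on_def)
 have pi_res: "\<pi> V (Tw.trs gm U V s) = Un.trs \<mu> U V (\<pi> U s)"
  if "op U" "op V" "V <= U" "s : ?I U" for U V s
  unfolding \<pi>_def c1_res[OF that] by (rule tres[OF that(1-3) c1_closed[OF that(1,4)]])
 have pi_surj: "\<exists>V r. op V & x : V & V <= U & r : ?I V & \<pi> V r = Un.trs \<mu> U V m"
  if U: "op U" and m: "m : Un.tw \<mu> U" and x: "x : U" for U m x
 proof -
  obtain i where i: "i : idx gm" "x : cov gm i" using x Tw.cocycle_cover[OF gm] openin_subset[OF U] by blast
  let ?V = "U Int cov gm i"
  have V: "op ?V" by (rule op_Int[OF gm U i(1)])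
  have m': "Un.trs \<mu> U ?V m : Un.tw \<mu> ?V" by (rule Un.trs_closed[OF \<mu> U V _ m]) auto
  then have "Un.trs \<mu> U ?V m : ?T ?V ` Un.tw xgm ?V"
   using Un.tht_bij[OF \<mu> xgm D V] by (simp only: bij_betw_def)
  then obtain m1 where m1: "m1 : Un.tw xgm ?V" "?T ?V m1 = Un.trs \<mu> U ?V m" by (rule imageE) (rule that, simp_all)
  obtain r where "r : ?I ?V" "c1 ?V r = m1" using c1_surj[OF V i(1) _ m1(1)] by auto
  then show ?thesis using V x i m1 by (intro exI[of _ ?V] exI[of _ r]) (auto simp: \<pi>_def)
 qed
 interpret Q: quot_map ?S ?J "Un.tw \<mu>" "Un.trs \<mu>" ?I \<pi>
 proof unfold_locales
  fix U s r assume "openin (topo ?S) U" "s : ?I U" "r : ?I U"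
  then have U: "op U" "s : ?I U" "r : ?I U" by simp_all
  show "\<pi> U s = \<pi> U r \<longleftrightarrow> s \<ominus>\<^bsub>sect ?S U\<^esub> r : ?J U" using pi_inj[OF U] c1_eq_iff[OF U] by simp
 next
  fix U m x assume "openin (topo ?S) U" "m : Un.tw \<mu> U" "x : U"
  then show "\<exists>V r. openin (topo ?S) V & x : V & V <= U & r : ?I V & \<pi> V r = Un.trs \<mu> U V m"
   using pi_surj[of U m x] by simp
 qed (simp_all add: pc_carrier[OF gm] pi_closed pi_res core_ideal_res core_idealD(1) pc_rest)
 have piadd: "\<pi> U (a \<oplus>\<^bsub>sect ?S U\<^esub> b) = (\<lambda>i\<in>idx \<mu>. \<pi> U a i \<oplus>\<^bsub>sect C (U Int cov \<mu> i)\<^esub> \<pi> U b i)"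
  if U: "op U" and a: "a : ?I U" "b : ?I U" for U a b
  using c1_add[OF U core_idealD(1)[OF U a(1)] core_idealD(1)[OF U a(2)]]
   lb_tht_add[OF \<mu> xgm D U c1_closed[OF U a(1)] c1_closed[OF U a(2)]] by (simp add: \<pi>_def)
 have pimult: "\<pi> U (a \<otimes>\<^bsub>sect ?S U\<^esub> b) = (\<lambda>i\<in>idx \<mu>. rest C U (U Int cov \<mu> i) (core gm U a) \<otimes>\<^bsub>sect C (U Int cov \<mu> i)\<^esub> \<pi> U b i)"
  if U: "op U" and a: "a : Tw.tw gm U" and b: "b : ?I U" for U a b
  using c1_mult[OF U a b] lb_tht_smult[OF \<mu> xgm D U core_closed[OF gm U a] c1_closed[OF U b]] by (simp add: \<pi>_def)
 have Iadd: "a \<oplus>\<^bsub>sect ?S U\<^esub> b : ?I U" if U: "op U" and a: "a : ?I U" "b : ?I U" for U a b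
 proof -
  have "tcf ((a \<oplus>\<^bsub>sect ?S U\<^esub> b) i) 0 = \<zero>\<^bsub>sect C (U Int cov gm i)\<^esub>" if i: "i : idx gm" for i
  proof -
   interpret R: trunc "sect C (U Int cov gm i)" n by (rule tr[OF op_Int[OF gm U i]])
   show ?thesis
    using i n_pos tw_closed[OF gm core_idealD(1)[OF U a(1)] i] tw_closed[OF gm core_idealD(1)[OF U a(2)] i]
     core_idealD(2)[OF U a(1) i] core_idealD(2)[OF U a(2) i] by (simp add: pc_ops)
  qed
  then show ?thesis
   using pc_add[OF gm U core_idealD(1)[OF U a(1)] core_idealD(1)[OF U a(2)]] by (simp add: core_ideal_eq[OF gm U])
 qed
 have Imult: "a \<otimes>\<^bsub>sect ?S U\<^esub> b : ?I U" if U: "op U" and a: "a : Tw.tw gm U" and b: "b : ?I U" for U a b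
 proof -
  have "tcf ((a \<otimes>\<^bsub>sect ?S U\<^esub> b) i) 0 = \<zero>\<^bsub>sect C (U Int cov gm i)\<^esub>" if i: "i : idx gm" for i
  proof -
   interpret R: trunc "sect C (U Int cov gm i)" n by (rule tr[OF op_Int[OF gm U i]])
   show ?thesis
    using i n_pos tw_closed[OF gm a i] tw_closed[OF gm core_idealD(1)[OF U b] i]
     core_idealD(2)[OF U b i] by (simp add: pc_ops R.tcf_mult_0)
  qed
  then show ?thesis
   using pc_mult[OF gm U a core_idealD(1)[OF U b]] by (simp add: core_ideal_eq[OF gm U])
 qed
 have pre: "preim C (fst (core_incl C gm)) V = V" if "op V" for V
  using openin_subset[OF that] by (auto simp: core_incl_simps preim_def)
 have lba: "add (msec (pushforward C (core_incl C gm) (line_bundle C \<mu>)) U) = (%f h. \<lambda>i\<in>idx \<mu>. f i \<oplus>\<^bsub>sect C (U Int cov \<mu> i)\<^esub> h i)"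
  and lbc: "carrier (msec (pushforward C (core_incl C gm) (line_bundle C \<mu>)) U) = Un.tw \<mu> U"
  and lbs: "module.smult (msec (pushforward C (core_incl C gm) (line_bundle C \<mu>)) U) a f =
    (\<lambda>i\<in>idx \<mu>. rest C U (U Int cov \<mu> i) (core gm U a) \<otimes>\<^bsub>sect C (U Int cov \<mu> i)\<^esub> f i)"
  if "op U" for U a f
  using pre[OF that] lb_carrier[OF \<mu>, of U]
  by (simp_all add: pushforward_def Let_def core_def[OF gm]) (simp_all add: line_bundle_def)
 have lbr: "mres (pushforward C (core_incl C gm) (line_bundle C \<mu>)) U V f = Un.trs \<mu> U V f" if "op U" "op V" for U V f
  using pre[OF that(1)] pre[OF that(2)] by (simp add: pushforward_def line_bundle_def Un.trs_def)
 have qc: "carrier (msec (quot_module ?S ?I ?J) U) = quot_sections ?S ?I ?J U"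
  and qa: "s \<oplus>\<^bsub>msec (quot_module ?S ?I ?J) U\<^esub> r = (\<lambda>y\<in>U. s y \<oplus>\<^bsub>stalk_quot ?S ?J y\<^esub> r y)"
  and qs: "a \<odot>\<^bsub>msec (quot_module ?S ?I ?J) U\<^esub> s = (\<lambda>y\<in>U. quot_germ ?S ?J y U a \<otimes>\<^bsub>stalk_quot ?S ?J y\<^esub> s y)"
  and qr: "mres (quot_module ?S ?I ?J) U V s = restrict s V" for U V s r a
  by (simp_all add: quot_module_def)
 have smult: "Q.qmap U (\<lambda>y\<in>U. quot_germ ?S ?J y U a \<otimes>\<^bsub>stalk_quot ?S ?J y\<^esub> s y) =
   (\<lambda>i\<in>idx \<mu>. rest C U (U Int cov \<mu> i) (core gm U a) \<otimes>\<^bsub>sect C (U Int cov \<mu> i)\<^esub> Q.qmap U s i)"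
  if U: "op U" and a: "a : Tw.tw gm U" and s: "s : quot_sections ?S ?I ?J U" for U a s
 proof -
  have U': "openin (topo ?S) U" using U by simp
  note qm = Q.qmap_closed[OF U' s]
  have aS: "a : carrier (sect ?S U)" using a by (simp add: pc_carrier[OF gm U])
  \<comment> \<open>Scalar multiplication by a is treated as a binary operation that multiplies its
    first argument by the restriction of a to the open set at hand and ignores the second
    argument.\<close>
  let ?a = "%V. Tw.trs gm U V a"
  have tra: "?a V : Tw.tw gm V" if "op V" "V <= U" for V by (rule Tw.trs_closed[OF gm U that a])
  have aUU: "?a U = a" by (rule Tw.trs_id[OF gm U a])
  have "Q.qmap U (\<lambda>y\<in>U. quot_germ ?S ?J y U a \<otimes>\<^bsub>stalk_quot ?S ?J y\<^esub> s y) =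
    (%V m m'. \<lambda>i\<in>idx \<mu>. rest C V (V Int cov \<mu> i) (core gm V (?a V)) \<otimes>\<^bsub>sect C (V Int cov \<mu> i)\<^esub> m i) U (Q.qmap U s) (Q.qmap U s)"
  proof (rule Q.qmap_bop(2)[where pS="%V x y. ?a V \<otimes>\<^bsub>sect ?S V\<^esub> x" and s'=s
     and pM="%V m m'. \<lambda>i\<in>idx \<mu>. rest C V (V Int cov \<mu> i) (core gm V (?a V)) \<otimes>\<^bsub>sect C (V Int cov \<mu> i)\<^esub> m i"
     and pQ="%y u v. quot_germ ?S ?J y U a \<otimes>\<^bsub>stalk_quot ?S ?J y\<^esub> u", OF U' s s])
   show "(\<lambda>i\<in>idx \<mu>. rest C U (U Int cov \<mu> i) (core gm U (?a U)) \<otimes>\<^bsub>sect C (U Int cov \<mu> i)\<^esub> Q.qmap U s i) : Un.tw \<mu> U"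
    using lb_smult_closed[OF \<mu> U core_closed[OF gm U a] qm] by (simp add: aUU)
  next
   fix V z x y assume V: "openin (topo ?S) V" "V <= U" "z : V" "x : ?I V"
   then have "quot_germ ?S ?J z U a = quot_germ ?S ?J z V (?a V)"
    using Ip.quot_germ_rest[OF U' V(1,2,3) aS] by (simp add: pc_rest)
   then show "quot_germ ?S ?J z U a \<otimes>\<^bsub>stalk_quot ?S ?J z\<^esub> quot_germ ?S ?J z V x = quot_germ ?S ?J z V (?a V \<otimes>\<^bsub>sect ?S V\<^esub> x)"
    using ring_hom_mult[OF Ip.quot_germ_hom[OF V(1,3)], of "?a V" x] tra[of V] V core_idealD(1)[of V x]
    by (simp add: pc_carrier[OF gm])
  next
   fix V assume "openin (topo ?S) V" "V <= U"
   then have V: "op V" "V <= U" by simp_all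
   show "Un.trs \<mu> U V (\<lambda>i\<in>idx \<mu>. rest C U (U Int cov \<mu> i) (core gm U (?a U)) \<otimes>\<^bsub>sect C (U Int cov \<mu> i)\<^esub> Q.qmap U s i) =
    (\<lambda>i\<in>idx \<mu>. rest C V (V Int cov \<mu> i) (core gm V (?a V)) \<otimes>\<^bsub>sect C (V Int cov \<mu> i)\<^esub> Un.trs \<mu> U V (Q.qmap U s) i)"
   proof -
    have "rest C (U Int cov \<mu> i) (V Int cov \<mu> i) (rest C U (U Int cov \<mu> i) (core gm U a) \<otimes>\<^bsub>sect C (U Int cov \<mu> i)\<^esub> Q.qmap U s i) =
     rest C V (V Int cov \<mu> i) (core gm V (?a V)) \<otimes>\<^bsub>sect C (V Int cov \<mu> i)\<^esub> rest C (U Int cov \<mu> i) (V Int cov \<mu> i) (Q.qmap U s i)"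
     if i: "i : idx \<mu>" for i
    proof -
     note o = Un.open_Int[OF \<mu> U i] Un.open_Int[OF \<mu> V(1) i]
     have sb: "V Int cov \<mu> i <= U Int cov \<mu> i" "U Int cov \<mu> i <= U" "V Int cov \<mu> i <= V" using V by auto
     note ca = core_closed[OF gm U a]
     have "rest C (U Int cov \<mu> i) (V Int cov \<mu> i) (rest C U (U Int cov \<mu> i) (core gm U a)) = rest C V (V Int cov \<mu> i) (core gm V (?a V))"
      using rest_comp[OF U o sb(1,2) ca] rest_comp[OF U V(1) o(2) sb(3) V(2) ca] core_res[OF gm U V a] by simp
     then show ?thesis
      using rest_mult[OF o sb(1) rest_closed[OF U o(1) sb(2) ca] Un.tw_comp_closed[OF \<mu> qm i]] by simp
    qed
    then show ?thesis by (auto simp: Un.trs_def aUU intro!: restrict_ext)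
   qed
  qed (use tra pimult Imult in simp_all)
  then show ?thesis by (simp add: aUU)
 qed
 have qadd: "Q.qmap U (\<lambda>y\<in>U. s y \<oplus>\<^bsub>stalk_quot ?S ?J y\<^esub> r y) = (\<lambda>i\<in>idx \<mu>. Q.qmap U s i \<oplus>\<^bsub>sect C (U Int cov \<mu> i)\<^esub> Q.qmap U r i)"
  if U: "op U" and s: "s : quot_sections ?S ?I ?J U" "r : quot_sections ?S ?I ?J U" for U s r
 proof -
  have U': "openin (topo ?S) U" using U by simp
  note qm = Q.qmap_closed[OF U' s(1)] Q.qmap_closed[OF U' s(2)]
  show ?thesis
  proof (rule Q.qmap_bop(2)[where pS="%V x y. x \<oplus>\<^bsub>sect ?S V\<^esub> y"
     and pM="%V m m'. \<lambda>i\<in>idx \<mu>. m i \<oplus>\<^bsub>sect C (V Int cov \<mu> i)\<^esub> m' i"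
     and pQ="%y u v. u \<oplus>\<^bsub>stalk_quot ?S ?J y\<^esub> v", OF U' s])
   show "(\<lambda>i\<in>idx \<mu>. Q.qmap U s i \<oplus>\<^bsub>sect C (U Int cov \<mu> i)\<^esub> Q.qmap U r i) : Un.tw \<mu> U"
    by (rule lb_add_closed[OF \<mu> U qm])
  next
   fix V z x y assume V: "openin (topo ?S) V" "V <= U" "z : V" "x : ?I V" "y : ?I V"
   then show "quot_germ ?S ?J z V x \<oplus>\<^bsub>stalk_quot ?S ?J z\<^esub> quot_germ ?S ?J z V y = quot_germ ?S ?J z V (x \<oplus>\<^bsub>sect ?S V\<^esub> y)"
    using ring_hom_add[OF Ip.quot_germ_hom[OF V(1,3)], of x y] core_idealD(1)[of V x] core_idealD(1)[of V y]
    by (simp add: pc_carrier[OF gm])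
  next
   fix V assume "openin (topo ?S) V" "V <= U"
   then have V: "op V" "V <= U" by simp_all
   have sb: "V Int cov \<mu> i <= U Int cov \<mu> i" for i using V by auto
   show "Un.trs \<mu> U V (\<lambda>i\<in>idx \<mu>. Q.qmap U s i \<oplus>\<^bsub>sect C (U Int cov \<mu> i)\<^esub> Q.qmap U r i) =
    (\<lambda>i\<in>idx \<mu>. Un.trs \<mu> U V (Q.qmap U s) i \<oplus>\<^bsub>sect C (V Int cov \<mu> i)\<^esub> Un.trs \<mu> U V (Q.qmap U r) i)"
    using rest_add[OF Un.open_Int[OF \<mu> U] Un.open_Int[OF \<mu> V(1)] sb Un.tw_comp_closed[OF \<mu> qm(1)] Un.tw_comp_closed[OF \<mu> qm(2)]]
    by (auto simp: Un.trs_def intro!: restrict_ext)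
  qed (use piadd Iadd in simp_all)
 qed
 show ?thesis
  unfolding conormal_iso_def modsheaf_iso_def pc_topo
 proof (intro exI[of _ Q.qmap] conjI allI impI ballI)
  fix U assume U: "op U"
  then have U': "openin (topo ?S) U" by simp
  show "bij_betw (Q.qmap U) (carrier (msec (quot_module ?S ?I ?J) U)) (carrier (msec (pushforward C (core_incl C gm) (line_bundle C \<mu>)) U))"
   using Q.qmap_bij[OF U'] by (simp add: qc lbc[OF U])
 next
  fix U s r assume U: "op U" and "s : carrier (msec (quot_module ?S ?I ?J) U)" "r : carrier (msec (quot_module ?S ?I ?J) U)"
  then have s: "s : quot_sections ?S ?I ?J U" "r : quot_sections ?S ?I ?J U" by (simp_all add: qc)
  show "Q.qmap U (s \<oplus>\<^bsub>msec (quot_module ?S ?I ?J) U\<^esub> r) =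
    Q.qmap U s \<oplus>\<^bsub>msec (pushforward C (core_incl C gm) (line_bundle C \<mu>)) U\<^esub> Q.qmap U r"
   unfolding qa lba[OF U] by (rule qadd[OF U s])
 next
  fix U a s assume U: "op U" and a: "a : carrier (sect ?S U)" and "s : carrier (msec (quot_module ?S ?I ?J) U)"
  then have s: "s : quot_sections ?S ?I ?J U" by (simp add: qc)
  show "Q.qmap U (a \<odot>\<^bsub>msec (quot_module ?S ?I ?J) U\<^esub> s) =
    a \<odot>\<^bsub>msec (pushforward C (core_incl C gm) (line_bundle C \<mu>)) U\<^esub> Q.qmap U s"
   unfolding qs lbs[OF U] using smult[OF U _ s] a by (simp add: pc_carrier[OF gm U])
 next
  fix U V s assume as: "op U & op V & V <= U & s : carrier (msec (quot_module ?S ?I ?J) U)"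
  then have "Q.qmap V (restrict s V) = Un.trs \<mu> U V (Q.qmap U s)"
   using Q.qmap_restrict[of U V s] by (simp add: qc)
  then show "Q.qmap V (mres (quot_module ?S ?I ?J) U V s) =
    mres (pushforward C (core_incl C gm) (line_bundle C \<mu>)) U V (Q.qmap U s)"
   using as lbr[of U V] by (simp add: qr)
 qed
qed

end

end

section \<open>Lifting automorphisms from R[t]/(t^n) to R[t]/(t^(n+1))\<close>

context trunc
begin

text \<open>The map preserves the filtration by powers of t and acts on the graded piece
  (t^k)/(t^(k+1)) as multiplication by \<nu>_0^k, where the unit \<nu>_0 is the coefficient of t in
  ph t. Injectivity and surjectivity follow degree by degree.\<close>

lemma trunc_hom_bij:
 assumes ph: "ph : ring_hom B B" and ph0: "!!F. F : carrier B ==> tcf (ph F) 0 = tcf F 0"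
  and u: "tcf (ph tt) 1 : Units R" and n1: "1 < n"
 shows "bij_betw ph (carrier B) (carrier B)"
proof -
 have n0: "0 < n" using n1 by simp
 interpret ph: ring_hom_cring B B ph by (rule ring_hom_cringI[OF B.is_cring B.is_cring ph])
 let ?\<nu> = "tdrop 1 (ph tt)"
 have \<nu>t: "ph tt = tt \<otimes>\<^bsub>B\<^esub> ?\<nu>"
  using tvan_factor[OF _ tvan_hom_t[OF ph ph0 n0]] by simp
 have \<nu>u: "tcf ?\<nu> 0 : Units R" using u n1 by simp
 have \<nu>: "?\<nu> : carrier B" by simp
 have \<nu>p: "tcf (?\<nu> [^]\<^bsub>B\<^esub> k) 0 = tcf ?\<nu> 0 [^] k" for k :: nat
  by (induction k) (use n0 \<nu> in \<open>simp_all add: tcf_mult_0\<close>)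
 have lead: "tcf (ph (tt [^]\<^bsub>B\<^esub> k \<otimes>\<^bsub>B\<^esub> G)) k = tcf ?\<nu> 0 [^] k \<otimes> tcf G 0"
  if G: "G : carrier B" and k: "k < n" for k G
 proof -
  have "ph (tt [^]\<^bsub>B\<^esub> k \<otimes>\<^bsub>B\<^esub> G) = (tt \<otimes>\<^bsub>B\<^esub> ?\<nu>) [^]\<^bsub>B\<^esub> k \<otimes>\<^bsub>B\<^esub> ph G" using G \<nu>t by simp
  also have "\<dots> = tt [^]\<^bsub>B\<^esub> k \<otimes>\<^bsub>B\<^esub> (?\<nu> [^]\<^bsub>B\<^esub> k \<otimes>\<^bsub>B\<^esub> ph G)"
   using G \<nu> by (simp add: B.nat_pow_distrib B.m_assoc)
  finally show ?thesis using G \<nu> k n0 by (simp add: tt_pow tcf_mult_0 \<nu>p ph0)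
 qed
 have pu: "tcf ?\<nu> 0 [^] (k::nat) : Units R" for k using \<nu>u Units_pow_closed by blast
 have inj: "tvan k F" if F: "F : carrier B" and z: "ph F = \<zero>\<^bsub>B\<^esub>" and "k \<le> n" for F k
  using \<open>k \<le> n\<close>
 proof (induction k)
  case (Suc k)
  then have v: "tvan k F" and k: "k < n" by auto
  have "tcf ?\<nu> 0 [^] k \<otimes> tcf (tdrop k F) 0 = \<zero>"
   using lead[OF tdrop_closed[OF F] k, of k] tvan_factor[OF F v] z k by simp
  then have "tcf ?\<nu> 0 [^] k \<otimes> tcf F k = tcf ?\<nu> 0 [^] k \<otimes> \<zero>" using F k n0 \<nu> by simp
  then have "tcf F k = \<zero>" using F k Units_l_cancel[OF pu[of k], of "tcf F k" "\<zero>"] by blast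
  then show ?case using v by (auto simp: tvan_def less_Suc_eq)
 qed simp
 have "inj_on ph (carrier B)"
 proof (rule inj_onI)
  fix F G assume F: "F : carrier B" "G : carrier B" and e: "ph F = ph G"
  have "ph (F \<ominus>\<^bsub>B\<^esub> G) = \<zero>\<^bsub>B\<^esub>" using F e by (simp add: a_minus_def B.r_neg)
  then have "F \<ominus>\<^bsub>B\<^esub> G = \<zero>\<^bsub>B\<^esub>" using inj[of "F \<ominus>\<^bsub>B\<^esub> G" n] F by (simp add: tvan_eq_zero)
  then show "F = G" using F by simp
 qed
 moreover have sur: "H : ph ` carrier B" if "H : carrier B" "tvan (n - k) H" "k \<le> n" for H k
  using that
 proof (induction k arbitrary: H)
  case 0
  then have "H = ph \<zero>\<^bsub>B\<^esub>" by (simp add: tvan_eq_zero)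
  then show ?case by blast
 next
  case (Suc k)
  let ?m = "n - Suc k"
  have m: "?m < n" "Suc ?m = n - k" using Suc.prems by auto
  \<comment> \<open>Chosen so that ph (t^m a) has the same lowest coefficient \<nu>_0^m a as H. The
    difference then lies one step deeper in the filtration.\<close>
  let ?a = "inv (tcf ?\<nu> 0 [^] ?m) \<otimes> tcf H ?m"
  have a: "?a : carrier R" using pu[of ?m] Suc.prems by simp
  let ?F = "tt [^]\<^bsub>B\<^esub> ?m \<otimes>\<^bsub>B\<^esub> tconst ?a"
  have F: "?F : carrier B" using a by simp
  have Fv: "tvan ?m (ph ?F)"
   by (rule tvan_hom[OF ph ph0 n0 F]) (use a in \<open>simp_all add: tt_pow tvan_monom_mult\<close>)
  have "tcf (ph ?F) ?m = tcf ?\<nu> 0 [^] ?m \<otimes> ?a" using lead[OF trunc_monom_closed[OF a] m(1), of 0] a n0 by simp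
  also have "\<dots> = tcf H ?m" using pu[of ?m] Suc.prems \<nu>
   by (simp add: m_assoc[symmetric] Units_r_inv)
  finally have "tvan (n - k) (H \<ominus>\<^bsub>B\<^esub> ph ?F)"
   using Suc.prems Fv F m unfolding tvan_def by (auto simp: less_Suc_eq simp flip: m(2))
  then have "H \<ominus>\<^bsub>B\<^esub> ph ?F : ph ` carrier B" using Suc.IH[of "H \<ominus>\<^bsub>B\<^esub> ph ?F"] Suc.prems F by simp
  then obtain G where G: "G : carrier B" "H \<ominus>\<^bsub>B\<^esub> ph ?F = ph G" by blast
  have "H = ph G \<oplus>\<^bsub>B\<^esub> ph ?F" using Suc.prems F G(1) by (simp add: G(2)[symmetric] a_minus_def B.a_assoc B.l_neg)
  then have "H = ph (G \<oplus>\<^bsub>B\<^esub> ?F)" using G F by simp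
  then show ?case using G F by blast
 qed
 have "carrier B <= ph ` carrier B" using sur[of _ n] by (auto simp: tvan_def)
 ultimately show ?thesis by (auto simp: bij_betw_def)
qed

end

text \<open>The derivation \<open>t d/dt\<close> of \<open>R[t]/(t\<^sup>n)\<close>.\<close>

locale trunc_alg = trunc R n for R :: "'a ring" (structure) and n +
 fixes \<kappa> :: "complex => 'a"
 assumes \<kappa>: "\<kappa> : ring_hom complex_ring R"
begin

lemma \<kappa>_closed [simp, intro]: "\<kappa> z : carrier R"
 using ring_hom_closed[OF \<kappa>, of z] by (simp add: ring_of_type_algebra_def)

lemma \<kappa>_mult: "\<kappa> y \<otimes> \<kappa> z = \<kappa> (y * z)"
 using ring_hom_mult[OF \<kappa>, of y z] by (simp add: ring_of_type_algebra_def)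

lemma \<kappa>_add: "\<kappa> y \<oplus> \<kappa> z = \<kappa> (y + z)"
 using ring_hom_add[OF \<kappa>, of y z] by (simp add: ring_of_type_algebra_def)

lemma \<kappa>_one [simp]: "\<kappa> 1 = \<one>"
 using ring_hom_one[OF \<kappa>] by (simp add: ring_of_type_algebra_def)

lemma \<kappa>_zero [simp]: "\<kappa> 0 = \<zero>"
 using \<kappa>_add[of 0 0] by (simp add: a_comm)

text \<open>Nonzero complex numbers act invertibly on R. For integers this is the form in which
  characteristic zero is used.\<close>

lemma \<kappa>_cancel: "[|a : carrier R; \<kappa> z \<otimes> a = \<zero>; z \<noteq> 0|] ==> a = \<zero>"
proof -
 assume a: "a : carrier R" and e: "\<kappa> z \<otimes> a = \<zero>" and z: "z \<noteq> 0"
 have "a = \<kappa> (inverse z * z) \<otimes> a" using a z by simp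
 also have "\<dots> = \<kappa> (inverse z) \<otimes> (\<kappa> z \<otimes> a)" using a by (simp add: \<kappa>_mult[symmetric] m_assoc)
 finally show "a = \<zero>" using e by simp
qed

text \<open>Unlike d/dt, the operator t d/dt maps (t^n) into itself, so it acts on R[t]/(t^n), and
  it does so diagonally.\<close>

definition eul :: "(nat => 'a) set => (nat => 'a) set" where
 "eul F = trunc_of R n (%i. \<kappa> (of_nat i) \<otimes> tcf F i)"

lemma eul_closed [simp, intro]: "F : carrier B ==> eul F : carrier B"
 unfolding eul_def by (rule trunc_of_closed) auto

lemma tcf_eul [simp]: "[|F : carrier B; i < n|] ==> tcf (eul F) i = \<kappa> (of_nat i) \<otimes> tcf F i"
 unfolding eul_def by (rule tcf_trunc_of) auto

lemma eul_add: "[|F : carrier B; G : carrier B|] ==> eul (F \<oplus>\<^bsub>B\<^esub> G) = eul F \<oplus>\<^bsub>B\<^esub> eul G"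
 by (rule trunc_eqI) (auto simp: r_distr)

lemma eul_const: "a : carrier R ==> eul (tconst a) = \<zero>\<^bsub>B\<^esub>"
 by (rule trunc_eqI) auto

lemma eul_tt: "eul tt = tt"
 by (rule trunc_eqI) (auto simp: )

text \<open>The rule is checked for F a constant or t and passes to sums and products in F, with G
  arbitrary throughout. For F = t it comes down to i = 1 + (i - 1).\<close>

lemma eul_mult:
 assumes F: "F : carrier B" and G: "G : carrier B"
 shows "eul (F \<otimes>\<^bsub>B\<^esub> G) = eul F \<otimes>\<^bsub>B\<^esub> G \<oplus>\<^bsub>B\<^esub> F \<otimes>\<^bsub>B\<^esub> eul G"
proof -
 have "\<forall>G\<in>carrier B. eul (F \<otimes>\<^bsub>B\<^esub> G) = eul F \<otimes>\<^bsub>B\<^esub> G \<oplus>\<^bsub>B\<^esub> F \<otimes>\<^bsub>B\<^esub> eul G"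
  using F
 proof (induction rule: trunc_induct)
  case (const a)
  show ?case
  proof
   fix G assume G: "G : carrier B"
   show "eul (tconst a \<otimes>\<^bsub>B\<^esub> G) = eul (tconst a) \<otimes>\<^bsub>B\<^esub> G \<oplus>\<^bsub>B\<^esub> tconst a \<otimes>\<^bsub>B\<^esub> eul G"
    using const G by (intro trunc_eqI) (auto simp: eul_const m_lcomm)
  qed
 next
  case t
  show ?case
  proof
   fix G assume G: "G : carrier B"
   show "eul (tt \<otimes>\<^bsub>B\<^esub> G) = eul tt \<otimes>\<^bsub>B\<^esub> G \<oplus>\<^bsub>B\<^esub> tt \<otimes>\<^bsub>B\<^esub> eul G"
   proof (rule trunc_eqI)
    fix i assume i: "i < n"
    have "\<kappa> (of_nat i) \<otimes> tcf G (i - 1) = tcf G (i - 1) \<oplus> \<kappa> (of_nat (i - 1)) \<otimes> tcf G (i - 1)" if "0 < i"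
    proof -
     have "\<kappa> (of_nat i) = \<one> \<oplus> \<kappa> (of_nat (i - 1))" using that by (simp flip: \<kappa>_one add: \<kappa>_add del: \<kappa>_one)
     then show ?thesis using G by (simp add: l_distr)
    qed
    then show "tcf (eul (tt \<otimes>\<^bsub>B\<^esub> G)) i = tcf (eul tt \<otimes>\<^bsub>B\<^esub> G \<oplus>\<^bsub>B\<^esub> tt \<otimes>\<^bsub>B\<^esub> eul G) i"
     using G i by (auto simp: eul_tt)
   qed (use G in auto)
  qed
 next
  case (add F H)
  then show ?case by (auto simp: eul_add B.l_distr B.a_ac)
 next
  case (mult F H)
  show ?case
  proof
   fix G assume G: "G : carrier B"
   have "eul (F \<otimes>\<^bsub>B\<^esub> H \<otimes>\<^bsub>B\<^esub> G) = eul (F \<otimes>\<^bsub>B\<^esub> (H \<otimes>\<^bsub>B\<^esub> G))" using mult G by (simp add: B.m_assoc)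
   also have "\<dots> = eul F \<otimes>\<^bsub>B\<^esub> (H \<otimes>\<^bsub>B\<^esub> G) \<oplus>\<^bsub>B\<^esub> F \<otimes>\<^bsub>B\<^esub> (eul H \<otimes>\<^bsub>B\<^esub> G \<oplus>\<^bsub>B\<^esub> H \<otimes>\<^bsub>B\<^esub> eul G)"
    using mult G by simp
   also have "\<dots> = (eul F \<otimes>\<^bsub>B\<^esub> H \<oplus>\<^bsub>B\<^esub> F \<otimes>\<^bsub>B\<^esub> eul H) \<otimes>\<^bsub>B\<^esub> G \<oplus>\<^bsub>B\<^esub> F \<otimes>\<^bsub>B\<^esub> H \<otimes>\<^bsub>B\<^esub> eul G"
    using mult G by (simp add: B.l_distr B.r_distr B.m_assoc B.a_assoc)
   also have "eul F \<otimes>\<^bsub>B\<^esub> H \<oplus>\<^bsub>B\<^esub> F \<otimes>\<^bsub>B\<^esub> eul H = eul (F \<otimes>\<^bsub>B\<^esub> H)" using mult by simp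
   finally show "eul (F \<otimes>\<^bsub>B\<^esub> H \<otimes>\<^bsub>B\<^esub> G) = eul (F \<otimes>\<^bsub>B\<^esub> H) \<otimes>\<^bsub>B\<^esub> G \<oplus>\<^bsub>B\<^esub> F \<otimes>\<^bsub>B\<^esub> H \<otimes>\<^bsub>B\<^esub> eul G" .
  qed
 qed
 then show ?thesis using G by blast
qed

end

text \<open>Lifting an automorphism \<open>\<phi>\<close> of \<open>R[t]/(t\<^sup>n)\<close> to \<open>R[t]/(t\<^sup>n\<^sup>+\<^sup>1)\<close>.  Since the characteristic is
 zero, \<open>\<phi>\<^sup>-\<^sup>1 \<circ> t d/dt \<circ> \<phi> = t Y\<close> for a derivation \<open>Y\<close>; setting \<open>t d/dt (\<phi> f) = t M f\<close> with
 \<open>M f = \<phi>(t)/t \<cdot> \<phi>(Y f)\<close> also in degree \<open>n\<close> prescribes the missing coefficient, and the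
 Leibniz rule for \<open>M\<close> makes the result multiplicative.\<close>

locale trunc_lift = trunc_alg R n \<kappa> for R :: "'a ring" (structure) and n \<kappa> +
 fixes ph \<psi> :: "(nat => 'a) set => (nat => 'a) set"
 assumes n1: "1 < n"
  and ph: "ph : ring_hom B B" and ph0: "!!F. F : carrier B ==> tcf (ph F) 0 = tcf F 0"
  and ph\<kappa>: "ph (trunc_monom R n (\<kappa> z) 0) = trunc_monom R n (\<kappa> z) 0"
  and \<psi>: "\<psi> : ring_hom B B"
  and ph\<psi>: "F : carrier B ==> ph (\<psi> F) = F" and \<psi>ph: "F : carrier B ==> \<psi> (ph F) = F"
  and unit: "tcf (ph (trunc_t R n)) 1 : Units R"
begin

interpretation ph: ring_hom_cring B B ph by (rule ring_hom_cringI[OF B.is_cring B.is_cring ph])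
interpretation \<psi>: ring_hom_cring B B \<psi> by (rule ring_hom_cringI[OF B.is_cring B.is_cring \<psi>])
interpretation T: trunc_alg R "Suc n" \<kappa> by unfold_locales (rule \<kappa>)
interpretation con: ring_hom_cring R B tconst by (rule ring_hom_cringI[OF is_cring B.is_cring tconst_hom])

lemma n0: "0 < n" using n1 by simp

lemma \<psi>0: "F : carrier B ==> tcf (\<psi> F) 0 = tcf F 0"
 using ph0[of "\<psi> F"] ph\<psi>[of F] by simp

text \<open>The conjugate of t d/dt by ph, restricted to constants. It is a derivation with values
  in (t), because t d/dt kills constant terms and \<psi> preserves them.\<close>

definition vX :: "'a => (nat => 'a) set" where "vX f = \<psi> (eul (ph (tconst f)))"
definition vY :: "'a => (nat => 'a) set" where "vY f = tdrop 1 (vX f)"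
definition vnu :: "(nat => 'a) set" where "vnu = tdrop 1 (ph tt)"
text \<open>Applying ph to X f = t Y f, with ph t = t \<nu>, gives t M f = t d/dt (ph f).
  Multiplication by t kills degree n - 1, so this equation leaves the coefficient of M f there free;
  the formula fixes it in such a way that M obeys a Leibniz rule.\<close>

definition vM :: "'a => (nat => 'a) set" where "vM f = vnu \<otimes>\<^bsub>B\<^esub> ph (vY f)"
text \<open>Multiplication by t as a map from R[t]/(t^n) to R[t]/(t^(n+1)); unlike multiplication by
  t inside R[t]/(t^n) it loses no coefficient.\<close>

definition up1 :: "(nat => 'a) set => (nat => 'a) set" where
 "up1 G = trunc_of R (Suc n) (%i. if i = 0 then \<zero> else tcf G (i - 1))"
text \<open>Below degree n the coefficients are those of ph f. The coefficient a in degree n has to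
  satisfy n a = (M f)_(n-1), so that t d/dt of the lift equals t M f in that degree too.\<close>

definition lift0 :: "'a => (nat => 'a) set" where
 "lift0 f = trunc_of R (Suc n) (%i. if i < n then tcf (ph (tconst f)) i else \<kappa> (1 / of_nat n) \<otimes> tcf (vM f) (n - 1))"

lemma closed [simp, intro]:
 "f : carrier R ==> vX f : carrier B" "f : carrier R ==> vY f : carrier B" "vnu : carrier B"
 "f : carrier R ==> vM f : carrier B"
 by (auto simp: vX_def vY_def vnu_def vM_def)

lemma up1_closed [simp, intro]: "G : carrier B ==> up1 G : carrier T.B"
 unfolding up1_def by (rule T.trunc_of_closed) auto

lemma tcf_up1 [simp]: "[|G : carrier B; i < Suc n|] ==> tcf (up1 G) i = (if i = 0 then \<zero> else tcf G (i - 1))"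
 unfolding up1_def by (subst T.tcf_trunc_of) auto

lemma lift0_closed [simp, intro]: "f : carrier R ==> lift0 f : carrier T.B"
 unfolding lift0_def by (rule T.trunc_of_closed) auto

lemma tcf_lift0: "[|f : carrier R; i < Suc n|] ==>
  tcf (lift0 f) i = (if i < n then tcf (ph (tconst f)) i else \<kappa> (1 / of_nat n) \<otimes> tcf (vM f) (n - 1))"
 unfolding lift0_def by (subst T.tcf_trunc_of) auto

lemma red_lift0: "f : carrier R ==> trunc_red R n (lift0 f) = ph (tconst f)"
 by (rule trunc_eqI) (auto simp: T.tcf_red tcf_lift0 intro: ring_hom_closed[OF T.trunc_red_hom])

lemma vX_t: "f : carrier R ==> vX f = tt \<otimes>\<^bsub>B\<^esub> vY f"
proof -
 assume f: "f : carrier R"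
 have "tvan 1 (vX f)" using f n0 by (simp add: tvan_def vX_def \<psi>0)
 from tvan_factor[OF closed(1)[OF f] this] show ?thesis by (simp add: vY_def)
qed

lemma vX_add: "[|f : carrier R; g : carrier R|] ==> vX (f \<oplus> g) = vX f \<oplus>\<^bsub>B\<^esub> vX g"
 by (simp add: vX_def eul_add)

lemma vX_mult: "[|f : carrier R; g : carrier R|] ==> vX (f \<otimes> g) = tconst g \<otimes>\<^bsub>B\<^esub> vX f \<oplus>\<^bsub>B\<^esub> tconst f \<otimes>\<^bsub>B\<^esub> vX g"
 by (simp add: vX_def eul_mult \<psi>ph B.m_comm)

lemma vY_add: "[|f : carrier R; g : carrier R|] ==> vY (f \<oplus> g) = vY f \<oplus>\<^bsub>B\<^esub> vY g"
 by (rule trunc_eqI) (auto simp: vY_def vX_add)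

text \<open>Division by t sets the top coefficient to zero, but \<open>tdrop 1\<close> commutes with
  multiplication by constants, so the Leibniz rule of X survives in all degrees, the top one
  included.\<close>

lemma vY_mult: "[|f : carrier R; g : carrier R|] ==> vY (f \<otimes> g) = tconst g \<otimes>\<^bsub>B\<^esub> vY f \<oplus>\<^bsub>B\<^esub> tconst f \<otimes>\<^bsub>B\<^esub> vY g"
 by (rule trunc_eqI) (auto simp: vY_def vX_mult)

lemma vM_add: "[|f : carrier R; g : carrier R|] ==> vM (f \<oplus> g) = vM f \<oplus>\<^bsub>B\<^esub> vM g"
 by (simp add: vM_def vY_add B.r_distr)

lemma vM_mult: "[|f : carrier R; g : carrier R|] ==>
  vM (f \<otimes> g) = vM f \<otimes>\<^bsub>B\<^esub> ph (tconst g) \<oplus>\<^bsub>B\<^esub> ph (tconst f) \<otimes>\<^bsub>B\<^esub> vM g"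
 by (simp add: vM_def vY_mult B.r_distr B.m_ac)

lemma vM_\<kappa>: "vM (\<kappa> z) = \<zero>\<^bsub>B\<^esub>"
proof -
 have "vX (\<kappa> z) = \<zero>\<^bsub>B\<^esub>" by (simp add: vX_def ph\<kappa> eul_const)
 then have "vY (\<kappa> z) = \<zero>\<^bsub>B\<^esub>" by (intro trunc_eqI) (auto simp: vY_def)
 then show ?thesis by (simp add: vM_def)
qed

lemma ph_tt: "ph tt = tt \<otimes>\<^bsub>B\<^esub> vnu"
 using tvan_factor[OF _ tvan_hom_t[OF ph ph0 n0]] by (simp add: vnu_def)

lemma tt_vM: "f : carrier R ==> tt \<otimes>\<^bsub>B\<^esub> vM f = eul (ph (tconst f))"
proof -
 assume f: "f : carrier R"
 have "tt \<otimes>\<^bsub>B\<^esub> vM f = ph tt \<otimes>\<^bsub>B\<^esub> ph (vY f)" using f by (simp add: vM_def ph_tt B.m_assoc)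
 also have "\<dots> = ph (vX f)" using f by (simp add: vX_t)
 finally show ?thesis using f by (simp add: vX_def ph\<psi>)
qed

text \<open>Below degree n this is t M f = t d/dt (ph f); in degree n it is the choice of the last
  coefficient.\<close>

lemma eul_lift0: "f : carrier R ==> T.eul (lift0 f) = up1 (vM f)"
proof (rule T.trunc_eqI)
 fix i assume f: "f : carrier R" and i: "i < Suc n"
 show "tcf (T.eul (lift0 f)) i = tcf (up1 (vM f)) i"
 proof (cases "i < n")
  case True
  have "tcf (eul (ph (tconst f))) i = tcf (tt \<otimes>\<^bsub>B\<^esub> vM f) i" using tt_vM[OF f] by simp
  then show ?thesis using f i True by (auto simp: tcf_lift0)
 next
  case False
  then have "i = n" using i by simp
  then show ?thesis using f n0 by (simp add: tcf_lift0 m_assoc[symmetric] \<kappa>_mult)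
 qed
qed auto

lemma up1_add: "[|F : carrier B; G : carrier B|] ==> up1 (F \<oplus>\<^bsub>B\<^esub> G) = up1 F \<oplus>\<^bsub>T.B\<^esub> up1 G"
 by (rule T.trunc_eqI) auto

lemma red_closed: "H : carrier T.B ==> trunc_red R n H : carrier B"
 by (rule ring_hom_closed[OF T.trunc_red_hom]) simp_all

lemma red_ops:
 "[|H : carrier T.B; H' : carrier T.B|] ==> trunc_red R n (H \<otimes>\<^bsub>T.B\<^esub> H') = trunc_red R n H \<otimes>\<^bsub>B\<^esub> trunc_red R n H'"
 "[|H : carrier T.B; H' : carrier T.B|] ==> trunc_red R n (H \<oplus>\<^bsub>T.B\<^esub> H') = trunc_red R n H \<oplus>\<^bsub>B\<^esub> trunc_red R n H'"
 using ring_hom_mult[OF T.trunc_red_hom[of n]] ring_hom_add[OF T.trunc_red_hom[of n]] by auto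

lemma red_monom: "a : carrier R ==> trunc_red R n (trunc_monom R (Suc n) a m) = trunc_monom R n a m"
 by (rule trunc_eqI) (auto simp: T.tcf_red red_closed)

text \<open>Multiplication by t identifies R[t]/(t^n) with the ideal (t) as a module over
  R[t]/(t^(n+1)), which acts on the former through reduction. The identity is verified on the
  generators of that ring.\<close>

lemma up1_mult:
 assumes H: "H : carrier T.B" and G: "G : carrier B"
 shows "up1 (G \<otimes>\<^bsub>B\<^esub> trunc_red R n H) = up1 G \<otimes>\<^bsub>T.B\<^esub> H"
proof -
 have m: "up1 (trunc_monom R n a m \<otimes>\<^bsub>B\<^esub> G) = trunc_monom R (Suc n) a m \<otimes>\<^bsub>T.B\<^esub> up1 G"
  if a: "a : carrier R" and G: "G : carrier B" for a m G
 proof (rule T.trunc_eqI)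
  fix i assume i: "i < Suc n"
  then have "i - 1 < n" using n0 by auto
  moreover have "i - 1 - m = i - m - 1" by simp
  ultimately show "tcf (up1 (trunc_monom R n a m \<otimes>\<^bsub>B\<^esub> G)) i = tcf (trunc_monom R (Suc n) a m \<otimes>\<^bsub>T.B\<^esub> up1 G) i"
   using a G i by auto
 qed (use a G in auto)
 have "\<forall>G\<in>carrier B. up1 (G \<otimes>\<^bsub>B\<^esub> trunc_red R n H) = up1 G \<otimes>\<^bsub>T.B\<^esub> H"
  using H
 proof (induction rule: T.trunc_induct)
  case (const a)
  then show ?case using m[OF const, of _ 0] by (auto simp: red_monom B.m_comm T.B.m_comm)
 next
  case t
  then show ?case using m[OF one_closed, of _ 1] by (auto simp: red_monom B.m_comm T.B.m_comm)
 next
  case (add F H)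
  then show ?case by (auto simp: red_ops red_closed B.r_distr T.B.r_distr up1_add)
 next
  case (mult F H)
  then show ?case by (auto simp: red_ops red_closed B.m_assoc[symmetric] T.B.m_assoc[symmetric])
 qed
 then show ?thesis using G by blast
qed

text \<open>For products, the Leibniz rules of t d/dt and of M show that t d/dt takes the same value
  on both sides. Below degree n the sides agree because ph is multiplicative; in degree n the factor
  n can be cancelled.\<close>

lemma lift0_hom: "lift0 : ring_hom R T.B"
proof (rule ring_hom_memI)
 fix f g assume f: "f : carrier R" and g: "g : carrier R"
 show "lift0 f : carrier T.B" using f by simp
 show "lift0 (f \<oplus> g) = lift0 f \<oplus>\<^bsub>T.B\<^esub> lift0 g"
  using f g n0 by (intro T.trunc_eqI) (auto simp: tcf_lift0 vM_add r_distr)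
 let ?d = "lift0 (f \<otimes> g)" and ?e = "lift0 f \<otimes>\<^bsub>T.B\<^esub> lift0 g"
 have "T.eul ?e = up1 (vM f) \<otimes>\<^bsub>T.B\<^esub> lift0 g \<oplus>\<^bsub>T.B\<^esub> lift0 f \<otimes>\<^bsub>T.B\<^esub> up1 (vM g)"
  using f g by (simp add: T.eul_mult eul_lift0)
 also have "\<dots> = up1 (vM f \<otimes>\<^bsub>B\<^esub> ph (tconst g)) \<oplus>\<^bsub>T.B\<^esub> up1 (vM g \<otimes>\<^bsub>B\<^esub> ph (tconst f))"
  using f g up1_mult[of "lift0 g" "vM f"] up1_mult[of "lift0 f" "vM g"] by (simp add: red_lift0 T.B.m_comm)
 also have "\<dots> = up1 (vM (f \<otimes> g))" using f g by (simp add: vM_mult up1_add B.m_comm)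
 finally have E: "T.eul ?e = T.eul ?d" using f g by (simp add: eul_lift0)
 show "?d = ?e"
 proof (rule T.trunc_eqI)
  fix i assume i: "i < Suc n"
  show "tcf ?d i = tcf ?e i"
  proof (cases "i < n")
   case True
   have "trunc_red R n ?d = trunc_red R n ?e" using f g by (simp add: red_lift0 red_ops)
   then show ?thesis
    using True T.tcf_red[of ?d n i] T.tcf_red[of ?e n i] f g by simp
  next
   case False
   then have i0: "of_nat i \<noteq> (0::complex)" using n0 by simp
   have "\<kappa> (of_nat i) \<otimes> (tcf ?d i \<ominus> tcf ?e i) = \<zero>"
   proof -
    have "\<kappa> (of_nat i) \<otimes> tcf ?d i = \<kappa> (of_nat i) \<otimes> tcf ?e i"
     using arg_cong[OF E, of "%F. tcf F i"] f g i by simp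
    then show ?thesis using f g by (simp add: a_minus_def r_distr r_minus r_neg)
   qed
   from \<kappa>_cancel[OF _ this i0] have "tcf ?d i \<ominus> tcf ?e i = \<zero>" using f g by simp
   then show ?thesis using f g by simp
  qed
 qed (use f g in auto)
next
 show "lift0 \<one> = \<one>\<^bsub>T.B\<^esub>"
  using n0 ph.hom_one vM_\<kappa>[of 1] by (intro T.trunc_eqI) (auto simp: tcf_lift0 simp flip: one_trunc_monom)
qed

text \<open>Constants go to \<open>lift0\<close> and t goes to t \<nu>, where the coefficient of
  t^n, left open by ph, is zero because \<open>vnu\<close> has top coefficient zero. The image of t
  has no constant term, so its power n + 1 vanishes and the universal property applies. Bijectivity
  follows from the unit coefficient of t.\<close>

lemma lift_exists:
 obtains \<Phi> where "\<Phi> : ring_hom T.B T.B" "!!a. a : carrier R ==> \<Phi> (T.tconst a) = lift0 a" "\<Phi> T.tt = up1 vnu"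
  "!!F. F : carrier T.B ==> trunc_red R n (\<Phi> F) = ph (trunc_red R n F)"
  "bij_betw \<Phi> (carrier T.B) (carrier T.B)" "!!F. F : carrier T.B ==> tcf (\<Phi> F) 0 = tcf F 0"
  "!!z. \<Phi> (T.tconst (\<kappa> z)) = T.tconst (\<kappa> z)"
proof -
 have nil: "up1 vnu [^]\<^bsub>T.B\<^esub> Suc n = \<zero>\<^bsub>T.B\<^esub>"
  by (rule T.tvan_nilpotent) (auto simp: T.tvan_def)
 obtain \<Phi> where \<Phi>: "\<Phi> : ring_hom T.B T.B" "!!a. a : carrier R ==> \<Phi> (T.tconst a) = lift0 a" "\<Phi> T.tt = up1 vnu"
  by (rule T.trunc_eval[OF T.B.is_cring lift0_hom up1_closed[OF closed(3)] nil]) blast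
 have cl: "\<Phi> F : carrier T.B" if "F : carrier T.B" for F by (rule ring_hom_closed[OF \<Phi>(1) that])
 have red: "trunc_red R n (\<Phi> F) = ph (trunc_red R n F)" if F: "F : carrier T.B" for F
 proof -
  have "(trunc_red R n \<circ> \<Phi>) F = (ph \<circ> trunc_red R n) F"
  proof (rule T.trunc_hom_eqI[OF B.is_cring ring_hom_trans[OF \<Phi>(1) T.trunc_red_hom] ring_hom_trans[OF T.trunc_red_hom ph] _ _ F])
   show "(trunc_red R n \<circ> \<Phi>) (T.tconst a) = (ph \<circ> trunc_red R n) (T.tconst a)" if "a : carrier R" for a
    using that by (simp add: \<Phi>(2) red_lift0 red_monom)
   have "trunc_red R n (up1 vnu) = tt \<otimes>\<^bsub>B\<^esub> vnu"
    by (rule trunc_eqI) (auto simp: red_closed T.tcf_red)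
   then show "(trunc_red R n \<circ> \<Phi>) T.tt = (ph \<circ> trunc_red R n) T.tt"
    by (simp add: \<Phi>(3) red_monom ph_tt)
  qed simp_all
  then show ?thesis by simp
 qed
 have z: "tcf (\<Phi> F) 0 = tcf F 0" if F: "F : carrier T.B" for F
  using T.tcf_red[OF cl[OF F], of n 0] T.tcf_red[OF F, of n 0] red[OF F] ph0[OF red_closed[OF F]] n0 by simp
 have "tcf (\<Phi> T.tt) 1 : Units R" using unit n1 by (simp add: \<Phi>(3) vnu_def)
 then have "bij_betw \<Phi> (carrier T.B) (carrier T.B)"
  using n1 by (intro T.trunc_hom_bij[OF \<Phi>(1) z]) auto
 moreover have "\<Phi> (T.tconst (\<kappa> z)) = T.tconst (\<kappa> z)" for z
  using n0 by (intro T.trunc_eqI) (auto simp: \<Phi>(2) tcf_lift0 ph\<kappa> vM_\<kappa>)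
 ultimately show ?thesis using that \<Phi> red z by blast
qed

end

context thickening
begin

text \<open>The coefficient of t in the image of t is a unit because it is the value of
  \<open>xi\<close>, a morphism to the sheaf of units.\<close>

lemma aut_trunc_lift:
 assumes n1: "1 < n" and U: "op U" and ph: "ph : aut_set C n U" and V: "op V" "V <= U"
 shows "trunc_lift (sect C V) n (scal C V) (ph V) (inv_into (carrier (th V)) (ph V))"
proof -
 interpret V: trunc "sect C V" n by (rule tr[OF V(1)])
 let ?\<psi> = "inv_into (carrier (th V)) (ph V)"
 note b = aut_bij[OF ph V]
 interpret \<chi>: group_presheaf_hom "topo C" GG "unit_sheaf C" "xi C n" by (rule xi_presheaf_hom[OF n1])
 show ?thesis
 proof (intro trunc_lift.intro trunc_alg.intro trunc_alg_axioms.intro trunc_lift_axioms.intro n1)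
  show "trunc (sect C V)" by (rule tr[OF V(1)])
  show "scal C V : ring_hom complex_ring (sect C V)" by (rule scal_hom[OF V(1)])
  show "ph V : ring_hom (th V) (th V)" by (rule aut_hom[OF ph V])
  show "tcf (ph V F) 0 = tcf F 0" if "F : carrier (th V)" for F by (rule aut_zero[OF ph V that])
  show "ph V (trunc_monom (sect C V) n (scal C V z) 0) = trunc_monom (sect C V) n (scal C V z) 0" for z
   by (rule aut_scal[OF ph V])
  have "?\<psi> : ring_iso (th V) (th V)"
   by (rule ring_iso_set_sym[OF cring.axioms(1)[OF th_cring[OF V(1)]] aut_iso[OF ph V]])
  then show "?\<psi> : ring_hom (th V) (th V)" by (simp add: ring_iso_def)
  show "ph V (?\<psi> F) = F" "?\<psi> (ph V F) = F" if "F : carrier (th V)" for F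
   using bij_betw_inv_into_right[OF b that] bij_betw_inv_into_left[OF b that] .
  have ph': "gres GG U V ph : aut_set C n V"
   using group_presheaf.res_closed[OF aut_presheaf U V] ph by (simp add: aut_carrier)
  have "xi C n V (gres GG U V ph) : carrier (gsec (unit_sheaf C) V)"
   using \<chi>.map_closed[OF V(1)] ph' by (simp add: aut_carrier)
  then show "tcf (ph V (trunc_t (sect C V) n)) 1 : Units (sect C V)"
   using V by (simp add: xi_eq[OF ph' V(1) n1] aut_gres_app unit_sheaf_def units_of_def)
 qed
qed

text \<open>The lifts over the various V are picked independently, but each has prescribed values on
  constants and on t, which \<open>ok\<close> records. These values are built from ph, its inverse,
  \<open>eul\<close> and \<open>tdrop\<close>, all compatible with restriction; hence so are the
  lifts.\<close>

lemma aut_lift: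
 assumes n1: "1 < n" and U: "op U" and ph: "ph : aut_set C n U"
 obtains \<Phi> where "\<Phi> : aut_set C (Suc n) U" "aut_red C (Suc n) n U \<Phi> = ph"
proof -
 interpret P: thickening_pair C "Suc n" n by unfold_locales simp_all
 let ?\<psi> = "%V. inv_into (carrier (th V)) (ph V)"
 note L = aut_trunc_lift[OF n1 U ph]
 let ?vM = "%V. trunc_lift.vM (sect C V) n (scal C V) (ph V) (?\<psi> V)"
 let ?nu = "%V. trunc_lift.vnu (sect C V) n (ph V)"
 let ?up = "%V. trunc_lift.up1 (sect C V) n"
 let ?l = "%V. trunc_lift.lift0 (sect C V) n (scal C V) (ph V) (?\<psi> V)"
 define ok where "ok V \<Phi> \<longleftrightarrow> \<Phi> : ring_hom (P.N.th V) (P.N.th V) \<and>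
   (\<forall>a\<in>carrier (sect C V). \<Phi> (trunc_monom (sect C V) (Suc n) a 0) = ?l V a) \<and>
   \<Phi> (trunc_t (sect C V) (Suc n)) = ?up V (?nu V) \<and>
   (\<forall>F\<in>carrier (P.N.th V). trunc_red (sect C V) n (\<Phi> F) = ph V (trunc_red (sect C V) n F)) \<and>
   bij_betw \<Phi> (carrier (P.N.th V)) (carrier (P.N.th V)) \<and>
   (\<forall>F\<in>carrier (P.N.th V). tcf (\<Phi> F) 0 = tcf F 0) \<and>
   (\<forall>z. \<Phi> (trunc_monom (sect C V) (Suc n) (scal C V z) 0) = trunc_monom (sect C V) (Suc n) (scal C V z) 0)"
  for V \<Phi>
 have "\<exists>\<Phi>. ok V \<Phi>" if V: "op V" "V <= U" for V
  unfolding ok_def by (rule trunc_lift.lift_exists[OF L[OF V]]) blast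
 then obtain \<Phi> where "!!V. [|op V; V <= U|] ==> ok V (\<Phi> V)" by metis
 note \<Phi> = this[unfolded ok_def, THEN conjunct1]
  and \<Phi>c = this[unfolded ok_def, THEN conjunct2, THEN conjunct1, rule_format]
  and \<Phi>t = this[unfolded ok_def, THEN conjunct2, THEN conjunct2, THEN conjunct1]
  and \<Phi>r = this[unfolded ok_def, THEN conjunct2, THEN conjunct2, THEN conjunct2, THEN conjunct1, rule_format]
  and \<Phi>b = this[unfolded ok_def, THEN conjunct2, THEN conjunct2, THEN conjunct2, THEN conjunct2, THEN conjunct1]
  and \<Phi>0 = this[unfolded ok_def, THEN conjunct2, THEN conjunct2, THEN conjunct2, THEN conjunct2, THEN conjunct2, THEN conjunct1, rule_format]
  and \<Phi>s = this[unfolded ok_def, THEN conjunct2, THEN conjunct2, THEN conjunct2, THEN conjunct2, THEN conjunct2, THEN conjunct2, rule_format]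
 have cl: "\<Phi> V F : carrier (P.N.th V)" if "op V" "V <= U" "F : carrier (P.N.th V)" for V F
  by (rule ring_hom_closed[OF \<Phi>[OF that(1,2)] that(3)])
 have nat: "\<Phi> V' (P.N.thr V V' F) = P.N.thr V V' (\<Phi> V F)"
  if V: "op V" "V <= U" and V': "op V'" "V' <= V" and F: "F : carrier (P.N.th V)" for V V' F
 proof -
  note VV = V(1) V'
  have V'U: "V' <= U" using V V' by simp
  interpret A: trunc_lift "sect C V" n "scal C V" "ph V" "?\<psi> V" by (rule L[OF V])
  interpret A': trunc_lift "sect C V'" n "scal C V'" "ph V'" "?\<psi> V'" by (rule L[OF V'(1) V'U])
  interpret E: trunc "sect C V" "Suc n" by (rule tr[OF V(1)])
  interpret E': trunc "sect C V'" "Suc n" by (rule tr[OF V'(1)])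
  let ?r = "rest C V V'"
  interpret r: ring_hom_cring "sect C V" "sect C V'" ?r
   by (rule ring_hom_cringI[OF sect_cring[OF V(1)] sect_cring[OF V'(1)] rest_hom[OF VV]])
  have eul: "thr V V' (A.eul G) = A'.eul (thr V V' G)" if "G : carrier (th V)" for G
   using that thr_closed[OF VV that] by (intro A'.trunc_eqI thr_closed[OF VV]) (auto simp: tcf_thr[OF VV] scal_rest[OF VV])
  have \<psi>: "thr V V' (?\<psi> V G) = ?\<psi> V' (thr V V' G)" if G: "G : carrier (th V)" for G
  proof -
   have c: "?\<psi> V G : carrier (th V)" by (rule ring_hom_closed[OF A.\<psi> G])
   have "ph V' (thr V V' (?\<psi> V G)) = thr V V' G"
    using aut_res[OF ph V V' c] A.ph\<psi>[OF G] by simp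
   then show ?thesis using A'.\<psi>ph[OF thr_closed[OF VV c]] by simp
  qed
  have drop: "thr V V' (A.tdrop 1 G) = A'.tdrop 1 (thr V V' G)" if "G : carrier (th V)" for G
   using that thr_closed[OF VV that] by (intro A'.trunc_eqI thr_closed[OF VV]) (auto simp: tcf_thr[OF VV])
  have thr_mult: "thr V V' (G \<otimes>\<^bsub>th V\<^esub> H) = thr V V' G \<otimes>\<^bsub>th V'\<^esub> thr V V' H" if "G : carrier (th V)" "H : carrier (th V)" for G H
   by (rule ring_hom_mult[OF thr_hom[OF VV] that])
  have nu: "thr V V' (?nu V) = ?nu V'"
   using aut_res[OF ph V V' A.trunc_monom_closed[OF A.one_closed], of 1] drop[OF aut_closed[OF ph V A.trunc_monom_closed[OF A.one_closed]], of 1]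
   by (simp add: A.vnu_def A'.vnu_def thr_monom[OF VV])
  have phc: "ph V (trunc_monom (sect C V) n a 0) : carrier (th V)" if "a : carrier (sect C V)" for a
   using aut_closed[OF ph V A.trunc_monom_closed[OF that]] .
  have phr: "thr V V' (ph V (trunc_monom (sect C V) n a 0)) = ph V' (trunc_monom (sect C V') n (?r a) 0)" if "a : carrier (sect C V)" for a
   using aut_res[OF ph V V' A.trunc_monom_closed[OF that], of 0] by (simp add: thr_monom[OF VV that])
  have vX: "thr V V' (A.vX a) = A'.vX (?r a)" if a: "a : carrier (sect C V)" for a
   by (simp add: A.vX_def A'.vX_def \<psi>[OF A.eul_closed[OF phc[OF a]]] eul[OF phc[OF a]] phr[OF a])
  have vM: "thr V V' (A.vM a) = A'.vM (?r a)" if a: "a : carrier (sect C V)" for a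
   using aut_res[OF ph V V' A.closed(2)[OF a]]
   by (simp add: A.vM_def A'.vM_def A.vY_def A'.vY_def drop[OF A.closed(1)[OF a]] vX[OF a] nu
     thr_mult[OF A.closed(3) aut_closed[OF ph V A.closed(2)[OF a], unfolded A.vY_def]])
  have l: "P.N.thr V V' (A.lift0 a) = A'.lift0 (?r a)" if a: "a : carrier (sect C V)" for a
  proof (rule E'.trunc_eqI)
   fix i assume i: "i < Suc n"
   show "tcf (P.N.thr V V' (A.lift0 a)) i = tcf (A'.lift0 (?r a)) i"
    using a i A.n0 tcf_thr[OF VV phc[OF a], of i] tcf_thr[OF VV A.closed(4)[OF a], of "n - 1"]
    by (auto simp: P.N.tcf_thr[OF VV] A.tcf_lift0 A'.tcf_lift0 phr[OF a] vM[OF a] scal_rest[OF VV])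
  qed (use a P.N.thr_closed[OF VV] in auto)
  have u: "P.N.thr V V' (A.up1 A.vnu) = A'.up1 A'.vnu"
  proof (rule E'.trunc_eqI)
   fix i assume i: "i < Suc n"
   show "tcf (P.N.thr V V' (A.up1 A.vnu)) i = tcf (A'.up1 A'.vnu) i"
    using i A.n0 tcf_thr[OF VV A.closed(3), of "i - 1"] by (auto simp: P.N.tcf_thr[OF VV] nu)
  qed (use P.N.thr_closed[OF VV] in auto)
  have "(\<Phi> V' \<circ> P.N.thr V V') F = (P.N.thr V V' \<circ> \<Phi> V) F"
  proof (rule E.trunc_hom_eqI[OF E'.B.is_cring ring_hom_trans[OF P.N.thr_hom[OF VV] \<Phi>[OF V'(1) V'U]]
     ring_hom_trans[OF \<Phi>[OF V] P.N.thr_hom[OF VV]] _ _ F])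
   show "(\<Phi> V' \<circ> P.N.thr V V') (E.tconst a) = (P.N.thr V V' \<circ> \<Phi> V) (E.tconst a)" if a: "a : carrier (sect C V)" for a
    by (simp add: P.N.thr_monom[OF VV a] \<Phi>c[OF V a] \<Phi>c[OF V'(1) V'U r.hom_closed[OF a]] l[OF a])
   show "(\<Phi> V' \<circ> P.N.thr V V') E.tt = (P.N.thr V V' \<circ> \<Phi> V) E.tt"
    by (simp add: P.N.thr_monom[OF VV] \<Phi>t[OF V] \<Phi>t[OF V'(1) V'U] u)
  qed
  then show ?thesis by simp
 qed
 define \<Psi> where "\<Psi> = (\<lambda>V\<in>opens_in C U. restrict (\<Phi> V) (carrier (P.N.th V)))"
 have app: "\<Psi> V = restrict (\<Phi> V) (carrier (P.N.th V))" if "op V" "V <= U" for V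
  using that by (simp add: \<Psi>_def opens_iff)
 have mem: "\<Psi> : aut_set C (Suc n) U"
 proof (rule P.N.aut_setI[OF U])
  show "\<Psi> : extensional (opens_in C U)" by (simp add: \<Psi>_def)
  fix V assume V: "op V" "V <= U"
  interpret E: trunc "sect C V" "Suc n" by (rule tr[OF V(1)])
  show "\<Psi> V : extensional (carrier (P.N.th V))" by (simp add: app[OF V])
  show "\<Psi> V : ring_hom (P.N.th V) (P.N.th V)"
   by (rule ring_hom_memI) (use \<Phi>[OF V] in \<open>simp_all add: app[OF V] cl[OF V] ring_hom_mult ring_hom_add ring_hom_one\<close>)
  show "bij_betw (\<Psi> V) (carrier (P.N.th V)) (carrier (P.N.th V))"
   using bij_betw_cong[of "carrier (P.N.th V)" "\<Phi> V" "\<Psi> V"] \<Phi>b[OF V] by (simp add: app[OF V])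
  show "\<Psi> V (trunc_monom (sect C V) (Suc n) (scal C V z) 0) = trunc_monom (sect C V) (Suc n) (scal C V z) 0" for z
   using E.trunc_monom_closed[OF scal_in[OF V(1)]] \<Phi>s[OF V] by (simp add: app[OF V])
  show "tcf (\<Psi> V F) 0 = tcf F 0" if "F : carrier (P.N.th V)" for F
   using that \<Phi>0[OF V that] by (simp add: app[OF V])
  show "\<Psi> V' (P.N.thr V V' F) = P.N.thr V V' (\<Psi> V F)" if V': "op V'" "V' <= V" and F: "F : carrier (P.N.th V)" for V' F
  proof -
   have "V' <= U" using V V' by simp
   then show ?thesis using nat[OF V V' F] F P.N.thr_closed[OF V(1) V' F] by (simp add: app[OF V] app[OF V'(1)])
  qed
 qed
 moreover have "aut_red C (Suc n) n U \<Psi> = ph"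
 proof (rule aut_eqI[OF P.aut_red_closed[OF mem U] ph])
  fix V F assume V: "op V" "V <= U" and F: "F : carrier (th V)"
  obtain E where E: "E : carrier (P.N.th V)" "F = trunc_red (sect C V) n E" by (rule P.red_surj[OF V(1) F])
  show "aut_red C (Suc n) n U \<Psi> V F = ph V F"
   using P.aut_red_app[OF mem V E(1)] \<Phi>r[OF V E(1)] E by (simp add: app[OF V])
 qed
 ultimately show ?thesis by (rule that)
qed

end

section \<open>Hilbert's basis theorem and proper closed subsets of a curve\<close>

text \<open>Ideals of a subring K that is a mere subset of R, so that adjoining generators one after
  another never changes the ambient ring.\<close>

definition subring_ideal :: "('a, 'b) ring_scheme => 'a set => 'a set => bool" where
 "subring_ideal R K I \<longleftrightarrow> I <= K & \<zero>\<^bsub>R\<^esub> : I & (\<forall>a\<in>I. \<forall>b\<in>I. a \<oplus>\<^bsub>R\<^esub> b : I) & (\<forall>k\<in>K. \<forall>a\<in>I. k \<otimes>\<^bsub>R\<^esub> a : I)"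

definition ideals_acc :: "('a, 'b) ring_scheme => 'a set => bool" where
 "ideals_acc R K \<longleftrightarrow> (\<forall>f. (\<forall>m. subring_ideal R K (f m)) & (\<forall>m. f m <= f (Suc m)) \<longrightarrow> (\<exists>N::nat. \<forall>m\<ge>N. f m = f N))"

definition closed_ops :: "('a, 'b) ring_scheme => 'a set => bool" where
 "closed_ops R K \<longleftrightarrow> K <= carrier R & \<one>\<^bsub>R\<^esub> : K & (\<forall>a\<in>K. \<ominus>\<^bsub>R\<^esub> a : K) \<and>
   (\<forall>a\<in>K. \<forall>b\<in>K. a \<oplus>\<^bsub>R\<^esub> b : K) & (\<forall>a\<in>K. \<forall>b\<in>K. a \<otimes>\<^bsub>R\<^esub> b : K)"

context cring
begin

text \<open>Polynomial expressions of degree below d in x over K. As x is an element of R and no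
  indeterminate, one element may have several such expressions.\<close>

fun polys :: "'a set => 'a => nat => 'a set" where
 "polys K x 0 = {\<zero>}"
| "polys K x (Suc d) = {a \<otimes> x [^] d \<oplus> p | a p. a : K & p : polys K x d}"

context
 fixes K x
 assumes K: "closed_ops R K" and x: "x : carrier R"
begin

lemma K_props:
 "K <= carrier R" "\<one> : K" "a : K ==> \<ominus> a : K" "[|a : K; b : K|] ==> a \<oplus> b : K" "[|a : K; b : K|] ==> a \<otimes> b : K"
 "a : K ==> a : carrier R"
 using K by (auto simp: closed_ops_def)

lemma K_zero: "\<zero> : K"
 using K_props(4)[OF K_props(2) K_props(3)[OF K_props(2)]] by (simp add: r_neg)

lemma polys_SucI: "[|a : K; p : polys K x d|] ==> a \<otimes> x [^] d \<oplus> p : polys K x (Suc d)"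
 by auto

lemma polys_carrier: "p : polys K x d ==> p : carrier R"
 using x K_props(6) by (induction d arbitrary: p) auto

lemma polys_zero: "\<zero> : polys K x d"
proof (induction d)
 case (Suc d)
 have "\<zero> = \<zero> \<otimes> x [^] d \<oplus> \<zero>" using x by simp
 then show ?case using Suc K_zero by auto
qed simp

lemma polys_Suc: "p : polys K x d ==> p : polys K x (Suc d)"
proof -
 assume p: "p : polys K x d"
 have "p = \<zero> \<otimes> x [^] d \<oplus> p" using x polys_carrier[OF p] by simp
 then show ?thesis using p K_zero by auto
qed

lemma polys_mono: "[|p : polys K x d; d \<le> e|] ==> p : polys K x e"
 by (induction e) (auto simp: le_Suc_eq simp del: polys.simps intro: polys_Suc)

lemma polys_add: "[|p : polys K x d; q : polys K x d|] ==> p \<oplus> q : polys K x d"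
proof (induction d arbitrary: p q)
 case (Suc d)
 then obtain a b p' q' where *: "p = a \<otimes> x [^] d \<oplus> p'" "q = b \<otimes> x [^] d \<oplus> q'"
  "a : K" "b : K" "p' : polys K x d" "q' : polys K x d" by auto
 have "p \<oplus> q = (a \<oplus> b) \<otimes> x [^] d \<oplus> (p' \<oplus> q')"
  using * x K_props(6) polys_carrier by (simp add: l_distr a_ac)
 then show ?case using polys_SucI[OF K_props(4)[OF *(3,4)] Suc.IH[OF *(5,6)]] by simp
qed simp

lemma polys_smult: "[|k : K; p : polys K x d|] ==> k \<otimes> p : polys K x d"
proof (induction d arbitrary: p)
 case (Suc d)
 then obtain a p' where *: "p = a \<otimes> x [^] d \<oplus> p'" "a : K" "p' : polys K x d" by auto
 have "k \<otimes> p = (k \<otimes> a) \<otimes> x [^] d \<oplus> k \<otimes> p'"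
  using * Suc.prems x K_props(6) polys_carrier by (simp add: r_distr m_assoc)
 then show ?case using polys_SucI[OF K_props(5)[OF Suc.prems(1) *(2)] Suc.IH[OF Suc.prems(1) *(3)]] by simp
qed (use K_props(6) in simp)

lemma polys_shift: "p : polys K x d ==> x \<otimes> p : polys K x (Suc d)"
proof (induction d arbitrary: p)
 case 0
 then show ?case using x polys_zero[of 1] by (simp add: One_nat_def del: polys.simps(2))
next
 case (Suc d)
 then obtain a p' where *: "p = a \<otimes> x [^] d \<oplus> p'" "a : K" "p' : polys K x d" by auto
 have "x \<otimes> p = a \<otimes> x [^] Suc d \<oplus> x \<otimes> p'"
  using * x K_props(6) polys_carrier by (simp add: r_distr m_ac)
 then show ?case using * Suc.IH[OF *(3)] by (subst polys.simps) blast
qed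

definition adj :: "'a set" where "adj = (\<Union>d. polys K x d)"

lemma adjE2:
 assumes "p : adj" "q : adj"
 obtains d where "p : polys K x d" "q : polys K x d"
proof -
 obtain d e where "p : polys K x d" "q : polys K x e" using assms by (auto simp: adj_def)
 then show ?thesis using that[of "max d e"] polys_mono by simp
qed

lemma adj_add: "[|p : adj; q : adj|] ==> p \<oplus> q : adj"
 by (erule (1) adjE2) (auto simp: adj_def intro: polys_add)

lemma adj_mult:
 assumes p: "p : adj" and q: "q : adj"
 shows "p \<otimes> q : adj"
proof -
 have q': "q : carrier R" using q polys_carrier by (auto simp: adj_def)
 have pow: "x [^] (d::nat) \<otimes> q : adj" for d
 proof (induction d)
  case (Suc d)
  have "x [^] Suc d \<otimes> q = x \<otimes> (x [^] d \<otimes> q)" using x q' by (simp add: m_ac)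
  then show ?case using Suc polys_shift unfolding adj_def by (auto simp del: polys.simps)
 qed (use q q' in simp)
 have "p \<otimes> q : adj" if "p : polys K x d" for d
  using that
 proof (induction d arbitrary: p)
  case 0
  then show ?case using q' polys_zero by (auto simp: adj_def)
 next
  case (Suc d)
  then obtain a p' where *: "p = a \<otimes> x [^] d \<oplus> p'" "a : K" "p' : polys K x d" by auto
  have "p \<otimes> q = a \<otimes> (x [^] d \<otimes> q) \<oplus> p' \<otimes> q"
   using * x q' K_props(6) polys_carrier by (simp add: l_distr m_assoc)
  moreover have "a \<otimes> (x [^] d \<otimes> q) : adj" using pow[of d] polys_smult[OF *(2)] unfolding adj_def by auto
  ultimately show ?case using adj_add Suc.IH[OF *(3)] by simp
 qed
 then show ?thesis using p by (auto simp: adj_def)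
qed

lemma K_adj: "a : K ==> a : adj"
proof -
 assume a: "a : K"
 have "a = a \<otimes> x [^] (0::nat) \<oplus> \<zero>" using a K_props(6) by simp
 then have "a : polys K x (Suc 0)" using a by auto
 then show ?thesis unfolding adj_def by blast
qed

lemma x_adj: "x : adj"
proof -
 have "\<one> : polys K x d ==> x : polys K x (Suc d)" for d using polys_shift[of \<one> d] x by simp
 then show ?thesis using K_adj[OF K_props(2)] unfolding adj_def by blast
qed

lemma adj_carrier: "adj <= carrier R" using polys_carrier by (auto simp: adj_def)

lemma adj_closed_ops: "closed_ops R adj"
proof -
 have "\<ominus> a = \<ominus> \<one> \<otimes> a" if "a : adj" for a using that adj_carrier by (auto simp: l_minus)
 then have "\<ominus> a : adj" if "a : adj" for a
  using that adj_mult[OF K_adj[OF K_props(3)[OF K_props(2)]] that] by simp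
 then show ?thesis unfolding closed_ops_def
  using adj_carrier K_adj K_props(2) adj_add adj_mult by auto
qed

text \<open>Leading coefficients in degree d of elements of I. Every expression of an element
  counts, so one element may contribute several coefficients.\<close>

definition leads :: "nat => 'a set => 'a set" where
 "leads d I = {a : K. \<exists>p\<in>polys K x d. a \<otimes> x [^] d \<oplus> p : I}"

lemma leads_ideal:
 assumes I: "subring_ideal R adj I"
 shows "subring_ideal R K (leads d I)"
 unfolding subring_ideal_def
proof (intro conjI ballI)
 show "leads d I <= K" by (auto simp: leads_def)
 show "\<zero> : leads d I"
  using I x K_zero polys_zero[of d] by (auto simp: leads_def subring_ideal_def intro!: bexI[of _ \<zero>])
next
 fix a b assume "a : leads d I" "b : leads d I"
 then obtain p q where *: "a : K" "b : K" "p : polys K x d" "q : polys K x d"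
  "a \<otimes> x [^] d \<oplus> p : I" "b \<otimes> x [^] d \<oplus> q : I" by (auto simp: leads_def)
 have "(a \<oplus> b) \<otimes> x [^] d \<oplus> (p \<oplus> q) = (a \<otimes> x [^] d \<oplus> p) \<oplus> (b \<otimes> x [^] d \<oplus> q)"
  using * x K_props(6) polys_carrier by (simp add: l_distr a_ac)
 also have "\<dots> : I" using I * by (simp add: subring_ideal_def)
 finally show "a \<oplus> b : leads d I" using * K_props(4) polys_add by (auto simp: leads_def)
next
 fix k a assume k: "k : K" and "a : leads d I"
 then obtain p where *: "a : K" "p : polys K x d" "a \<otimes> x [^] d \<oplus> p : I" by (auto simp: leads_def)
 have "(k \<otimes> a) \<otimes> x [^] d \<oplus> k \<otimes> p = k \<otimes> (a \<otimes> x [^] d \<oplus> p)"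
  using * k x K_props(6) polys_carrier by (simp add: r_distr m_assoc)
 also have "\<dots> : I" using I * K_adj[OF k] by (simp add: subring_ideal_def)
 finally show "k \<otimes> a : leads d I" using * k K_props(5) polys_smult by (auto simp: leads_def)
qed

lemma leads_mono: "I <= J ==> leads d I <= leads d J" by (auto simp: leads_def)

lemma leads_Suc:
 assumes I: "subring_ideal R adj I"
 shows "leads d I <= leads (Suc d) I"
proof
 fix a assume "a : leads d I"
 then obtain p where *: "a : K" "p : polys K x d" "a \<otimes> x [^] d \<oplus> p : I" by (auto simp: leads_def)
 have "a \<otimes> x [^] Suc d \<oplus> x \<otimes> p = x \<otimes> (a \<otimes> x [^] d \<oplus> p)"
  using * x K_props(6) polys_carrier by (simp add: r_distr m_ac)
 also have "\<dots> : I" using I * x_adj by (simp add: subring_ideal_def)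
 finally show "a : leads (Suc d) I"
  using *(1) polys_shift[OF *(2)] unfolding leads_def by blast
qed

text \<open>Induction on the degree: from q in J subtract an element of I with the same leading
  coefficient. The difference lies in J and has an expression of smaller degree, so it lies in
  I.\<close>

lemma leads_eq_imp:
 assumes I: "subring_ideal R adj I" and J: "subring_ideal R adj J" and IJ: "I <= J"
  and e: "!!d. leads d J = leads d I"
 shows "J <= I"
proof -
 have "q : I" if "q : J" "q : polys K x d" for q d
  using that
 proof (induction d arbitrary: q)
  case 0
  then show ?case using I by (simp add: subring_ideal_def)
 next
  case (Suc d)
  then obtain a p where *: "a : K" "p : polys K x d" "q = a \<otimes> x [^] d \<oplus> p" by auto
  then have "a : leads d J" using Suc.prems by (auto simp: leads_def)
  then have "a : leads d I" by (simp add: e)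
  then obtain p' where p': "p' : polys K x d" "a \<otimes> x [^] d \<oplus> p' : I" by (auto simp: leads_def)
  let ?r = "a \<otimes> x [^] d \<oplus> p'"
  have cl: "a \<otimes> x [^] d : carrier R" "p : carrier R" "p' : carrier R"
   using * p' x K_props(6) polys_carrier by auto
  have m1: "\<ominus> \<one> : K" using K_props(2,3) by blast
  have "q \<oplus> \<ominus> \<one> \<otimes> ?r = p \<oplus> \<ominus> \<one> \<otimes> p'"
   using cl *(3) by (simp add: l_minus minus_add a_ac r_neg r_neg1 r_neg2)
  moreover have "p \<oplus> \<ominus> \<one> \<otimes> p' : polys K x d" using polys_add[OF *(2) polys_smult[OF m1 p'(1)]] .
  moreover have "q \<oplus> \<ominus> \<one> \<otimes> ?r : J"
   using Suc.prems(1) p'(2) IJ J K_adj[OF m1] by (auto simp: subring_ideal_def)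
  ultimately have "q \<oplus> \<ominus> \<one> \<otimes> ?r : I" using Suc.IH by metis
  then have "(q \<oplus> \<ominus> \<one> \<otimes> ?r) \<oplus> ?r : I" using p'(2) I by (simp add: subring_ideal_def)
  moreover have "(q \<oplus> \<ominus> \<one> \<otimes> ?r) \<oplus> ?r = q"
   using cl *(3) by (simp add: l_minus a_assoc l_neg)
  ultimately show ?case by simp
 qed
 moreover have "\<exists>d. q : polys K x d" if "q : J" for q
  using J that by (auto simp: subring_ideal_def adj_def)
 ultimately show ?thesis by blast
qed

text \<open>The ideals \<open>leads d (f m)\<close> grow with d and with m. The diagonal d = m
  becomes constant from some N on, which settles every d >= N by sandwiching; each of the finitely
  many d < N gives a chain of ideals of K that becomes constant by itself.\<close>

lemma hilbert_step:
 assumes acc: "ideals_acc R K"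
 shows "ideals_acc R adj"
 unfolding ideals_acc_def
proof (intro allI impI, elim conjE)
 fix f :: "nat => 'a set"
 assume f: "\<forall>m. subring_ideal R adj (f m)" and fs: "\<forall>m. f m <= f (Suc m)"
 have fm: "f m <= f m'" if "m \<le> m'" for m m' using lift_Suc_mono_le[of f] fs that by blast
 have lm: "leads d (f m) <= leads d' (f m')" if "d \<le> d'" "m \<le> m'" for d d' m m'
  using lift_Suc_mono_le[of "%d. leads d (f m)", OF leads_Suc[OF f[rule_format]] that(1)]
   leads_mono[OF fm[OF that(2)], of d'] by blast
 have stab: "\<exists>N. \<forall>m\<ge>N. g m = g N" if "!!m. subring_ideal R K (g m)" "!!m. g m <= g (Suc m)" for g :: "nat => 'a set"
  using acc that unfolding ideals_acc_def by blast
 obtain N where N: "!!m. m \<ge> N ==> leads m (f m) = leads N (f N)"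
  using stab[of "%m. leads m (f m)"] leads_ideal f lm by (metis le_SucI order_refl)
 have "\<exists>M. \<forall>m\<ge>M. leads d (f m) = leads d (f M)" for d
  using stab[of "%m. leads d (f m)"] leads_ideal f lm[of d d] by simp
 then obtain M where M: "!!d m. m \<ge> M d ==> leads d (f m) = leads d (f (M d))" by metis
 define M' where "M' = Max (insert N (M ` {..<N}))"
 have M': "N \<le> M'" "!!d. d < N ==> M d \<le> M'" by (auto simp: M'_def)
 have "leads d (f m) = leads d (f M')" if m: "m \<ge> M'" for d m
 proof (cases "d < N")
  case True
  then have "M d \<le> m" "M d \<le> M'" using M'(2)[OF True] m by auto
  then show ?thesis using M[of d m] M[of d M'] by simp
 next
  case False
  have "leads d (f m') = leads N (f N)" if "N \<le> m'" for m'
  proof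
   have "leads d (f m') <= leads (max d m') (f (max d m'))" by (rule lm) auto
   also have "\<dots> = leads N (f N)" using that by (intro N) auto
   finally show "leads d (f m') <= leads N (f N)" .
   show "leads N (f N) <= leads d (f m')" using False that by (intro lm) auto
  qed
  then show ?thesis using M'(1) m by simp
 qed
 then have "f m = f M'" if "m \<ge> M'" for m
  using leads_eq_imp[OF f[rule_format] f[rule_format] fm[OF that]] fm[OF that] that by blast
 then show "\<exists>N. \<forall>m\<ge>N. f m = f N" by blast
qed

end

text \<open>Generators are adjoined one at a time to the image of the complex numbers, each time
  with \<open>hilbert_step\<close>.\<close>

lemma hilbert_basis:
 assumes \<kappa>: "\<kappa> : ring_hom complex_ring R" and B: "finite B" "B <= carrier R"
 shows "\<exists>K. closed_ops R K & range \<kappa> \<union> B <= K & ideals_acc R K"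
 using B
proof (induction B)
 case empty
 have car: "\<kappa> z : carrier R" for z
  using ring_hom_closed[OF \<kappa>, of z] by (simp add: ring_of_type_algebra_def)
 have ops: "\<kappa> y \<otimes> \<kappa> z = \<kappa> (y * z)" "\<kappa> y \<oplus> \<kappa> z = \<kappa> (y + z)" "\<kappa> 1 = \<one>" for y z
  using ring_hom_mult[OF \<kappa>, of y z] ring_hom_add[OF \<kappa>, of y z] ring_hom_one[OF \<kappa>]
  by (simp_all add: ring_of_type_algebra_def)
 have z: "\<kappa> 0 = \<zero>" using ops(2)[of 0 0] car[of 0] by (simp add: add.l_cancel_one)
 have "\<ominus> \<kappa> y = \<kappa> (- y)" for y
  using ops(2)[of y "- y"] car z by (intro minus_equality) (auto simp: a_comm)
 then have 1: "closed_ops R (range \<kappa>)"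
  unfolding closed_ops_def using car ops by (auto simp flip: ops(3))
 \<comment> \<open>The image of the complex numbers is a field: every \<kappa> w is a multiple of a
   given nonzero \<kappa> y.\<close>
 have I: "I = {\<zero>} \<or> I = range \<kappa>" if I: "subring_ideal R (range \<kappa>) I" for I
 proof (cases "I <= {\<zero>}")
  case True
  then show ?thesis using I by (auto simp: subring_ideal_def)
 next
  case False
  then obtain a where "a : I" "a \<noteq> \<zero>" by blast
  moreover then obtain y where "a = \<kappa> y" using I by (auto simp: subring_ideal_def)
  ultimately have y: "\<kappa> y : I" "\<kappa> y \<noteq> \<zero>" by auto
  then have "y \<noteq> 0" using z by auto
  then have w: "\<kappa> (w / y) \<otimes> \<kappa> y = \<kappa> w" for w by (simp add: ops)
  have "\<kappa> w : I" for w using I y(1) unfolding subring_ideal_def w[of w, symmetric] by blast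
  then show ?thesis using I by (auto simp: subring_ideal_def)
 qed
 have "ideals_acc R (range \<kappa>)"
  unfolding ideals_acc_def
 proof (intro allI impI, elim conjE)
  fix f :: "nat => 'a set" assume f: "\<forall>m. subring_ideal R (range \<kappa>) (f m)" and fs: "\<forall>m. f m <= f (Suc m)"
  show "\<exists>N. \<forall>m\<ge>N. f m = f N"
  proof (cases "\<exists>N. f N = range \<kappa>")
   case True
   then obtain N where N: "f N = range \<kappa>" by blast
   have "f m = f N" if "m \<ge> N" for m
    using lift_Suc_mono_le[of f, OF _ that] fs f N by (auto simp: subring_ideal_def)
   then show ?thesis by blast
  next
   case False
   then have "f m = {\<zero>}" for m using I f by blast
   then show ?thesis by auto
  qed
 qed
 then show ?case using 1 by blast
next
 case (insert x B)
 then obtain K where K: "closed_ops R K" "range \<kappa> \<union> B <= K" "ideals_acc R K" by auto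
 have x: "x : carrier R" using insert.prems by simp
 show ?case
  using adj_closed_ops[OF K(1) x] hilbert_step[OF K(1) x K(3)] K_adj[OF K(1) x] x_adj[OF K(1) x] K(2)
  by (intro exI[of _ "adj K x"]) auto
qed

lemma finitely_generated_acc:
 assumes \<kappa>: "\<kappa> : ring_hom complex_ring R" and B: "finite B" "B <= carrier R"
  and g: "generate_ring R (range \<kappa> \<union> B) = carrier R"
 shows "ideals_acc R (carrier R)"
proof -
 obtain K where K: "closed_ops R K" "range \<kappa> \<union> B <= K" "ideals_acc R K" using hilbert_basis[OF \<kappa> B] by blast
 have "h : K" if "h : generate_ring R (range \<kappa> \<union> B)" for h
  using that by induction (use K in \<open>auto simp: closed_ops_def\<close>)
 then have "K = carrier R" using g K(1) by (auto simp: closed_ops_def)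
 then show ?thesis using K(3) by simp
qed

end

section \<open>Localizations, the Zariski topology and affine charts\<close>

locale affine_ring = cring R for R :: "'a ring" (structure)
begin

lemma prime_diff_mult: "[|primeideal P R; s : carrier R - P; t : carrier R - P|] ==> s \<otimes> t : carrier R - P"
 using primeideal.I_prime[of P R s t] by auto

lemma loc_rel_trans:
 assumes p: "primeideal P R"
  and c: "a : carrier R" "b : carrier R" "c : carrier R" "s : carrier R - P" "t : carrier R - P" "r : carrier R - P"
  and u: "u : carrier R - P" "u \<otimes> (a \<otimes> t) = u \<otimes> (b \<otimes> s)"
  and v: "v : carrier R - P" "v \<otimes> (b \<otimes> r) = v \<otimes> (c \<otimes> t)"
 shows "\<exists>w\<in>carrier R - P. w \<otimes> (a \<otimes> r) = w \<otimes> (c \<otimes> s)"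
proof (rule bexI)
 have "u \<otimes> v \<otimes> t \<otimes> (a \<otimes> r) = v \<otimes> r \<otimes> (u \<otimes> (a \<otimes> t))" using c u(1) v(1) by (simp add: m_ac)
 also have "\<dots> = u \<otimes> s \<otimes> (v \<otimes> (b \<otimes> r))" unfolding u(2) using c u(1) v(1) by (simp add: m_ac)
 also have "\<dots> = u \<otimes> v \<otimes> t \<otimes> (c \<otimes> s)" unfolding v(2) using c u(1) v(1) by (simp add: m_ac)
 finally show "u \<otimes> v \<otimes> t \<otimes> (a \<otimes> r) = u \<otimes> v \<otimes> t \<otimes> (c \<otimes> s)" .
 show "u \<otimes> v \<otimes> t : carrier R - P" by (intro prime_diff_mult[OF p] u(1) v(1) c(5))
qed

lemma prime_one: "primeideal P R ==> \<one> : carrier R - P"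
 using ideal.one_imp_carrier[OF primeideal.axioms(1)] primeideal.I_notcarr[of P R] by auto

lemma loc_frac_eq_iff:
 assumes p: "primeideal P R" and c: "a : carrier R" "s : carrier R - P" "b : carrier R" "t : carrier R - P"
 shows "loc_frac R P a s = loc_frac R P b t \<longleftrightarrow> (\<exists>u\<in>carrier R - P. u \<otimes> (a \<otimes> t) = u \<otimes> (b \<otimes> s))"
proof
 assume e: "loc_frac R P a s = loc_frac R P b t"
 have "(b, t) : loc_frac R P b t" using c prime_one[OF p] by (auto simp: loc_frac_def)
 then have "(b, t) : loc_frac R P a s" by (simp only: e)
 then show "\<exists>u\<in>carrier R - P. u \<otimes> (a \<otimes> t) = u \<otimes> (b \<otimes> s)" by (simp add: loc_frac_def)
next
 have sub: "loc_frac R P b t <= loc_frac R P a s"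
  if c: "a : carrier R" "s : carrier R - P" "b : carrier R" "t : carrier R - P"
   and u: "u : carrier R - P" "u \<otimes> (a \<otimes> t) = u \<otimes> (b \<otimes> s)" for a s b t u
 proof
  fix z assume "z : loc_frac R P b t"
  then obtain d r v where z: "z = (d, r)" "d : carrier R" "r : carrier R - P" "v : carrier R - P"
   "v \<otimes> (b \<otimes> r) = v \<otimes> (d \<otimes> t)" by (auto simp: loc_frac_def)
  then show "z : loc_frac R P a s"
   using loc_rel_trans[OF p c(1,3) z(2) c(2,4) z(3) u z(4,5)] by (auto simp: loc_frac_def)
 qed
 assume "\<exists>u\<in>carrier R - P. u \<otimes> (a \<otimes> t) = u \<otimes> (b \<otimes> s)"
 then obtain u where u: "u : carrier R - P" "u \<otimes> (a \<otimes> t) = u \<otimes> (b \<otimes> s)" by blast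
 show "loc_frac R P a s = loc_frac R P b t"
  by (rule antisym) (rule sub[OF c(3,4,1,2) u(1) u(2)[symmetric]], rule sub[OF c u])
qed

text \<open>Lying in the maximal ideal of the localization does not depend on how a fraction is
  written: u b s lies in P, and u and s do not.\<close>

lemma loc_frac_mem_iff:
 assumes p: "primeideal P R" and c: "a : carrier R" "s : carrier R - P" "b : carrier R" "t : carrier R - P"
  and e: "loc_frac R P a s = loc_frac R P b t" and a: "a : P"
 shows "b : P"
proof -
 interpret P: primeideal P R by (rule p)
 obtain u where u: "u : carrier R - P" "u \<otimes> (a \<otimes> t) = u \<otimes> (b \<otimes> s)" using e loc_frac_eq_iff[OF p c] by blast
 have "u \<otimes> (a \<otimes> t) : P" using P.I_l_closed[OF P.I_r_closed[OF a, of t], of u] u c by auto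
 then have "u \<otimes> (b \<otimes> s) : P" by (simp add: u(2))
 then show ?thesis using P.I_prime[of u "b \<otimes> s"] P.I_prime[of b s] u(1) c by auto
qed

lemma loc_op_eq:
 assumes p: "primeideal P R" and c: "a : carrier R" "s : carrier R - P" "b : carrier R" "t : carrier R - P"
  and cong: "!!a s b t a' s' b' t'. [|a : carrier R; s : carrier R - P; b : carrier R; t : carrier R - P;
    a' : carrier R; s' : carrier R - P; b' : carrier R; t' : carrier R - P;
    loc_frac R P a s = loc_frac R P a' s'; loc_frac R P b t = loc_frac R P b' t'|]
   ==> loc_frac R P (num a s b t) (s \<otimes> t) = loc_frac R P (num a' s' b' t') (s' \<otimes> t')"
 shows "loc_op R P num (loc_frac R P a s) (loc_frac R P b t) = loc_frac R P (num a s b t) (s \<otimes> t)"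
 unfolding loc_op_def
proof (rule the_equality)
 show "\<exists>a' s' b' t'. a' : carrier R & s' : carrier R - P & b' : carrier R & t' : carrier R - P \<and>
   loc_frac R P a s = loc_frac R P a' s' & loc_frac R P b t = loc_frac R P b' t' \<and>
   loc_frac R P (num a s b t) (s \<otimes> t) = loc_frac R P (num a' s' b' t') (s' \<otimes> t')"
  using c by blast
next
 fix z assume "\<exists>a' s' b' t'. a' : carrier R & s' : carrier R - P & b' : carrier R & t' : carrier R - P \<and>
   loc_frac R P a s = loc_frac R P a' s' & loc_frac R P b t = loc_frac R P b' t' \<and>
   z = loc_frac R P (num a' s' b' t') (s' \<otimes> t')"
 then obtain a' s' b' t' where d: "a' : carrier R" "s' : carrier R - P" "b' : carrier R" "t' : carrier R - P"
   "loc_frac R P a s = loc_frac R P a' s'" "loc_frac R P b t = loc_frac R P b' t'"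
   "z = loc_frac R P (num a' s' b' t') (s' \<otimes> t')" by blast
 show "z = loc_frac R P (num a s b t) (s \<otimes> t)" using cong[OF c d(1-6)] d(7) by simp
qed

lemma localization_ops:
 assumes p: "primeideal P R" and c: "a : carrier R" "s : carrier R - P" "b : carrier R" "t : carrier R - P"
 shows "loc_frac R P a s \<otimes>\<^bsub>localization R P\<^esub> loc_frac R P b t = loc_frac R P (a \<otimes> b) (s \<otimes> t)"
  and "loc_frac R P a s \<oplus>\<^bsub>localization R P\<^esub> loc_frac R P b t = loc_frac R P (a \<otimes> t \<oplus> b \<otimes> s) (s \<otimes> t)"
proof -
 have cong: "loc_frac R P (a \<otimes> b) (s \<otimes> t) = loc_frac R P (a' \<otimes> b') (s' \<otimes> t') \<and>
  loc_frac R P (a \<otimes> t \<oplus> b \<otimes> s) (s \<otimes> t) = loc_frac R P (a' \<otimes> t' \<oplus> b' \<otimes> s') (s' \<otimes> t')"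
  if c: "a : carrier R" "s : carrier R - P" "b : carrier R" "t : carrier R - P"
   and c': "a' : carrier R" "s' : carrier R - P" "b' : carrier R" "t' : carrier R - P"
   and e: "loc_frac R P a s = loc_frac R P a' s'" "loc_frac R P b t = loc_frac R P b' t'" for a s b t a' s' b' t'
 proof -
  obtain u where u: "u : carrier R - P" "u \<otimes> (a \<otimes> s') = u \<otimes> (a' \<otimes> s)"
   using e(1) loc_frac_eq_iff[OF p c(1,2) c'(1,2)] by blast
  obtain v where v: "v : carrier R - P" "v \<otimes> (b \<otimes> t') = v \<otimes> (b' \<otimes> t)"
   using e(2) loc_frac_eq_iff[OF p c(3,4) c'(3,4)] by blast
  note cl = c c' u(1) v(1)
  have uv: "u \<otimes> v : carrier R - P" by (rule prime_diff_mult[OF p u(1) v(1)])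
  have "u \<otimes> v \<otimes> (a \<otimes> b \<otimes> (s' \<otimes> t')) = (u \<otimes> (a \<otimes> s')) \<otimes> (v \<otimes> (b \<otimes> t'))" using cl by (simp add: m_ac)
  also have "\<dots> = u \<otimes> v \<otimes> (a' \<otimes> b' \<otimes> (s \<otimes> t))" unfolding u(2) v(2) using cl by (simp add: m_ac)
  finally have 1: "\<exists>w\<in>carrier R - P. w \<otimes> (a \<otimes> b \<otimes> (s' \<otimes> t')) = w \<otimes> (a' \<otimes> b' \<otimes> (s \<otimes> t))" using uv by blast
  have "u \<otimes> v \<otimes> ((a \<otimes> t \<oplus> b \<otimes> s) \<otimes> (s' \<otimes> t')) = v \<otimes> t \<otimes> t' \<otimes> (u \<otimes> (a \<otimes> s')) \<oplus> u \<otimes> s \<otimes> s' \<otimes> (v \<otimes> (b \<otimes> t'))"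
   using cl by (simp add: l_distr r_distr m_ac)
  also have "\<dots> = u \<otimes> v \<otimes> ((a' \<otimes> t' \<oplus> b' \<otimes> s') \<otimes> (s \<otimes> t))"
   unfolding u(2) v(2) using cl by (simp add: l_distr r_distr m_ac)
  finally have 2: "\<exists>w\<in>carrier R - P. w \<otimes> ((a \<otimes> t \<oplus> b \<otimes> s) \<otimes> (s' \<otimes> t')) = w \<otimes> ((a' \<otimes> t' \<oplus> b' \<otimes> s') \<otimes> (s \<otimes> t))"
   using uv by blast
  have st: "s \<otimes> t : carrier R - P" "s' \<otimes> t' : carrier R - P" by (intro prime_diff_mult[OF p] c c')+
  show ?thesis
   by (intro conjI iffD2[OF loc_frac_eq_iff[OF p _ st(1) _ st(2)] 1] iffD2[OF loc_frac_eq_iff[OF p _ st(1) _ st(2)] 2])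
    (use c c' in auto)
 qed
 show "loc_frac R P a s \<otimes>\<^bsub>localization R P\<^esub> loc_frac R P b t = loc_frac R P (a \<otimes> b) (s \<otimes> t)"
 proof -
  have "loc_op R P (%a s b t. a \<otimes> b) (loc_frac R P a s) (loc_frac R P b t) = loc_frac R P (a \<otimes> b) (s \<otimes> t)"
   by (rule loc_op_eq[OF p c]) (rule conjunct1, rule cong, assumption+)
  then show ?thesis by (simp add: localization_def)
 qed
 show "loc_frac R P a s \<oplus>\<^bsub>localization R P\<^esub> loc_frac R P b t = loc_frac R P (a \<otimes> t \<oplus> b \<otimes> s) (s \<otimes> t)"
 proof -
  have "loc_op R P (%a s b t. a \<otimes> t \<oplus> b \<otimes> s) (loc_frac R P a s) (loc_frac R P b t) = loc_frac R P (a \<otimes> t \<oplus> b \<otimes> s) (s \<otimes> t)"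
   by (rule loc_op_eq[OF p c]) (rule conjunct2, rule cong, assumption+)
  then show ?thesis by (simp add: localization_def)
 qed
qed

text \<open>Avoiding a and b is the same, for a prime, as avoiding their product, so the generating
  sets are closed under binary intersection.\<close>

lemma zariski_basis:
 assumes W: "openin (zariski R) W" and P: "P : W"
 obtains a where "a : carrier R" "a \<notin> P" "{Q. primeideal Q R & a \<notin> Q} <= W"
proof -
 have "generate_topology_on {{Q. primeideal Q R & f \<notin> Q} |f. f : carrier R} W"
  using W by (simp add: zariski_def openin_topology_generated_by_iff)
 then have "\<exists>a\<in>carrier R. a \<notin> P & {Q. primeideal Q R & a \<notin> Q} <= W" if "P : W" "primeideal P R"
  using that
 proof induction
  case (Int U V)
  then obtain a b where *: "a : carrier R" "a \<notin> P" "{Q. primeideal Q R & a \<notin> Q} <= U"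
   "b : carrier R" "b \<notin> P" "{Q. primeideal Q R & b \<notin> Q} <= V" by auto
  have "a \<otimes> b \<notin> P" using prime_diff_mult[OF Int.prems(2), of a b] * by blast
  moreover have "a \<notin> Q & b \<notin> Q" if "primeideal Q R" "a \<otimes> b \<notin> Q" for Q
  proof -
   interpret Q: primeideal Q R by (rule that)
   show ?thesis using that *(1,4) Q.I_l_closed Q.I_r_closed by blast
  qed
  ultimately show ?case using * by (intro bexI[of _ "a \<otimes> b"]) auto
 next
  case (UN K)
  then obtain k where k: "k : K" "P : k" by blast
  then show ?case using UN.IH[OF k(1) k(2) UN.prems(2)] by blast
 qed auto
 moreover have "primeideal P R" using openin_subset[OF W] P by (auto simp: zariski_def)
 ultimately show ?thesis using that P by blast
qed

lemma zariski_openin: "a : carrier R ==> openin (zariski R) {Q. primeideal Q R & a \<notin> Q}"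
 unfolding zariski_def by (rule topology_generated_by_Basis) blast

lemma zariski_prime: "P : topspace (zariski R) ==> primeideal P R"
 by (auto simp: zariski_def)

end

text \<open>The sections of the spectrum vanishing at a prime form an ideal.  This is all that is needed
 of the structure sheaf to bound the closed subsets of an affine open set: no isomorphism of the
 ring with its global sections is required.\<close>

context
 fixes S :: "('p, 'a) cspace" and U :: "'p set" and A :: "'a ring" and \<kappa> f ph
 assumes S: "ringed_cspace S" and U: "openin (topo S) U" and A: "cring A"
  and iso: "cspace_iso (open_subspace S U) (Spec A \<kappa>) (f, ph)"
begin

interpretation S: ringed_cspace S by (rule S)
interpretation A: affine_ring A by (rule affine_ring.intro[OF A])

abbreviation (input) "TT \<equiv> topspace (zariski A)"

lemma chart_homeo: "homeomorphic_map (subtopology (topo S) U) (zariski A) f"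
 using iso by (simp add: cspace_iso_def open_subspace_def Spec_def)

lemma chart_bij: "bij_betw f U TT"
proof -
 have "topspace (subtopology (topo S) U) = U" using openin_subset[OF U] by auto
 then show ?thesis using homeomorphic_imp_injective_map[OF chart_homeo] homeomorphic_imp_surjective_map[OF chart_homeo]
  by (simp add: bij_betw_def)
qed

lemma chart_prime: "y : U ==> primeideal (f y) A"
 using A.zariski_prime bij_betwE[OF chart_bij] by blast

lemma chart_open: "[|W <= U; openin (topo S) W|] ==> openin (zariski A) (f ` W)"
 using homeomorphic_map_openness_eq[OF chart_homeo, of W] openin_subset[OF U] U
 by (simp add: openin_open_subtopology)

lemma chart_basic: "a : carrier A ==> openin (topo S) {y : U. a \<notin> f y}"
proof -
 assume a: "a : carrier A"
 have "openin (subtopology (topo S) U) {y : topspace (subtopology (topo S) U). f y : {Q. primeideal Q A & a \<notin> Q}}"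
  using openin_continuous_map_preimage[OF homeomorphic_imp_continuous_map[OF chart_homeo] A.zariski_openin[OF a]] .
 moreover have "{y : topspace (subtopology (topo S) U). f y : {Q. primeideal Q A & a \<notin> Q}} = {y : U. a \<notin> f y}"
  using chart_prime openin_subset[OF U] by auto
 ultimately show ?thesis using U by (simp add: openin_open_subtopology)
qed

lemma chart_separate:
 assumes W: "openin (topo S) W" "y : W" "W <= U"
 obtains a where "a : carrier A" "a \<notin> f y" "!!z. [|z : U; z \<notin> W|] ==> a : f z"
proof -
 obtain a where a: "a : carrier A" "a \<notin> f y" "{Q. primeideal Q A & a \<notin> Q} <= f ` W"
  using A.zariski_basis[OF chart_open[OF W(3,1)] imageI[OF W(2)]] by blast
 show ?thesis
 proof (rule that[OF a(1,2)])
  fix z assume z: "z : U" "z \<notin> W"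
  then have "f z \<notin> f ` W" using bij_betw_imp_inj_on[OF chart_bij] W(3) by (auto dest: inj_onD)
  then show "a : f z" using a(3) chart_prime[OF z(1)] by auto
 qed
qed

lemma chart_T0: "[|y : U; z : U; y \<noteq> z|] ==> \<exists>W. openin (topo S) W & W <= U & (y : W \<longleftrightarrow> z \<notin> W)"
proof -
 assume yz: "y : U" "z : U" "y \<noteq> z"
 then have "f y \<noteq> f z" using bij_betw_imp_inj_on[OF chart_bij] by (auto dest: inj_onD)
 then obtain a where a: "a : f y \<longleftrightarrow> a \<notin> f z" by blast
 have "a : carrier A"
  using a ideal.Icarr[OF primeideal.axioms(1)[OF chart_prime]] yz by blast
 from chart_basic[OF this] show ?thesis using a yz by (intro exI[of _ "{y : U. a \<notin> f y}"]) auto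
qed

lemma chart_preim: "preim (open_subspace S U) f TT = U"
 using bij_betwE[OF chart_bij] openin_subset[OF U] by (auto simp: preim_def open_subspace_def)

lemma chart_ring: "ph TT : ring_iso (sect (Spec A \<kappa>) TT) (sect S U)"
proof -
 have "openin (topo (Spec A \<kappa>)) TT" by (simp add: Spec_def)
 then have "ph TT : ring_iso (sect (Spec A \<kappa>) TT) (sect (open_subspace S U) (preim (open_subspace S U) f TT))"
  using iso by (simp add: cspace_iso_def)
 then show ?thesis by (simp only: chart_preim) (simp add: open_subspace_def)
qed

lemma chart_sect_iff:
 "s : carrier (sect (Spec A \<kappa>) TT) \<longleftrightarrow> s : extensional TT & (\<forall>Q\<in>TT. \<exists>V a b. openin (zariski A) V & Q : V \<and>
   a : carrier A & b : carrier A & (\<forall>q\<in>V. b \<notin> q & s q = loc_frac A q a b))" (is "_ \<longleftrightarrow> ?ext & ?loc")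
proof -
 have carr: "s : carrier (sect (Spec A \<kappa>) TT) \<longleftrightarrow> s : (\<Pi>\<^sub>E \<pp>\<in>TT. carrier (localization A \<pp>)) \<and>
  (\<forall>Q\<in>TT. \<exists>V a b. openin (zariski A) V & Q : V & V <= TT \<and>
   a : carrier A & b : carrier A & (\<forall>q\<in>V. b \<notin> q & s q = loc_frac A q a b))" by (simp add: Spec_def)
 show ?thesis
  unfolding carr
 proof (rule iffI, elim conjE, intro conjI ballI)
  assume "s : (\<Pi>\<^sub>E \<pp>\<in>TT. carrier (localization A \<pp>))"
  then show "s : extensional TT" by (simp add: PiE_def)
 next
  fix Q assume Q: "Q : TT" and "\<forall>Q\<in>TT. \<exists>V a b. openin (zariski A) V & Q : V & V <= TT \<and>
   a : carrier A & b : carrier A & (\<forall>q\<in>V. b \<notin> q & s q = loc_frac A q a b)"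
  from bspec[OF this(2) Q] show "\<exists>V a b. openin (zariski A) V & Q : V \<and>
   a : carrier A & b : carrier A & (\<forall>q\<in>V. b \<notin> q & s q = loc_frac A q a b)" by (elim exE conjE) (intro exI conjI)
 next
  assume s: "?ext & ?loc"
  have *: "s Q : carrier (localization A Q) & (\<exists>V a b. openin (zariski A) V & Q : V & V <= TT \<and>
   a : carrier A & b : carrier A & (\<forall>q\<in>V. b \<notin> q & s q = loc_frac A q a b))" if Q: "Q : TT" for Q
  proof -
   obtain V a b where V: "openin (zariski A) V" "Q : V" "a : carrier A" "b : carrier A"
    "\<forall>q\<in>V. b \<notin> q & s q = loc_frac A q a b"
    using bspec[OF conjunct2[OF s] Q] by (elim exE conjE)
   have "s Q : carrier (localization A Q)" using V(2-5) unfolding localization_def by auto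
   then show ?thesis using V openin_subset[OF V(1)] by (intro conjI exI)
  qed
  then show "s : (\<Pi>\<^sub>E \<pp>\<in>TT. carrier (localization A \<pp>)) & (\<forall>Q\<in>TT. \<exists>V a b. openin (zariski A) V & Q : V & V <= TT \<and>
   a : carrier A & b : carrier A & (\<forall>q\<in>V. b \<notin> q & s q = loc_frac A q a b))"
   using s by (intro conjI PiE_I ballI) (simp_all add: extensional_def)
 qed
qed

lemma chart_global:
 "a : carrier A ==> (\<lambda>Q\<in>TT. loc_frac A Q a \<one>\<^bsub>A\<^esub>) : carrier (sect (Spec A \<kappa>) TT)"
 unfolding chart_sect_iff using A.prime_one A.zariski_prime
 by (intro conjI ballI exI[of _ TT] exI[of _ a] exI[of _ "\<one>\<^bsub>A\<^esub>"]) auto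

lemma chart_ops_closed:
 assumes s: "s : carrier (sect (Spec A \<kappa>) TT)" and r: "r : carrier (sect (Spec A \<kappa>) TT)"
 shows "s \<otimes>\<^bsub>sect (Spec A \<kappa>) TT\<^esub> r : carrier (sect (Spec A \<kappa>) TT)"
  and "s \<oplus>\<^bsub>sect (Spec A \<kappa>) TT\<^esub> r : carrier (sect (Spec A \<kappa>) TT)"
proof -
 let ?O = "sect (Spec A \<kappa>) TT"
 have ext: "s \<otimes>\<^bsub>?O\<^esub> r : extensional TT" "s \<oplus>\<^bsub>?O\<^esub> r : extensional TT" by (simp_all add: Spec_def)
 have loc: "\<exists>V a b. openin (zariski A) V & Q : V & a : carrier A & b : carrier A \<and>
    (\<forall>q\<in>V. b \<notin> q & (s \<otimes>\<^bsub>?O\<^esub> r) q = loc_frac A q a b)"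
   "\<exists>V a b. openin (zariski A) V & Q : V & a : carrier A & b : carrier A \<and>
    (\<forall>q\<in>V. b \<notin> q & (s \<oplus>\<^bsub>?O\<^esub> r) q = loc_frac A q a b)" if Q: "Q : TT" for Q
 proof -
  obtain V a b where V: "openin (zariski A) V" "Q : V" "a : carrier A" "b : carrier A"
   "!!q. q : V ==> b \<notin> q" "!!q. q : V ==> s q = loc_frac A q a b"
   using bspec[OF conjunct2[OF iffD1[OF chart_sect_iff s]] Q] by (elim exE conjE) simp
  obtain V' c d where V': "openin (zariski A) V'" "Q : V'" "c : carrier A" "d : carrier A"
   "!!q. q : V' ==> d \<notin> q" "!!q. q : V' ==> r q = loc_frac A q c d"
   using bspec[OF conjunct2[OF iffD1[OF chart_sect_iff r]] Q] by (elim exE conjE) simp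
  have o: "openin (zariski A) (V Int V')" "Q : V Int V'" using V V' by auto
  have q: "b \<otimes>\<^bsub>A\<^esub> d \<notin> q & (s \<otimes>\<^bsub>?O\<^esub> r) q = loc_frac A q (a \<otimes>\<^bsub>A\<^esub> c) (b \<otimes>\<^bsub>A\<^esub> d) \<and>
    (s \<oplus>\<^bsub>?O\<^esub> r) q = loc_frac A q (a \<otimes>\<^bsub>A\<^esub> d \<oplus>\<^bsub>A\<^esub> c \<otimes>\<^bsub>A\<^esub> b) (b \<otimes>\<^bsub>A\<^esub> d)" if q: "q : V Int V'" for q
  proof -
   have qT: "q : TT" using openin_subset[OF o(1)] q by blast
   note p = A.zariski_prime[OF qT]
   have bd: "b : carrier A - q" "d : carrier A - q" using V V' q by auto
   show ?thesis
    using A.prime_diff_mult[OF p bd] A.localization_ops[OF p V(3) bd(1) V'(3) bd(2)] qT V(6) V'(6) q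
    by (simp add: Spec_def)
  qed
  show "\<exists>V a b. openin (zariski A) V & Q : V & a : carrier A & b : carrier A \<and>
    (\<forall>q\<in>V. b \<notin> q & (s \<otimes>\<^bsub>?O\<^esub> r) q = loc_frac A q a b)"
   using o q V(3,4) V'(3,4) by (intro exI[of _ "V Int V'"] exI[of _ "a \<otimes>\<^bsub>A\<^esub> c"] exI[of _ "b \<otimes>\<^bsub>A\<^esub> d"]) simp
  show "\<exists>V a b. openin (zariski A) V & Q : V & a : carrier A & b : carrier A \<and>
    (\<forall>q\<in>V. b \<notin> q & (s \<oplus>\<^bsub>?O\<^esub> r) q = loc_frac A q a b)"
   using o q V(3,4) V'(3,4) by (intro exI[of _ "V Int V'"] exI[of _ "a \<otimes>\<^bsub>A\<^esub> d \<oplus>\<^bsub>A\<^esub> c \<otimes>\<^bsub>A\<^esub> b"] exI[of _ "b \<otimes>\<^bsub>A\<^esub> d"]) simp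
 qed
 show "s \<otimes>\<^bsub>?O\<^esub> r : carrier ?O" "s \<oplus>\<^bsub>?O\<^esub> r : carrier ?O"
  by (intro iffD2[OF chart_sect_iff] conjI ballI ext loc, assumption)+
qed

text \<open>The maximal ideal at the prime \<open>f y\<close>, pulled back to global sections of the
  spectrum and transported to \<open>sect S U\<close>, the ring whose finite generation is
  known.\<close>

definition vanishing :: "'p => 'a set" where
 "vanishing y = {ph TT s | s. s : carrier (sect (Spec A \<kappa>) TT) \<and>
   (\<exists>a\<in>f y. \<exists>b\<in>carrier A - f y. s (f y) = loc_frac A (f y) a b)}"

lemma vanishing_ideal:
 assumes y: "y : U"
 shows "subring_ideal (sect S U) (carrier (sect S U)) (vanishing y)"
proof -
 let ?O = "sect (Spec A \<kappa>) TT" and ?P = "f y"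
 interpret P: primeideal ?P A by (rule chart_prime[OF y])
 note p = chart_prime[OF y]
 have PT: "?P : TT" using bij_betwE[OF chart_bij] y by blast
 have h: "ph TT : ring_hom ?O (sect S U)" and b: "bij_betw (ph TT) (carrier ?O) (carrier (sect S U))"
  using chart_ring by (auto simp: ring_iso_def)
 have sur: "\<exists>s\<in>carrier ?O. r = ph TT s" if "r : carrier (sect S U)" for r
  using that bij_betw_imp_surj_on[OF b] by blast
 have frac: "\<exists>a\<in>carrier A. \<exists>b\<in>carrier A - ?P. s ?P = loc_frac A ?P a b" if "s : carrier ?O" for s
 proof -
  have "s : (\<Pi>\<^sub>E \<pp>\<in>TT. carrier (localization A \<pp>))" using that by (simp add: Spec_def)
  then have "s ?P : carrier (localization A ?P)" using PT by blast
  then show ?thesis by (auto simp: localization_def)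
 qed
 have ops: "(s \<otimes>\<^bsub>?O\<^esub> r) ?P = s ?P \<otimes>\<^bsub>localization A ?P\<^esub> r ?P" "(s \<oplus>\<^bsub>?O\<^esub> r) ?P = s ?P \<oplus>\<^bsub>localization A ?P\<^esub> r ?P" for s r
  using PT by (simp_all add: Spec_def)
 interpret O: cring "sect S U" by (rule S.sect_cring[OF U])
 have van: "ph TT s : vanishing y" if "s : carrier ?O" "s ?P = loc_frac A ?P a b" "a : ?P" "b : carrier A - ?P" for s a b
  using that unfolding vanishing_def by blast
 have vc: "vanishing y <= carrier (sect S U)" using ring_hom_closed[OF h] by (auto simp: vanishing_def)
 obtain s0 where s0: "s0 : carrier ?O" "s0 ?P = loc_frac A ?P \<zero>\<^bsub>A\<^esub> \<one>\<^bsub>A\<^esub>"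
  using chart_global[OF A.zero_closed] PT by auto
 have m: "k \<otimes>\<^bsub>sect S U\<^esub> v : vanishing y" if k: "k : carrier (sect S U)" and v: "v : vanishing y" for k v
 proof -
  obtain s a b where s: "v = ph TT s" "s : carrier ?O" "a : ?P" "b : carrier A - ?P" "s ?P = loc_frac A ?P a b"
   using v unfolding vanishing_def by blast
  obtain r where r: "r : carrier ?O" "k = ph TT r" using sur[OF k] by blast
  obtain c d where cd: "c : carrier A" "d : carrier A - ?P" "r ?P = loc_frac A ?P c d" using frac[OF r(1)] by blast
  have "ph TT (r \<otimes>\<^bsub>?O\<^esub> s) : vanishing y"
   by (rule van[OF chart_ops_closed(1)[OF r(1) s(2)] _ P.I_l_closed[OF s(3) cd(1)] A.prime_diff_mult[OF p cd(2) s(4)]])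
    (simp add: ops cd(3) s(5) A.localization_ops(1)[OF p cd(1,2) P.Icarr[OF s(3)] s(4)])
  then show ?thesis by (simp add: r(2) s(1) ring_hom_mult[OF h r(1) s(2)])
 qed
 show ?thesis
  unfolding subring_ideal_def
 proof (intro conjI ballI vc m)
  have "ph TT s0 : vanishing y" by (rule van[OF s0 P.zero_closed A.prime_one[OF p]])
  from m[OF O.zero_closed this] show "\<zero>\<^bsub>sect S U\<^esub> : vanishing y" using vc \<open>ph TT s0 : vanishing y\<close> by (simp add: subset_iff)
  fix v w assume v: "v : vanishing y" and w: "w : vanishing y"
  obtain s a b where s: "v = ph TT s" "s : carrier ?O" "a : ?P" "b : carrier A - ?P" "s ?P = loc_frac A ?P a b"
   using v unfolding vanishing_def by blast
  obtain r c d where r: "w = ph TT r" "r : carrier ?O" "c : ?P" "d : carrier A - ?P" "r ?P = loc_frac A ?P c d"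
   using w unfolding vanishing_def by blast
  have num: "a \<otimes>\<^bsub>A\<^esub> d \<oplus>\<^bsub>A\<^esub> c \<otimes>\<^bsub>A\<^esub> b : ?P"
   using P.a_closed[OF P.I_r_closed[OF s(3)] P.I_r_closed[OF r(3)]] r(4) s(4) by blast
  have "ph TT (s \<oplus>\<^bsub>?O\<^esub> r) : vanishing y"
   by (rule van[OF chart_ops_closed(2)[OF s(2) r(2)] _ num A.prime_diff_mult[OF p s(4) r(4)]])
    (simp add: ops r(5) s(5) A.localization_ops(2)[OF p P.Icarr[OF s(3)] s(4) P.Icarr[OF r(3)] r(4)])
  then show "v \<oplus>\<^bsub>sect S U\<^esub> w : vanishing y" by (simp add: r(1) s(1) ring_hom_add[OF h s(2) r(2)])
 qed
qed

text \<open>The witness is the section a/1, with a from \<open>chart_separate\<close>; it vanishes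
  at a prime iff a belongs to that prime.\<close>

lemma vanishing_separates:
 assumes W: "openin (topo S) W" "y : W" "W <= U"
 obtains s where "s : carrier (sect S U)" "s \<notin> vanishing y" "!!z. [|z : U; z \<notin> W|] ==> s : vanishing z"
proof -
 let ?O = "sect (Spec A \<kappa>) TT"
 obtain a where a: "a : carrier A" "a \<notin> f y" "!!z. [|z : U; z \<notin> W|] ==> a : f z"
  by (rule chart_separate[OF W]) blast
 obtain s where s: "s : carrier ?O" "!!Q. Q : TT ==> s Q = loc_frac A Q a \<one>\<^bsub>A\<^esub>"
  using chart_global[OF a(1)] by auto
 have h: "ph TT : ring_hom ?O (sect S U)" and b: "bij_betw (ph TT) (carrier ?O) (carrier (sect S U))"
  using chart_ring by (auto simp: ring_iso_def)
 have fT: "f z : TT" if "z : U" for z using bij_betwE[OF chart_bij] that by blast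
 show ?thesis
 proof (rule that)
  show "ph TT s : carrier (sect S U)" by (rule ring_hom_closed[OF h s(1)])
  show "ph TT s : vanishing z" if z: "z : U" "z \<notin> W" for z
   unfolding vanishing_def using s(1) s(2)[OF fT[OF z(1)]] a(3)[OF z] A.prime_one[OF chart_prime[OF z(1)]] by blast
  show "ph TT s \<notin> vanishing y"
  proof
   assume "ph TT s : vanishing y"
   then obtain r c d where r: "ph TT s = ph TT r" "r : carrier ?O" "c : f y" "d : carrier A - f y" "r (f y) = loc_frac A (f y) c d"
    unfolding vanishing_def by blast
   have y: "y : U" using W by blast
   note p = chart_prime[OF y]
   have "s = r" using inj_onD[OF bij_betw_imp_inj_on[OF b] r(1) s(1) r(2)] .
   then have "loc_frac A (f y) c d = loc_frac A (f y) a \<one>\<^bsub>A\<^esub>" using r(5) s(2)[OF fT[OF y]] by simp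
   then have "a : f y"
    using A.loc_frac_mem_iff[OF p ideal.Icarr[OF primeideal.axioms(1)[OF p] r(3)] r(4) a(1) A.prime_one[OF p]] r(3) by blast
   then show False using a(2) by blast
  qed
 qed
qed

text \<open>A closed subset is recovered from the ideal of sections vanishing on it, since
  \<open>vanishing_separates\<close> distinguishes it from any outside point. A descending chain of
  closed sets thus gives an ascending chain of ideals, and the former is constant where the latter
  is.\<close>

lemma chart_dcc:
 assumes acc: "ideals_acc (sect S U) (carrier (sect S U))"
  and Y: "!!m. Y m <= U" "!!m. openin (topo S) (U - Y m)" "!!m. Y (Suc m) <= Y m"
 shows "\<exists>N::nat. \<forall>m\<ge>N. Y m = Y N"
proof -
 let ?c = "carrier (sect S U)"
 interpret O: cring "sect S U" by (rule S.sect_cring[OF U])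
 define I where "I m = {s : ?c. \<forall>y\<in>Y m. s : vanishing y}" for m
 have id: "subring_ideal (sect S U) ?c (I m)" for m
  unfolding subring_ideal_def
 proof (intro conjI ballI)
  have v: "\<zero>\<^bsub>sect S U\<^esub> : vanishing y"
   "[|a : vanishing y; b : vanishing y|] ==> a \<oplus>\<^bsub>sect S U\<^esub> b : vanishing y"
   "[|k : ?c; a : vanishing y|] ==> k \<otimes>\<^bsub>sect S U\<^esub> a : vanishing y" if "y : Y m" for y a b k
   using vanishing_ideal[of y] Y(1)[of m] that by (auto simp: subring_ideal_def)
  show "I m <= ?c" by (auto simp: I_def)
  show "\<zero>\<^bsub>sect S U\<^esub> : I m" using v(1) by (simp add: I_def)
  show "a \<oplus>\<^bsub>sect S U\<^esub> b : I m" if "a : I m" "b : I m" for a b using that v(2) by (simp add: I_def)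
  show "k \<otimes>\<^bsub>sect S U\<^esub> a : I m" if "k : ?c" "a : I m" for a k using that v(3) by (simp add: I_def)
 qed
 have "I m <= I (Suc m)" for m using Y(3)[of m] by (auto simp: I_def)
 then obtain N where N: "!!m. m \<ge> N ==> I m = I N" using acc id unfolding ideals_acc_def by meson
 have "Y m = Y N" if m: "m \<ge> N" for m
 proof (rule ccontr)
  assume "Y m \<noteq> Y N"
  moreover have "Y m <= Y N" using lift_Suc_antimono_le[of Y, OF Y(3) m] .
  ultimately obtain y where y: "y : Y N" "y \<notin> Y m" by blast
  then have "y : U - Y m" using Y(1) by blast
  then obtain s where s: "s : ?c" "s \<notin> vanishing y" "!!z. [|z : U; z \<notin> U - Y m|] ==> s : vanishing z"
   by (rule vanishing_separates[OF Y(2)[of m] _ Diff_subset]) blast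
  then have "s : I m" using Y(1)[of m] by (auto simp: I_def)
  then have "s : I N" by (simp add: N[OF m])
  then show False using s(2) y(1) by (simp add: I_def)
 qed
 then show ?thesis by blast
qed

end

lemma irreducible_in_closure: "irreducible_in T Y ==> irreducible_in T (T closure_of Y)"
 unfolding irreducible_in_def
 by (metis closure_of_eq_empty closure_of_minimal closure_of_subset closure_of_subset_topspace subset_trans)

lemma irreducible_in_singleton: "y : topspace T ==> irreducible_in T {y}"
 by (auto simp: irreducible_in_def)

section \<open>Proper closed subsets of a curve\<close>

context smooth_irreducible_curve
begin

lemma no_irreducible_chain:
 assumes Z0: "closedin (topo S) Z0" "irreducible_in (topo S) Z0"
  and Z1: "closedin (topo S) Z1" "irreducible_in (topo S) Z1" and lt: "Z0 \<subset> Z1" "Z1 \<subset> points S"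
 shows False
proof -
 let ?Z = "%i::nat. if i = 0 then Z0 else if i = 1 then Z1 else points S"
 have "\<forall>i\<le>2. closedin (topo S) (?Z i) & irreducible_in (topo S) (?Z i)" using Z0 Z1 irred by simp
 moreover have "\<forall>i<2. ?Z i \<subset> ?Z (Suc i)" using lt by (auto simp: less_Suc_eq numeral_2_eq_2 One_nat_def)
 ultimately have "enat 2 \<le> top_dim (topo S)"
  unfolding top_dim_def by (intro Sup_upper CollectI exI[of _ 2] conjI refl exI[of _ ?Z])
 then show False by (simp add: dim one_enat_def)
qed

text \<open>In a chart U of finite type, the points of Z are closed in U and finite in number:
  either failure would produce irreducible closed sets Z0 < Z1 < C, against dimension one. Removing
  the closures of the other points isolates x.\<close>

lemma proper_closed_discrete:
 assumes Z: "closedin (topo S) Z" "Z \<noteq> points S" and x: "x : Z"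
 obtains V where "openin (topo S) V" "x : V" "V Int Z = {x}"
proof -
 let ?T = "topo S"
 have Zs: "Z \<subset> points S" using Z closedin_subset by blast
 obtain U B where U: "affine_open S U" "x : U" and B: "finite B" "B <= carrier (sect S U)"
  "generate_ring (sect S U) (range (scal S U) \<union> B) = carrier (sect S U)"
  using ft x Zs unfolding finite_type_def by blast
 have Uo: "openin ?T U" using U(1) by (simp add: affine_open_def)
 obtain A :: "'b ring" and \<kappa> f ph where A: "cring A" "cspace_iso (open_subspace S U) (Spec A \<kappa>) (f, ph)"
  using U(1) unfolding affine_open_def by force
 note S = ringed_cspace_axioms
 interpret O: cring "sect S U" by (rule sect_cring[OF Uo])
 have acc: "ideals_acc (sect S U) (carrier (sect S U))"
  by (rule O.finitely_generated_acc[OF scal_hom[OF Uo] B])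
 note dcc = chart_dcc[OF S Uo A acc] and T0 = chart_T0[OF S Uo A]
 have UP: "U <= points S" by (rule openin_subset[OF Uo])
 have clo: "y : ?T closure_of {y}" if "y : points S" for y using that by (simp add: in_closure_of)
 \<comment> \<open>Otherwise the closures of z and of y are distinct by the T0 property of spectra,
   and with C they form a chain of three irreducible closed sets.\<close>
 have pt: "z = y" if y: "y : Z" "y : U" and z: "z : ?T closure_of {y}" "z : U" for y z
 proof (rule ccontr)
  assume "z \<noteq> y"
  then obtain W where W: "openin ?T W" "y : W \<longleftrightarrow> z \<notin> W" using T0[OF y(2) z(2)] by blast
  have zW: "openin ?T W & z : W ==> y : W" for W using z(1) by (auto simp: in_closure_of)
  then have yW: "y : W" "z \<notin> W" using W by auto
  have "y \<notin> ?T closure_of {z}" using W(1) yW by (auto simp: in_closure_of)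
  moreover have "?T closure_of {z} <= ?T closure_of {y}" using z by (intro closure_of_minimal) auto
  ultimately have lt: "?T closure_of {z} \<subset> ?T closure_of {y}" using clo[of y] y UP by auto
  have "?T closure_of {y} <= Z" using y Z by (intro closure_of_minimal) auto
  then have "?T closure_of {y} \<subset> points S" using Zs by blast
  then show False
   using y z UP by (intro no_irreducible_chain[OF _ _ _ _ lt] irreducible_in_closure irreducible_in_singleton) auto
 qed
 \<comment> \<open>Otherwise the chain condition yields a minimal infinite subset Y of Z Int U that
   is closed in U. Minimality makes Y irreducible, and the closures of one of its points and of Y
   itself, together with C, form a forbidden chain.\<close>
 have fin: "finite (Z Int U)"
 proof (rule ccontr)
  assume inf: "infinite (Z Int U)"
  define \<C> where "\<C> = {Y. Y <= Z Int U & openin ?T (U - Y) & infinite Y}"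
  have "U - Z Int U = U Int (points S - Z)" using UP by blast
  then have ZC: "Z Int U : \<C>" using inf Uo Z(1) by (auto simp: \<C>_def closedin_def)
  have "wf {(Y', Y). Y' : \<C> & Y : \<C> & Y' \<subset> Y}"
   unfolding wf_iff_no_infinite_down_chain
  proof
   assume "\<exists>F. \<forall>i. (F (Suc i), F i) : {(Y', Y). Y' : \<C> & Y : \<C> & Y' \<subset> Y}"
   then obtain F where F: "!!i. F i : \<C>" "!!i. F (Suc i) \<subset> F i" by blast
   have "\<exists>N. \<forall>m\<ge>N. F m = F N"
    by (rule dcc) (use F(1) psubset_imp_subset[OF F(2)] in \<open>simp_all add: \<C>_def\<close>)
   then obtain N where N: "\<forall>m\<ge>N. F m = F N" by (elim exE)
   show False using N[rule_format, of "Suc N"] F(2)[of N] by simp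
  qed
  then obtain Y where Y: "Y : \<C>" and "!!Y'. (Y', Y) : {(Y', Y). Y' : \<C> & Y : \<C> & Y' \<subset> Y} ==> Y' \<notin> \<C>"
  proof (rule wfE_min[OF _ ZC])
   fix z assume z: "z : \<C>" "!!y. (y, z) : {(Y', Y). Y' : \<C> & Y : \<C> & Y' \<subset> Y} ==> y \<notin> \<C>"
   show thesis by (rule that[OF z(1)]) (rule z(2))
  qed
  then have Ymin: "\<not> (Y' \<subset> Y & Y' : \<C>)" for Y' using Y by auto
  have YU: "Y <= U" "Y <= Z" "infinite Y" "openin ?T (U - Y)" using Y by (simp_all add: \<C>_def)
  have half: "Y <= D" if D: "closedin ?T D" "infinite (Y Int D)" for D
  proof (rule ccontr)
   assume "\<not> Y <= D"
   have "U - Y Int D = (U - Y) \<union> (U Int (points S - D))" using UP by blast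
   then have "openin ?T (U - Y Int D)" using YU(4) Uo D(1) by (auto simp: closedin_def)
   then have "Y Int D : \<C>" using D(2) YU by (auto simp: \<C>_def)
   moreover have "Y Int D \<subset> Y" using \<open>\<not> Y <= D\<close> by blast
   ultimately show False using Ymin by simp
  qed
  \<comment> \<open>If two closed sets cover Y, one of them meets Y in an infinite set and then
    contains Y by minimality.\<close>
  have Yi: "irreducible_in ?T Y"
   unfolding irreducible_in_def
  proof (intro conjI allI impI, goal_cases)
   case 1 show ?case using YU(3) by auto
  next
   case 2 show ?case using YU UP by blast
  next
   case (3 D E)
   then have "Y = (Y Int D) \<union> (Y Int E)" by blast
   then have "infinite (Y Int D) \<or> infinite (Y Int E)" using YU(3) by (metis finite_UnI)
   then show ?case using half 3 by blast
  qed
  obtain y where y: "y : Y" using YU(3) by (metis finite.emptyI ex_in_conv)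
  have "infinite (Y - {y})" using YU(3) by simp
  then obtain z where z: "z : Y" "z \<noteq> y" by (metis finite.emptyI ex_in_conv Diff_iff singletonI)
  have "z \<notin> ?T closure_of {y}" using pt[of y z] y z YU by blast
  moreover have "z : ?T closure_of Y" using closure_of_subset[of Y ?T] z YU UP by blast
  moreover have "?T closure_of {y} <= ?T closure_of Y" using y by (intro closure_of_mono) simp
  ultimately have lt: "?T closure_of {y} \<subset> ?T closure_of Y" by blast
  have "?T closure_of Y <= Z" using YU Z by (intro closure_of_minimal) auto
  then have "?T closure_of Y \<subset> points S" using Zs by blast
  then show False
   using y YU UP Yi by (intro no_irreducible_chain[OF _ _ _ _ lt] irreducible_in_closure irreducible_in_singleton) auto
 qed
 \<comment> \<open>A finite union of closures, hence closed. It misses x because the other points of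
   Z Int U are closed in U.\<close>
 let ?D = "\<Union>y\<in>Z Int U - {x}. ?T closure_of {y}"
 have D: "closedin ?T ?D" using fin by (intro closedin_Union) auto
 show ?thesis
 proof (rule that)
  show "openin ?T (U - ?D)" using Uo D by (rule openin_diff)
  show "x : U - ?D" using U(2) pt[of _ x] by auto
  show "(U - ?D) Int Z = {x}"
  proof
   show "(U - ?D) Int Z <= {x}" using clo UP by fastforce
   show "{x} <= (U - ?D) Int Z" using \<open>x : U - ?D\<close> x by blast
  qed
 qed
qed

lemma curve_points: "points S \<noteq> {}"
 using irred by (simp add: irreducible_in_def)

text \<open>If 1 = 0 on a neighbourhood of x, the stalk at x is the zero ring, which has no maximal
  ideal; a regular local ring has one.\<close>

lemma curve_nontrivial:
 assumes V: "openin (topo S) V" "V \<noteq> {}"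
 shows "\<one>\<^bsub>sect S V\<^esub> \<noteq> \<zero>\<^bsub>sect S V\<^esub>"
proof
 assume e: "\<one>\<^bsub>sect S V\<^esub> = \<zero>\<^bsub>sect S V\<^esub>"
 obtain x where x: "x : V" using V by blast
 then have xp: "x : points S" using openin_subset[OF V(1)] by blast
 have e': "\<one>\<^bsub>stalk S x\<^esub> = \<zero>\<^bsub>stalk S x\<^esub>" using germ_consts[OF V(1) x] by (simp add: e)
 obtain I where I: "maximalideal I (stalk S x)" using smooth[OF xp] by (auto simp: regular_local_ring_def)
 note id = maximalideal.axioms(1)[OF I]
 have "\<one>\<^bsub>stalk S x\<^esub> : I" unfolding e' by (rule additive_subgroup.zero_closed[OF ideal.axioms(1)[OF id]])
 then have "I = carrier (stalk S x)" by (rule ideal.one_imp_carrier[OF id])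
 then show False using maximalideal.I_notcarr[OF I] by simp
qed

end

section \<open>Lifting cocycles\<close>

context group_presheaf_hom
begin

lemma map_inv: "[|openin T U; g : carrier (gsec G U)|] ==> f U (inv\<^bsub>gsec G U\<^esub> g) = inv\<^bsub>gsec H U\<^esub> (f U g)"
 using group_hom.hom_inv[of "gsec G U" "gsec H U" "f U" g] map_hom G.sec_group H.sec_group
 by (simp add: group_hom_def group_hom_axioms_def)

lemma map_one: "openin T U ==> f U \<one>\<^bsub>gsec G U\<^esub> = \<one>\<^bsub>gsec H U\<^esub>"
 by (rule hom_one[OF map_hom G.sec_group H.sec_group])

text \<open>Shrink the cover to one large set \<^term>\<open>U0\<close> and small sets each containing a single point of the
 complement of \<^term>\<open>U0\<close>.  Distinct members then meet inside \<^term>\<open>U0\<close>, so the transition functions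
 from \<^term>\<open>U0\<close> can be lifted arbitrarily and determine the others.\<close>

lemma lift_cocycle:
 fixes c :: "('i, 'p, 'h) cocycle"
 assumes surj: "!!U h. [|openin T U; h : carrier (gsec H U)|] ==> \<exists>g\<in>carrier (gsec G U). f U g = h"
  and disc: "!!Z x. [|closedin T Z; Z \<noteq> topspace T; x : Z|] ==> \<exists>V. openin T V & x : V & V Int Z = {x}"
  and ne: "topspace T \<noteq> {}" and c: "is_cocycle T H c"
 obtains d :: "('p set, 'p, 'g) cocycle" where "is_cocycle T G d" "cohomologous T H (map_cocycle f d) c"
proof -
 note co = H.cocycle_open[OF c] and cc = H.cocycle_cover[OF c]
 \<comment> \<open>A nonempty member of the cover, so that its complement Z is a proper closed
   subset and therefore discrete.\<close>
 obtain i0 where i0: "i0 : idx c" "cov c i0 \<noteq> {}" using ne cc by blast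
 define U0 where "U0 = cov c i0"
 have U0: "openin T U0" "U0 \<noteq> {}" "U0 <= topspace T" using i0 co openin_subset by (auto simp: U0_def)
 define Z where "Z = topspace T - U0"
 have Z: "closedin T Z" "Z \<noteq> topspace T" using U0 by (auto simp: Z_def)
 have "\<exists>V. openin T V & x : V & V Int Z = {x} & (\<exists>i\<in>idx c. V <= cov c i)" if x: "x : Z" for x
 proof -
  obtain i where i: "i : idx c" "x : cov c i" using x cc by (auto simp: Z_def)
  obtain V where V: "openin T V" "x : V" "V Int Z = {x}" using disc[OF Z x] by blast
  have "V Int cov c i Int Z = {x}" using V i by blast
  then show ?thesis using V i co[OF i(1)] by (intro exI[of _ "V Int cov c i"]) auto
 qed
 then obtain V where V: "!!x. x : Z ==> openin T (V x) & x : V x & V x Int Z = {x} & (\<exists>i\<in>idx c. V x <= cov c i)"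
  by metis
 define I where "I = insert U0 (V ` Z)"
 have U0I: "U0 : I" by (simp add: I_def)
 have Io: "openin T k" if "k : I" for k using that V U0 by (auto simp: I_def)
 have "\<exists>i\<in>idx c. k <= cov c i" if "k : I" for k using that V i0 by (auto simp: I_def U0_def)
 then obtain sg where sg: "!!k. k : I ==> sg k : idx c" "!!k. k : I ==> k <= cov c (sg k)" by metis
 have Ic: "\<Union>I = topspace T"
 proof
  show "\<Union>I <= topspace T" using Io openin_subset by blast
  show "topspace T <= \<Union>I" using V by (auto simp: I_def Z_def)
 qed
 have meet: "k Int l <= U0" if "k : I" "l : I" "k \<noteq> l" for k l
 proof -
  have "k Int l Int Z = {}"
  proof (cases "k = U0 \<or> l = U0")
   case False
   then obtain x y where xy: "x : Z" "y : Z" "k = V x" "l = V y" using \<open>k : I\<close> \<open>l : I\<close> by (auto simp: I_def)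
   have xz: "k Int Z = {x}" "l Int Z = {y}" using V[OF xy(1)] V[OF xy(2)] xy(3,4) by simp_all
   have "x \<noteq> y" using \<open>k \<noteq> l\<close> xy(3,4) by metis
   have "k Int l Int Z = (k Int Z) Int (l Int Z)" by blast
   also have "\<dots> = {}" using \<open>x \<noteq> y\<close> by (simp add: xz)
   finally show ?thesis .
  qed (auto simp: Z_def)
  then show ?thesis using openin_subset[OF Io[OF \<open>k : I\<close>]] by (auto simp: Z_def)
 qed
 let ?b = "%k. H.cres c (sg U0) (sg k)"
 have b: "?b k W : carrier (gsec H W)" if "k : I" "openin T W" "W <= U0 Int k" for k W
  using sg(2)[OF U0I] sg(2)[OF that(1)] that(3)
  by (intro H.cres_closed[OF c sg(1)[OF U0I] sg(1)[OF that(1)] that(2)]) auto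
 have "\<exists>g\<in>carrier (gsec G (U0 Int k)). f (U0 Int k) g = ?b k (U0 Int k)" if "k : I" for k
  using b[OF that] Io[OF that] U0 by (intro surj) auto
 then obtain g where g: "!!k. k : I ==> g k : carrier (gsec G (U0 Int k))" "!!k. k : I ==> f (U0 Int k) (g k) = ?b k (U0 Int k)"
  by metis
 define gr where "gr k W = gres G (U0 Int k) W (g k)" for k W
 have gr: "gr k W : carrier (gsec G W)" if "k : I" "openin T W" "W <= U0 Int k" for k W
  unfolding gr_def using that Io[OF that(1)] U0 g by (intro G.res_closed) auto
 have gr_res: "gres G W W' (gr k W) = gr k W'"
  if "k : I" "openin T W" "W <= U0 Int k" "openin T W'" "W' <= W" for k W W'
  unfolding gr_def using that Io[OF that(1)] U0 g by (intro G.res_comp) auto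
 have gr_map: "f W (gr k W) = ?b k W" if "k : I" "openin T W" "W <= U0 Int k" for k W
 proof -
  have o: "openin T (U0 Int k)" using Io[OF that(1)] U0 by auto
  have "f W (gr k W) = gres H (U0 Int k) W (?b k (U0 Int k))"
   unfolding gr_def using map_res[OF o that(2,3) g(1)[OF that(1)]] g(2)[OF that(1)] by simp
  also have "\<dots> = ?b k W" using sg(2)[OF U0I] sg(2)[OF that(1)] that(3)
   by (intro H.cres_res[OF c sg(1)[OF U0I] sg(1)[OF that(1)] o _ _ that(2)]) auto
  finally show ?thesis .
 qed
 \<comment> \<open>For k and l distinct, k Int l lies in U0, where the lifts g_k of the transition
   functions from U0 are available, and g_k^-1 g_l makes sense. For k = l the set k may reach
   outside U0, but there the transition function has to be trivial.\<close>
 define \<delta> where "\<delta> k l = (if k = l then \<one>\<^bsub>gsec G (k Int l)\<^esub>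
   else inv\<^bsub>gsec G (k Int l)\<^esub> (gr k (k Int l)) \<otimes>\<^bsub>gsec G (k Int l)\<^esub> gr l (k Int l))" for k l
 have \<delta>: "\<delta> k l : carrier (gsec G (k Int l))" if kl: "k : I" "l : I" for k l
 proof -
  have o: "openin T (k Int l)" using Io kl by auto
  interpret K: group "gsec G (k Int l)" by (rule G.sec_group[OF o])
  show ?thesis using gr[OF kl(1) o] gr[OF kl(2) o] meet[OF kl] K.one_closed by (cases "k = l") (auto simp: \<delta>_def simp del: Int_absorb)
 qed
 have \<delta>_res: "gres G (k Int l) W (\<delta> k l) = inv\<^bsub>gsec G W\<^esub> (gr k W) \<otimes>\<^bsub>gsec G W\<^esub> gr l W"
  if kl: "k : I" "l : I" and W: "openin T W" "W <= k Int l" "W <= U0" for k l W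
 proof -
  have o: "openin T (k Int l)" using Io kl by auto
  interpret W: group "gsec G W" by (rule G.sec_group[OF W(1)])
  interpret K: group "gsec G (k Int l)" by (rule G.sec_group[OF o])
  show ?thesis
  proof (cases "k = l")
   case True
   then show ?thesis using G.res_one[OF o W(1,2)] gr[OF kl(1) W(1)] W by (simp add: \<delta>_def)
  next
   case False
   then have s: "k Int l <= U0 Int k" "k Int l <= U0 Int l" using meet[OF kl] by auto
   note g1 = gr[OF kl(1) o s(1)] and g2 = gr[OF kl(2) o s(2)]
   show ?thesis
    using False by (simp add: \<delta>_def G.res_mult[OF o W(1,2) K.inv_closed[OF g1] g2] G.res_inv[OF o W(1,2) g1]
      gr_res[OF kl(1) o s(1) W(1,2)] gr_res[OF kl(2) o s(2) W(1,2)])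
  qed
 qed
 \<comment> \<open>As g_k lifts c(U0, k), the image of g_k^-1 g_l is c(k, U0) c(U0, l) = c(k,
   l).\<close>
 have \<delta>_map: "f (k Int l) (\<delta> k l) = H.cres c (sg k) (sg l) (k Int l)" if kl: "k : I" "l : I" for k l
 proof -
  have o: "openin T (k Int l)" using Io kl by auto
  interpret K: group "gsec G (k Int l)" by (rule G.sec_group[OF o])
  show ?thesis
  proof (cases "k = l")
   case True
   then show ?thesis using map_one[OF o] H.cres_self[OF c sg(1)[OF kl(1)] o] sg(2)[OF kl(1)] by (simp add: \<delta>_def)
  next
   case False
   then have s: "k Int l <= U0 Int k" "k Int l <= U0 Int l" using meet[OF kl] by auto
   note g1 = gr[OF kl(1) o s(1)] and g2 = gr[OF kl(2) o s(2)]
   have s': "k Int l <= cov c (sg k)" "k Int l <= cov c (sg l)" "k Int l <= cov c (sg U0)" using s sg(2) U0I kl by blast+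
   have "f (k Int l) (\<delta> k l) = inv\<^bsub>gsec H (k Int l)\<^esub> (?b k (k Int l)) \<otimes>\<^bsub>gsec H (k Int l)\<^esub> ?b l (k Int l)"
    using False by (simp add: \<delta>_def map_mult[OF o K.inv_closed[OF g1] g2] map_inv[OF o g1]
      gr_map[OF kl(1) o s(1)] gr_map[OF kl(2) o s(2)])
   also have "inv\<^bsub>gsec H (k Int l)\<^esub> (?b k (k Int l)) = H.cres c (sg k) (sg U0) (k Int l)"
    by (rule H.cres_inv[OF c sg(1)[OF U0I] sg(1)[OF kl(1)] o s'(3,1)])
   also have "H.cres c (sg k) (sg U0) (k Int l) \<otimes>\<^bsub>gsec H (k Int l)\<^esub> ?b l (k Int l) = H.cres c (sg k) (sg l) (k Int l)"
    by (rule H.cres_mult[OF c sg(1)[OF kl(1)] sg(1)[OF U0I] sg(1)[OF kl(2)] o s'(1,3,2)])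
   finally show ?thesis .
  qed
 qed
 let ?d = "\<lparr>idx = I, cov = (%k. k), trans = \<delta>\<rparr> :: ('p set, 'p, 'g) cocycle"
 have d: "is_cocycle T G ?d"
  unfolding is_cocycle_def Let_def
 proof (intro conjI ballI)
  show "(\<Union>i\<in>idx ?d. cov ?d i) = topspace T" using Ic by simp
 next
  fix k l m assume "k : idx ?d" "l : idx ?d" "m : idx ?d"
  then have I: "k : I" "l : I" "m : I" by auto
  let ?W = "k Int l Int m"
  have W: "openin T ?W" using Io I by auto
  interpret W: group "gsec G ?W" by (rule G.sec_group[OF W])
  have "gres G (k Int l) ?W (\<delta> k l) \<otimes>\<^bsub>gsec G ?W\<^esub> gres G (l Int m) ?W (\<delta> l m) = gres G (k Int m) ?W (\<delta> k m)"
  proof (cases "?W <= U0")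
   case True
   have s: "?W <= k Int l" "?W <= l Int m" "?W <= k Int m" by auto
   have gg: "gr k ?W : carrier (gsec G ?W)" "gr l ?W : carrier (gsec G ?W)" "gr m ?W : carrier (gsec G ?W)"
    using True by (auto intro!: gr I W)
   have "inv\<^bsub>gsec G ?W\<^esub> gr k ?W \<otimes>\<^bsub>gsec G ?W\<^esub> gr l ?W \<otimes>\<^bsub>gsec G ?W\<^esub> (inv\<^bsub>gsec G ?W\<^esub> gr l ?W \<otimes>\<^bsub>gsec G ?W\<^esub> gr m ?W)
    = inv\<^bsub>gsec G ?W\<^esub> gr k ?W \<otimes>\<^bsub>gsec G ?W\<^esub> (gr l ?W \<otimes>\<^bsub>gsec G ?W\<^esub> (inv\<^bsub>gsec G ?W\<^esub> gr l ?W \<otimes>\<^bsub>gsec G ?W\<^esub> gr m ?W))"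
    using gg by (simp add: W.m_assoc)
   also have "gr l ?W \<otimes>\<^bsub>gsec G ?W\<^esub> (inv\<^bsub>gsec G ?W\<^esub> gr l ?W \<otimes>\<^bsub>gsec G ?W\<^esub> gr m ?W) = gr m ?W"
    using gg by (simp add: W.m_assoc[symmetric])
   finally show ?thesis
    by (simp only: \<delta>_res[OF I(1,2) W s(1) True] \<delta>_res[OF I(2,3) W s(2) True] \<delta>_res[OF I(1,3) W s(3) True])
  next
   case False
   \<comment> \<open>A triple intersection reaching outside U0 forces all three indices to coincide,
     and the identity is trivial. Inside U0 it holds because all factors have the form g_k^-1
     g_l.\<close>
   then have klm: "k = l" "l = m" using meet[OF I(1,2)] meet[OF I(2,3)] by blast+
   interpret M: group "gsec G m" by (rule G.sec_group[OF Io[OF I(3)]])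
   show ?thesis using klm G.res_one[OF _ W, of k] Io[OF I(1)] by (simp add: \<delta>_def)
  qed
  then show "gres G (cov ?d k Int cov ?d l) (cov ?d k Int cov ?d l Int cov ?d m) (trans ?d k l)
    \<otimes>\<^bsub>gsec G (cov ?d k Int cov ?d l Int cov ?d m)\<^esub>
    gres G (cov ?d l Int cov ?d m) (cov ?d k Int cov ?d l Int cov ?d m) (trans ?d l m) =
    gres G (cov ?d k Int cov ?d m) (cov ?d k Int cov ?d l Int cov ?d m) (trans ?d k m)" by simp
 qed (use Io \<delta> in auto)
 show ?thesis
 proof (rule that[OF d], rule H.cohomologousI[where I=I and W="%k. k" and sg="%k. k" and \<tau>=sg and h="%k. \<one>\<^bsub>gsec H k\<^esub>",
    OF map_cocycle_cocycle[OF d] c])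
  show "openin T k & k : idx (map_cocycle f ?d) & sg k : idx c & k <= cov (map_cocycle f ?d) k \<and>
    k <= cov c (sg k) & \<one>\<^bsub>gsec H k\<^esub> : carrier (gsec H k)" if "k : I" for k
   using that Io sg group.is_monoid[OF H.sec_group[OF Io[OF that]]] by (simp add: map_cocycle_def monoid.one_closed)
  show "(\<Union>k\<in>I. k) = topspace T" using Ic by simp
  fix k l V assume kl: "k : I" "l : I" and V: "V = k Int l" "openin T V"
  interpret V: group "gsec H V" by (rule H.sec_group[OF V(2)])
  have s: "V <= cov c (sg k)" "V <= cov c (sg l)" using V sg(2) kl by blast+
  have "H.cres (map_cocycle f ?d) k l V = H.cres c (sg k) (sg l) V"
   using H.res_id[OF V(2)] \<delta>_map[OF kl] H.cres_closed[OF c sg(1)[OF kl(1)] sg(1)[OF kl(2)] V(2) s]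
   by (simp add: map_cocycle_def V(1))
  moreover have "gres H l V \<one>\<^bsub>gsec H l\<^esub> = \<one>\<^bsub>gsec H V\<^esub>" "gres H k V \<one>\<^bsub>gsec H k\<^esub> = \<one>\<^bsub>gsec H V\<^esub>"
   using Io kl V by (auto intro!: H.res_one)
  ultimately show "H.cres (map_cocycle f ?d) k l V \<otimes>\<^bsub>gsec H V\<^esub> gres H l V \<one>\<^bsub>gsec H l\<^esub> =
    gres H k V \<one>\<^bsub>gsec H k\<^esub> \<otimes>\<^bsub>gsec H V\<^esub> H.cres c (sg k) (sg l) V"
   using H.cres_closed[OF c sg(1)[OF kl(1)] sg(1)[OF kl(2)] V(2) s] by simp
 qed
qed

end

section \<open>Primitive curves\<close>

context smooth_irreducible_curve
begin

lemma curve_thickening: "0 < m ==> thickening S m"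
 by (rule thickening.intro[OF ringed_cspace_axioms thickening_axioms.intro])

lemma curve_thickening_pair: "[|0 < k; k \<le> m|] ==> thickening_pair S m k"
 by (intro thickening_pair.intro thickening_pair_axioms.intro curve_thickening) auto

text \<open>The multiplicities have to be proved equal first: until then the two cocycles take
  values in different groups.\<close>

lemma iso_over_core_iff:
 assumes n: "0 < n" "0 < n'" and g: "g : H1 (topo S) (aut_sheaf S n)" and g': "g' : H1 (topo S) (aut_sheaf S n')"
  and gm: "gm : g" "gm' : g'"
 shows "iso_over_core S n gm n' gm' \<longleftrightarrow> n = n' & g = g'"
proof -
 interpret N: thickening S n by (rule curve_thickening[OF n(1)])
 interpret M: thickening S n' by (rule curve_thickening[OF n(2)])
 note c = N.Tw.H1_cocycle[OF g gm(1)] and d = M.Tw.H1_cocycle[OF g' gm(2)]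
 show ?thesis
 proof
  assume i: "iso_over_core S n gm n' gm'"
  then obtain \<psi> where "core_iso S n n' gm gm' \<psi>"
   unfolding iso_over_core_def
   using core_iso.intro[OF N.thickening_axioms M.thickening_axioms core_iso_axioms.intro[OF c d]] by blast
  then have nn: "n = n'" by (rule core_iso.multiplicity_eq[OF _ curve_nontrivial curve_points])
  have "cohomologous (topo S) (aut_sheaf S n) gm gm'"
   using N.iso_over_coreD[OF c] d i by (simp add: nn)
  then show "n = n' & g = g'" using N.Tw.H1_eqI[OF g _ gm] g' nn by simp
 next
  assume e: "n = n' & g = g'"
  then have "cohomologous (topo S) (aut_sheaf S n) gm gm'" using N.Tw.H1_cohomologous[OF g gm(1)] gm(2) by simp
  then show "iso_over_core S n gm n' gm'" using N.iso_over_coreI[OF c] d e by simp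
 qed
qed

lemma is_sub_curve_reduction:
 assumes k: "0 < k" "k \<le> n" and g: "g : H1 (topo S) (aut_sheaf S n)" and gm: "gm : g"
  and \<delta>: "\<delta> : H1_map (topo S) (aut_sheaf S k) (aut_red S n k) g"
 shows "is_sub_curve S n gm k \<delta>"
proof -
 interpret P: thickening_pair S n k by (rule curve_thickening_pair[OF k])
 show ?thesis
  by (rule P.is_sub_curveI[OF P.N.Tw.H1_cocycle[OF g gm] curve_nontrivial P.red.H1_map_cocycle[OF \<delta>] P.red.H1_map_cohomologous[OF g gm \<delta>]])
qed

text \<open>Sections lift by \<open>aut_lift\<close> and cocycles by \<open>lift_cocycle\<close>,
  whose topological hypothesis is \<open>proper_closed_discrete\<close>. The class of the lifted
  cocycle reduces to g.\<close>

lemma extension_exists: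
 assumes n: "1 < n" and g: "g : H1 (topo S) (aut_sheaf S n)"
 shows "\<exists>h\<in>H1 (topo S) (aut_sheaf S (Suc n)). H1_map (topo S) (aut_sheaf S n) (aut_red S (Suc n) n) h = g"
proof -
 interpret P: thickening_pair S "Suc n" n using n by (intro curve_thickening_pair) auto
 obtain gm where gm: "gm : g" using P.K.Tw.H1_nonempty[OF g] by blast
 note c = P.K.Tw.H1_cocycle[OF g gm]
 have "\<exists>G\<in>carrier (gsec (aut_sheaf S (Suc n)) U). aut_red S (Suc n) n U G = ph"
  if U: "openin (topo S) U" and ph: "ph : carrier (gsec (aut_sheaf S n) U)" for U ph
  by (rule P.K.aut_lift[OF n U ph[unfolded P.K.aut_carrier]]) (auto simp: P.N.aut_carrier)
 then obtain d :: "('a set, 'a, ('a, 'b) taut) cocycle" where d: "is_cocycle (topo S) (aut_sheaf S (Suc n)) d"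
  "cohomologous (topo S) (aut_sheaf S n) (map_cocycle (aut_red S (Suc n) n) d) gm"
  using P.red.lift_cocycle[OF _ _ curve_points c] proper_closed_discrete by metis
 let ?h = "{e. is_cocycle (topo S) (aut_sheaf S (Suc n)) e & cohomologous (topo S) (aut_sheaf S (Suc n)) d e}"
 have h: "?h : H1 (topo S) (aut_sheaf S (Suc n))" by (rule P.N.Tw.H1_classI[OF d(1)])
 have dh: "d : ?h" using d(1) P.N.Tw.cohomologous_refl by simp
 have "gm : H1_map (topo S) (aut_sheaf S n) (aut_red S (Suc n) n) ?h"
  using P.red.H1_map_class[OF h dh] c d(2) by simp
 then have "H1_map (topo S) (aut_sheaf S n) (aut_red S (Suc n) n) ?h = g"
  using P.K.Tw.H1_eqI[OF P.red.H1_map_closed[OF h] g _ gm P.K.Tw.cohomologous_refl[OF c]] by simp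
 then show ?thesis using h by blast
qed

end

theorem mainTheorem7:
  fixes C :: "('p, 'a) cspace"
    and n :: nat
    and g :: "('p set, 'p, ('p, 'a) taut) cocycle set"
  assumes "smooth_irreducible_curve C"
    and "n \<ge> 2"
    and "g \<in> H1 (topo C) (aut_sheaf C n)"
  shows
    "(\<forall>n'\<ge>2. \<forall>g' \<in> H1 (topo C) (aut_sheaf C n'). \<forall>\<gamma>\<in>g. \<forall>\<gamma>'\<in>g'.
        iso_over_core C n \<gamma> n' \<gamma>' \<longleftrightarrow> n = n' \<and> g = g') \<and>
     (\<forall>k. 2 \<le> k \<and> k \<le> n \<longrightarrow>
        (let g\<^sub>k = H1_map (topo C) (aut_sheaf C k) (aut_red C n k) g in
           g\<^sub>k \<in> H1 (topo C) (aut_sheaf C k) \<and>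
           (\<forall>\<gamma>\<in>g. \<forall>\<gamma>\<^sub>k\<in>g\<^sub>k. is_sub_curve C n \<gamma> k \<gamma>\<^sub>k))) \<and>
     (let L = H1_map (topo C) (unit_sheaf C) (xi C n) g in
        L \<in> H1 (topo C) (unit_sheaf C) \<and>
        (\<forall>\<gamma>\<in>g. \<forall>\<mu>\<in>L. conormal_iso C n \<gamma> \<mu>)) \<and>
     (\<exists>h \<in> H1 (topo C) (aut_sheaf C (n + 1)).
        \<forall>\<gamma>\<in>g. \<forall>\<delta>\<in>h. is_sub_curve C (n + 1) \<delta> n \<gamma>)"
proof -
 interpret smooth_irreducible_curve C by (rule assms(1))
 interpret N: thickening C n using assms(2) by (intro curve_thickening) simp
 have n: "0 < n" "1 < n" using assms(2) by auto
 note g = assms(3)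
 show ?thesis
 proof (intro conjI allI impI ballI)
  fix n' g' \<gamma> \<gamma>' assume "2 \<le> n'" "g' : H1 (topo C) (aut_sheaf C n')" "\<gamma> : g" "\<gamma>' : g'"
  then show "iso_over_core C n \<gamma> n' \<gamma>' \<longleftrightarrow> n = n' & g = g'" using iso_over_core_iff[OF n(1) _ g] by simp
 next
  fix k assume "2 \<le> k & k \<le> n"
  then have k: "0 < k" "k \<le> n" by auto
  interpret P: thickening_pair C n k by (rule curve_thickening_pair[OF k])
  show "let g\<^sub>k = H1_map (topo C) (aut_sheaf C k) (aut_red C n k) g in
      g\<^sub>k : H1 (topo C) (aut_sheaf C k) & (\<forall>\<gamma>\<in>g. \<forall>\<gamma>\<^sub>k\<in>g\<^sub>k. is_sub_curve C n \<gamma> k \<gamma>\<^sub>k)"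
   using group_presheaf_hom.H1_map_closed[OF P.aut_red_presheaf_hom g] is_sub_curve_reduction[OF k g]
   by (simp add: Let_def)
 next
  interpret \<chi>: group_presheaf_hom "topo C" "aut_sheaf C n" "unit_sheaf C" "xi C n" by (rule N.xi_presheaf_hom[OF n(2)])
  show "let L = H1_map (topo C) (unit_sheaf C) (xi C n) g in
    L : H1 (topo C) (unit_sheaf C) & (\<forall>\<gamma>\<in>g. \<forall>\<mu>\<in>L. conormal_iso C n \<gamma> \<mu>)"
   unfolding Let_def
  proof (intro conjI ballI \<chi>.H1_map_closed[OF g])
   fix \<gamma> \<mu> assume \<gamma>: "\<gamma> : g" and \<mu>: "\<mu> : H1_map (topo C) (unit_sheaf C) (xi C n) g"
   show "conormal_iso C n \<gamma> \<mu>"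
    by (rule N.conormal_isoI[OF N.Tw.H1_cocycle[OF g \<gamma>] n(2) \<chi>.H1_map_cocycle[OF \<mu>] \<chi>.H1_map_cohomologous[OF g \<gamma> \<mu>]])
  qed
 next
  \<comment> \<open>The extension is an instance of the statement on subcurves: g is the reduction
    of h from multiplicity n + 1 to n.\<close>
  obtain h where h: "h : H1 (topo C) (aut_sheaf C (Suc n))"
   "H1_map (topo C) (aut_sheaf C n) (aut_red C (Suc n) n) h = g" using extension_exists[OF n(2) g] by blast
  show "\<exists>h\<in>H1 (topo C) (aut_sheaf C (n + 1)). \<forall>\<gamma>\<in>g. \<forall>\<delta>\<in>h. is_sub_curve C (n + 1) \<delta> n \<gamma>"
   unfolding Suc_eq_plus1[symmetric]
   using h(1) is_sub_curve_reduction[OF n(1) _ h(1)] by (auto simp: h(2) intro!: bexI[of _ h])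
 qed
qed

end
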